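(* Let $1\le d<n$, $\mathrm{rch}_{\min}>0$, $R\ge144\,\mathrm{rch}_{\min}$, $0<f_{\min}\le f_{\max}/96$, $L\ge0$, $\tau>0$, $\alpha<1$, $\varepsilon\le\mathrm{rch}_{\min}/(2^{34}d^2)$, and assume $$\min_{1\le k\le n}\left(\frac{192\,\mathrm{rch}_{\min}\sqrt k}{R}\right)^k\le36\cdot8^d\sigma_{d-1}f_{\min}\mathrm{rch}_{\min}^d\le1.$$ Then any randomized SQ algorithm estimating $M=\mathrm{Supp}(D)$ over the bounding ball model $\mathcal{D}^{n,d}_{\mathrm{rch}_{\min}}(f_{\min},f_{\max},L;R)$ with respect to $d_H$ with precision $\varepsilon$ and probability of success at least $1-\alpha$ must make at least $$q\ge\frac{n\max\left\{\log\frac{R}{4\varepsilon},\ \frac{1}{\omega_d f_{\min}\mathrm{rch}_{\min}^d}\left(\frac{\mathrm{rch}_{\min}}{2^{31}\varepsilon}\right)^{d/2}\right\}+\log(1-\alpha)}{\log(1+1/\tau)}$$ queries to $\mathrm{STAT}(\tau)$.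
   Context: Notation: $\omega_d$ is the volume of the unit ball of $\mathbb{R}^d$, $\sigma_{d-1}$ the $(d-1)$-dimensional volume of the unit sphere of $\mathbb{R}^d$. $\mathrm{B}(x,r)$ closed Euclidean ball, $\mathrm{d}(z,K)=\inf_{p\in K}\|p-z\|$. The reach $\mathrm{rch}_K$ of a closed set $K$ is the infimum of $\mathrm{d}(z,K)$ over the medial axis (points with at least two distinct nearest points in $K$). $\mathcal{M}^{n,d}_{\rho}$ is the set of compact connected $d$-dimensional $C^2$ submanifolds of $\mathbb{R}^n$ without boundary with reach $\ge\rho$. $\mathcal{D}^{n,d}_{\mathrm{rch}_{\min}}(f_{\min},f_{\max},L)$ is the set of Borel probability distributions $D$ on $\mathbb{R}^n$ with support $M\in\mathcal{M}^{n,d}_{\mathrm{rch}_{\min}}$ having a density $f$ w.r.t. the $d$-dimensional Hausdorff measure restricted to $M$ with $f_{\min}\le f\le f_{\max}$ and $f$ $L$-Lipschitz on $M$; the bounding ball model $\mathcal{D}^{n,d}_{\mathrm{rch}_{\min}}(f_{\min},f_{\max},L;R)$ consists of those with support in $\mathrm{B}(0,R)$. $d_H(K,K')=\sup_x|\mathrm{d}(x,K)-\mathrm{d}(x,K')|$. SQ framework: a $\mathrm{STAT}(\tau)$ oracle for $D$ answers each measurable query $r:\mathbb{R}^n\to[-1,1]$ with an arbitrary adversarial real $a$ with $|a-\mathbb{E}_D[r]|\le\tau$. A deterministic SQ algorithm chooses its queries adaptively and outputs a function of all answers; a randomized SQ algorithm is a probability distribution over deterministic ones; it estimates $\mathrm{Supp}(D)$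 with precision $\varepsilon$ and probability of success $1-\alpha$ if for every $D$ in the model and every valid $\mathrm{STAT}(\tau)$ oracle for $D$, with probability at least $1-\alpha$ its output $\hat M$ satisfies $d_H(\mathrm{Supp}(D),\hat M)\le\varepsilon$. *)

theory Defs
  imports "HOL-Analysis.Analysis" "HOL-Probability.Probability"
begin

definition hausdorff_pre :: "nat \<Rightarrow> real \<Rightarrow> 'a::euclidean_space set \<Rightarrow> ennreal" where
  "hausdorff_pre k \<delta> A =
     (INF C \<in> {C :: nat \<Rightarrow> 'a set. A \<subseteq> (\<Union>i. C i) \<and>
                 (\<forall>i. bounded (C i) \<and> diameter (C i) \<le> \<delta>)}.
        (\<Sum>i. (if C i = {} then 0
               else ennreal (unit_ball_vol (real k) * (diameter (C i) / 2) ^ k))))"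

definition hausdorff_outer :: "nat \<Rightarrow> 'a::euclidean_space set \<Rightarrow> ennreal" where
  "hausdorff_outer k A = (SUP \<delta> \<in> {0<..}. hausdorff_pre k \<delta> A)"

definition hausdorff_measure :: "nat \<Rightarrow> 'a::euclidean_space measure" where
  "hausdorff_measure k = measure_of UNIV (sets borel) (hausdorff_outer k)"

definition omega_vol :: "('d::finite) itself \<Rightarrow> real" where
  "omega_vol _ = measure lborel (ball (0::real^'d) 1)"

definition sigma_vol :: "('d::finite) itself \<Rightarrow> real" where
  "sigma_vol _ = enn2real (hausdorff_outer (CARD('d) - 1) (sphere (0::real^'d) 1))"

definition medial_axis :: "'a::euclidean_space set \<Rightarrow> 'a set" where
  "medial_axis K = {z. \<exists>p q. p \<in> K \<and> q \<in> K \<and> p \<noteq> q \<and>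
                        dist z p = infdist z K \<and> dist z q = infdist z K}"

definition reach :: "'a::euclidean_space set \<Rightarrow> ereal" where
  "reach K = (INF z \<in> medial_axis K. ereal (infdist z K))"

definition C2_on :: "'a::euclidean_space set \<Rightarrow> ('a \<Rightarrow> 'b::euclidean_space) \<Rightarrow> bool" where
  "C2_on U f \<longleftrightarrow> open U \<and>
     (\<exists>(f' :: 'a \<Rightarrow> ('a \<Rightarrow>\<^sub>L 'b)) (f'' :: 'a \<Rightarrow> ('a \<Rightarrow>\<^sub>L ('a \<Rightarrow>\<^sub>L 'b))).
        (\<forall>x\<in>U. (f has_derivative blinfun_apply (f' x)) (at x)) \<and>
        (\<forall>x\<in>U. (f' has_derivative blinfun_apply (f'' x)) (at x)) \<and>
        continuous_on U f'')"

definition C2_submanifold :: "nat \<Rightarrow> 'a::euclidean_space set \<Rightarrow> bool" where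
  "C2_submanifold d M \<longleftrightarrow>
     (\<forall>p\<in>M. \<exists>U V (\<phi> :: 'a \<Rightarrow> 'a) \<psi> E.
        open U \<and> p \<in> U \<and> open V \<and> subspace E \<and> dim E = d \<and>
        \<phi> ` U = V \<and> \<psi> ` V = U \<and> (\<forall>x\<in>U. \<psi> (\<phi> x) = x) \<and> (\<forall>y\<in>V. \<phi> (\<psi> y) = y) \<and>
        C2_on U \<phi> \<and> C2_on V \<psi> \<and> \<phi> ` (M \<inter> U) = V \<inter> E)"

definition manifolds :: "nat \<Rightarrow> real \<Rightarrow> 'a::euclidean_space set set" where
  "manifolds d \<rho> = {M. compact M \<and> connected M \<and> C2_submanifold d M \<and> reach M \<ge> ereal \<rho>}"

definition msupport :: "'a::metric_space measure \<Rightarrow> 'a set" where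
  "msupport D = {x. \<forall>e>0. emeasure D (ball x e) > 0}"

definition bb_model ::
  "nat \<Rightarrow> real \<Rightarrow> real \<Rightarrow> real \<Rightarrow> real \<Rightarrow> real \<Rightarrow> 'a::euclidean_space measure set" where
  "bb_model d rch fmin fmax L R = {D. prob_space D \<and>
     (\<exists>M (f :: 'a \<Rightarrow> real). M \<in> manifolds d rch \<and> M \<subseteq> cball 0 R \<and> msupport D = M \<and>
        (\<forall>x\<in>M. fmin \<le> f x \<and> f x \<le> fmax) \<and>
        (\<forall>x\<in>M. \<forall>y\<in>M. \<bar>f x - f y\<bar> \<le> L * dist x y) \<and>
        D = density (hausdorff_measure d) (\<lambda>x. ennreal (indicator M x * f x)))}"

definition dH :: "'a::metric_space set \<Rightarrow> 'a set \<Rightarrow> ereal" where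
  "dH K K' = (SUP x. ereal \<bar>infdist x K - infdist x K'\<bar>)"

definition valid_query :: "('a::euclidean_space \<Rightarrow> real) \<Rightarrow> bool" where
  "valid_query r \<longleftrightarrow> r \<in> borel_measurable borel \<and> (\<forall>x. \<bar>r x\<bar> \<le> 1)"

text \<open>An adversarial STAT(tau) oracle for D: answers the last query of the query
  history (it may depend on the whole history) within tau of its expectation.\<close>
definition valid_oracle ::
  "'a::euclidean_space measure \<Rightarrow> real \<Rightarrow> (('a \<Rightarrow> real) list \<Rightarrow> real) \<Rightarrow> bool" where
  "valid_oracle D \<tau> Orc \<longleftrightarrow>
     (\<forall>rs r. valid_query r \<longrightarrow> \<bar>Orc (rs @ [r]) - (\<integral>x. r x \<partial>D)\<bar> \<le> \<tau>)"

fun sq_answers :: "(real list \<Rightarrow> 'q) \<Rightarrow> ('q list \<Rightarrow> real) \<Rightarrow> nat \<Rightarrow> real list" where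
  "sq_answers Q Orc 0 = []"
| "sq_answers Q Orc (Suc k) =
     (let as = sq_answers Q Orc k in as @ [Orc (map (\<lambda>i. Q (take i as)) [0..<Suc k])])"

text \<open>A randomized SQ algorithm making q queries is given by a probability space P of
  random seeds w and, for each w, a deterministic algorithm (query strategy Q w and
  output map Out w).  It estimates Supp(D) over the model with precision eps and
  probability of success 1 - alpha.\<close>
definition sq_estimates ::
  "'w measure \<Rightarrow> ('w \<Rightarrow> real list \<Rightarrow> ('a::euclidean_space \<Rightarrow> real)) \<Rightarrow> ('w \<Rightarrow> real list \<Rightarrow> 'a set)
   \<Rightarrow> nat \<Rightarrow> real \<Rightarrow> 'a measure set \<Rightarrow> real \<Rightarrow> real \<Rightarrow> bool" where
  "sq_estimates P Q Out q \<tau> Model \<epsilon> \<alpha> \<longleftrightarrow>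
     prob_space P \<and> (\<forall>w\<in>space P. \<forall>as. valid_query (Q w as)) \<and>
     (\<forall>D\<in>Model. \<forall>Orc. valid_oracle D \<tau> Orc \<longrightarrow>
        measure P {w \<in> space P. dH (msupport D) (Out w (sq_answers (Q w) Orc q)) \<le> ereal \<epsilon>}
          \<ge> 1 - \<alpha>)"

end

theory Submission imports Defs begin

text \<open>If the models contain a finite family of manifolds at pairwise distance greater than
  $2\varepsilon$, an oracle that rounds every expectation to one of about $1 + 1/\tau$ values leaves at most
  $(1 + 1/\tau)^q$ transcripts, and each transcript identifies at most one member of the family; so the family has at most
  $(1 + 1/\tau)^q / (1 - \alpha)$ members. Two families are needed, both built from one base manifold whose volume is
  comparable to $1/f_{\min}$ and whose curvature leaves some room below $1/\mathrm{rch}_{\min}$. The base is a round sphere if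
  the ball of radius $R$ is large enough for one of the required volume. Otherwise it is a long chain of thick
  $d$-dimensional discs, two parallel flat sheets joined along a rounded rim, stacked in the remaining $k - d$
  dimensions along a Hamiltonian path of a grid and connected through necks; here $k$ minimises the
  left-hand side of the hypothesis. Translating the base by a packing of a ball gives the term $\log(R/4\varepsilon)$. Pushing a
  maximal separated set of sites of the base along normal vectors of length at most $20\varepsilon$, chosen independently from a
  packing of the normal space, gives the other term. Reach is controlled throughout by Federer's quadratic bound on
  the distance to the tangent space, which is stable under maps that are close to the identity up to second order.\<close>

section \<open>Hausdorff measure\<close>

text \<open>The obstacle behind most constants is measure-theoretic: surface volumes are never
  computed, only bounded through covers in terms of one number s, the value of
  \<open>hausdorff_outer (d - 1)\<close> on a unit sphere. Lower bounds slice a cover by radii,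
  upper bounds build covers of product form. Each comparison loses at most a factor exponential in
  d, for which the powers 8^d and 192^k in the hypothesis leave room. That s is finite and positive
  is read off from the same hypothesis. The number of bump sites is found by counting separated
  points instead, so there \<open>unit_ball_vol\<close>, the normalising constant of the measure,
  enters directly.

  Margins are fixed in advance. With V = 1/fmin, the base has tangent bounds for reach 3/2 rch, lies
  in the ball of radius R/2 and has volume between V/64 and V/2. Perturbing spends these down to
  rch, R, V/96 and V, which is where the ratio 96 of fmax to fmin comes from. All laws are uniform,
  so the Lipschitz condition holds for every L \<ge> 0.\<close>

definition hausdorff_weight :: "nat \<Rightarrow> 'a::euclidean_space set \<Rightarrow> ennreal" where
  "hausdorff_weight k C = (if C = {} then 0 else ennreal (unit_ball_vol (real k) * (diameter C / 2) ^ k))"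

text \<open>The case distinction in the weight matters for k = 0, where 0 ^ 0 = 1 would charge every
  empty member of a cover. It lets finite covers be padded with empty sets.\<close>

lemma hausdorff_weight_empty [simp]: "hausdorff_weight k {} = 0"
  by (simp add: hausdorff_weight_def)

lemma hausdorff_weight_le:
  assumes "bounded C" "diameter C \<le> D"
  shows "hausdorff_weight k C \<le> ennreal (unit_ball_vol (real k) * (D / 2) ^ k)"
proof -
  have "0 \<le> diameter C" using assms by (simp add: diameter_ge_0)
  then show ?thesis
    using assms by (auto simp: hausdorff_weight_def intro!: ennreal_leI mult_left_mono power_mono)
qed

lemma hausdorff_pre_alt:
  "hausdorff_pre k \<delta> A = (INF C \<in> {C. A \<subseteq> (\<Union>i. C i) \<and> (\<forall>i. bounded (C i) \<and> diameter (C i) \<le> \<delta>)}.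
      (\<Sum>i. hausdorff_weight k (C i)))"
  by (simp add: hausdorff_pre_def hausdorff_weight_def)

lemma hausdorff_pre_le:
  assumes "A \<subseteq> (\<Union>i. C i)" "\<And>i. bounded (C i)" "\<And>i. diameter (C i) \<le> \<delta>"
  shows "hausdorff_pre k \<delta> A \<le> (\<Sum>i. hausdorff_weight k (C i))"
  unfolding hausdorff_pre_alt using assms by (intro INF_lower) auto

lemma hausdorff_pre_lessD:
  assumes "hausdorff_pre k \<delta> A < e"
  obtains C where "A \<subseteq> (\<Union>i. C i)" "\<And>i. bounded (C i)" "\<And>i. diameter (C i) \<le> \<delta>"
    "(\<Sum>i. hausdorff_weight k (C i)) < e"
  using assms unfolding hausdorff_pre_alt INF_less_iff by auto

lemma hausdorff_pre_greatest:
  assumes "\<And>C. A \<subseteq> (\<Union>i. C i) \<Longrightarrow> (\<And>i. bounded (C i)) \<Longrightarrow> (\<And>i. diameter (C i) \<le> \<delta>) \<Longrightarrow>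
      e \<le> (\<Sum>i. hausdorff_weight k (C i))"
  shows "e \<le> hausdorff_pre k \<delta> A"
  unfolding hausdorff_pre_alt by (intro INF_greatest) (auto intro: assms)

lemma hausdorff_pre_mono: "A \<subseteq> B \<Longrightarrow> hausdorff_pre k \<delta> A \<le> hausdorff_pre k \<delta> B"
  by (rule hausdorff_pre_greatest) (auto intro!: hausdorff_pre_le)

lemma hausdorff_pre_antimono: "\<delta> \<le> \<delta>' \<Longrightarrow> hausdorff_pre k \<delta>' A \<le> hausdorff_pre k \<delta> A"
  by (rule hausdorff_pre_greatest) (auto intro!: hausdorff_pre_le order_trans[of _ \<delta> \<delta>'])

lemma hausdorff_pre_single:
  assumes "bounded A" "diameter A \<le> D" "D \<le> \<delta>"
  shows "hausdorff_pre k \<delta> A \<le> ennreal (unit_ball_vol (real k) * (D / 2) ^ k)"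
proof -
  have D: "0 \<le> D" using assms diameter_ge_0[OF assms(1)] by linarith
  let ?C = "\<lambda>i::nat. if i = 0 then A else {}"
  have "hausdorff_pre k \<delta> A \<le> (\<Sum>i. hausdorff_weight k (?C i))"
    using assms D by (intro hausdorff_pre_le) (auto split: if_splits)
  also have "\<dots> = (\<Sum>i\<in>{0}. hausdorff_weight k (?C i))"
    by (rule suminf_finite) auto
  also have "\<dots> \<le> ennreal (unit_ball_vol (real k) * (D / 2) ^ k)"
    using hausdorff_weight_le[OF assms(1,2)] by simp
  finally show ?thesis .
qed

lemma hausdorff_pre_empty [simp]: "0 \<le> \<delta> \<Longrightarrow> hausdorff_pre k \<delta> {} = 0"
  using hausdorff_pre_le[of "{}" "\<lambda>_. {}" \<delta> k] by simp

lemma hausdorff_pre_UN: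
  "hausdorff_pre k \<delta> (\<Union>i::nat. A i) \<le> (\<Sum>i. hausdorff_pre k \<delta> (A i))"
proof (rule ennreal_le_epsilon)
  fix e :: real assume e: "0 < e" "(\<Sum>n. hausdorff_pre k \<delta> (A n)) < top"
  then have *: "\<And>n. hausdorff_pre k \<delta> (A n) < hausdorff_pre k \<delta> (A n) + e * (1/2)^Suc n"
    by (auto simp add: less_top dest!: ennreal_suminf_lessD)
  have "\<exists>C. A n \<subseteq> (\<Union>i. C i) \<and> (\<forall>i. bounded (C i) \<and> diameter (C i) \<le> \<delta>) \<and>
      (\<Sum>i. hausdorff_weight k (C i)) \<le> hausdorff_pre k \<delta> (A n) + e * (1/2)^Suc n" for n
    by (rule hausdorff_pre_lessD[OF *[of n]]) (auto intro: less_imp_le)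
  then obtain B where B: "\<And>n. A n \<subseteq> (\<Union>i. B n i)" "\<And>n i. bounded (B n i)" "\<And>n i. diameter (B n i) \<le> \<delta>"
      "\<And>n. (\<Sum>i. hausdorff_weight k (B n i)) \<le> hausdorff_pre k \<delta> (A n) + e * (1/2)^Suc n"
    by metis
  define C where "C = case_prod B o prod_decode"
  have A_C: "(\<Union>i. A i) \<subseteq> (\<Union>i. C i)"
    using B(1) by (auto simp add: C_def subset_eq) (metis prod.case prod_encode_inverse)
  have "hausdorff_pre k \<delta> (\<Union>i. A i) \<le> (\<Sum>i. hausdorff_weight k (C i))"
    using A_C B by (intro hausdorff_pre_le) (auto simp: C_def split: prod.splits)
  also have "\<dots> = (\<Sum>n. \<Sum>i. hausdorff_weight k (B n i))"
    unfolding C_def comp_def by (intro suminf_ennreal_2dimen) auto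
  also have "\<dots> \<le> (\<Sum>n. hausdorff_pre k \<delta> (A n) + e * (1/2) ^ Suc n)"
    by (intro suminf_le allI B) auto
  also have "... = (\<Sum>n. hausdorff_pre k \<delta> (A n)) + (\<Sum>n. ennreal e * ennreal ((1/2) ^ Suc n))"
    using \<open>0 < e\<close> by (subst suminf_add[symmetric])
                     (auto simp del: ennreal_suminf_cmult simp add: ennreal_mult[symmetric])
  also have "\<dots> = (\<Sum>n. hausdorff_pre k \<delta> (A n)) + e"
    unfolding ennreal_suminf_cmult
    by (subst suminf_ennreal_eq[OF zero_le_power power_half_series]) auto
  finally show "hausdorff_pre k \<delta> (\<Union>i. A i) \<le> (\<Sum>n. hausdorff_pre k \<delta> (A n)) + e" .
qed

lemma hausdorff_pre_UN_finite:
  assumes "finite J" "0 \<le> \<delta>"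
  shows "hausdorff_pre k \<delta> (\<Union>j\<in>J. A j) \<le> (\<Sum>j\<in>J. hausdorff_pre k \<delta> (A j))"
proof -
  obtain h where h: "bij_betw h {0..<card J} J" using assms(1) ex_bij_betw_nat_finite by blast
  let ?B = "\<lambda>i. if i < card J then A (h i) else {}"
  have "(\<Union>j\<in>J. A j) \<subseteq> (\<Union>i. ?B i)"
  proof
    fix x assume "x \<in> (\<Union>j\<in>J. A j)"
    then obtain j where j: "j \<in> J" "x \<in> A j" by auto
    then obtain i where "i < card J" "h i = j"
      using h by (metis atLeastLessThan_iff bij_betw_imp_surj_on imageE)
    then show "x \<in> (\<Union>i. ?B i)" using j by (auto intro!: exI[of _ i])
  qed
  then have "hausdorff_pre k \<delta> (\<Union>j\<in>J. A j) \<le> (\<Sum>i. hausdorff_pre k \<delta> (?B i))"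
    by (rule order_trans[OF hausdorff_pre_mono hausdorff_pre_UN])
  also have "\<dots> = (\<Sum>i<card J. hausdorff_pre k \<delta> (?B i))"
    by (rule suminf_finite) (use assms in auto)
  also have "\<dots> = (\<Sum>i\<in>{0..<card J}. hausdorff_pre k \<delta> (A (h i)))"
    by (rule sum.cong) auto
  also have "\<dots> = (\<Sum>j\<in>J. hausdorff_pre k \<delta> (A j))"
    by (rule sum.reindex_bij_betw[OF h])
  finally show ?thesis .
qed

lemma hausdorff_outer_ge: "0 < \<delta> \<Longrightarrow> hausdorff_pre k \<delta> A \<le> hausdorff_outer k A"
  unfolding hausdorff_outer_def by (intro SUP_upper) auto

text \<open>The pre-measures increase as the scale decreases, so scales below any fixed
  \<open>\<delta>0\<close> determine the supremum.\<close>

lemma hausdorff_outer_le: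
  assumes "\<And>\<delta>. 0 < \<delta> \<Longrightarrow> \<delta> < \<delta>0 \<Longrightarrow> hausdorff_pre k \<delta> A \<le> e" "0 < \<delta>0"
  shows "hausdorff_outer k A \<le> e"
  unfolding hausdorff_outer_def
proof (intro SUP_least)
  fix \<delta> :: real assume "\<delta> \<in> {0<..}"
  then have "hausdorff_pre k \<delta> A \<le> hausdorff_pre k (min \<delta> (\<delta>0/2)) A"
    by (intro hausdorff_pre_antimono) auto
  also have "\<dots> \<le> e" using assms \<open>\<delta> \<in> {0<..}\<close> by auto
  finally show "hausdorff_pre k \<delta> A \<le> e" .
qed

lemma hausdorff_outer_mono: "A \<subseteq> B \<Longrightarrow> hausdorff_outer k A \<le> hausdorff_outer k B"
  unfolding hausdorff_outer_def by (intro SUP_mono) (auto intro: hausdorff_pre_mono)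

lemma hausdorff_outer_empty [simp]: "hausdorff_outer k {} = 0"
proof -
  have "hausdorff_outer k ({}::'a set) \<le> 0" by (rule hausdorff_outer_le[of 1]) auto
  then show ?thesis by simp
qed

lemma hausdorff_outer_UN: "hausdorff_outer k (\<Union>i::nat. A i) \<le> (\<Sum>i. hausdorff_outer k (A i))"
proof (rule hausdorff_outer_le[of 1])
  fix \<delta> :: real assume "0 < \<delta>"
  have "hausdorff_pre k \<delta> (\<Union>i. A i) \<le> (\<Sum>i. hausdorff_pre k \<delta> (A i))" by (rule hausdorff_pre_UN)
  also have "\<dots> \<le> (\<Sum>i. hausdorff_outer k (A i))"
    using \<open>0 < \<delta>\<close> by (intro suminf_le allI hausdorff_outer_ge) auto
  finally show "hausdorff_pre k \<delta> (\<Union>i. A i) \<le> (\<Sum>i. hausdorff_outer k (A i))" .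
qed auto

lemma hausdorff_outer_UN_finite:
  assumes "finite J"
  shows "hausdorff_outer k (\<Union>j\<in>J. A j) \<le> (\<Sum>j\<in>J. hausdorff_outer k (A j))"
proof (rule hausdorff_outer_le[of 1])
  fix \<delta> :: real assume "0 < \<delta>"
  then have "hausdorff_pre k \<delta> (\<Union>j\<in>J. A j) \<le> (\<Sum>j\<in>J. hausdorff_pre k \<delta> (A j))"
    using assms by (intro hausdorff_pre_UN_finite) auto
  also have "\<dots> \<le> (\<Sum>j\<in>J. hausdorff_outer k (A j))"
    using \<open>0 < \<delta>\<close> by (intro sum_mono hausdorff_outer_ge) auto
  finally show "hausdorff_pre k \<delta> (\<Union>j\<in>J. A j) \<le> (\<Sum>j\<in>J. hausdorff_outer k (A j))" .
qed auto

lemma hausdorff_outer_Un: "hausdorff_outer k (A \<union> B) \<le> hausdorff_outer k A + hausdorff_outer k B"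
  using hausdorff_outer_UN_finite[of "{True,False}" k "\<lambda>b. if b then A else B"] by (simp add: Un_commute)

text \<open>At scales below \<eta> no member of a cover meets both sets, so a cover of the union
  splits into a cover of each. The two suprema over scales are then taken one after the other, with
  a common smaller scale for each pair.\<close>

lemma hausdorff_outer_separated:
  assumes sep: "\<And>x y. x \<in> A \<Longrightarrow> y \<in> B \<Longrightarrow> \<eta> \<le> dist x y" and "0 < \<eta>"
  shows "hausdorff_outer k A + hausdorff_outer k B \<le> hausdorff_outer k (A \<union> B)"
proof -
  have pre: "hausdorff_pre k \<delta> A + hausdorff_pre k \<delta> B \<le> hausdorff_pre k \<delta> (A \<union> B)"
    if "0 < \<delta>" "\<delta> < \<eta>" for \<delta>
  proof (rule hausdorff_pre_greatest)
    fix C :: "nat \<Rightarrow> 'a set"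
    assume C: "A \<union> B \<subseteq> (\<Union>i. C i)" "\<And>i. bounded (C i)" "\<And>i. diameter (C i) \<le> \<delta>"
    let ?C = "\<lambda>S i. if C i \<inter> S \<noteq> {} then C i else {}"
    have cov: "A \<subseteq> (\<Union>i. ?C A i)" "B \<subseteq> (\<Union>i. ?C B i)"
      using C(1) by (auto simp: subset_iff Bex_def Ball_def split: if_splits) (metis IntI empty_iff)+
    have "hausdorff_pre k \<delta> A \<le> (\<Sum>i. hausdorff_weight k (?C A i))"
      using C(2,3) that cov(1) by (intro hausdorff_pre_le) auto
    moreover have "hausdorff_pre k \<delta> B \<le> (\<Sum>i. hausdorff_weight k (?C B i))"
      using C(2,3) that cov(2) by (intro hausdorff_pre_le) auto
    ultimately have "hausdorff_pre k \<delta> A + hausdorff_pre k \<delta> B \<le>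
        (\<Sum>i. hausdorff_weight k (?C A i) + hausdorff_weight k (?C B i))"
      by (subst suminf_add[symmetric]) (auto intro: add_mono)
    also have "\<dots> \<le> (\<Sum>i. hausdorff_weight k (C i))"
    proof (intro suminf_le allI)
      fix i
      have "\<not> (C i \<inter> A \<noteq> {} \<and> C i \<inter> B \<noteq> {})"
      proof
        assume "C i \<inter> A \<noteq> {} \<and> C i \<inter> B \<noteq> {}"
        then obtain x y where "x \<in> C i" "x \<in> A" "y \<in> C i" "y \<in> B" by blast
        then show False using sep[of x y] diameter_bounded_bound[OF C(2), of x i y] C(3)[of i] that by auto
      qed
      then show "hausdorff_weight k (?C A i) + hausdorff_weight k (?C B i) \<le> hausdorff_weight k (C i)"
        by auto
    qed auto
    finally show "hausdorff_pre k \<delta> A + hausdorff_pre k \<delta> B \<le> (\<Sum>i. hausdorff_weight k (C i))" .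
  qed
  have *: "hausdorff_pre k a A + hausdorff_pre k b B \<le> hausdorff_outer k (A \<union> B)"
    if "0 < a" "0 < b" for a b
  proof -
    let ?\<delta> = "min (min a b) (\<eta>/2)"
    have "hausdorff_pre k a A + hausdorff_pre k b B \<le> hausdorff_pre k ?\<delta> A + hausdorff_pre k ?\<delta> B"
      by (intro add_mono hausdorff_pre_antimono) auto
    also have "\<dots> \<le> hausdorff_pre k ?\<delta> (A \<union> B)" using that assms by (intro pre) auto
    also have "\<dots> \<le> hausdorff_outer k (A \<union> B)" using that assms by (intro hausdorff_outer_ge) auto
    finally show ?thesis .
  qed
  have 2: "hausdorff_outer k A + hausdorff_pre k b B \<le> hausdorff_outer k (A \<union> B)" if "0 < b" for b
  proof -
    have "hausdorff_outer k A + hausdorff_pre k b B = (SUP a\<in>{0<..}. hausdorff_pre k a A + hausdorff_pre k b B)"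
      unfolding hausdorff_outer_def by (subst ennreal_SUP_add_left) auto
    also have "\<dots> \<le> hausdorff_outer k (A \<union> B)" using that * by (intro SUP_least) auto
    finally show ?thesis .
  qed
  have "hausdorff_outer k A + hausdorff_outer k B = (SUP b\<in>{0<..}. hausdorff_outer k A + hausdorff_pre k b B)"
    by (subst (2) hausdorff_outer_def, subst ennreal_SUP_add_right) auto
  also have "\<dots> \<le> hausdorff_outer k (A \<union> B)" using 2 by (intro SUP_least) auto
  finally show ?thesis .
qed

text \<open>Caratheodory's argument for metric outer measures. The part of X at distance at least
  1/(n + 1) from F is separated from F, and the rest of X - F lies in the shells \<open>R n\<close>,
  \<open>R (n + 1)\<close> and so on. Shells two apart are separated, so the even ones and the odd
  ones each have total measure at most that of X; the series converges and its tails vanish.\<close>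

lemma hausdorff_outer_closed_split:
  assumes "closed F"
  shows "hausdorff_outer k (X \<inter> F) + hausdorff_outer k (X - F) \<le> hausdorff_outer k X"
proof (cases "hausdorff_outer k X = top \<or> F = {}")
  case True then show ?thesis by auto
next
  case False
  let ?H = "hausdorff_outer k"
  define S where "S n = {x\<in>X. 1 / real (Suc n) \<le> infdist x F}" for n
  define R where "R n = {x\<in>X. 1 / real (Suc (Suc n)) \<le> infdist x F \<and> infdist x F < 1 / real (Suc n)}" for n
  have fin: "?H X \<noteq> top" "F \<noteq> {}" using False by auto
  have step: "?H (X \<inter> F) + ?H (S n) \<le> ?H X" for n
  proof -
    have "?H (X \<inter> F) + ?H (S n) \<le> ?H ((X \<inter> F) \<union> S n)"
    proof (rule hausdorff_outer_separated[of _ _ "1 / real (Suc n)"])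
      fix x y assume "x \<in> X \<inter> F" "y \<in> S n"
      then show "1 / real (Suc n) \<le> dist x y"
        using infdist_le[of x F y] by (auto simp: S_def dist_commute)
    qed auto
    also have "\<dots> \<le> ?H X" by (intro hausdorff_outer_mono) (auto simp: S_def)
    finally show ?thesis .
  qed
  have Rsep: "1 / real (Suc (Suc m)) - 1 / real (Suc n) \<le> dist x y" if "x \<in> R m" "y \<in> R n" for m n x y
    using that infdist_triangle[of x F y] by (auto simp: R_def)
  have par: "(\<Sum>i<n. ?H (R (2 * i + b))) \<le> ?H X" for n b
  proof -
    have "(\<Sum>i<n. ?H (R (2 * i + b))) \<le> ?H (\<Union>i<n. R (2 * i + b))"
    proof (induction n)
      case (Suc n)
      have "(\<Sum>i<Suc n. ?H (R (2 * i + b))) \<le> ?H (\<Union>i<n. R (2 * i + b)) + ?H (R (2 * n + b))"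
        using Suc by (auto intro: add_mono)
      also have "\<dots> \<le> ?H ((\<Union>i<n. R (2 * i + b)) \<union> R (2 * n + b))"
      \<comment> \<open>For n = 0 the union is empty and the gap 1/(2n + b) may be a division by
        zero, so only successors use the separation.\<close>
      proof (cases n)
        case (Suc n')
        show ?thesis
        proof (rule hausdorff_outer_separated[of _ _ "1 / real (2 * n + b) - 1 / real (Suc (2 * n + b))"])
          fix x y assume "x \<in> (\<Union>i<n. R (2 * i + b))" "y \<in> R (2 * n + b)"
          then obtain i where i: "i < n" "x \<in> R (2 * i + b)" by auto
          have "1 / real (2 * n + b) \<le> 1 / real (Suc (Suc (2 * i + b)))"
            using i by (intro divide_left_mono) auto
          then show "1 / real (2 * n + b) - 1 / real (Suc (2 * n + b)) \<le> dist x y"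
            using Rsep[OF i(2) \<open>y \<in> R (2 * n + b)\<close>] by linarith
        next
          show "0 < 1 / real (2 * n + b) - 1 / real (Suc (2 * n + b))"
          proof -
            have "0 < real (2 * n + b)" using Suc by simp
            then have "1 / (real (2 * n + b) + 1) < 1 / real (2 * n + b)" by (intro divide_strict_left_mono) auto
            then show ?thesis by (simp add: add.commute)
          qed
        qed
      qed simp
      also have "\<dots> = ?H (\<Union>i<Suc n. R (2 * i + b))"
        by (rule arg_cong[where f="?H"]) (auto simp: lessThan_Suc)
      finally show ?case .
    qed simp
    also have "\<dots> \<le> ?H X" by (intro hausdorff_outer_mono) (auto simp: R_def)
    finally show ?thesis .
  qed
  have "(\<Sum>i<n. ?H (R i)) \<le> ?H X + ?H X" for n
  proof -
    have "(\<Sum>i<n. ?H (R i)) \<le> (\<Sum>i<2*n. ?H (R i))" by (intro sum_mono2) auto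
    also have "(\<Sum>i<2*n. ?H (R i)) = (\<Sum>i<n. ?H (R (2 * i + 0))) + (\<Sum>i<n. ?H (R (2 * i + 1)))"
      by (induction n) (auto simp: ac_simps)
    also have "\<dots> \<le> ?H X + ?H X" by (intro add_mono par)
    finally show ?thesis .
  qed
  then have "(\<Sum>i. ?H (R i)) \<le> ?H X + ?H X" by (intro suminf_le_const) auto
  then have sfin: "(\<Sum>i. ?H (R i)) \<noteq> top"
    using fin(1) by (metis ennreal_add_eq_top top_unique)
  have ex: "infdist x F > 0" if "x \<in> X - F" for x
    using that assms fin infdist_pos_not_in_closed by auto
  have le: "?H (X - F) \<le> ?H (S n) + (\<Sum>i. ?H (R (i + n)))" for n
  proof -
    have "X - F \<subseteq> S n \<union> (\<Union>i. R (i + n))"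
    proof
      fix x assume x: "x \<in> X - F"
      show "x \<in> S n \<union> (\<Union>i. R (i + n))"
      proof (cases "x \<in> S n")
        case False
        then have lt: "infdist x F < 1 / real (Suc n)" using x by (auto simp: S_def)
        obtain m where "inverse (real (Suc m)) < infdist x F"
          using ex[OF x] reals_Archimedean by blast
        then have exm: "\<exists>m. 1 / real (Suc m) \<le> infdist x F" by (auto simp: inverse_eq_divide intro: less_imp_le)
        define m where "m = (LEAST m. 1 / real (Suc m) \<le> infdist x F)"
        have m: "1 / real (Suc m) \<le> infdist x F" unfolding m_def using exm by (rule LeastI_ex)
        have "n < m"
        proof (rule ccontr)
          assume "\<not> n < m"
          then have "1 / real (Suc n) \<le> 1 / real (Suc m)" by (intro divide_left_mono) auto
          then show False using m lt by linarith
        qed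
        then obtain m' where m': "m = Suc m'" "n \<le> m'" by (cases m) auto
        have "\<not> 1 / real (Suc m') \<le> infdist x F"
          using not_less_Least[of m' "\<lambda>m. 1 / real (Suc m) \<le> infdist x F"] m' m_def by auto
        then have "x \<in> R ((m' - n) + n)" using m m' x by (auto simp: R_def)
        then show ?thesis by blast
      qed auto
    qed
    then have "?H (X - F) \<le> ?H (S n \<union> (\<Union>i. R (i + n)))" by (rule hausdorff_outer_mono)
    also have "\<dots> \<le> ?H (S n) + (\<Sum>i. ?H (R (i + n)))"
      by (intro order_trans[OF hausdorff_outer_Un] add_mono hausdorff_outer_UN) auto
    finally show ?thesis .
  qed
  have "(\<lambda>n. (\<Sum>i. ?H (R (i + n)))) \<longlonglongrightarrow> 0"
  proof -
    define h where "h i = enn2real (?H (R i))" for i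
    have h: "?H (R i) = ennreal (h i)" "0 \<le> h i" for i
      using ennreal_suminf_lessD[of "\<lambda>i. ?H (R i)" top i] sfin
      by (auto simp: h_def less_top)
    have sm: "summable h" using sfin h(2) unfolding h(1) by (auto intro: summable_suminf_not_top)
    have "(\<lambda>n. suminf h - (\<Sum>i<n. h i)) \<longlonglongrightarrow> suminf h - suminf h"
      by (intro tendsto_intros summable_LIMSEQ sm)
    moreover have "(\<Sum>i. h (i + n)) = suminf h - (\<Sum>i<n. h i)" for n
      by (rule suminf_minus_initial_segment[OF sm])
    ultimately have "(\<lambda>n. (\<Sum>i. h (i + n))) \<longlonglongrightarrow> 0" by simp
    then have "(\<lambda>n. ennreal (\<Sum>i. h (i + n))) \<longlonglongrightarrow> ennreal 0" by (intro tendsto_ennrealI)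
    moreover have "(\<Sum>i. ?H (R (i + n))) = ennreal (\<Sum>i. h (i + n))" for n
      unfolding h(1) by (rule suminf_ennreal2) (use h sm summable_ignore_initial_segment in auto)
    ultimately show ?thesis by simp
  qed
  then have "(\<lambda>n. ?H X + (\<Sum>i. ?H (R (i + n)))) \<longlonglongrightarrow> ?H X + 0"
    by (intro tendsto_add) auto
  moreover have "?H (X \<inter> F) + ?H (X - F) \<le> ?H X + (\<Sum>i. ?H (R (i + n)))" for n
  proof -
    have "?H (X \<inter> F) + ?H (X - F) \<le> ?H (X \<inter> F) + (?H (S n) + (\<Sum>i. ?H (R (i + n))))"
      by (intro add_mono le) auto
    also have "\<dots> = (?H (X \<inter> F) + ?H (S n)) + (\<Sum>i. ?H (R (i + n)))" by (simp only: add.assoc)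
    also have "\<dots> \<le> ?H X + (\<Sum>i. ?H (R (i + n)))" by (rule add_right_mono[OF step])
    finally show ?thesis .
  qed
  ultimately show ?thesis
    by (simp add: LIMSEQ_le_const)
qed

text \<open>\<open>measure_of\<close> silently returns the zero measure unless its set function is a
  measure on the generated sigma-algebra, so \<open>hausdorff_measure\<close> has its intended
  meaning only through this fact. The Caratheodory-measurable sets form a sigma-algebra that
  contains the closed sets, hence the Borel sets.\<close>

lemma measure_space_hausdorff:
  "measure_space UNIV (sets borel) (hausdorff_outer k :: 'a::euclidean_space set \<Rightarrow> ennreal)"
proof -
  let ?H = "hausdorff_outer k :: 'a set \<Rightarrow> ennreal"
  interpret P: sigma_algebra "UNIV::'a set" "Pow UNIV" by (rule sigma_algebra_Pow)
  have "outer_measure_space (Pow UNIV) ?H"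
    by (auto simp: outer_measure_space_def positive_def increasing_def countably_subadditive_def
        intro!: hausdorff_outer_mono hausdorff_outer_UN)
  then have L: "measure_space UNIV (lambda_system UNIV (Pow UNIV) ?H) ?H"
    by (rule P.caratheodory_lemma)
  then interpret L: sigma_algebra UNIV "lambda_system UNIV (Pow UNIV) ?H"
    by (simp add: measure_space_def)
  have "F \<in> lambda_system UNIV (Pow UNIV) ?H" if "closed F" for F
  proof -
    have "?H (F \<inter> X) + ?H ((UNIV - F) \<inter> X) = ?H X" for X
    proof (rule antisym)
      have "?H (F \<inter> X) + ?H ((UNIV - F) \<inter> X) = ?H (X \<inter> F) + ?H (X - F)"
        by (simp add: Int_commute Diff_eq)
      then show "?H (F \<inter> X) + ?H ((UNIV - F) \<inter> X) \<le> ?H X"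
        using hausdorff_outer_closed_split[OF that, of k X] by simp
      have "?H X = ?H ((F \<inter> X) \<union> ((UNIV - F) \<inter> X))" by (rule arg_cong[where f="?H"]) auto
      also have "\<dots> \<le> ?H (F \<inter> X) + ?H ((UNIV - F) \<inter> X)" by (rule hausdorff_outer_Un)
      finally show "?H X \<le> ?H (F \<inter> X) + ?H ((UNIV - F) \<inter> X)" .
    qed
    then show ?thesis by (auto simp: lambda_system_def)
  qed
  then have "sets borel \<subseteq> lambda_system UNIV (Pow UNIV) ?H"
    using L.sigma_sets_subset[of "Collect closed"]
    by (subst borel_eq_closed) auto
  then show ?thesis
    by (rule measure_down[OF L, rotated]) (metis sets.sigma_algebra_axioms space_borel)
qed

lemma sets_hausdorff_measure [simp, measurable_cong]: "sets (hausdorff_measure k) = sets borel"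
  by (simp add: hausdorff_measure_def sigma_algebra.sigma_sets_eq[OF sets.sigma_algebra_axioms[of borel, simplified]])

lemma space_hausdorff_measure [simp]: "space (hausdorff_measure k) = UNIV"
  by (simp add: hausdorff_measure_def)

lemma emeasure_hausdorff_measure:
  assumes "A \<in> sets borel"
  shows "emeasure (hausdorff_measure k) A = hausdorff_outer k A"
proof -
  have "hausdorff_measure k = measure_of UNIV (sets borel) (hausdorff_outer k :: 'a set \<Rightarrow> ennreal)"
    by (rule hausdorff_measure_def)
  moreover have "measure_space UNIV (sets borel) (hausdorff_outer k :: 'a set \<Rightarrow> ennreal)"
    by (rule measure_space_hausdorff)
  ultimately show ?thesis using assms
    by (simp add: measure_space_def emeasure_measure_of_sigma)
qed

lemma hausdorff_outer_Un_disjoint: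
  assumes "A \<in> sets borel" "B \<in> sets borel" "A \<inter> B = {}"
  shows "hausdorff_outer k (A \<union> B) = hausdorff_outer k A + hausdorff_outer k B"
  using plus_emeasure[of A "hausdorff_measure k" B] assms
  by (simp add: emeasure_hausdorff_measure)

lemma hausdorff_outer_UN_disjoint:
  assumes "finite J" "\<And>j. j \<in> J \<Longrightarrow> A j \<in> sets borel" "disjoint_family_on A J"
  shows "hausdorff_outer k (\<Union>j\<in>J. A j) = (\<Sum>j\<in>J. hausdorff_outer k (A j))"
proof -
  have "(\<Sum>j\<in>J. emeasure (hausdorff_measure k) (A j)) = emeasure (hausdorff_measure k) (\<Union>j\<in>J. A j)"
    by (rule sum_emeasure) (use assms in auto)
  then show ?thesis using assms by (simp add: emeasure_hausdorff_measure sets.finite_UN)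
qed

section \<open>Hausdorff measure under Lipschitz maps, isometries and scalings\<close>

lemma hausdorff_outer_lipschitz_image:
  fixes f :: "'a::euclidean_space \<Rightarrow> 'b::euclidean_space"
  assumes lip: "\<And>x y. x \<in> A \<Longrightarrow> y \<in> A \<Longrightarrow> dist (f x) (f y) \<le> c * dist x y" and c: "0 < c"
  shows "hausdorff_outer k (f ` A) \<le> ennreal (c ^ k) * hausdorff_outer k A"
proof (rule hausdorff_outer_le[of 1])
  fix \<delta> :: real assume \<delta>: "0 < \<delta>"
  have "hausdorff_pre k \<delta> (f ` A) \<le> ennreal (c ^ k) * hausdorff_pre k (\<delta> / c) A"
  proof (cases "ennreal (c ^ k) * hausdorff_pre k (\<delta> / c) A = top")
    case False
    have eq: "ennreal (c ^ k) * e = e * ennreal (c^k)" for e by (simp add: mult.commute)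
    \<comment> \<open>The factor is moved to the left so that the infimum over covers stands alone
      on the right.\<close>
    have "hausdorff_pre k \<delta> (f ` A) / ennreal (c ^ k) \<le> hausdorff_pre k (\<delta> / c) A"
    proof (rule hausdorff_pre_greatest)
      fix C :: "nat \<Rightarrow> 'a set"
      assume C: "A \<subseteq> (\<Union>i. C i)" "\<And>i. bounded (C i)" "\<And>i. diameter (C i) \<le> \<delta> / c"
      let ?C = "\<lambda>i. f ` (C i \<inter> A)"
      have d: "dist x y \<le> c * diameter (C i)" if "x \<in> ?C i" "y \<in> ?C i" for x y i
      proof -
        obtain x' y' where xy: "x = f x'" "y = f y'" "x' \<in> C i \<inter> A" "y' \<in> C i \<inter> A" using \<open>x \<in> ?C i\<close> \<open>y \<in> ?C i\<close> by blast
        then have "dist x y \<le> c * dist x' y'" using lip by auto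
        also have "\<dots> \<le> c * diameter (C i)" using xy c C(2) by (intro mult_left_mono diameter_bounded_bound) auto
        finally show ?thesis .
      qed
      have bd: "bounded (?C i)" for i
        unfolding bounded_two_points using d by blast
      have dm: "diameter (?C i) \<le> c * diameter (C i)" for i
        using d c diameter_ge_0[OF C(2)[of i]] by (intro diameter_le) (auto simp: dist_norm)
      have "hausdorff_pre k \<delta> (f ` A) \<le> (\<Sum>i. hausdorff_weight k (?C i))"
      proof (rule hausdorff_pre_le)
        show "diameter (?C i) \<le> \<delta>" for i
          using dm[of i] mult_left_mono[OF C(3)[of i], of c] c by auto
        show "f ` A \<subseteq> (\<Union>i. ?C i)"
        proof
          fix z assume "z \<in> f ` A"
          then obtain x where x: "x \<in> A" "z = f x" by blast
          then obtain i where "x \<in> C i" using C(1) by blast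
          then show "z \<in> (\<Union>i. ?C i)" using x by (intro UN_I[of i]) auto
        qed
      qed (use bd in auto)
      also have "\<dots> \<le> (\<Sum>i. ennreal (c ^ k) * hausdorff_weight k (C i))"
      proof (intro suminf_le allI)
        fix i
        have dd: "0 \<le> diameter (?C i)" using bd diameter_ge_0 by blast
        have "unit_ball_vol (real k) * (diameter (?C i) / 2) ^ k \<le> unit_ball_vol (real k) * (c * diameter (C i) / 2) ^ k"
          using dm[of i] dd by (intro mult_left_mono power_mono) auto
        also have "\<dots> = c ^ k * (unit_ball_vol (real k) * (diameter (C i) / 2) ^ k)"
          by (simp add: power_mult_distrib power_divide)
        finally show "hausdorff_weight k (?C i) \<le> ennreal (c ^ k) * hausdorff_weight k (C i)"
          using c diameter_ge_0[OF C(2)[of i]]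
          by (auto simp: hausdorff_weight_def ennreal_mult'[symmetric] intro!: ennreal_leI)
      qed auto
      also have "\<dots> = ennreal (c ^ k) * (\<Sum>i. hausdorff_weight k (C i))" by simp
      finally show "hausdorff_pre k \<delta> (f ` A) / ennreal (c ^ k) \<le> (\<Sum>i. hausdorff_weight k (C i))"
        using c by (subst divide_le_posI_ennreal) (auto simp: mult.commute)
    qed
    then have "hausdorff_pre k \<delta> (f ` A) / ennreal (c ^ k) * ennreal (c ^ k) \<le> hausdorff_pre k (\<delta> / c) A * ennreal (c^k)"
      by (rule mult_right_mono) auto
    moreover have "hausdorff_pre k \<delta> (f ` A) / ennreal (c ^ k) * ennreal (c ^ k) = hausdorff_pre k \<delta> (f ` A)"
      using c by (simp add: ennreal_divide_times mult_divide_eq_ennreal)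
    ultimately show ?thesis by (simp add: mult.commute)
  qed simp
  also have "\<dots> \<le> ennreal (c ^ k) * hausdorff_outer k A"
    using \<delta> c by (intro mult_left_mono hausdorff_outer_ge) auto
  finally show "hausdorff_pre k \<delta> (f ` A) \<le> ennreal (c ^ k) * hausdorff_outer k A" .
qed auto

lemma hausdorff_outer_lipschitz_onto:
  fixes f :: "'a::euclidean_space \<Rightarrow> 'b::euclidean_space"
  assumes "\<And>x y. x \<in> A \<Longrightarrow> y \<in> A \<Longrightarrow> dist (f x) (f y) \<le> c * dist x y" "0 < c" "B \<subseteq> f ` A"
  shows "hausdorff_outer k B \<le> ennreal (c ^ k) * hausdorff_outer k A"
  by (rule order_trans[OF hausdorff_outer_mono[OF assms(3)] hausdorff_outer_lipschitz_image]) (use assms in auto)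

lemma hausdorff_outer_nonexpansive_onto:
  fixes f :: "'a::euclidean_space \<Rightarrow> 'b::euclidean_space"
  assumes "\<And>x y. x \<in> A \<Longrightarrow> y \<in> A \<Longrightarrow> dist (f x) (f y) \<le> dist x y" "B \<subseteq> f ` A"
  shows "hausdorff_outer k B \<le> hausdorff_outer k A"
  using hausdorff_outer_lipschitz_onto[of A f 1 B k] assms by simp

lemma hausdorff_outer_isometric:
  fixes f :: "'a::euclidean_space \<Rightarrow> 'b::euclidean_space"
  assumes "\<And>x y. x \<in> A \<Longrightarrow> y \<in> A \<Longrightarrow> dist (f x) (f y) = dist x y"
  shows "hausdorff_outer k (f ` A) = hausdorff_outer k A"
proof (rule antisym)
  show "hausdorff_outer k (f ` A) \<le> hausdorff_outer k A"
    by (rule hausdorff_outer_nonexpansive_onto[of A f]) (use assms in auto)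
  have inj: "inj_on f A" using assms by (metis inj_onI dist_eq_0_iff)
  show "hausdorff_outer k A \<le> hausdorff_outer k (f ` A)"
    by (rule hausdorff_outer_nonexpansive_onto[of "f ` A" "inv_into A f"])
       (auto simp: assms inj image_image)
qed

lemma hausdorff_outer_scaleR:
  fixes A :: "'a::euclidean_space set"
  assumes "0 < c"
  shows "hausdorff_outer k ((\<lambda>x. c *\<^sub>R x) ` A) = ennreal (c ^ k) * hausdorff_outer k A"
proof (rule antisym)
  show "hausdorff_outer k ((\<lambda>x. c *\<^sub>R x) ` A) \<le> ennreal (c ^ k) * hausdorff_outer k A"
    by (rule hausdorff_outer_lipschitz_image) (use assms in \<open>auto simp: dist_norm scaleR_diff_right[symmetric]\<close>)
  have "hausdorff_outer k A \<le> ennreal ((1/c)^k) * hausdorff_outer k ((\<lambda>x. c *\<^sub>R x) ` A)"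
    by (rule hausdorff_outer_lipschitz_onto[of _ "\<lambda>x. (1/c) *\<^sub>R x"])
       (use assms in \<open>auto simp: dist_norm scaleR_diff_right[symmetric] image_image\<close>)
  then have "ennreal (c^k) * hausdorff_outer k A \<le> ennreal (c^k) * (ennreal ((1/c)^k) * hausdorff_outer k ((\<lambda>x. c *\<^sub>R x) ` A))"
    by (rule mult_left_mono) auto
  also have "\<dots> = hausdorff_outer k ((\<lambda>x. c *\<^sub>R x) ` A)"
    using assms by (simp add: mult.assoc[symmetric] ennreal_mult'[symmetric] power_mult_distrib[symmetric])
  finally show "ennreal (c ^ k) * hausdorff_outer k A \<le> hausdorff_outer k ((\<lambda>x. c *\<^sub>R x) ` A)" .
qed

text \<open>The conversion factor between dimensions: the weight of C in dimension d is
  \<open>slice_const d\<close> times \<open>diameter C\<close> times the weight of C in dimension d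
  - 1. It appears in both the lower and the upper volume bounds below.\<close>

definition slice_const :: "nat \<Rightarrow> real" where
  "slice_const d = unit_ball_vol (real d) / (2 * unit_ball_vol (real (d - 1)))"

lemma slice_const_pos: "0 < slice_const d"
  by (simp add: slice_const_def)

lemma real_set_in_interval:
  fixes S :: "real set"
  assumes "\<And>x y. x \<in> S \<Longrightarrow> y \<in> S \<Longrightarrow> \<bar>x - y\<bar> \<le> D"
  obtains a where "S \<subseteq> {a..a + D}"
proof (cases "S = {}")
  case False
  then obtain z where z: "z \<in> S" by auto
  have lb: "z - D \<le> x" if "x \<in> S" for x using assms[OF z that] by linarith
  have "bdd_below S" using lb by (auto simp: bdd_below_def)
  moreover have "x \<le> Inf S + D" if "x \<in> S" for x
  proof -
    have "x - D \<le> Inf S"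
      using assms[OF that] False by (intro cInf_greatest) (force simp: abs_le_iff)+
    then show ?thesis by simp
  qed
  ultimately have "S \<subseteq> {Inf S..Inf S + D}" by (auto intro: cInf_lower)
  then show ?thesis using that by blast
qed (use that in auto)

text \<open>Polar integration applied to covers. For each radius t in [r1, r2], the traces of a
  cover on the sphere of radius t, rescaled by 1/t, cover the unit vectors of the cone S. A member C
  contributes only for t in an interval of length \<open>diameter C\<close>, so integrating t^(d -
  1) over [r1, r2] trades weights in dimension d - 1 for weights in dimension d.\<close>

lemma hausdorff_outer_annulus_ge:
  fixes S :: "'a::euclidean_space set"
  assumes cone: "\<And>c x. 0 < c \<Longrightarrow> x \<in> S \<Longrightarrow> c *\<^sub>R x \<in> S" and d: "1 \<le> d" and r: "0 < r1" "r1 < r2"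
  shows "ennreal (slice_const d * ((r2 ^ d - r1 ^ d) / real d)) * hausdorff_outer (d - 1) {x\<in>S. norm x = 1}
      \<le> hausdorff_outer d {p. p - v \<in> S \<and> r1 \<le> norm (p - v) \<and> norm (p - v) \<le> r2}"
proof -
  let ?S = "{x\<in>S. norm x = 1}" and ?A = "{p. p - v \<in> S \<and> r1 \<le> norm (p - v) \<and> norm (p - v) \<le> r2}"
  let ?e = "slice_const d" and ?I = "(r2 ^ d - r1 ^ d) / real d"
  have I: "0 \<le> ?I" using r by (auto intro!: divide_nonneg_nonneg power_mono)
  \<comment> \<open>Rescaling by 1/t with t \<ge> r1 may enlarge diameters by the factor 1/r1, hence
    the scale \<open>\<delta> / r1\<close> on the sphere.\<close>
  have main: "ennreal ?I * hausdorff_pre (d - 1) (\<delta> / r1) ?S \<le> ennreal (1 / ?e) * hausdorff_pre d \<delta> ?A"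
    if "0 < \<delta>" for \<delta>
  proof -
    have "ennreal ?e * (ennreal ?I * hausdorff_pre (d - 1) (\<delta> / r1) ?S) \<le> hausdorff_pre d \<delta> ?A"
    proof (rule hausdorff_pre_greatest)
      fix C :: "nat \<Rightarrow> 'a set"
      assume C: "?A \<subseteq> (\<Union>i. C i)" "\<And>i. bounded (C i)" "\<And>i. diameter (C i) \<le> \<delta>"
      have dge: "0 \<le> diameter (C i)" for i using C(2) diameter_ge_0 by blast
      \<comment> \<open>Members of a cover may fail to be measurable; enclosing the set of their
        radii in a closed interval of length equal to the diameter makes the integrand
        measurable.\<close>
      have "\<exists>a. (\<lambda>p. norm (p - v)) ` C i \<subseteq> {a..a + diameter (C i)}" for i
      proof -
        have "\<bar>x - y\<bar> \<le> diameter (C i)" if "x \<in> (\<lambda>p. norm (p - v)) ` C i" "y \<in> (\<lambda>p. norm (p - v)) ` C i" for x y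
        proof -
          obtain p q where pq: "p \<in> C i" "q \<in> C i" "x = norm (p - v)" "y = norm (q - v)" using \<open>x \<in> _\<close> \<open>y \<in> _\<close> by auto
          have "\<bar>x - y\<bar> \<le> norm ((p - v) - (q - v))" unfolding pq by (rule norm_triangle_ineq3)
          also have "\<dots> \<le> diameter (C i)" using diameter_bounded_bound[OF C(2) pq(1,2)] by (simp add: dist_norm)
          finally show ?thesis .
        qed
        then show ?thesis using real_set_in_interval by meson
      qed
      then obtain a where a: "\<And>i. (\<lambda>p. norm (p - v)) ` C i \<subseteq> {a i..a i + diameter (C i)}" by metis
      have pt: "ennreal (t ^ (d - 1)) * hausdorff_pre (d - 1) (\<delta> / r1) ?S \<le>
          (\<Sum>i. hausdorff_weight (d - 1) (C i) * indicator {a i..a i + diameter (C i)} t)" if t: "t \<in> {r1..r2}" for t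
      proof -
        have t0: "0 < t" using t r by auto
        define D where "D i = {\<theta>\<in>?S. v + t *\<^sub>R \<theta> \<in> C i}" for i
        have dD: "dist x y \<le> diameter (C i) / t" if "x \<in> D i" "y \<in> D i" for x y i
        proof -
          have "dist (v + t *\<^sub>R x) (v + t *\<^sub>R y) \<le> diameter (C i)"
            using that by (intro diameter_bounded_bound C) (auto simp: D_def)
          then have "t * dist x y \<le> diameter (C i)"
            using t0 by (simp add: dist_norm scaleR_diff_right[symmetric])
          then show ?thesis using t0 by (simp add: field_simps)
        qed
        have bD: "bounded (D i)" for i unfolding bounded_two_points using dD by blast
        have dmD: "diameter (D i) \<le> diameter (C i) / t" for i
          using dD dge[of i] t0 by (intro diameter_le) (auto simp: dist_norm)
        have "hausdorff_pre (d - 1) (\<delta> / r1) ?S \<le> (\<Sum>i. hausdorff_weight (d - 1) (D i))"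
        proof (rule hausdorff_pre_le)
          show "?S \<subseteq> (\<Union>i. D i)"
          proof
            fix \<theta> assume th: "\<theta> \<in> ?S"
            then have "v + t *\<^sub>R \<theta> \<in> ?A" using t t0 cone[OF t0, of \<theta>] by auto
            then obtain i where "v + t *\<^sub>R \<theta> \<in> C i" using C(1) by blast
            then show "\<theta> \<in> (\<Union>i. D i)" using th by (auto simp: D_def)
          qed
          show "diameter (D i) \<le> \<delta> / r1" for i
          proof -
            have "diameter (C i) / t \<le> \<delta> / r1"
              using C(3)[of i] t r dge[of i] that by (intro frac_le) auto
            then show ?thesis using dmD[of i] by linarith
          qed
        qed (rule bD)
        then have "ennreal (t ^ (d - 1)) * hausdorff_pre (d - 1) (\<delta> / r1) ?S \<le>
            ennreal (t ^ (d - 1)) * (\<Sum>i. hausdorff_weight (d - 1) (D i))" by (rule mult_left_mono) auto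
        also have "\<dots> = (\<Sum>i. ennreal (t ^ (d - 1)) * hausdorff_weight (d - 1) (D i))" by simp
        also have "\<dots> \<le> (\<Sum>i. hausdorff_weight (d - 1) (C i) * indicator {a i..a i + diameter (C i)} t)"
        proof (intro suminf_le allI)
          fix i
          show "ennreal (t ^ (d - 1)) * hausdorff_weight (d - 1) (D i) \<le>
              hausdorff_weight (d - 1) (C i) * indicator {a i..a i + diameter (C i)} t"
          proof (cases "D i = {}")
            case False
            then obtain \<theta> where th: "\<theta> \<in> ?S" "v + t *\<^sub>R \<theta> \<in> C i" by (auto simp: D_def)
            have "norm (v + t *\<^sub>R \<theta> - v) \<in> {a i..a i + diameter (C i)}"
              using a[of i] th(2) by blast
            then have tin: "t \<in> {a i..a i + diameter (C i)}" using th t0 by simp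
            have dd: "0 \<le> diameter (D i)" using bD diameter_ge_0 by blast
            have "t ^ (d - 1) * (unit_ball_vol (real (d-1)) * (diameter (D i) / 2) ^ (d - 1))
                \<le> t ^ (d - 1) * (unit_ball_vol (real (d-1)) * (diameter (C i) / t / 2) ^ (d - 1))"
              using t0 dmD[of i] dd by (intro mult_left_mono power_mono divide_right_mono) auto
            also have "\<dots> = unit_ball_vol (real (d-1)) * (diameter (C i) / 2) ^ (d - 1)"
              using t0 by (simp add: power_divide)
            finally show ?thesis
              using False th tin t0 dd by (auto simp: hausdorff_weight_def ennreal_mult'[symmetric] intro!: ennreal_leI)
          qed simp
        qed auto
        finally show ?thesis .
      qed
      have "ennreal ?I * hausdorff_pre (d - 1) (\<delta> / r1) ?S =
          (\<integral>\<^sup>+t. ennreal (t ^ (d - 1)) * indicator {r1..r2} t \<partial>lborel) * hausdorff_pre (d - 1) (\<delta> / r1) ?S"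
      proof -
        have "(\<integral>\<^sup>+t. ennreal (t ^ (d - 1)) * indicator {r1..r2} t \<partial>lborel) = ennreal (r2 ^ d / real d - r1 ^ d / real d)"
        proof (rule nn_integral_FTC_Icc)
          show "DERIV (\<lambda>t. t ^ d / real d) x :> x ^ (d - 1)" for x
            using d by (auto intro!: derivative_eq_intros)
        qed (use r in auto)
        then show ?thesis by (simp add: diff_divide_distrib)
      qed
      also have "\<dots> = (\<integral>\<^sup>+t. (ennreal (t ^ (d - 1)) * indicator {r1..r2} t) * hausdorff_pre (d - 1) (\<delta> / r1) ?S \<partial>lborel)"
        by (rule nn_integral_multc[symmetric]) auto
      also have "\<dots> \<le> (\<integral>\<^sup>+t. (\<Sum>i. hausdorff_weight (d - 1) (C i) * indicator {a i..a i + diameter (C i)} t) \<partial>lborel)"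
        using pt by (intro nn_integral_mono) (auto simp: indicator_def)
      also have "\<dots> = (\<Sum>i. \<integral>\<^sup>+t. hausdorff_weight (d - 1) (C i) * indicator {a i..a i + diameter (C i)} t \<partial>lborel)"
        by (rule nn_integral_suminf) auto
      also have "\<dots> = (\<Sum>i. hausdorff_weight (d - 1) (C i) * ennreal (diameter (C i)))"
        using dge by (simp add: nn_integral_cmult)
      also have "\<dots> = (\<Sum>i. ennreal (1 / ?e) * hausdorff_weight d (C i))"
      proof (rule suminf_cong)
        fix i
        have "unit_ball_vol (real (d-1)) * (diameter (C i) / 2) ^ (d - 1) * diameter (C i) =
            1 / ?e * (unit_ball_vol (real d) * (diameter (C i) / 2) ^ d)"
        proof -
          obtain d' where d': "d = Suc d'" using d by (cases d) auto
          have "unit_ball_vol (real d) \<noteq> 0" using unit_ball_vol_pos[of "real d"] by linarith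
          then show ?thesis unfolding slice_const_def d' by (simp add: field_simps)
        qed
        then show "hausdorff_weight (d - 1) (C i) * ennreal (diameter (C i)) = ennreal (1 / ?e) * hausdorff_weight d (C i)"
          using dge[of i] slice_const_pos[of d] by (auto simp: hausdorff_weight_def ennreal_mult'[symmetric] ennreal_mult''[symmetric])
      qed
      also have "\<dots> = ennreal (1 / ?e) * (\<Sum>i. hausdorff_weight d (C i))" by simp
      finally have "ennreal ?e * (ennreal ?I * hausdorff_pre (d - 1) (\<delta> / r1) ?S) \<le> ennreal ?e * (ennreal (1 / ?e) * (\<Sum>i. hausdorff_weight d (C i)))"
        by (rule mult_left_mono) auto
      also have "\<dots> = (\<Sum>i. hausdorff_weight d (C i))"
        using slice_const_pos[of d] by (simp add: mult.assoc[symmetric] ennreal_mult'[symmetric])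
      finally show "ennreal ?e * (ennreal ?I * hausdorff_pre (d - 1) (\<delta> / r1) ?S) \<le> (\<Sum>i. hausdorff_weight d (C i))" .
    qed
    then have "ennreal (1/?e) * (ennreal ?e * (ennreal ?I * hausdorff_pre (d - 1) (\<delta> / r1) ?S)) \<le> ennreal (1/?e) * hausdorff_pre d \<delta> ?A"
      by (rule mult_left_mono) auto
    then show ?thesis
      using slice_const_pos[of d] by (simp add: mult.assoc[symmetric] ennreal_mult'[symmetric])
  qed
  have "ennreal (?e * ?I) * hausdorff_outer (d - 1) ?S = (SUP \<delta>\<in>{0<..}. ennreal (?e * ?I) * hausdorff_pre (d - 1) \<delta> ?S)"
    unfolding hausdorff_outer_def by (rule SUP_mult_left_ennreal)
  also have "\<dots> \<le> hausdorff_outer d ?A"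
  proof (intro SUP_least)
    fix \<delta> :: real assume "\<delta> \<in> {0<..}"
    then have \<delta>: "0 < \<delta> * r1" "\<delta> * r1 / r1 = \<delta>" using r by auto
    have "ennreal (?e * ?I) * hausdorff_pre (d - 1) \<delta> ?S = ennreal ?e * (ennreal ?I * hausdorff_pre (d - 1) \<delta> ?S)"
      using ennreal_mult[OF less_imp_le[OF slice_const_pos[of d]] I] by (simp only: mult.assoc)
    also have "\<dots> \<le> ennreal ?e * (ennreal (1 / ?e) * hausdorff_pre d (\<delta> * r1) ?A)"
      using main[OF \<delta>(1)] unfolding \<delta>(2) by (rule mult_left_mono) auto
    also have "\<dots> = hausdorff_pre d (\<delta> * r1) ?A"
      using slice_const_pos[of d] by (simp add: mult.assoc[symmetric] ennreal_mult'[symmetric])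
    also have "\<dots> \<le> hausdorff_outer d ?A" using \<delta>(1) by (rule hausdorff_outer_ge)
    finally show "ennreal (?e * ?I) * hausdorff_pre (d - 1) \<delta> ?S \<le> hausdorff_outer d ?A" .
  qed
  finally show ?thesis .
qed

text \<open>A behaves metrically like a subset of S times [0, T], with S scaled by Rm. Over a member
  of size D in a cover of S, the interval is cut into pieces of length h = Rm * D; each resulting
  block has diameter at most sqrt 2 * h, and at most 2 * T / h blocks occur. The powers of D left
  over are those of the weight in dimension d - 1.\<close>

lemma hausdorff_outer_product_le:
  fixes \<theta> :: "'a::euclidean_space \<Rightarrow> 'b::euclidean_space"
  assumes d: "1 \<le> d" and th: "\<And>p. p \<in> A \<Longrightarrow> \<theta> p \<in> S" and ta: "\<And>p. p \<in> A \<Longrightarrow> 0 \<le> \<tau> p \<and> \<tau> p \<le> T"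
    and pos: "0 < T" "0 < Rm"
    and lip: "\<And>p q. p \<in> A \<Longrightarrow> q \<in> A \<Longrightarrow> (dist p q)\<^sup>2 \<le> (Rm * dist (\<theta> p) (\<theta> q))\<^sup>2 + (\<tau> p - \<tau> q)\<^sup>2"
  shows "hausdorff_outer d A \<le> ennreal (2 * sqrt 2 ^ d * slice_const d * Rm ^ (d - 1) * T) * hausdorff_outer (d - 1) S"
proof -
  define K where "K = 2 * sqrt 2 ^ d * slice_const d * Rm ^ (d - 1) * T"
  have K: "0 < K" unfolding K_def using slice_const_pos[of d] pos by auto
  have main: "hausdorff_pre d \<delta> A \<le> ennreal K * hausdorff_outer (d - 1) S + ennreal e"
    if \<delta>: "0 < \<delta>" and e: "0 < e" and fin: "hausdorff_outer (d - 1) S < top" for \<delta> e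
  proof -
    define \<delta>' where "\<delta>' = min (\<delta> / (4 * Rm)) (T / (2 * Rm))"
    have \<delta>': "0 < \<delta>'" "4 * Rm * \<delta>' \<le> \<delta>" "2 * Rm * \<delta>' \<le> T"
      using \<delta> pos by (auto simp: \<delta>'_def min_def field_simps)
    define \<eta> where "\<eta> = e / (2 * K)"
    have \<eta>: "0 < \<eta>" using e K by (simp add: \<eta>_def)
    have "hausdorff_pre (d - 1) \<delta>' S < hausdorff_outer (d - 1) S + ennreal \<eta>"
    proof -
      have "hausdorff_outer (d - 1) S < hausdorff_outer (d - 1) S + ennreal \<eta>" using fin \<eta> by auto
      then show ?thesis using hausdorff_outer_ge[OF \<delta>'(1), of "d-1" S] by (rule le_less_trans[rotated])
    qed
    then obtain U where U: "S \<subseteq> (\<Union>i. U i)" "\<And>i. bounded (U i)" "\<And>i. diameter (U i) \<le> \<delta>'"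
        "(\<Sum>i. hausdorff_weight (d - 1) (U i)) < hausdorff_outer (d - 1) S + ennreal \<eta>"
      by (rule hausdorff_pre_lessD) (rule that)
    let ?w = "unit_ball_vol (real (d - 1))"
    \<comment> \<open>A member of diameter 0 would give no positive step h. Each diameter is
      therefore enlarged slightly, at a total cost of \<eta> in the sum of the weights.\<close>
    have "\<exists>x. diameter (U i) \<le> x \<and> 0 < x \<and> x \<le> 2 * \<delta>' \<and>
        ?w * (x / 2) ^ (d - 1) \<le> ?w * (diameter (U i) / 2) ^ (d - 1) + \<eta> * (1/2) ^ Suc i" for i
    proof -
      let ?D = "diameter (U i)"
      have D0: "0 \<le> ?D" using U(2) diameter_ge_0 by blast
      have "((\<lambda>x. ?w * (x / 2) ^ (d - 1)) \<longlongrightarrow> ?w * (?D / 2) ^ (d - 1)) (at_right ?D)"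
        by (intro tendsto_intros) auto
      then have "\<forall>\<^sub>F x in at_right ?D. ?w * (x / 2) ^ (d - 1) < ?w * (?D / 2) ^ (d - 1) + \<eta> * (1/2) ^ Suc i"
        using \<eta> by (auto intro: order_tendstoD)
      moreover have "\<forall>\<^sub>F x in at_right ?D. ?D < x \<and> x < ?D + \<delta>'"
        using \<delta>'(1) by (intro eventually_conj eventually_at_right_less eventually_at_rightI[of _ "?D + \<delta>'"]) auto
      ultimately have "\<forall>\<^sub>F x in at_right ?D. ?w * (x / 2) ^ (d - 1) < ?w * (?D / 2) ^ (d - 1) + \<eta> * (1/2) ^ Suc i \<and> ?D < x \<and> x < ?D + \<delta>'"
        by (rule eventually_conj)
      then obtain x where "?w * (x / 2) ^ (d - 1) < ?w * (?D / 2) ^ (d - 1) + \<eta> * (1/2) ^ Suc i" "?D < x" "x < ?D + \<delta>'"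
        using eventually_happens[of _ "at_right ?D"] by auto
      then show ?thesis using U(3)[of i] D0 by (intro exI[of _ x]) auto
    qed
    then obtain D where D: "\<And>i. diameter (U i) \<le> D i" "\<And>i. 0 < D i" "\<And>i. D i \<le> 2 * \<delta>'"
        "\<And>i. ?w * (D i / 2) ^ (d - 1) \<le> ?w * (diameter (U i) / 2) ^ (d - 1) + \<eta> * (1/2) ^ Suc i"
      by metis
    let ?A = "\<lambda>i. {p\<in>A. \<theta> p \<in> U i}"
    have piece: "hausdorff_pre d \<delta> (?A i) \<le> ennreal K * (hausdorff_weight (d - 1) (U i) + ennreal (\<eta> * (1/2) ^ Suc i))" for i
    proof (cases "U i = {}")
      case False
      let ?h = "Rm * D i"
      have h: "0 < ?h" "?h \<le> T" 
      proof -
        show "0 < ?h" using D(2)[of i] pos by simp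
        have "Rm * D i \<le> Rm * (2 * \<delta>')" using D(3)[of i] pos by (intro mult_left_mono) auto
        then show "?h \<le> T" using \<delta>'(3) by linarith
      qed
      define n where "n = nat \<lfloor>T / ?h\<rfloor>"
      let ?B = "\<lambda>j. {p\<in>?A i. \<tau> p \<in> {real j * ?h .. real (Suc j) * ?h}}"
      have "?A i \<subseteq> (\<Union>j\<in>{..n}. ?B j)"
      proof
        fix p assume p: "p \<in> ?A i"
        define j where "j = nat \<lfloor>\<tau> p / ?h\<rfloor>"
        have t: "0 \<le> \<tau> p" "\<tau> p \<le> T" using ta p by auto
        have "real j = of_int \<lfloor>\<tau> p / ?h\<rfloor>" using t h by (simp add: j_def)
        then have "real j \<le> \<tau> p / ?h" "\<tau> p / ?h \<le> real j + 1" by linarith+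
        then have "real j * ?h \<le> \<tau> p" "\<tau> p \<le> real (Suc j) * ?h" using h(1) by (auto simp: pos_le_divide_eq pos_divide_le_eq add.commute)
        moreover have "j \<le> n" unfolding j_def n_def using t h by (intro nat_mono floor_mono divide_right_mono) auto
        ultimately show "p \<in> (\<Union>j\<in>{..n}. ?B j)" using p by auto
      qed
      then have "hausdorff_pre d \<delta> (?A i) \<le> hausdorff_pre d \<delta> (\<Union>j\<in>{..n}. ?B j)" by (rule hausdorff_pre_mono)
      also have "\<dots> \<le> (\<Sum>j\<in>{..n}. hausdorff_pre d \<delta> (?B j))"
        using \<delta> by (intro hausdorff_pre_UN_finite) auto
      also have "\<dots> \<le> (\<Sum>j\<in>{..n}. ennreal (unit_ball_vol (real d) * (sqrt 2 * ?h / 2) ^ d))"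
      proof (rule sum_mono)
        fix j
        have ds: "dist p q \<le> sqrt 2 * ?h" if "p \<in> ?B j" "q \<in> ?B j" for p q
        proof -
          have "dist (\<theta> p) (\<theta> q) \<le> D i"
            using that diameter_bounded_bound[OF U(2)[of i], of "\<theta> p" "\<theta> q"] D(1)[of i] by auto
          then have 1: "(Rm * dist (\<theta> p) (\<theta> q))\<^sup>2 \<le> ?h\<^sup>2" using pos by (intro power_mono) auto
          have "\<bar>\<tau> p - \<tau> q\<bar> \<le> ?h" using that by (auto simp: algebra_simps)
          then have 2: "(\<tau> p - \<tau> q)\<^sup>2 \<le> ?h\<^sup>2" using h by (simp add: abs_le_square_iff[symmetric])
          have "(dist p q)\<^sup>2 \<le> 2 * ?h\<^sup>2" using lip[of p q] that 1 2 by auto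
          also have "\<dots> = (sqrt 2 * ?h)\<^sup>2" by (simp add: power_mult_distrib)
          finally show ?thesis by (rule power2_le_imp_le) (use h in auto)
        qed
        have "sqrt 2 \<le> 2" by (rule real_le_lsqrt) auto
        then have "sqrt 2 * ?h \<le> 2 * (Rm * (2 * \<delta>'))"
          using D(2,3)[of i] h pos by (intro mult_mono) (auto intro: less_imp_le)
        then have "sqrt 2 * ?h \<le> \<delta>" using \<delta>'(2) by auto
        then show "hausdorff_pre d \<delta> (?B j) \<le> ennreal (unit_ball_vol (real d) * (sqrt 2 * ?h / 2) ^ d)"
          using ds h by (intro hausdorff_pre_single diameter_le) (auto simp: bounded_two_points dist_norm)
      qed
      also have "\<dots> = ennreal (real (Suc n) * (unit_ball_vol (real d) * (sqrt 2 * ?h / 2) ^ d))"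
        by (simp add: ennreal_of_nat_eq_real_of_nat ennreal_mult' del: of_nat_Suc)
      \<comment> \<open>Rounding up adds one block; it is absorbed because h \<le> T.\<close>
      also have "\<dots> \<le> ennreal (2 * T / ?h * (unit_ball_vol (real d) * (sqrt 2 * ?h / 2) ^ d))"
      proof (intro ennreal_leI mult_right_mono)
        have "real n \<le> T / ?h" using h pos unfolding n_def by (simp add: of_nat_nat)
        moreover have "1 \<le> T / ?h" using h by simp
        ultimately show "real (Suc n) \<le> 2 * T / ?h" by simp
      qed (use h in auto)
      also have "2 * T / ?h * (unit_ball_vol (real d) * (sqrt 2 * ?h / 2) ^ d) = K * (?w * (D i / 2) ^ (d - 1))"
      proof -
        obtain d' where d': "d = Suc d'" using d by (cases d) auto
        have "unit_ball_vol (real d') \<noteq> 0" using unit_ball_vol_pos[of "real d'"] by linarith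
        then show ?thesis unfolding K_def slice_const_def d' using pos D(2)[of i]
          by (simp add: field_simps power_mult_distrib power_divide)
      qed
      also have "ennreal (K * (?w * (D i / 2) ^ (d - 1))) \<le> ennreal (K * (?w * (diameter (U i) / 2) ^ (d - 1) + \<eta> * (1/2) ^ Suc i))"
        using K D(4)[of i] by (intro ennreal_leI mult_left_mono) auto
      also have "\<dots> = ennreal K * (hausdorff_weight (d - 1) (U i) + ennreal (\<eta> * (1/2) ^ Suc i))"
      proof -
        have 1: "0 \<le> ?w * (diameter (U i) / 2) ^ (d - 1)" using diameter_ge_0[OF U(2)[of i]] by simp
        have 2: "0 \<le> \<eta> * (1/2) ^ Suc i" using \<eta> by simp
        show ?thesis using False K by (simp only: hausdorff_weight_def if_False ennreal_plus[OF 1 2] ennreal_mult'[OF less_imp_le[OF K]])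
      qed
      finally show ?thesis .
    qed (use \<delta> in simp)
    have "hausdorff_pre d \<delta> A \<le> hausdorff_pre d \<delta> (\<Union>i. ?A i)"
      using th U(1) by (intro hausdorff_pre_mono) blast
    also have "\<dots> \<le> (\<Sum>i. hausdorff_pre d \<delta> (?A i))" by (rule hausdorff_pre_UN)
    also have "\<dots> \<le> (\<Sum>i. ennreal K * (hausdorff_weight (d - 1) (U i) + ennreal (\<eta> * (1/2) ^ Suc i)))"
      by (intro suminf_le allI piece) auto
    also have "\<dots> = ennreal K * ((\<Sum>i. hausdorff_weight (d - 1) (U i)) + (\<Sum>i. ennreal (\<eta> * (1/2) ^ Suc i)))"
      by (simp add: suminf_add)
    also have "(\<Sum>i. ennreal (\<eta> * (1/2) ^ Suc i)) = ennreal \<eta>"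
    proof -
      have "(\<lambda>i. \<eta> * (1/2) ^ Suc i) sums (\<eta> * 1)" by (intro sums_mult power_half_series)
      then show ?thesis using \<eta> by (subst suminf_ennreal_eq[where x=\<eta>]) auto
    qed
    also have "ennreal K * ((\<Sum>i. hausdorff_weight (d - 1) (U i)) + ennreal \<eta>) \<le>
        ennreal K * (hausdorff_outer (d - 1) S + ennreal \<eta> + ennreal \<eta>)"
      using U(4) by (intro mult_left_mono add_mono) auto
    also have "\<dots> = ennreal K * hausdorff_outer (d - 1) S + ennreal (K * (2 * \<eta>))"
      using K \<eta> by (simp add: add.assoc distrib_left ennreal_mult ennreal_plus[symmetric] del: ennreal_plus)
    also have "K * (2 * \<eta>) = e" using K by (simp add: \<eta>_def)
    finally show ?thesis .
  qed
  show ?thesis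
  proof (cases "hausdorff_outer (d - 1) S < top")
    case True
    have "hausdorff_outer d A \<le> ennreal K * hausdorff_outer (d - 1) S"
    proof (rule ennreal_le_epsilon)
      fix e :: real assume "0 < e"
      then show "hausdorff_outer d A \<le> ennreal K * hausdorff_outer (d - 1) S + ennreal e"
        using main True by (intro hausdorff_outer_le[of 1]) auto
    qed
    then show ?thesis by (simp add: K_def)
  next
    case False
    then have "hausdorff_outer (d - 1) S = top" using top.not_eq_extremum by blast
    then have "ennreal K * hausdorff_outer (d - 1) S = top" using K by (simp add: ennreal_mult_top)
    then show ?thesis unfolding K_def by (simp only: top_greatest)
  qed
qed

section \<open>Separated sets and counting bounds\<close>

definition separated :: "real \<Rightarrow> 'a::metric_space set \<Rightarrow> bool" where
  "separated \<eta> P \<longleftrightarrow> (\<forall>x\<in>P. \<forall>y\<in>P. x \<noteq> y \<longrightarrow> \<eta> \<le> dist x y)"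

text \<open>A separated subset of largest cardinality is a net: a point outside all the balls could
  still be added.\<close>

lemma maximal_separated:
  assumes bnd: "\<And>P. finite P \<Longrightarrow> P \<subseteq> S \<Longrightarrow> separated \<eta> P \<Longrightarrow> card P \<le> n" and "0 < \<eta>"
  shows "\<exists>P. finite P \<and> P \<subseteq> S \<and> separated \<eta> P \<and> S \<subseteq> (\<Union>p\<in>P. ball p \<eta>)"
proof -
  let ?Q = "\<lambda>P. finite P \<and> P \<subseteq> S \<and> separated \<eta> P"
  have 1: "?Q {}" by (simp add: separated_def)
  have 2: "\<forall>P. ?Q P \<longrightarrow> card P < Suc n" using bnd by (simp add: less_Suc_eq_le)
  have "\<exists>P. ?Q P \<and> (\<forall>P'. ?Q P' \<longrightarrow> card P' \<le> card P)"
    by (rule ex_has_greatest_nat[of ?Q, OF 1 2])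
  then obtain P where P: "finite P" "P \<subseteq> S" "separated \<eta> P"
      and max: "\<And>P'. finite P' \<Longrightarrow> P' \<subseteq> S \<Longrightarrow> separated \<eta> P' \<Longrightarrow> card P' \<le> card P" by auto
  have "S \<subseteq> (\<Union>p\<in>P. ball p \<eta>)"
  proof
    fix x assume x: "x \<in> S"
    show "x \<in> (\<Union>p\<in>P. ball p \<eta>)"
    proof (rule ccontr)
      assume "x \<notin> (\<Union>p\<in>P. ball p \<eta>)"
      then have far: "\<And>p. p \<in> P \<Longrightarrow> \<eta> \<le> dist p x" by (auto simp: not_less)
      then have xP: "x \<notin> P" using \<open>0 < \<eta>\<close> by force
      have "card (insert x P) \<le> card P"
        using P x far by (intro max) (auto simp: separated_def dist_commute)
      then show False using P(1) xP by simp
    qed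
  qed
  then show ?thesis using P by blast
qed

text \<open>The balls of radius \<eta>/2 around the points are disjoint and lie in the ball of
  radius D + \<eta>/2.\<close>

lemma separated_card_le:
  fixes P :: "'a::euclidean_space set"
  assumes "finite P" "separated \<eta> P" "P \<subseteq> cball a D" "0 < \<eta>" "0 \<le> D"
  shows "real (card P) \<le> ((2 * D + \<eta>) / \<eta>) ^ DIM('a)"
proof -
  let ?w = "unit_ball_vol (real DIM('a))"
  have dis: "disjoint_family_on (\<lambda>p. ball p (\<eta>/2)) P"
    unfolding disjoint_family_on_def
  proof (intro ballI impI)
    fix p q assume "p \<in> P" "q \<in> P" "p \<noteq> q"
    then have "\<eta>/2 + \<eta>/2 \<le> dist p q" using assms(2) by (auto simp: separated_def)
    then show "ball p (\<eta>/2) \<inter> ball q (\<eta>/2) = {}" by (rule disjoint_ballI)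
  qed
  have "(\<Sum>p\<in>P. emeasure lborel (ball p (\<eta>/2))) = emeasure lborel (\<Union>p\<in>P. ball p (\<eta>/2))"
    by (rule sum_emeasure) (use dis assms in auto)
  also have "\<dots> \<le> emeasure lborel (ball a (D + \<eta>/2))"
  proof (rule emeasure_mono)
    show "(\<Union>p\<in>P. ball p (\<eta>/2)) \<subseteq> ball a (D + \<eta>/2)"
    proof
      fix x assume "x \<in> (\<Union>p\<in>P. ball p (\<eta>/2))"
      then obtain p where "p \<in> P" "dist p x < \<eta>/2" by auto
      then show "x \<in> ball a (D + \<eta>/2)" using assms(3) dist_triangle[of a x p] by force
    qed
  qed simp
  also have "\<dots> = ennreal (?w * (D + \<eta>/2) ^ DIM('a))" using assms by (intro emeasure_ball) auto
  also have "(\<Sum>p\<in>P. emeasure lborel (ball p (\<eta>/2))) = (\<Sum>p\<in>P. ennreal (?w * (\<eta>/2) ^ DIM('a)))"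
    using assms by (intro sum.cong refl emeasure_ball) auto
  also have "\<dots> = ennreal (real (card P) * (?w * (\<eta>/2) ^ DIM('a)))"
    using assms by (simp add: ennreal_of_nat_eq_real_of_nat ennreal_mult')
  finally have "real (card P) * (?w * (\<eta>/2) ^ DIM('a)) \<le> ?w * (D + \<eta>/2) ^ DIM('a)"
    using assms by (subst (asm) ennreal_le_iff) auto
  then have "real (card P) * (\<eta>/2) ^ DIM('a) \<le> (D + \<eta>/2) ^ DIM('a)"
    using unit_ball_vol_pos[of "real DIM('a)"] by (simp add: mult.left_commute)
  then have "real (card P) \<le> (D + \<eta>/2) ^ DIM('a) / (\<eta>/2) ^ DIM('a)"
    using assms by (simp add: pos_le_divide_eq)
  also have "\<dots> = ((D + \<eta>/2) / (\<eta>/2)) ^ DIM('a)" by (rule power_divide[symmetric])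
  also have "(D + \<eta>/2) / (\<eta>/2) = (2 * D + \<eta>) / \<eta>"
    using assms by (simp add: field_simps)
  finally show ?thesis .
qed

lemma maximal_separated_bounded:
  fixes S :: "'a::euclidean_space set"
  assumes "bounded S" "0 < \<eta>"
  shows "\<exists>P. finite P \<and> P \<subseteq> S \<and> separated \<eta> P \<and> S \<subseteq> (\<Union>p\<in>P. ball p \<eta>)"
proof -
  obtain D where D: "S \<subseteq> cball 0 D" "0 < D"
    using bounded_subset_ballD[OF assms(1), of 0] by (force simp: subset_iff)
  then have "card P \<le> nat \<lfloor>((2 * D + \<eta>) / \<eta>) ^ DIM('a)\<rfloor>" if "finite P" "P \<subseteq> S" "separated \<eta> P" for P
    using separated_card_le[of P \<eta> 0 D] that assms by (auto simp: le_nat_floor)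
  then show ?thesis using assms(2) by (rule maximal_separated)
qed

text \<open>S is covered by balls around a maximal \<eta>-separated subset, whose image is
  \<eta>/2-separated in the target space and can be counted there by Lebesgue volume. With \<eta> =
  \<delta>/2 the balls have diameter at most \<delta>, and \<eta> \<le> D turns 4 * D + \<eta> into
  5 * D.\<close>

lemma hausdorff_outer_le_of_expanding_map:
  fixes f :: "'a::euclidean_space \<Rightarrow> 'b::euclidean_space"
  assumes ex: "\<And>x y. x \<in> S \<Longrightarrow> y \<in> S \<Longrightarrow> dist x y \<le> 2 * dist (f x) (f y)"
    and im: "f ` S \<subseteq> cball a D" and D: "0 < D"
  shows "hausdorff_outer DIM('b) S \<le> ennreal (unit_ball_vol (real DIM('b)) * (5 * D) ^ DIM('b))"
proof (rule hausdorff_outer_le[of D])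
  fix \<delta> :: real assume \<delta>: "0 < \<delta>" "\<delta> < D"
  let ?d = "DIM('b)" and ?w = "unit_ball_vol (real DIM('b))"
  define \<eta> where "\<eta> = \<delta> / 2"
  have \<eta>: "0 < \<eta>" "\<eta> \<le> D" using \<delta> by (auto simp: \<eta>_def)
  have cnt: "real (card P) \<le> ((4 * D + \<eta>) / \<eta>) ^ ?d" if P: "finite P" "P \<subseteq> S" "separated \<eta> P" for P
  proof -
    have inj: "inj_on f P"
    proof (rule inj_onI)
      fix x y assume xy: "x \<in> P" "y \<in> P" "f x = f y"
      then have "dist x y \<le> 2 * dist (f x) (f y)" using ex P(2) by blast
      then show "x = y" using xy(3) by simp
    qed
    have "separated (\<eta>/2) (f ` P)"
      unfolding separated_def
    proof (intro ballI impI)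
      fix u v assume "u \<in> f ` P" "v \<in> f ` P" "u \<noteq> v"
      then obtain x y where "x \<in> P" "y \<in> P" "u = f x" "v = f y" "x \<noteq> y" by auto
      then show "\<eta>/2 \<le> dist u v" using ex[of x y] P by (force simp: separated_def)
    qed
    then have "real (card (f ` P)) \<le> ((2 * D + \<eta>/2) / (\<eta>/2)) ^ ?d"
      using P im D \<eta> by (intro separated_card_le[of _ _ a]) auto
    moreover have "(2 * D + \<eta>/2) / (\<eta>/2) = (4 * D + \<eta>) / \<eta>" using \<eta> by (simp add: field_simps)
    ultimately show ?thesis using card_image[OF inj] by simp
  qed
  then have "card P \<le> nat \<lfloor>((4 * D + \<eta>) / \<eta>) ^ ?d\<rfloor>" if "finite P" "P \<subseteq> S" "separated \<eta> P" for P
    using that by (auto simp: le_nat_floor)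
  then obtain P where P: "finite P" "P \<subseteq> S" "separated \<eta> P" "S \<subseteq> (\<Union>p\<in>P. ball p \<eta>)"
    using maximal_separated[of S \<eta> "nat \<lfloor>((4 * D + \<eta>) / \<eta>) ^ ?d\<rfloor>"] \<eta>(1) by auto
  have "hausdorff_pre ?d \<delta> S \<le> hausdorff_pre ?d \<delta> (\<Union>p\<in>P. ball p \<eta>)" using P by (intro hausdorff_pre_mono)
  also have "\<dots> \<le> (\<Sum>p\<in>P. hausdorff_pre ?d \<delta> (ball p \<eta>))" using P \<delta> by (intro hausdorff_pre_UN_finite) auto
  also have "\<dots> \<le> (\<Sum>p\<in>P. ennreal (?w * \<eta> ^ ?d))"
  proof (rule sum_mono)
    fix p :: 'a
    show "hausdorff_pre ?d \<delta> (ball p \<eta>) \<le> ennreal (?w * \<eta> ^ ?d)"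
      using hausdorff_pre_single[of "ball p \<eta>" "2 * \<eta>" \<delta> ?d] \<eta> by (auto simp: \<eta>_def)
  qed
  also have "\<dots> = ennreal (real (card P) * (?w * \<eta> ^ ?d))"
    using \<eta> by (simp add: ennreal_of_nat_eq_real_of_nat ennreal_mult')
  also have "\<dots> \<le> ennreal (?w * (5 * D) ^ ?d)"
  proof (rule ennreal_leI)
    have "real (card P) * (?w * \<eta> ^ ?d) \<le> ((4 * D + \<eta>) / \<eta>) ^ ?d * (?w * \<eta> ^ ?d)"
      using cnt[OF P(1-3)] \<eta> by (intro mult_right_mono) auto
    also have "\<dots> = ?w * (4 * D + \<eta>) ^ ?d" using \<eta> by (simp add: power_divide)
    also have "\<dots> \<le> ?w * (5 * D) ^ ?d" using \<eta> D by (intro mult_left_mono power_mono) auto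
    finally show "real (card P) * (?w * \<eta> ^ ?d) \<le> ?w * (5 * D) ^ ?d" .
  qed
  finally show "hausdorff_pre ?d \<delta> S \<le> ennreal (?w * (5 * D) ^ ?d)" .
qed (rule D)

section \<open>Statistical queries against a packing\<close>

lemma dH_triangle_le:
  assumes "dH A C \<le> ereal e1" "dH B C \<le> ereal e2"
  shows "dH A B \<le> ereal (e1 + e2)"
  unfolding dH_def
proof (rule SUP_least)
  fix x
  have "ereal \<bar>infdist x A - infdist x C\<bar> \<le> ereal e1" "ereal \<bar>infdist x B - infdist x C\<bar> \<le> ereal e2"
    using assms unfolding dH_def by (auto simp: SUP_le_iff)
  then show "ereal \<bar>infdist x A - infdist x B\<bar> \<le> ereal (e1 + e2)" by auto
qed

text \<open>The interval [-1, 1] is cut into m = ceiling (1 / \<tau>) cells of length 2 / m, and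
  \<open>g\<close> sends a number to the midpoint of its cell, hence moves it by at most 1 / m \<le>
  \<tau>.\<close>

lemma finite_rounding:
  assumes "0 < (\<tau>::real)"
  obtains g :: "real \<Rightarrow> real" and G where "finite G" "real (card G) \<le> 1 + 1 / \<tau>" "range g \<subseteq> G"
    "\<And>a. \<bar>a\<bar> \<le> 1 \<Longrightarrow> \<bar>g a - a\<bar> \<le> \<tau>"
proof -
  define m where "m = nat \<lceil>1 / \<tau>\<rceil>"
  have m: "1 / \<tau> \<le> real m" "real m \<le> 1 + 1 / \<tau>" "0 < m"
    using assms unfolding m_def by (auto simp: of_nat_nat le_of_int_ceiling) linarith
  \<comment> \<open>The minimum with m - 1 puts the right endpoint a = 1 into the last cell and
    keeps the range finite for arguments outside [-1, 1].\<close>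
  define g where "g a = -1 + (2 * real (min (nat \<lfloor>(a + 1) * real m / 2\<rfloor>) (m - 1)) + 1) / real m" for a :: real
  define G where "G = (\<lambda>j. -1 + (2 * real j + 1) / real m) ` {..<m}"
  have "finite G" by (simp add: G_def)
  moreover have "real (card G) \<le> 1 + 1 / \<tau>"
    using card_image_le[of "{..<m}" "\<lambda>j. -1 + (2 * real j + 1) / real m"] m by (simp add: G_def)
  moreover have "range g \<subseteq> G" using m by (auto simp: g_def G_def)
  moreover have "\<bar>g a - a\<bar> \<le> \<tau>" if "\<bar>a\<bar> \<le> 1" for a
  proof -
    define y where "y = (a + 1) * real m / 2"
    have a: "a = -1 + 2 * y / real m" using m by (simp add: y_def field_simps)
    have y: "0 \<le> y" "y \<le> real m" 
    proof -
      have "0 \<le> a + 1" "a + 1 \<le> 2" using that by auto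
      then have "0 \<le> (a + 1) * real m" "(a + 1) * real m \<le> 2 * real m" by (auto intro: mult_right_mono)
      then show "0 \<le> y" "y \<le> real m" by (auto simp: y_def)
    qed
    define j where "j = min (nat \<lfloor>y\<rfloor>) (m - 1)"
    have "real j \<le> y" "y \<le> real j + 1"
    proof -
      have *: "real (nat \<lfloor>y\<rfloor>) = of_int \<lfloor>y\<rfloor>" using y by simp
      have "real j \<le> real (nat \<lfloor>y\<rfloor>)" by (simp add: j_def)
      then show "real j \<le> y" using * by linarith
      show "y \<le> real j + 1"
      proof (cases "nat \<lfloor>y\<rfloor> \<le> m - 1")
        case True
        then have "real j = of_int \<lfloor>y\<rfloor>" using * by (simp add: j_def min_def)
        then show ?thesis by linarith
      next
        case False
        then have "real j = real m - 1" using m by (simp add: j_def min_def of_nat_diff)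
        then show ?thesis using y by linarith
      qed
    qed
    then have "\<bar>2 * real j + 1 - 2 * y\<bar> \<le> 1" by linarith
    then have "\<bar>(2 * real j + 1 - 2 * y) / real m\<bar> \<le> 1 / real m" using m by (simp add: divide_right_mono)
    moreover have "1 / real m \<le> \<tau>" using m assms by (simp add: field_simps)
    moreover have "g a - a = (2 * real j + 1 - 2 * y) / real m"
      unfolding g_def y_def[symmetric] j_def[symmetric] by (subst a) (simp add: diff_divide_distrib add_divide_distrib)
    ultimately show ?thesis by linarith
  qed
  ultimately show ?thesis using that by blast
qed

lemma length_sq_answers: "length (sq_answers Q Orc k) = k"
  by (induction k) (auto simp: Let_def)

lemma set_sq_answers:
  assumes "\<And>rs. Orc rs \<in> G"
  shows "set (sq_answers Q Orc k) \<subseteq> G"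
  using assms by (induction k) (auto simp: Let_def)

text \<open>Double counting of pairs of a seed and a member that it estimates well. For one seed
  these members have distinct answer lists, because equal answers produce one output within
  \<epsilon> of two supports that are more than 2 * \<epsilon> apart; so there are at most (card
  G)^q of them. Averaging over the seeds compares this with 1 - \<alpha> for each member.\<close>

lemma sq_packing_bound:
  fixes D :: "'i \<Rightarrow> 'a::euclidean_space measure" and Q :: "'w \<Rightarrow> real list \<Rightarrow> ('a \<Rightarrow> real)"
  assumes sq: "sq_estimates P Q Out q \<tau> Model \<epsilon> \<alpha>" and \<tau>: "0 < \<tau>" and \<alpha>: "\<alpha> < 1"
    and fin: "finite \<Lambda>" and mod: "\<And>i. i \<in> \<Lambda> \<Longrightarrow> D i \<in> Model"
    and prob: "\<And>i. i \<in> \<Lambda> \<Longrightarrow> prob_space (D i)" "\<And>i. i \<in> \<Lambda> \<Longrightarrow> sets (D i) = sets borel"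
    and sep: "\<And>i j. i \<in> \<Lambda> \<Longrightarrow> j \<in> \<Lambda> \<Longrightarrow> i \<noteq> j \<Longrightarrow> ereal (2 * \<epsilon>) < dH (msupport (D i)) (msupport (D j))"
  shows "real (card \<Lambda>) * (1 - \<alpha>) \<le> (1 + 1 / \<tau>) ^ q"
proof -
  obtain g :: "real \<Rightarrow> real" and G where G: "finite G" "real (card G) \<le> 1 + 1 / \<tau>" "range g \<subseteq> G"
    "\<And>a. \<bar>a\<bar> \<le> 1 \<Longrightarrow> \<bar>g a - a\<bar> \<le> \<tau>" by (rule finite_rounding[OF \<tau>]) blast
  interpret P: prob_space P using sq by (simp add: sq_estimates_def)
  define Orc where "Orc i = (\<lambda>rs :: ('a \<Rightarrow> real) list. g (\<integral>x. last rs x \<partial>D i))" for i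
  have valid: "valid_oracle (D i) \<tau> (Orc i)" if "i \<in> \<Lambda>" for i
    unfolding valid_oracle_def
  proof (intro allI impI)
    fix rs and r :: "'a \<Rightarrow> real" assume r: "valid_query r"
    interpret D: prob_space "D i" using prob that by auto
    have "AE x in D i. norm (r x) \<le> 1" using r by (auto simp: valid_query_def)
    moreover have rm: "r \<in> borel_measurable (D i)"
      using r prob(2)[OF that] by (auto simp: valid_query_def cong: measurable_cong_sets)
    ultimately have "integrable (D i) r" by (intro D.integrable_const_bound[where B=1]) auto
    then have "(\<integral>x. r x \<partial>D i) \<le> 1" "-1 \<le> (\<integral>x. r x \<partial>D i)"
      using r by (auto intro!: D.integral_le_const D.integral_ge_const simp: valid_query_def abs_le_iff minus_le_iff)
    then have "\<bar>\<integral>x. r x \<partial>D i\<bar> \<le> 1" by linarith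
    then show "\<bar>Orc i (rs @ [r]) - (\<integral>x. r x \<partial>D i)\<bar> \<le> \<tau>" using G(4) by (simp add: Orc_def)
  qed
  define E where "E i = {w \<in> space P. dH (msupport (D i)) (Out w (sq_answers (Q w) (Orc i) q)) \<le> ereal \<epsilon>}" for i
  have E: "1 - \<alpha> \<le> measure P (E i)" if "i \<in> \<Lambda>" for i
    using sq mod[OF that] valid[OF that] unfolding sq_estimates_def E_def by blast
  \<comment> \<open>\<open>measure\<close> is 0 on nonmeasurable sets, so a success probability of
    at least 1 - \<alpha> > 0 forces the success event to be measurable.\<close>
  have Em: "E i \<in> sets P" if "i \<in> \<Lambda>" for i
  proof (rule ccontr)
    assume "E i \<notin> sets P"
    then have "measure P (E i) = 0" by (rule measure_notin_sets)
    then show False using E[OF that] \<alpha> by simp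
  qed
  have cnt: "(\<Sum>i\<in>\<Lambda>. indicator (E i) w) \<le> (1 + 1 / \<tau>) ^ q" if w: "w \<in> space P" for w
  proof -
    let ?S = "{i\<in>\<Lambda>. w \<in> E i}" and ?L = "{xs. set xs \<subseteq> G \<and> length xs = q}"
    let ?a = "\<lambda>i. sq_answers (Q w) (Orc i) q"
    have "inj_on ?a ?S"
    proof (rule inj_onI, rule ccontr)
      fix i j assume ij: "i \<in> ?S" "j \<in> ?S" "?a i = ?a j" "i \<noteq> j"
      then have "dH (msupport (D i)) (Out w (?a i)) \<le> ereal \<epsilon>" "dH (msupport (D j)) (Out w (?a i)) \<le> ereal \<epsilon>"
        by (auto simp: E_def)
      then have "dH (msupport (D i)) (msupport (D j)) \<le> ereal (\<epsilon> + \<epsilon>)" by (rule dH_triangle_le)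
      moreover have "\<epsilon> + \<epsilon> = 2 * \<epsilon>" by simp
      ultimately have "dH (msupport (D i)) (msupport (D j)) \<le> ereal (2 * \<epsilon>)" by metis
      then show False using sep[of i j] ij by (simp add: not_less[symmetric])
    qed
    moreover have "?a ` ?S \<subseteq> ?L"
    proof
      fix xs assume "xs \<in> ?a ` ?S"
      then obtain i where xs: "xs = ?a i" by blast
      have "set (?a i) \<subseteq> G" by (rule set_sq_answers) (use G(3) in \<open>auto simp: Orc_def\<close>)
      then show "xs \<in> ?L" using xs by (simp add: length_sq_answers)
    qed
    moreover have "finite ?L" using G(1) by (rule finite_lists_length_eq)
    ultimately have "card ?S \<le> card ?L" by (rule card_inj_on_le)
    then have "card ?S \<le> card G ^ q" using G(1) by (simp add: card_lists_length_eq)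
    then have "real (card ?S) \<le> real (card G) ^ q" by (metis of_nat_le_iff of_nat_power)
    also have "\<dots> \<le> (1 + 1 / \<tau>) ^ q" using G(2) by (intro power_mono) auto
    finally have "real (card ?S) \<le> (1 + 1 / \<tau>) ^ q" .
    moreover have "(\<Sum>i\<in>\<Lambda>. indicator (E i) w) = real (card ?S)"
    proof -
      have "(\<Sum>i\<in>\<Lambda>. indicator (E i) w :: real) = (\<Sum>i\<in>\<Lambda>. if w \<in> E i then 1 else 0)"
        by (intro sum.cong) (auto simp: indicator_def)
      also have "\<dots> = real (card ?S)" using fin by (simp add: sum.If_cases Int_def)
      finally show ?thesis .
    qed
    ultimately show ?thesis by simp
  qed
  have "real (card \<Lambda>) * (1 - \<alpha>) = (\<Sum>i\<in>\<Lambda>. 1 - \<alpha>)" by simp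
  also have "\<dots> \<le> (\<Sum>i\<in>\<Lambda>. measure P (E i))" by (intro sum_mono E)
  also have "\<dots> = (\<Sum>i\<in>\<Lambda>. \<integral>w. indicator (E i) w \<partial>P)"
    using Em by (intro sum.cong) (auto simp: sets.Int_space_eq2)
  also have "\<dots> = (\<integral>w. (\<Sum>i\<in>\<Lambda>. indicator (E i) w) \<partial>P)"
    using Em by (subst Bochner_Integration.integral_sum) (auto intro!: integrable_real_indicator simp: P.emeasure_finite less_top[symmetric])
  also have "\<dots> \<le> (1 + 1 / \<tau>) ^ q"
  proof (rule P.integral_le_const)
    show "integrable P (\<lambda>w. (\<Sum>i\<in>\<Lambda>. indicator (E i) w :: real))"
      using Em by (intro Bochner_Integration.integrable_sum integrable_real_indicator) (auto simp: less_top[symmetric])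
    show "AE w in P. (\<Sum>i\<in>\<Lambda>. indicator (E i) w) \<le> (1 + 1 / \<tau>) ^ q" using cnt by auto
  qed
  finally show ?thesis .
qed

section \<open>Twice continuously differentiable maps\<close>

text \<open>Stated for normed spaces because it is applied to derivatives, whose values are linear
  operators. A map is C2 when it is differentiable with a C1 derivative, so each rule for
  \<open>C2_on\<close> reduces to rules for \<open>C1_on\<close> applied to the derivative.\<close>

definition C1_on :: "'a::real_normed_vector set \<Rightarrow> ('a \<Rightarrow> 'b::real_normed_vector) \<Rightarrow> bool" where
  "C1_on U f \<longleftrightarrow> (\<exists>f' :: 'a \<Rightarrow> ('a \<Rightarrow>\<^sub>L 'b). (\<forall>x\<in>U. (f has_derivative blinfun_apply (f' x)) (at x)) \<and> continuous_on U f')"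

lemma C1_onI:
  assumes "\<And>x. x \<in> U \<Longrightarrow> (f has_derivative blinfun_apply (f' x)) (at x)" "continuous_on U f'"
  shows "C1_on U f"
  using assms unfolding C1_on_def by blast

lemma C1_on_imp_continuous_on: "C1_on U f \<Longrightarrow> continuous_on U f"
  unfolding C1_on_def by (meson has_derivative_continuous continuous_at_imp_continuous_on)

lemma C1_on_subset: "C1_on U f \<Longrightarrow> V \<subseteq> U \<Longrightarrow> C1_on V f"
  unfolding C1_on_def by (meson continuous_on_subset subsetD)

lemma C1_on_bounded_linear:
  assumes "bounded_linear f" shows "C1_on U f"
  by (rule C1_onI[where f'="\<lambda>_. Blinfun f"])
     (use assms in \<open>auto simp: bounded_linear_Blinfun_apply intro: bounded_linear_imp_has_derivative\<close>)

lemma C1_on_const: "C1_on U (\<lambda>_. c)"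
  by (rule C1_onI[where f'="\<lambda>_. 0"]) (auto simp: zero_blinfun.rep_eq)

lemma C1_on_add:
  assumes "C1_on U f" "C1_on U g" shows "C1_on U (\<lambda>x. f x + g x)"
proof -
  obtain f' where f': "\<And>x. x \<in> U \<Longrightarrow> (f has_derivative blinfun_apply (f' x)) (at x)" "continuous_on U f'"
    using assms(1) unfolding C1_on_def by auto
  obtain g' where g': "\<And>x. x \<in> U \<Longrightarrow> (g has_derivative blinfun_apply (g' x)) (at x)" "continuous_on U g'"
    using assms(2) unfolding C1_on_def by auto
  show ?thesis
    by (rule C1_onI[where f'="\<lambda>x. f' x + g' x"])
       (use f' g' in \<open>auto simp: plus_blinfun.rep_eq intro!: has_derivative_add continuous_on_add\<close>)
qed

lemma C1_on_bilinear:
  assumes B: "bounded_bilinear B" and "C1_on U f" "C1_on U g"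
  shows "C1_on U (\<lambda>x. B (f x) (g x))"
proof -
  interpret B: bounded_bilinear B by (rule B)
  obtain f' where f': "\<And>x. x \<in> U \<Longrightarrow> (f has_derivative blinfun_apply (f' x)) (at x)" "continuous_on U f'"
    using assms(2) unfolding C1_on_def by auto
  obtain g' where g': "\<And>x. x \<in> U \<Longrightarrow> (g has_derivative blinfun_apply (g' x)) (at x)" "continuous_on U g'"
    using assms(3) unfolding C1_on_def by auto
  have cf: "continuous_on U f" "continuous_on U g" using assms C1_on_imp_continuous_on by blast+
  show ?thesis
  proof (rule C1_onI[where f'="\<lambda>x. (B.prod_right (f x) o\<^sub>L g' x) + (B.prod_left (g x) o\<^sub>L f' x)"])
    fix x assume x: "x \<in> U"
    have "((\<lambda>x. B (f x) (g x)) has_derivative (\<lambda>h. B (f x) (g' x h) + B (f' x h) (g x))) (at x)"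
      by (rule B.FDERIV[OF f'(1)[OF x] g'(1)[OF x]])
    then show "((\<lambda>x. B (f x) (g x)) has_derivative blinfun_apply ((B.prod_right (f x) o\<^sub>L g' x) + (B.prod_left (g x) o\<^sub>L f' x))) (at x)"
      by (simp add: plus_blinfun.rep_eq)
  next
    have "continuous_on U (\<lambda>x. B.prod_right (f x))" "continuous_on U (\<lambda>x. B.prod_left (g x))"
      using cf by (auto intro: bounded_linear.continuous_on[OF B.bounded_linear_prod_right]
          bounded_linear.continuous_on[OF B.bounded_linear_prod_left])
    then show "continuous_on U (\<lambda>x. (B.prod_right (f x) o\<^sub>L g' x) + (B.prod_left (g x) o\<^sub>L f' x))"
      using f' g' by (intro continuous_on_add bounded_bilinear.continuous_on[OF bounded_bilinear_blinfun_compose])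
  qed
qed

lemma C1_on_compose:
  assumes "C1_on V g" "C1_on U f" "f ` U \<subseteq> V"
  shows "C1_on U (\<lambda>x. g (f x))"
proof -
  obtain f' where f': "\<And>x. x \<in> U \<Longrightarrow> (f has_derivative blinfun_apply (f' x)) (at x)" "continuous_on U f'"
    using assms(2) unfolding C1_on_def by auto
  obtain g' where g': "\<And>x. x \<in> V \<Longrightarrow> (g has_derivative blinfun_apply (g' x)) (at x)" "continuous_on V g'"
    using assms(1) unfolding C1_on_def by auto
  have cf: "continuous_on U f" by (rule C1_on_imp_continuous_on[OF assms(2)])
  show ?thesis
  proof (rule C1_onI[where f'="\<lambda>x. g' (f x) o\<^sub>L f' x"])
    fix x assume x: "x \<in> U"
    have "((\<lambda>x. g (f x)) has_derivative (\<lambda>h. g' (f x) (f' x h))) (at x)"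
      by (rule has_derivative_compose[OF f'(1)[OF x] g'(1)]) (use x assms(3) in auto)
    then show "((\<lambda>x. g (f x)) has_derivative blinfun_apply (g' (f x) o\<^sub>L f' x)) (at x)"
      by (simp add: blinfun_compose.rep_eq comp_def)
  next
    have "continuous_on U (\<lambda>x. g' (f x))" using continuous_on_compose2[OF g'(2) cf assms(3)] .
    then show "continuous_on U (\<lambda>x. g' (f x) o\<^sub>L f' x)"
      using f' by (intro bounded_bilinear.continuous_on[OF bounded_bilinear_blinfun_compose])
  qed
qed

lemma C1_on_linear_compose: "bounded_linear L \<Longrightarrow> C1_on U f \<Longrightarrow> C1_on U (\<lambda>x. L (f x))"
  by (rule C1_on_compose[OF C1_on_bounded_linear[of L UNIV]]) auto

lemma C2_on_iff:
  "C2_on U f \<longleftrightarrow> open U \<and> (\<exists>f' :: 'a::euclidean_space \<Rightarrow> ('a \<Rightarrow>\<^sub>L 'b::euclidean_space).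
     (\<forall>x\<in>U. (f has_derivative blinfun_apply (f' x)) (at x)) \<and> C1_on U f')"
  unfolding C2_on_def C1_on_def by blast

lemma C2_onI:
  assumes "open U" "\<And>x. x \<in> U \<Longrightarrow> (f has_derivative blinfun_apply (f' x)) (at x)" "C1_on U f'"
  shows "C2_on U f"
  using assms unfolding C2_on_iff by blast

lemma C2_on_imp_C1_on: "C2_on U f \<Longrightarrow> C1_on U f"
  unfolding C2_on_iff C1_on_def by (meson has_derivative_continuous continuous_at_imp_continuous_on)

lemma C2_on_imp_continuous_on: "C2_on U f \<Longrightarrow> continuous_on U f"
  using C2_on_imp_C1_on C1_on_imp_continuous_on by blast

lemma C2_on_imp_open: "C2_on U f \<Longrightarrow> open U"
  by (simp add: C2_on_def)

lemma C2_on_subset: "C2_on U f \<Longrightarrow> V \<subseteq> U \<Longrightarrow> open V \<Longrightarrow> C2_on V f"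
  unfolding C2_on_iff by (meson C1_on_subset subsetD)

lemma C2_on_bounded_linear:
  assumes "bounded_linear f" "open U" shows "C2_on U f"
  by (rule C2_onI[where f'="\<lambda>_. Blinfun f"])
     (use assms in \<open>auto simp: bounded_linear_Blinfun_apply C1_on_const intro: bounded_linear_imp_has_derivative\<close>)

lemma C2_on_const: "open U \<Longrightarrow> C2_on U (\<lambda>_. c)"
  by (rule C2_onI[where f'="\<lambda>_. 0"]) (auto simp: zero_blinfun.rep_eq C1_on_const)

lemma C2_on_add:
  assumes "C2_on U f" "C2_on U g" shows "C2_on U (\<lambda>x. f x + g x)"
proof -
  obtain f' where f': "\<And>x. x \<in> U \<Longrightarrow> (f has_derivative blinfun_apply (f' x)) (at x)" "C1_on U f'"
    using assms(1) unfolding C2_on_iff by auto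
  obtain g' where g': "\<And>x. x \<in> U \<Longrightarrow> (g has_derivative blinfun_apply (g' x)) (at x)" "C1_on U g'"
    using assms(2) unfolding C2_on_iff by auto
  show ?thesis
    by (rule C2_onI[where f'="\<lambda>x. f' x + g' x"])
       (use f' g' C2_on_imp_open[OF assms(1)] in \<open>auto simp: plus_blinfun.rep_eq intro!: has_derivative_add C1_on_add\<close>)
qed

lemma C2_on_sum:
  assumes "finite I" "open U" "\<And>i. i \<in> I \<Longrightarrow> C2_on U (f i)"
  shows "C2_on U (\<lambda>x. \<Sum>i\<in>I. f i x)"
  using assms(1,3) by (induction I) (auto simp: C2_on_const assms(2) intro: C2_on_add)

lemma C2_on_bilinear:
  assumes B: "bounded_bilinear B" and f: "C2_on U f" and g: "C2_on U g"
  shows "C2_on U (\<lambda>x. B (f x) (g x))"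
proof -
  interpret B: bounded_bilinear B by (rule B)
  obtain f' where f': "\<And>x. x \<in> U \<Longrightarrow> (f has_derivative blinfun_apply (f' x)) (at x)" "C1_on U f'"
    using f unfolding C2_on_iff by auto
  obtain g' where g': "\<And>x. x \<in> U \<Longrightarrow> (g has_derivative blinfun_apply (g' x)) (at x)" "C1_on U g'"
    using g unfolding C2_on_iff by auto
  show ?thesis
  proof (rule C2_onI[where f'="\<lambda>x. (B.prod_right (f x) o\<^sub>L g' x) + (B.prod_left (g x) o\<^sub>L f' x)"])
    show "open U" by (rule C2_on_imp_open[OF f])
    fix x assume x: "x \<in> U"
    have "((\<lambda>x. B (f x) (g x)) has_derivative (\<lambda>h. B (f x) (g' x h) + B (f' x h) (g x))) (at x)"
      by (rule B.FDERIV[OF f'(1)[OF x] g'(1)[OF x]])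
    then show "((\<lambda>x. B (f x) (g x)) has_derivative blinfun_apply ((B.prod_right (f x) o\<^sub>L g' x) + (B.prod_left (g x) o\<^sub>L f' x))) (at x)"
      by (simp add: plus_blinfun.rep_eq)
  next
    show "C1_on U (\<lambda>x. (B.prod_right (f x) o\<^sub>L g' x) + (B.prod_left (g x) o\<^sub>L f' x))"
      using f'(2) g'(2) C2_on_imp_C1_on[OF f] C2_on_imp_C1_on[OF g]
      by (intro C1_on_add C1_on_bilinear[OF bounded_bilinear_blinfun_compose]
          C1_on_linear_compose[OF B.bounded_linear_prod_right] C1_on_linear_compose[OF B.bounded_linear_prod_left])
  qed
qed

lemma C2_on_compose:
  assumes g: "C2_on V g" and f: "C2_on U f" and im: "f ` U \<subseteq> V"
  shows "C2_on U (\<lambda>x. g (f x))"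
proof -
  obtain f' where f': "\<And>x. x \<in> U \<Longrightarrow> (f has_derivative blinfun_apply (f' x)) (at x)" "C1_on U f'"
    using f unfolding C2_on_iff by auto
  obtain g' where g': "\<And>x. x \<in> V \<Longrightarrow> (g has_derivative blinfun_apply (g' x)) (at x)" "C1_on V g'"
    using g unfolding C2_on_iff by auto
  show ?thesis
  proof (rule C2_onI[where f'="\<lambda>x. g' (f x) o\<^sub>L f' x"])
    show "open U" by (rule C2_on_imp_open[OF f])
    fix x assume x: "x \<in> U"
    have "((\<lambda>x. g (f x)) has_derivative (\<lambda>h. g' (f x) (f' x h))) (at x)"
      by (rule has_derivative_compose[OF f'(1)[OF x] g'(1)]) (use x im in auto)
    then show "((\<lambda>x. g (f x)) has_derivative blinfun_apply (g' (f x) o\<^sub>L f' x)) (at x)"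
      by (simp add: blinfun_compose.rep_eq comp_def)
  next
    show "C1_on U (\<lambda>x. g' (f x) o\<^sub>L f' x)"
      using C1_on_compose[OF g'(2) C2_on_imp_C1_on[OF f] im] f'(2)
      by (rule C1_on_bilinear[OF bounded_bilinear_blinfun_compose])
  qed
qed

lemma C2_on_real:
  fixes F :: "real \<Rightarrow> real"
  assumes "\<And>x. (F has_real_derivative F' x) (at x)" "\<And>x. (F' has_real_derivative F'' x) (at x)" "continuous_on UNIV F''"
  shows "C2_on UNIV F"
proof (rule C2_onI[where f'="\<lambda>x. blinfun_mult_right (F' x)"])
  show "(F has_derivative blinfun_apply (blinfun_mult_right (F' x))) (at x)" for x
    using assms(1)[of x] by (simp add: has_field_derivative_def)
  have "C1_on UNIV F'"
  proof (rule C1_onI[where f'="\<lambda>x. blinfun_mult_right (F'' x)"])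
    show "(F' has_derivative blinfun_apply (blinfun_mult_right (F'' x))) (at x)" for x
      using assms(2)[of x] by (simp add: has_field_derivative_def)
    show "continuous_on UNIV (\<lambda>x. blinfun_mult_right (F'' x))"
      by (rule bounded_linear.continuous_on[OF bounded_linear_blinfun_mult_right assms(3)])
  qed
  then show "C1_on UNIV (\<lambda>x. blinfun_mult_right (F' x))"
    by (rule C1_on_linear_compose[OF bounded_linear_blinfun_mult_right])
qed auto

text \<open>A product rule in which one factor is merely continuous: where the other factor
  vanishes, the change of the first contributes only a term of order o(norm h).\<close>

lemma has_derivative_bilinear_zero:
  assumes B: "bounded_bilinear B" and g: "continuous (at y) g" and f: "(f has_derivative f') (at y)" and f0: "f y = 0"
  shows "((\<lambda>z. B (g z) (f z)) has_derivative (\<lambda>h. B (g y) (f' h))) (at y)"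
proof -
  interpret B: bounded_bilinear B by (rule B)
  obtain K where K: "0 < K" "\<And>a b. norm (B a b) \<le> norm a * norm b * K" using B.pos_bounded by blast
  have bl: "bounded_linear f'" using f by (rule has_derivative_bounded_linear)
  obtain C where C: "\<And>h. norm (f' h) \<le> norm h * C" "0 < C" using bounded_linear.pos_bounded[OF bl] by blast
  have f1: "((\<lambda>h. norm (f (y + h) - f y - f' h) / norm h) \<longlongrightarrow> 0) (at 0)"
    using f by (simp add: has_derivative_at)
  have g0: "((\<lambda>h. g (y + h)) \<longlongrightarrow> g y) (at 0)"
    using g by (simp add: continuous_at LIM_offset_zero_iff)
  have g1: "((\<lambda>h. g (y + h) - g y) \<longlongrightarrow> 0) (at 0)" using tendsto_diff[OF g0 tendsto_const[of "g y"]] by simp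
  have "((\<lambda>h. norm (g (y + h)) * (norm (f (y + h) - f y - f' h) / norm h) * K + norm (g (y + h) - g y) * C * K)
      \<longlongrightarrow> norm (g y) * 0 * K + 0 * C * K) (at 0)"
    by (intro tendsto_add tendsto_mult tendsto_const tendsto_norm[OF g0] f1 tendsto_norm_zero[OF g1])
  then have lim: "((\<lambda>h. norm (g (y + h)) * (norm (f (y + h) - f y - f' h) / norm h) * K + norm (g (y + h) - g y) * C * K)
      \<longlongrightarrow> 0) (at 0)" by simp
  show ?thesis
    unfolding has_derivative_at
  proof
    show "bounded_linear (\<lambda>h. B (g y) (f' h))" by (intro bounded_linear_compose[OF B.bounded_linear_right bl])
    show "((\<lambda>h. norm (B (g (y + h)) (f (y + h)) - B (g y) (f y) - B (g y) (f' h)) / norm h) \<longlongrightarrow> 0) (at 0)"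
    proof (rule Lim_null_comparison[OF _ lim], rule always_eventually, rule allI)
      fix h
      have "B (g (y + h)) (f (y + h)) - B (g y) (f y) - B (g y) (f' h)
          = B (g (y + h)) (f (y + h) - f y - f' h) + B (g (y + h) - g y) (f' h)"
        by (simp add: f0 B.diff_left B.diff_right B.zero_right)
      also have "norm \<dots> \<le> norm (g (y + h)) * norm (f (y + h) - f y - f' h) * K + norm (g (y + h) - g y) * norm (f' h) * K"
        by (intro order_trans[OF norm_triangle_ineq] add_mono K)
      also have "\<dots> \<le> norm (g (y + h)) * norm (f (y + h) - f y - f' h) * K + norm (g (y + h) - g y) * (norm h * C) * K"
        using K(1) by (intro add_mono mult_right_mono mult_left_mono C) auto
      finally have "norm (B (g (y + h)) (f (y + h)) - B (g y) (f y) - B (g y) (f' h)) / norm h \<le>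
          (norm (g (y + h)) * norm (f (y + h) - f y - f' h) * K + norm (g (y + h) - g y) * (norm h * C) * K) / norm h"
        by (rule divide_right_mono) simp
      also have "\<dots> \<le> norm (g (y + h)) * (norm (f (y + h) - f y - f' h) / norm h) * K + norm (g (y + h) - g y) * C * K"
      proof (cases "h = 0")
        case True then show ?thesis using K C by simp
      next
        case False then show ?thesis by (simp add: add_divide_distrib)
      qed
      finally show "norm (norm (B (g (y + h)) (f (y + h)) - B (g y) (f y) - B (g y) (f' h)) / norm h) \<le>
          norm (g (y + h)) * (norm (f (y + h) - f y - f' h) / norm h) * K + norm (g (y + h) - g y) * C * K"
        by simp
    qed
  qed
qed

text \<open>The resolvent identity. Its factor \<open>A z - A y\<close> vanishes at z = y, which is
  the situation of the product rule above.\<close>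

lemma blinfun_inverse_diff:
  fixes A B :: "'c \<Rightarrow> ('a::real_normed_vector \<Rightarrow>\<^sub>L 'a)"
  assumes "B y o\<^sub>L A y = id_blinfun" "A y o\<^sub>L B y = id_blinfun" "B z o\<^sub>L A z = id_blinfun"
  shows "B z = B y - (B z o\<^sub>L ((A z - A y) o\<^sub>L B y))"
proof (rule blinfun_eqI)
  fix h
  have 1: "B z (A z k) = k" "B y (A y k) = k" "A y (B y k) = k" for k
    using assms by (metis blinfun_apply_blinfun_compose blinfun_apply_id_blinfun)+
  show "B z h = (B y - (B z o\<^sub>L ((A z - A y) o\<^sub>L B y))) h"
    by (simp add: blinfun.diff_left blinfun.diff_right 1)
qed

text \<open>The derivative of the inverse at y in direction h is the negative of B y composed with
  A' y h and B y, obtained from the resolvent identity and the product rule with a vanishing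
  factor.\<close>

lemma C1_on_blinfun_inverse:
  fixes A B :: "'c::real_normed_vector \<Rightarrow> ('a::real_normed_vector \<Rightarrow>\<^sub>L 'a)"
  assumes C1: "C1_on V A" and "open V"
    and inv: "\<And>y. y \<in> V \<Longrightarrow> B y o\<^sub>L A y = id_blinfun" "\<And>y. y \<in> V \<Longrightarrow> A y o\<^sub>L B y = id_blinfun"
    and cont: "continuous_on V B"
  shows "C1_on V B"
proof -
  interpret bc: bounded_bilinear "(o\<^sub>L) :: ('a \<Rightarrow>\<^sub>L 'a) \<Rightarrow> ('a \<Rightarrow>\<^sub>L 'a) \<Rightarrow> _" by (rule bounded_bilinear_blinfun_compose)
  obtain A' where A': "\<And>x. x \<in> V \<Longrightarrow> (A has_derivative blinfun_apply (A' x)) (at x)" "continuous_on V A'"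
    using C1 unfolding C1_on_def by auto
  show ?thesis
  proof (rule C1_onI[where f'="\<lambda>y. (- bc.prod_right (B y)) o\<^sub>L (bc.prod_left (B y) o\<^sub>L A' y)"])
    fix y assume y: "y \<in> V"
    have "((\<lambda>z. (A z - A y) o\<^sub>L B y) has_derivative (\<lambda>h. A' y h o\<^sub>L B y)) (at y)"
      by (rule bounded_linear.has_derivative[OF bc.bounded_linear_left])
         (auto intro!: derivative_eq_intros A'(1) y)
    then have "((\<lambda>z. B z o\<^sub>L ((A z - A y) o\<^sub>L B y)) has_derivative (\<lambda>h. B y o\<^sub>L (A' y h o\<^sub>L B y))) (at y)"
      using cont y \<open>open V\<close>
      by (intro has_derivative_bilinear_zero[OF bounded_bilinear_blinfun_compose])
         (auto simp: continuous_on_eq_continuous_at bc.zero_left)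
    then have "((\<lambda>z. B y - (B z o\<^sub>L ((A z - A y) o\<^sub>L B y))) has_derivative (\<lambda>h. 0 - (B y o\<^sub>L (A' y h o\<^sub>L B y)))) (at y)"
      by (intro has_derivative_diff has_derivative_const)
    then have "(B has_derivative (\<lambda>h. 0 - (B y o\<^sub>L (A' y h o\<^sub>L B y)))) (at y)"
    proof (rule has_derivative_transform_within_open[OF _ \<open>open V\<close> y])
      fix z assume "z \<in> V"
      then show "B y - (B z o\<^sub>L ((A z - A y) o\<^sub>L B y)) = B z"
        using blinfun_inverse_diff[of B y A z] inv y by simp
    qed
    then show "(B has_derivative blinfun_apply ((- bc.prod_right (B y)) o\<^sub>L (bc.prod_left (B y) o\<^sub>L A' y))) (at y)"
      by (simp add: uminus_blinfun.rep_eq blinfun_compose.rep_eq comp_def)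
  next
    have "continuous_on V (\<lambda>y. bc.prod_right (B y))" "continuous_on V (\<lambda>y. bc.prod_left (B y))"
      using cont by (auto intro: bounded_linear.continuous_on[OF bc.bounded_linear_prod_right]
          bounded_linear.continuous_on[OF bc.bounded_linear_prod_left])
    then show "continuous_on V (\<lambda>y. (- bc.prod_right (B y)) o\<^sub>L (bc.prod_left (B y) o\<^sub>L A' y))"
      by (intro bounded_bilinear.continuous_on[OF bounded_bilinear_blinfun_compose] continuous_on_minus A')
  qed
qed

lemma near_id_blinfun_lower:
  fixes T :: "'a::real_normed_vector \<Rightarrow>\<^sub>L 'a"
  assumes "norm (T - id_blinfun) \<le> 1/2"
  shows "norm h \<le> 2 * norm (T h)"
proof -
  have "norm ((T - id_blinfun) h) \<le> 1/2 * norm h"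
    by (rule order_trans[OF norm_blinfun mult_right_mono[OF assms norm_ge_zero]])
  then have "norm (T h - h) \<le> 1/2 * norm h" by (simp add: blinfun.diff_left)
  then show ?thesis using norm_triangle_ineq3[of h "T h"] by (simp add: norm_minus_commute abs_le_iff)
qed

text \<open>The inverse function theorem gives a differentiable local inverse; its regularity is
  then bootstrapped. Staying within 1/2 of the identity bounds all inverse operators by 2, so the
  resolvent identity makes them continuous along the inverse map.\<close>

lemma C2_local_inverse:
  fixes f :: "'a::euclidean_space \<Rightarrow> 'a"
  assumes U: "open U" and der: "\<And>x. x \<in> U \<Longrightarrow> (f has_derivative blinfun_apply (f' x)) (at x)" and C1: "C1_on U f'"
    and near: "\<And>x. x \<in> U \<Longrightarrow> norm (f' x - id_blinfun) \<le> 1/2" and x0: "x0 \<in> U"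
  shows "\<exists>U' V g G. open U' \<and> U' \<subseteq> U \<and> x0 \<in> U' \<and> open V \<and> f ` U' = V \<and> g ` V = U' \<and>
    (\<forall>x\<in>U'. g (f x) = x) \<and> (\<forall>y\<in>V. f (g y) = y) \<and> C2_on U' f \<and> C2_on V g \<and>
    (g has_derivative blinfun_apply G) (at (f x0)) \<and> G o\<^sub>L f' x0 = id_blinfun"
proof -
  have lower: "norm h \<le> 2 * norm (f' x h)" if "x \<in> U" for x h
    by (rule near_id_blinfun_lower[OF near[OF that]])
  have inj: "inj (blinfun_apply (f' x))" if "x \<in> U" for x
  proof (rule injI)
    fix h k assume "f' x h = f' x k"
    then have "f' x (h - k) = 0" by (simp add: blinfun.diff_right)
    then show "h = k" using lower[OF that, of "h - k"] by simp
  qed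
  have lin: "linear (blinfun_apply (f' x))" for x
    using blinfun.bounded_linear_right bounded_linear.linear by blast
  have "\<exists>B. B o\<^sub>L f' x = id_blinfun \<and> f' x o\<^sub>L B = id_blinfun" if xU: "x \<in> U" for x
  proof -
    obtain g where g: "linear g" "g \<circ> blinfun_apply (f' x) = id"
      using linear_injective_left_inverse[OF lin inj[OF xU]] by auto
    have g2: "blinfun_apply (f' x) \<circ> g = id" by (rule linear_inverse_left[OF lin g(1), THEN iffD2, OF g(2)])
    have "bounded_linear g" using g(1) by (simp add: linear_conv_bounded_linear)
    then have "Blinfun g o\<^sub>L f' x = id_blinfun \<and> f' x o\<^sub>L Blinfun g = id_blinfun"
      using g(2) g2 by (auto intro!: blinfun_eqI simp: bounded_linear_Blinfun_apply fun_eq_iff)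
    then show ?thesis by blast
  qed
  then obtain I where I: "\<And>x. x \<in> U \<Longrightarrow> I x o\<^sub>L f' x = id_blinfun" "\<And>x. x \<in> U \<Longrightarrow> f' x o\<^sub>L I x = id_blinfun"
    by metis
  have Iapp: "I x (f' x h) = h" "f' x (I x h) = h" if "x \<in> U" for x h
    using I[OF that] by (metis blinfun_apply_blinfun_compose blinfun_apply_id_blinfun)+
  have cont: "continuous_on U f'" by (rule C1_on_imp_continuous_on[OF C1])
  obtain U' V g g' where g: "open U'" "U' \<subseteq> U" "x0 \<in> U'" "open V" "f x0 \<in> V" "homeomorphism U' V f g"
    "\<And>y. y \<in> V \<Longrightarrow> (g has_derivative (g' y)) (at y)"
    "\<And>y. y \<in> V \<Longrightarrow> g' y = inv (blinfun_apply (f'(g y)))"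
    "\<And>y. y \<in> V \<Longrightarrow> bij (blinfun_apply (f'(g y)))"
    using inverse_function_theorem[OF U der cont x0 I(1)[OF x0]] by metis
  have hom: "f ` U' = V" "g ` V = U'" "\<And>x. x \<in> U' \<Longrightarrow> g (f x) = x" "\<And>y. y \<in> V \<Longrightarrow> f (g y) = y" "continuous_on V g"
    using g(6) by (auto simp: homeomorphism_def)
  have gU: "g y \<in> U" if "y \<in> V" for y using hom(2) g(2) that by blast
  define B where "B y = I (g y)" for y
  define A where "A y = f' (g y)" for y
  have gder: "(g has_derivative blinfun_apply (B y)) (at y)" if y: "y \<in> V" for y
  proof -
    have "g' y = blinfun_apply (B y)"
      unfolding g(8)[OF y] B_def
      by (rule inv_equality) (use Iapp[OF gU[OF y]] in auto)
    then show ?thesis using g(7)[OF y] by simp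
  qed
  have BA: "B y o\<^sub>L A y = id_blinfun" "A y o\<^sub>L B y = id_blinfun" if "y \<in> V" for y
    using I gU[OF that] by (auto simp: A_def B_def)
  have Bnorm: "norm (B y) \<le> 2" if "y \<in> V" for y
  proof (rule norm_blinfun_bound)
    fix h show "norm (B y h) \<le> 2 * norm h"
      using lower[OF gU[OF that], of "B y h"] Iapp[OF gU[OF that]] by (simp add: B_def)
  qed simp
  have contA: "continuous_on V A"
    unfolding A_def using continuous_on_compose2[OF cont hom(5)] gU by blast
  have contB: "continuous_on V B"
    unfolding continuous_on_iff
  proof (intro ballI allI impI)
    fix y and e :: real assume y: "y \<in> V" and e: "0 < e"
    obtain \<delta> where \<delta>: "0 < \<delta>" "\<And>z. z \<in> V \<Longrightarrow> dist z y < \<delta> \<Longrightarrow> dist (A z) (A y) < e / 4"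
      using contA[unfolded continuous_on_iff, rule_format, OF y, of "e / 4"] e by auto
    show "\<exists>d>0. \<forall>x'\<in>V. dist x' y < d \<longrightarrow> dist (B x') (B y) < e"
    proof (intro exI conjI ballI impI)
      fix z assume z: "z \<in> V" "dist z y < \<delta>"
      have "B z - B y = - (B z o\<^sub>L ((A z - A y) o\<^sub>L B y))"
        using blinfun_inverse_diff[of B y A z] BA y z(1) by (simp add: algebra_simps)
      then have "norm (B z - B y) = norm (B z o\<^sub>L ((A z - A y) o\<^sub>L B y))" by simp
      also have "\<dots> \<le> norm (B z) * (norm (A z - A y) * norm (B y))"
        by (rule order_trans[OF norm_blinfun_compose mult_left_mono[OF norm_blinfun_compose]]) simp
      also have "\<dots> \<le> 2 * (norm (A z - A y) * 2)"
        using Bnorm y z(1) by (intro mult_mono) auto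
      finally show "dist (B z) (B y) < e" using \<delta>(2)[OF z] by (simp add: dist_norm)
    qed (rule \<delta>(1))
  qed
  \<comment> \<open>Bootstrapping: g is C1 since its derivative B is continuous; then A, the
    derivative of f along g, is C1; then its inverse B is C1, so g is C2.\<close>
  have "C1_on V g" by (rule C1_onI[OF gder contB])
  then have "C1_on V A" unfolding A_def using C1 gU by (intro C1_on_compose[of U f' V g]) auto
  then have "C1_on V B" using \<open>open V\<close> BA contB by (rule C1_on_blinfun_inverse)
  then have "C2_on V g" using \<open>open V\<close> gder by (intro C2_onI) auto
  moreover have "C2_on U' f" using g(1,2) der C1_on_subset[OF C1] by (intro C2_onI) auto
  moreover have "B (f x0) o\<^sub>L f' x0 = id_blinfun" using BA(1)[OF g(5)] hom(3)[OF g(3)] by (simp add: A_def)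
  ultimately show ?thesis using g(1-5) hom gder[OF g(5)]
    by (intro exI[of _ U'] exI[of _ V] exI[of _ g] exI[of _ "B (f x0)"]) simp
qed

section \<open>Charts, tangent spaces and reach\<close>

text \<open>The condition of \<open>C2_submanifold\<close> at a single point, so that different
  local models can be used at different points.\<close>

definition chart_at :: "nat \<Rightarrow> 'a::euclidean_space set \<Rightarrow> 'a \<Rightarrow> bool" where
  "chart_at d M p \<longleftrightarrow> (\<exists>U V (\<phi> :: 'a \<Rightarrow> 'a) \<psi> E.
        open U \<and> p \<in> U \<and> open V \<and> subspace E \<and> dim E = d \<and>
        \<phi> ` U = V \<and> \<psi> ` V = U \<and> (\<forall>x\<in>U. \<psi> (\<phi> x) = x) \<and> (\<forall>y\<in>V. \<phi> (\<psi> y) = y) \<and>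
        C2_on U \<phi> \<and> C2_on V \<psi> \<and> \<phi> ` (M \<inter> U) = V \<inter> E)"

lemma C2_submanifold_iff: "C2_submanifold d M \<longleftrightarrow> (\<forall>p\<in>M. chart_at d M p)"
  by (simp add: C2_submanifold_def chart_at_def)

text \<open>One-sided by design: every vector of T is the velocity of a curve in M, which is what
  first-order conditions at nearest points use. That T is large enough is expressed separately by
  \<open>quad_tangent\<close>.\<close>

definition tangent_at :: "'a::euclidean_space set \<Rightarrow> 'a \<Rightarrow> 'a set \<Rightarrow> bool" where
  "tangent_at M p T \<longleftrightarrow> subspace T \<and> (\<forall>u\<in>T. \<exists>c :: real \<Rightarrow> 'a. c 0 = p \<and>
      (c has_derivative (\<lambda>s. s *\<^sub>R u)) (at 0) \<and> (\<forall>\<^sub>F s in at 0. c s \<in> M))"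

text \<open>After shrinking, \<Phi> itself is the chart, and its local inverse carries the lines
  \<Phi> p + s u with u in E to curves in M. Their velocity at p is u because the derivative of
  \<Phi> at p is the identity, so E serves as the tangent space.\<close>

lemma chart_and_tangent_of_level_map:
  fixes \<Phi> :: "'a::euclidean_space \<Rightarrow> 'a"
  assumes p: "p \<in> W" "p \<in> M" and W: "open W" and C2: "C2_on W \<Phi>" and der: "(\<Phi> has_derivative (\<lambda>h. h)) (at p)"
    and E: "subspace E" "dim E = d" and M: "\<And>x. x \<in> W \<Longrightarrow> x \<in> M \<longleftrightarrow> \<Phi> x \<in> E"
  shows "chart_at d M p" "tangent_at M p E"
proof -
  obtain f' where f': "\<And>x. x \<in> W \<Longrightarrow> (\<Phi> has_derivative blinfun_apply (f' x)) (at x)" "C1_on W f'"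
    using C2 unfolding C2_on_iff by auto
  have fp: "f' p = id_blinfun"
    using has_derivative_unique[OF f'(1)[OF p(1)] der] by (intro blinfun_eqI) simp
  define U where "U = {x\<in>W. norm (f' x - id_blinfun) < 1/2}"
  have "continuous_on W (\<lambda>x. norm (f' x - id_blinfun))"
    by (intro continuous_intros C1_on_imp_continuous_on f')
  then have oU: "open U"
    using continuous_on_open_vimage[OF W, of "\<lambda>x. norm (f' x - id_blinfun)"]
    by (auto simp: U_def vimage_def Int_def conj_commute open_lessThan elim!: allE[of _ "{..<1/2}"])
  have "p \<in> U" using p fp by (simp add: U_def)
  then have "\<exists>U' V g G. open U' \<and> U' \<subseteq> U \<and> p \<in> U' \<and> open V \<and> \<Phi> ` U' = V \<and> g ` V = U' \<and>
    (\<forall>x\<in>U'. g (\<Phi> x) = x) \<and> (\<forall>y\<in>V. \<Phi> (g y) = y) \<and> C2_on U' \<Phi> \<and> C2_on V g \<and>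
    (g has_derivative blinfun_apply G) (at (\<Phi> p)) \<and> G o\<^sub>L f' p = id_blinfun"
    using f'(1) C1_on_subset[OF f'(2), of U] by (intro C2_local_inverse[OF oU]) (auto simp: U_def)
  then obtain U' V g G where g0: "open U'" "U' \<subseteq> U" "p \<in> U'" "open V" "\<Phi> ` U' = V" "g ` V = U'"
    "\<forall>x\<in>U'. g (\<Phi> x) = x" "\<forall>y\<in>V. \<Phi> (g y) = y" "C2_on U' \<Phi>" "C2_on V g"
    "(g has_derivative blinfun_apply G) (at (\<Phi> p))" "G o\<^sub>L f' p = id_blinfun"
    by (elim exE conjE) (rule that)
  note g = g0(1-6) g0(7,8)[rule_format] g0(9-12)
  have UW: "U' \<subseteq> W" using g(2) by (auto simp: U_def)
  have Gid: "blinfun_apply G = (\<lambda>h. h)"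
  proof
    fix h
    have "(G o\<^sub>L f' p) h = h" by (simp add: g(12))
    then show "G h = h" by (simp add: fp)
  qed
  have "\<Phi> ` (M \<inter> U') = V \<inter> E"
  proof (intro equalityI subsetI)
    fix y assume "y \<in> \<Phi> ` (M \<inter> U')"
    then show "y \<in> V \<inter> E" using g(5) M UW by auto
  next
    fix y assume y: "y \<in> V \<inter> E"
    then have "g y \<in> U'" using g(6) by auto
    moreover have "g y \<in> M" using M[of "g y"] y g(8) UW \<open>g y \<in> U'\<close> by auto
    ultimately show "y \<in> \<Phi> ` (M \<inter> U')" using g(8)[of y] y by (metis IntD1 IntI image_eqI)
  qed
  then show "chart_at d M p"
    unfolding chart_at_def using g E
    by (intro exI[of _ U'] exI[of _ V] exI[of _ \<Phi>] exI[of _ g] exI[of _ E]) simp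
  show "tangent_at M p E"
    unfolding tangent_at_def
  proof (intro conjI E ballI)
    fix u assume u: "u \<in> E"
    define c where "c s = g (\<Phi> p + s *\<^sub>R u)" for s :: real
    have pE: "\<Phi> p \<in> E" using M p by auto
    have pV: "\<Phi> p \<in> V" using g by auto
    have "((\<lambda>s. \<Phi> p + s *\<^sub>R u) has_derivative (\<lambda>s. s *\<^sub>R u)) (at (0::real))"
      by (auto intro!: derivative_eq_intros)
    moreover have "(g has_derivative (\<lambda>h. h)) (at (\<Phi> p + 0 *\<^sub>R u))" using g(11) Gid by simp
    ultimately have "(c has_derivative (\<lambda>s. s *\<^sub>R u)) (at 0)"
      unfolding c_def by (rule has_derivative_compose)
    moreover have "\<forall>\<^sub>F s in at 0. c s \<in> M"
    proof -
      have "((\<lambda>s::real. \<Phi> p + s *\<^sub>R u) \<longlongrightarrow> \<Phi> p + 0 *\<^sub>R u) (at 0)" by (intro tendsto_intros)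
      then have "\<forall>\<^sub>F s::real in at 0. \<Phi> p + s *\<^sub>R u \<in> V"
        using topological_tendstoD[OF _ g(4)] pV by simp
      then show ?thesis
      proof eventually_elim
        case (elim s)
        then have "c s \<in> U'" "\<Phi> (c s) = \<Phi> p + s *\<^sub>R u" using g(6,8) by (auto simp: c_def)
        moreover have "\<Phi> p + s *\<^sub>R u \<in> E" using pE u E by (simp add: subspace_add subspace_scale)
        ultimately show ?case using M UW by auto
      qed
    qed
    moreover have "c 0 = p" using g(3,7) by (simp add: c_def)
    ultimately show "\<exists>c. c 0 = p \<and> (c has_derivative (\<lambda>s. s *\<^sub>R u)) (at 0) \<and> (\<forall>\<^sub>F s in at 0. c s \<in> M)" by blast
  qed
qed

text \<open>The chart of the image is the old chart after a local inverse of \<Psi>. Global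
  injectivity of \<Psi> ensures that no distant part of M lands in the neighbourhood of \<Psi>
  p.\<close>

lemma chart_at_image:
  fixes \<Psi> :: "'a::euclidean_space \<Rightarrow> 'a"
  assumes der: "\<And>x. (\<Psi> has_derivative blinfun_apply (D x)) (at x)" and C1: "C1_on UNIV D"
    and near: "\<And>x. norm (D x - id_blinfun) \<le> 1/2" and inj: "inj \<Psi>" and ch: "chart_at d M p"
  shows "chart_at d (\<Psi> ` M) (\<Psi> p)"
proof -
  obtain U V E and \<phi> \<psi> :: "'a \<Rightarrow> 'a" where c0: "open U" "p \<in> U" "open V" "subspace E" "dim E = d"
      "\<phi> ` U = V" "\<psi> ` V = U" "\<forall>x\<in>U. \<psi> (\<phi> x) = x" "\<forall>y\<in>V. \<phi> (\<psi> y) = y"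
      "C2_on U \<phi>" "C2_on V \<psi>" "\<phi> ` (M \<inter> U) = V \<inter> E"
    using ch unfolding chart_at_def by (elim exE conjE) (rule that)
  note c = c0(1-7) c0(8,9)[rule_format] c0(10-12)
  have "\<exists>U' V' g G. open U' \<and> U' \<subseteq> U \<and> p \<in> U' \<and> open V' \<and> \<Psi> ` U' = V' \<and> g ` V' = U' \<and>
    (\<forall>x\<in>U'. g (\<Psi> x) = x) \<and> (\<forall>y\<in>V'. \<Psi> (g y) = y) \<and> C2_on U' \<Psi> \<and> C2_on V' g \<and>
    (g has_derivative blinfun_apply G) (at (\<Psi> p)) \<and> G o\<^sub>L D p = id_blinfun"
    by (rule C2_local_inverse[OF c(1) der C1_on_subset[OF C1] near c(2)]) simp
  then obtain U1 V1 g G where g0: "open U1" "U1 \<subseteq> U" "p \<in> U1" "open V1" "\<Psi> ` U1 = V1" "g ` V1 = U1"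
    "\<forall>x\<in>U1. g (\<Psi> x) = x" "\<forall>y\<in>V1. \<Psi> (g y) = y" "C2_on U1 \<Psi>" "C2_on V1 g"
    "(g has_derivative blinfun_apply G) (at (\<Psi> p))" "G o\<^sub>L D p = id_blinfun"
    by (elim exE conjE) (rule that)
  note g = g0(1-6) g0(7,8)[rule_format] g0(10)
  define V2 where "V2 = {y\<in>V. \<psi> y \<in> U1}"
  have oV2: "open V2"
    using continuous_on_open_vimage[OF c(3), of \<psi>] C2_on_imp_continuous_on[OF c(11)] g(1)
    by (auto simp: V2_def vimage_def Int_def conj_commute)
  have C2P: "C2_on UNIV \<Psi>" by (rule C2_onI[OF _ der C1]) auto
  have V2im: "\<phi> ` U1 = V2" "\<psi> ` V2 = U1"
    using g(2) c(6-9) by (auto simp: V2_def image_iff subset_eq) (metis c(8) image_eqI)+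
  have im1: "(\<lambda>y. \<phi> (g y)) ` V1 = V2"
    using g(6) V2im(1) by (metis image_image)
  have im2: "(\<lambda>y. \<Psi> (\<psi> y)) ` V2 = V1"
    using g(5) V2im(2) by (metis image_image)
  have c1: "C2_on V1 (\<lambda>y. \<phi> (g y))"
    using C2_on_compose[OF c(10) g(9)] g(2,6) by simp
  have c2: "C2_on V2 (\<lambda>y. \<Psi> (\<psi> y))"
    by (rule C2_on_compose[OF C2P C2_on_subset[OF c(11) _ oV2]]) (auto simp: V2_def)
  have lv: "(\<lambda>y. \<phi> (g y)) ` (\<Psi> ` M \<inter> V1) = V2 \<inter> E"
  proof (intro equalityI subsetI)
    fix z assume "z \<in> (\<lambda>y. \<phi> (g y)) ` (\<Psi> ` M \<inter> V1)"
    then obtain m where m: "m \<in> M" "\<Psi> m \<in> V1" "z = \<phi> (g (\<Psi> m))" by auto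
    then obtain m' where "m' \<in> U1" "\<Psi> m = \<Psi> m'" using g(5) by auto
    then have mU: "m \<in> U1" using inj by (simp add: inj_eq)
    then have "z = \<phi> m" using m g(7) by simp
    moreover have "\<phi> m \<in> V \<inter> E" using c(12) m(1) mU g(2) by auto
    ultimately show "z \<in> V2 \<inter> E" using mU V2im by auto
  next
    fix z assume z: "z \<in> V2 \<inter> E"
    then have zV: "z \<in> V" "\<psi> z \<in> U1" by (auto simp: V2_def)
    then obtain m where m: "m \<in> M" "m \<in> U" "z = \<phi> m" using c(12) z by auto
    then have "\<psi> z = m" using c(8) by simp
    then have mU: "m \<in> U1" using zV by simp
    then have "\<Psi> m \<in> \<Psi> ` M \<inter> V1" "z = \<phi> (g (\<Psi> m))" using m g(5,7) by auto
    then show "z \<in> (\<lambda>y. \<phi> (g y)) ` (\<Psi> ` M \<inter> V1)" by blast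
  qed
  have inv1: "\<Psi> (\<psi> (\<phi> (g y))) = y" if "y \<in> V1" for y
  proof -
    have "g y \<in> U" using g(2,6) that by auto
    then show ?thesis using c(8) g(8) that by simp
  qed
  have inv2: "\<phi> (g (\<Psi> (\<psi> z))) = z" if "z \<in> V2" for z
    using that g(7) c(9) by (simp add: V2_def)
  have "\<Psi> p \<in> V1" using g(3,5) by blast
  moreover have "\<forall>x\<in>V1. \<Psi> (\<psi> (\<phi> (g x))) = x" "\<forall>y\<in>V2. \<phi> (g (\<Psi> (\<psi> y))) = y" using inv1 inv2 by blast+
  ultimately show ?thesis
    unfolding chart_at_def using g(4) oV2 c(4,5) im1 im2 c1 c2 lv
    by (intro exI[of _ V1] exI[of _ V2] exI[of _ "\<lambda>y. \<phi> (g y)"] exI[of _ "\<lambda>y. \<Psi> (\<psi> y)"] exI[of _ E] conjI)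
qed

lemma tangent_at_image:
  assumes der: "(\<Psi> has_derivative D) (at p)" and T: "tangent_at M p T"
  shows "tangent_at (\<Psi> ` M) (\<Psi> p) (D ` T)"
  unfolding tangent_at_def
proof (intro conjI ballI)
  have lin: "linear D" using der has_derivative_linear by blast
  show "subspace (D ` T)" using T lin by (simp add: tangent_at_def linear_subspace_image)
  fix u assume "u \<in> D ` T"
  then obtain u' where u': "u' \<in> T" "u = D u'" by auto
  then obtain c where c: "c 0 = p" "(c has_derivative (\<lambda>s. s *\<^sub>R u')) (at 0)" "\<forall>\<^sub>F s in at 0. c s \<in> M"
    using T unfolding tangent_at_def by meson
  have "((\<lambda>s. \<Psi> (c s)) has_derivative (\<lambda>s. D (s *\<^sub>R u'))) (at 0)"
    by (rule has_derivative_compose[OF c(2)]) (use der c(1) in simp)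
  then have "((\<lambda>s. \<Psi> (c s)) has_derivative (\<lambda>s. s *\<^sub>R u)) (at 0)"
    using u' lin by (simp add: linear_scale)
  moreover have "\<forall>\<^sub>F s in at 0. \<Psi> (c s) \<in> \<Psi> ` M" using c(3) by eventually_elim auto
  ultimately show "\<exists>c. c 0 = \<Psi> p \<and> (c has_derivative (\<lambda>s. s *\<^sub>R u)) (at 0) \<and> (\<forall>\<^sub>F s in at 0. c s \<in> \<Psi> ` M)"
    using c(1) by (intro exI[of _ "\<lambda>s. \<Psi> (c s)"]) simp
qed

section \<open>Reach from a quadratic bound on the distance to tangent spaces\<close>

lemma nearest_point_orthogonal:
  assumes T: "tangent_at M p T" and p: "p \<in> M" "dist z p = infdist z M" and w: "w \<in> T"
  shows "(z - p) \<bullet> w = 0"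
proof -
  obtain c where c: "c 0 = p" "(c has_derivative (\<lambda>s. s *\<^sub>R w)) (at 0)" "\<forall>\<^sub>F s in at 0. c s \<in> M"
    using T w unfolding tangent_at_def by meson
  let ?h = "\<lambda>s. (z - c s) \<bullet> (z - c s)"
  have "(?h has_derivative (\<lambda>s. (z - c 0) \<bullet> (0 - s *\<^sub>R w) + (0 - s *\<^sub>R w) \<bullet> (z - c 0))) (at 0)"
  proof -
    have hd: "((\<lambda>s. z - c s) has_derivative (\<lambda>s. 0 - s *\<^sub>R w)) (at 0)"
      by (intro has_derivative_diff c has_derivative_const)
    show ?thesis by (rule has_derivative_inner[OF hd hd])
  qed
  then have D: "DERIV ?h 0 :> (- 2 * ((z - p) \<bullet> w))"
    by (rule has_derivative_imp_has_field_derivative) (simp add: c(1) inner_commute)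
  obtain e where e: "0 < e" "\<And>s. s \<noteq> 0 \<Longrightarrow> dist s 0 < e \<Longrightarrow> c s \<in> M"
    using c(3) unfolding eventually_at by auto
  have "?h 0 \<le> ?h s" if "\<bar>0 - s\<bar> < e" for s
  proof -
    have "c s \<in> M" using e(2)[of s] that c(1) p by (cases "s = 0") auto
    then have "dist z p \<le> dist z (c s)" unfolding p(2) by (rule infdist_le)
    then have "(dist z p)\<^sup>2 \<le> (dist z (c s))\<^sup>2" by (rule power_mono) simp
    then show ?thesis by (simp add: c(1) dist_norm power2_norm_eq_inner)
  qed
  then have "- 2 * ((z - p) \<bullet> w) = 0" by (intro DERIV_local_min[OF D e(1)]) auto
  then show ?thesis by simp
qed

text \<open>Federer's description of reach \<rho>, with the distance from q - p to T expressed by a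
  witness so that it can be pushed forward by linear maps. A sphere of radius \<rho> attains
  equality.\<close>

definition quad_tangent :: "real \<Rightarrow> 'a::euclidean_space set \<Rightarrow> 'a \<Rightarrow> 'a set \<Rightarrow> bool" where
  "quad_tangent \<rho> M p T \<longleftrightarrow> (\<forall>q\<in>M. \<exists>w\<in>T. norm (q - p - w) \<le> (norm (q - p))\<^sup>2 / (2 * \<rho>))"

text \<open>From distance 2 * \<rho> on, the witness 0 works.\<close>

lemma quad_tangent_local:
  assumes "\<And>q. q \<in> M \<Longrightarrow> norm (q - p) < 2 * \<rho> \<Longrightarrow> \<exists>w\<in>T. norm (q - p - w) \<le> (norm (q - p))\<^sup>2 / (2 * \<rho>)"
    "0 < \<rho>" "subspace T"
  shows "quad_tangent \<rho> M p T"
  unfolding quad_tangent_def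
proof
  fix q assume q: "q \<in> M"
  show "\<exists>w\<in>T. norm (q - p - w) \<le> (norm (q - p))\<^sup>2 / (2 * \<rho>)"
  proof (cases "norm (q - p) < 2 * \<rho>")
    case False
    then have "norm (q - p) * (2 * \<rho>) \<le> norm (q - p) * norm (q - p)" by (intro mult_left_mono) auto
    then have "norm (q - p - 0) \<le> (norm (q - p))\<^sup>2 / (2 * \<rho>)"
      using assms(2) by (simp add: pos_le_divide_eq power2_eq_square)
    then show ?thesis using assms(3) subspace_0 by blast
  qed (use assms q in auto)
qed

text \<open>Let z have two nearest points p and q at distance t. Equality of the distances makes
  norm (q - p)^2 twice the inner product of z - p and q - p. As z - p is orthogonal to T, the vector
  q - p may be replaced there by its deviation from T. Cauchy-Schwarz and the quadratic bound then
  give norm (q - p)^2 \<le> (t / \<rho>) * norm (q - p)^2.\<close>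

lemma reach_ge:
  assumes M: "\<And>p. p \<in> M \<Longrightarrow> \<exists>T. tangent_at M p T \<and> quad_tangent \<rho> M p T" and \<rho>: "0 < \<rho>"
  shows "ereal \<rho> \<le> reach M"
  unfolding reach_def
proof (rule INF_greatest)
  fix z assume "z \<in> medial_axis M"
  then obtain p q where pq: "p \<in> M" "q \<in> M" "p \<noteq> q" "dist z p = infdist z M" "dist z q = infdist z M"
    unfolding medial_axis_def by auto
  obtain T where T: "tangent_at M p T" "quad_tangent \<rho> M p T" using M pq by blast
  obtain w where w: "w \<in> T" "norm (q - p - w) \<le> (norm (q - p))\<^sup>2 / (2 * \<rho>)"
    using T(2) pq(2) unfolding quad_tangent_def by blast
  let ?t = "infdist z M"
  have "(norm (z - q))\<^sup>2 = (norm (z - p))\<^sup>2" using pq by (simp add: dist_norm)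
  then have "(norm (q - p))\<^sup>2 = 2 * ((z - p) \<bullet> (q - p))"
    by (simp add: power2_norm_eq_inner inner_diff_left inner_diff_right inner_commute algebra_simps)
  also have "(z - p) \<bullet> (q - p) = (z - p) \<bullet> (q - p - w)"
    using nearest_point_orthogonal[OF T(1) pq(1,4) w(1)] by (simp add: inner_diff_right)
  also have "2 * ((z - p) \<bullet> (q - p - w)) \<le> 2 * (norm (z - p) * norm (q - p - w))"
    using norm_cauchy_schwarz by (intro mult_left_mono) auto
  also have "\<dots> \<le> 2 * (?t * ((norm (q - p))\<^sup>2 / (2 * \<rho>)))"
    using w(2) pq(4) by (intro mult_left_mono mult_mono) (auto simp: dist_norm infdist_nonneg)
  finally have "(norm (q - p))\<^sup>2 * \<rho> \<le> (norm (q - p))\<^sup>2 * ?t"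
    using \<rho> by (simp add: field_simps)
  then have "\<rho> \<le> ?t" using pq(3) by (subst (asm) mult_le_cancel_left_pos) auto
  then show "ereal \<rho> \<le> ereal ?t" by simp
qed

text \<open>The witness is the image of the old one under the derivative D. The deviation grows by
  the factor 1 + \<eta> and by the Taylor error \<kappa>, while chords shrink by at most the factor
  1 - \<eta>; \<open>num\<close> is the resulting condition on the two reach bounds.\<close>

lemma quad_tangent_image:
  assumes Q: "quad_tangent \<rho>0 M p T" and pos: "0 < \<rho>0" "0 < \<rho>" "0 \<le> \<eta>" "\<eta> < 1"
    and lin: "linear D" and Dn: "\<And>h. norm (D h) \<le> (1 + \<eta>) * norm h"
    and tay: "\<And>q. q \<in> M \<Longrightarrow> norm (\<Psi> q - \<Psi> p - D (q - p)) \<le> \<kappa> * (norm (q - p))\<^sup>2"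
    and low: "\<And>q. q \<in> M \<Longrightarrow> (1 - \<eta>) * norm (q - p) \<le> norm (\<Psi> q - \<Psi> p)"
    and num: "(1 + \<eta>) / (2 * \<rho>0) + \<kappa> \<le> (1 - \<eta>)\<^sup>2 / (2 * \<rho>)"
  shows "quad_tangent \<rho> (\<Psi> ` M) (\<Psi> p) (D ` T)"
  unfolding quad_tangent_def
proof
  fix q' assume "q' \<in> \<Psi> ` M"
  then obtain q where q: "q \<in> M" "q' = \<Psi> q" by auto
  obtain w where w: "w \<in> T" "norm (q - p - w) \<le> (norm (q - p))\<^sup>2 / (2 * \<rho>0)"
    using Q q unfolding quad_tangent_def by blast
  have "norm (\<Psi> q - \<Psi> p - D w) = norm ((\<Psi> q - \<Psi> p - D (q - p)) + D (q - p - w))"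
    using lin by (simp add: linear_diff)
  also have "\<dots> \<le> \<kappa> * (norm (q - p))\<^sup>2 + (1 + \<eta>) * norm (q - p - w)"
    by (rule order_trans[OF norm_triangle_ineq add_mono[OF tay[OF q(1)] Dn]])
  also have "\<dots> \<le> \<kappa> * (norm (q - p))\<^sup>2 + (1 + \<eta>) * ((norm (q - p))\<^sup>2 / (2 * \<rho>0))"
    by (rule add_left_mono, rule mult_left_mono[OF w(2)]) (use pos in auto)
  also have "\<dots> = ((1 + \<eta>) / (2 * \<rho>0) + \<kappa>) * (norm (q - p))\<^sup>2" by (simp add: algebra_simps)
  also have "\<dots> \<le> (1 - \<eta>)\<^sup>2 / (2 * \<rho>) * (norm (q - p))\<^sup>2" by (rule mult_right_mono[OF num]) simp
  also have "\<dots> = ((1 - \<eta>) * norm (q - p))\<^sup>2 / (2 * \<rho>)" by (simp add: power_mult_distrib)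
  also have "\<dots> \<le> (norm (\<Psi> q - \<Psi> p))\<^sup>2 / (2 * \<rho>)"
    using low[OF q(1)] pos by (intro divide_right_mono power_mono) auto
  finally show "\<exists>w\<in>D ` T. norm (q' - \<Psi> p - w) \<le> (norm (q' - \<Psi> p))\<^sup>2 / (2 * \<rho>)"
    using w(1) q(2) by blast
qed

section \<open>Uniform distributions on submanifolds and local volume bounds\<close>

lemma hausdorff_outer_subspace_sphere:
  fixes E :: "'a::euclidean_space set" and E' :: "'b::euclidean_space set"
  assumes "subspace E" "subspace E'" "dim E = dim E'"
  shows "hausdorff_outer k {x\<in>E. norm x = 1} = hausdorff_outer k {x\<in>E'. norm x = 1}"
proof -
  obtain f g where f: "linear f" "linear g" "f ` E = E'" "g ` E' = E" "\<And>x. x \<in> E \<Longrightarrow> norm (f x) = norm x"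
      "\<And>x. x \<in> E' \<Longrightarrow> norm (g x) = norm x" "\<And>x. x \<in> E \<Longrightarrow> g (f x) = x" "\<And>x. x \<in> E' \<Longrightarrow> f (g x) = x"
    by (rule isometries_subspaces[OF assms]) (rule that)
  have "f ` {x\<in>E. norm x = 1} = {x\<in>E'. norm x = 1}"
  proof (intro equalityI subsetI)
    fix y assume "y \<in> f ` {x\<in>E. norm x = 1}" then show "y \<in> {x\<in>E'. norm x = 1}" using f(3,5) by auto
  next
    fix y assume y: "y \<in> {x\<in>E'. norm x = 1}"
    then have "g y \<in> {x\<in>E. norm x = 1}" using f(4,6) by auto
    moreover have "y = f (g y)" using y f(8) by simp
    ultimately show "y \<in> f ` {x\<in>E. norm x = 1}" by (rule rev_image_eqI)
  qed
  moreover have "hausdorff_outer k (f ` {x\<in>E. norm x = 1}) = hausdorff_outer k {x\<in>E. norm x = 1}"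
  proof (rule hausdorff_outer_isometric)
    fix x y assume "x \<in> {x\<in>E. norm x = 1}" "y \<in> {x\<in>E. norm x = 1}"
    then have "x - y \<in> E" using assms(1) by (auto intro: subspace_diff)
    then show "dist (f x) (f y) = dist x y" using f(5)[of "x - y"] f(1) by (simp add: dist_norm linear_diff)
  qed
  ultimately show ?thesis by simp
qed

lemma hausdorff_outer_subspace_ball_pos:
  assumes E: "subspace E" and pos: "0 < hausdorff_outer (d - 1) {x\<in>E. norm x = 1}" and d: "1 \<le> d" and \<eta>: "0 < \<eta>"
    and a: "a \<in> E"
  shows "0 < hausdorff_outer d (E \<inter> ball a \<eta>)"
proof -
  have p: "0 < slice_const d * (((\<eta>/2) ^ d - (\<eta>/3) ^ d) / real d)"
    using slice_const_pos[of d] d \<eta> by (intro mult_pos_pos divide_pos_pos) (auto intro!: power_strict_mono)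
  have "0 < ennreal (slice_const d * (((\<eta>/2) ^ d - (\<eta>/3) ^ d) / real d)) * hausdorff_outer (d - 1) {x\<in>E. norm x = 1}"
    using p pos by (simp add: ennreal_zero_less_mult_iff)
  also have "\<dots> \<le> hausdorff_outer d {p. p - a \<in> E \<and> \<eta>/3 \<le> norm (p - a) \<and> norm (p - a) \<le> \<eta>/2}"
    using E \<eta> d by (intro hausdorff_outer_annulus_ge) (auto intro: subspace_scale)
  also have "\<dots> \<le> hausdorff_outer d (E \<inter> ball a \<eta>)"
  proof (rule hausdorff_outer_mono, rule subsetI)
    fix p assume p: "p \<in> {p. p - a \<in> E \<and> \<eta>/3 \<le> norm (p - a) \<and> norm (p - a) \<le> \<eta>/2}"
    then have "(p - a) + a \<in> E" using E a by (intro subspace_add) auto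
    moreover have "dist a p < \<eta>" using p \<eta> by (auto simp: dist_norm norm_minus_commute)
    ultimately show "p \<in> E \<inter> ball a \<eta>" by simp
  qed
  finally show ?thesis .
qed

text \<open>This makes the support of the uniform law all of M. Near p the chart is Lipschitz, and
  the image of a small piece of M contains the part of the subspace E in a small ball, which has
  positive measure.\<close>

lemma hausdorff_outer_chart_pos:
  fixes M :: "'a::euclidean_space set"
  assumes ch: "chart_at d M p" and p: "p \<in> M" and d: "1 \<le> d" and e: "0 < e"
    and pos: "\<And>E :: 'a set. subspace E \<Longrightarrow> dim E = d \<Longrightarrow> 0 < hausdorff_outer (d - 1) {x\<in>E. norm x = 1}"
  shows "0 < hausdorff_outer d (M \<inter> ball p e)"
proof -
  obtain U V E and \<phi> \<psi> :: "'a \<Rightarrow> 'a" where c0: "open U" "p \<in> U" "open V" "subspace E" "dim E = d"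
      "\<phi> ` U = V" "\<psi> ` V = U" "\<forall>x\<in>U. \<psi> (\<phi> x) = x" "\<forall>y\<in>V. \<phi> (\<psi> y) = y"
      "C2_on U \<phi>" "C2_on V \<psi>" "\<phi> ` (M \<inter> U) = V \<inter> E"
    using ch unfolding chart_at_def by (elim exE conjE) (rule that)
  note c = c0(1-7) c0(8,9)[rule_format] c0(10-12)
  obtain f' where f': "\<And>x. x \<in> U \<Longrightarrow> (\<phi> has_derivative blinfun_apply (f' x)) (at x)" "continuous_on U f'"
    using C2_on_imp_C1_on[OF c(10)] unfolding C1_on_def by auto
  define K where "K = norm (f' p) + 1"
  have K: "0 < K" by (simp add: K_def add_nonneg_pos)
  obtain r1 where r1: "0 < r1" "\<And>x. x \<in> U \<Longrightarrow> dist x p < r1 \<Longrightarrow> dist (f' x) (f' p) < 1"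
    using f'(2)[unfolded continuous_on_iff, rule_format, OF c(2), of 1] by auto
  obtain r2 where r2: "0 < r2" "ball p r2 \<subseteq> U" using c(1,2) open_contains_ball by blast
  define r where "r = min e (min r1 r2)"
  have r: "0 < r" "r \<le> e" "r \<le> r1" "r \<le> r2" using e r1 r2 by (auto simp: r_def)
  have rU: "ball p r \<subseteq> U" using r r2 by (auto intro: subset_ball order_trans)
  have lip: "dist (\<phi> x) (\<phi> y) \<le> K * dist x y" if "x \<in> ball p r" "y \<in> ball p r" for x y
    unfolding dist_norm
  proof (rule differentiable_bound[of "ball p r"])
    fix z assume z: "z \<in> ball p r"
    then have zU: "z \<in> U" using rU by auto
    show "(\<phi> has_derivative blinfun_apply (f' z)) (at z within ball p r)"
      using f'(1)[OF zU] by (rule has_derivative_at_withinI)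
    have "dist (f' z) (f' p) < 1" using r1(2)[OF zU] z r by (simp add: dist_commute)
    then have "norm (f' z) \<le> K" using norm_triangle_ineq2[of "f' z" "f' p"] by (simp add: K_def dist_norm)
    then show "onorm (blinfun_apply (f' z)) \<le> K" by (simp add: norm_blinfun.rep_eq)
  qed (use that in auto)
  have pV: "\<phi> p \<in> V" "\<phi> p \<in> E" "\<psi> (\<phi> p) = p" using c p by auto
  obtain r3 where r3: "0 < r3" "ball (\<phi> p) r3 \<subseteq> V" using c(3) pV open_contains_ball by blast
  obtain r4 where r4: "0 < r4" "\<And>y. y \<in> V \<Longrightarrow> dist y (\<phi> p) < r4 \<Longrightarrow> dist (\<psi> y) (\<psi> (\<phi> p)) < r"
    using C2_on_imp_continuous_on[OF c(11), unfolded continuous_on_iff, rule_format, OF pV(1) r(1)] by auto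
  define \<eta> where "\<eta> = min r3 r4"
  have sub: "E \<inter> ball (\<phi> p) \<eta> \<subseteq> \<phi> ` (M \<inter> ball p r)"
  proof
    fix y assume y: "y \<in> E \<inter> ball (\<phi> p) \<eta>"
    then have yV: "y \<in> V" using r3 by (auto simp: \<eta>_def)
    then obtain m where m: "m \<in> M" "m \<in> U" "y = \<phi> m" using c(12) y by auto
    have "dist (\<psi> y) p < r" using r4(2)[OF yV] y pV by (auto simp: \<eta>_def dist_commute)
    then have "m \<in> ball p r" using m c(8) by (simp add: dist_commute)
    then show "y \<in> \<phi> ` (M \<inter> ball p r)" using m by auto
  qed
  have "0 < hausdorff_outer d (E \<inter> ball (\<phi> p) \<eta>)"
    using hausdorff_outer_subspace_ball_pos[OF c(4) pos[OF c(4,5)] d _ pV(2)] r3 r4 by (simp add: \<eta>_def)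
  also have "\<dots> \<le> ennreal (K ^ d) * hausdorff_outer d (M \<inter> ball p r)"
    by (rule hausdorff_outer_lipschitz_onto[OF _ K sub]) (use lip in auto)
  finally have "0 < hausdorff_outer d (M \<inter> ball p r)"
    by (simp add: ennreal_zero_less_mult_iff)
  also have "\<dots> \<le> hausdorff_outer d (M \<inter> ball p e)"
    using r by (intro hausdorff_outer_mono) auto
  finally show ?thesis .
qed

lemma uniform_in_bb_model:
  fixes M :: "'a::euclidean_space set"
  assumes M: "M \<in> manifolds d rch" "M \<subseteq> cball 0 R" and h: "hausdorff_outer d M = ennreal h" "0 < h"
    and f: "fmin \<le> 1 / h" "1 / h \<le> fmax" and L: "0 \<le> L"
    and pos: "\<And>p e. p \<in> M \<Longrightarrow> 0 < e \<Longrightarrow> 0 < hausdorff_outer d (M \<inter> ball p e)"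
  defines "D \<equiv> density (hausdorff_measure d) (\<lambda>x. ennreal (indicator M x * (1 / h)))"
  shows "D \<in> bb_model d rch fmin fmax L R" "msupport D = M" "prob_space D" "sets D = sets borel"
proof -
  have cM: "closed M" using M by (auto simp: manifolds_def compact_imp_closed)
  then have Mb: "M \<in> sets borel" by auto
  have em: "emeasure D A = ennreal (1 / h) * hausdorff_outer d (M \<inter> A)" if "A \<in> sets borel" for A
  proof -
    have "emeasure D A = (\<integral>\<^sup>+x. ennreal (indicator M x * (1 / h)) * indicator A x \<partial>hausdorff_measure d)"
      unfolding D_def by (rule emeasure_density) (use that Mb in auto)
    also have "\<dots> = (\<integral>\<^sup>+x. ennreal (1 / h) * indicator (M \<inter> A) x \<partial>hausdorff_measure d)"
      by (rule nn_integral_cong) (auto simp: indicator_def)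
    also have "\<dots> = ennreal (1 / h) * emeasure (hausdorff_measure d) (M \<inter> A)"
      by (rule nn_integral_cmult_indicator) (use that Mb in auto)
    finally show ?thesis using that Mb by (simp add: emeasure_hausdorff_measure)
  qed
  show sets: "sets D = sets borel" by (simp add: D_def)
  have sp: "space D = UNIV" by (simp add: D_def)
  show prob: "prob_space D"
  proof
    show "emeasure D (space D) = 1" using h by (simp add: sp em ennreal_mult'[symmetric])
  qed
  show supp: "msupport D = M"
  proof (intro equalityI subsetI)
    fix x assume x: "x \<in> msupport D"
    show "x \<in> M"
    proof (rule ccontr)
      assume "x \<notin> M"
      then obtain e where e: "0 < e" "ball x e \<subseteq> - M" using cM open_contains_ball[of "- M"] by (auto simp: open_Compl)
      then have "M \<inter> ball x e = {}" by auto
      then have "emeasure D (ball x e) = 0" by (simp add: em)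
      then show False using x e by (auto simp: msupport_def)
    qed
  next
    fix x assume x: "x \<in> M"
    have "0 < emeasure D (ball x e)" if "0 < e" for e
      using pos[OF x that] h by (simp add: em ennreal_zero_less_mult_iff)
    then show "x \<in> msupport D" by (simp add: msupport_def)
  qed
  show "D \<in> bb_model d rch fmin fmax L R"
    unfolding bb_model_def mem_Collect_eq
    by (intro conjI prob exI[of _ M] exI[of _ "\<lambda>_. 1 / h"]) (use M supp f L in \<open>auto simp: D_def\<close>)
qed

text \<open>The expanding map is orthogonal projection to T in isometric coordinates, realised as
  the adjoint of an isometric embedding \<open>g\<close> of the model space onto T. A chord of M
  near p deviates from T by at most a quarter of its length, so projection keeps at least half of
  it.\<close>

lemma hausdorff_outer_local_le:
  fixes M :: "'a::euclidean_space set"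
  assumes T: "subspace T" "dim T = DIM('b::euclidean_space)" and D: "0 < D"
    and near: "\<And>q q'. q \<in> M \<inter> cball p D \<Longrightarrow> q' \<in> M \<inter> cball p D \<Longrightarrow> \<exists>w\<in>T. norm (q - q' - w) \<le> norm (q - q') / 4"
  shows "hausdorff_outer DIM('b) (M \<inter> cball p D) \<le> ennreal (unit_ball_vol (real DIM('b)) * (5 * D) ^ DIM('b))"
proof -
  have "dim (UNIV :: 'b set) = dim T" using T by simp
  then obtain g :: "'b \<Rightarrow> 'a" and g' where g: "linear g" "linear g'" "g ` UNIV = T" "g' ` T = UNIV"
      "\<And>x. x \<in> UNIV \<Longrightarrow> norm (g x) = norm x" "\<And>x. x \<in> T \<Longrightarrow> norm (g' x) = norm x"
      "\<And>x. x \<in> UNIV \<Longrightarrow> g' (g x) = x" "\<And>x. x \<in> T \<Longrightarrow> g (g' x) = x"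
    by (rule isometries_subspaces[OF subspace_UNIV T(1)]) (rule that)
  have ng: "norm (g x) = norm x" for x using g(5) by simp
  have ig: "g x \<bullet> g y = x \<bullet> y" for x y
  proof -
    have "(norm (g (x + y)))\<^sup>2 = (norm (x + y))\<^sup>2" by (simp add: ng)
    moreover have "(norm (g x))\<^sup>2 = (norm x)\<^sup>2" "(norm (g y))\<^sup>2 = (norm y)\<^sup>2" by (simp_all add: ng)
    ultimately show ?thesis
      unfolding power2_norm_eq_inner linear_add[OF g(1)] by (simp add: inner_add_left inner_add_right inner_commute)
  qed
  let ?f = "adjoint g"
  have lf: "linear ?f" using g(1) by (rule adjoint_linear)
  have adj: "?f y \<bullet> x = y \<bullet> g x" for x y using adjoint_works[OF g(1), of x y] by (simp add: inner_commute)
  have fg: "?f (g x) = x" for x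
  proof -
    have "\<forall>z. ?f (g x) \<bullet> z = x \<bullet> z" by (simp only: adj ig simp_thms)
    then show ?thesis by (simp only: vector_eq_rdot)
  qed
  have fn: "norm (?f z) \<le> norm z" for z
  proof (cases "?f z = 0")
    case False
    have "norm (?f z) * norm (?f z) = z \<bullet> g (?f z)"
      by (simp only: adj[symmetric] power2_norm_eq_inner[symmetric] power2_eq_square)
    also have "\<dots> \<le> norm z * norm (?f z)" using norm_cauchy_schwarz[of z "g (?f z)"] ng by simp
    finally show ?thesis using False by simp
  qed simp
  show ?thesis
  proof (rule hausdorff_outer_le_of_expanding_map[of _ ?f "?f p"])
    show "?f ` (M \<inter> cball p D) \<subseteq> cball (?f p) D"
    proof
      fix y assume "y \<in> ?f ` (M \<inter> cball p D)"
      then obtain q where q: "y = ?f q" "dist p q \<le> D" by auto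
      have "dist (?f p) y \<le> dist p q" using fn[of "p - q"] lf by (simp add: q dist_norm linear_diff)
      then show "y \<in> cball (?f p) D" using q by simp
    qed
  next
    fix x y assume xy: "x \<in> M \<inter> cball p D" "y \<in> M \<inter> cball p D"
    then obtain w where w: "w \<in> T" "norm (x - y - w) \<le> norm (x - y) / 4" using near by blast
    then obtain b where b: "w = g b" using g(3) by auto
    have "norm w = norm (?f w)" by (simp add: b fg ng)
    also have "\<dots> = norm (?f (x - y) - ?f (x - y - w))" using lf by (simp add: linear_diff)
    also have "\<dots> \<le> norm (?f (x - y)) + norm (x - y - w)"
      using norm_triangle_ineq4[of "?f (x - y)" "?f (x - y - w)"] fn[of "x - y - w"] by linarith
    finally have "norm w \<le> norm (?f (x - y)) + norm (x - y) / 4" using w by linarith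
    moreover have "norm (x - y) \<le> norm w + norm (x - y - w)" using norm_triangle_ineq[of w "x - y - w"] by simp
    ultimately have "norm (x - y) \<le> 2 * norm (?f (x - y))" using w by linarith
    then show "dist x y \<le> 2 * dist (?f x) (?f y)" using lf by (simp add: dist_norm linear_diff)
  qed (rule D)
qed

section \<open>Coordinate projections and packings of balls in subspaces\<close>

definition coord_proj :: "'a::euclidean_space set \<Rightarrow> 'a \<Rightarrow> 'a" where
  "coord_proj J x = (\<Sum>j\<in>J. (x \<bullet> j) *\<^sub>R j)"

lemma linear_coord_proj: "linear (coord_proj J)"
  unfolding coord_proj_def
  by (intro linear_compose_sum ballI) (auto intro!: linearI simp: inner_add_left scaleR_add_left)

lemma coord_proj_inner:
  assumes "J \<subseteq> Basis" "b \<in> Basis"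
  shows "coord_proj J x \<bullet> b = (if b \<in> J then x \<bullet> b else 0)"
proof -
  have "finite J" by (rule finite_subset[OF assms(1) finite_Basis])
  have "coord_proj J x \<bullet> b = (\<Sum>j\<in>J. if j = b then x \<bullet> j else 0)"
    using assms by (auto simp: coord_proj_def inner_sum_left inner_Basis intro!: sum.cong)
  then show ?thesis using \<open>finite J\<close> by (simp add: sum.delta)
qed

lemma span_coord: "J \<subseteq> Basis \<Longrightarrow> x \<in> span J \<longleftrightarrow> coord_proj J x = x"
proof
  assume J: "J \<subseteq> Basis" and x: "x \<in> span J"
  have "\<forall>b\<in>Basis. b \<notin> J \<longrightarrow> x \<bullet> b = 0" using span_substd_basis[OF J] x by blast
  then show "coord_proj J x = x" by - (rule euclidean_eqI, simp add: coord_proj_inner[OF J])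
next
  assume "J \<subseteq> Basis" "coord_proj J x = x"
  then have "x \<in> span J \<longleftrightarrow> coord_proj J x \<in> span J" by simp
  moreover have "coord_proj J x \<in> span J" unfolding coord_proj_def by (intro span_sum span_scale span_base)
  ultimately show "x \<in> span J" by simp
qed

lemma coord_proj_in_span: "J \<subseteq> Basis \<Longrightarrow> coord_proj J x \<in> span J"
  unfolding coord_proj_def by (intro span_sum span_scale span_base)

lemma coord_proj_idem: "J \<subseteq> Basis \<Longrightarrow> coord_proj J (coord_proj J x) = coord_proj J x"
  using span_coord[of J "coord_proj J x"] coord_proj_in_span[of J x] by simp

lemma norm_coord_proj_le: "J \<subseteq> Basis \<Longrightarrow> norm (coord_proj J x) \<le> norm x"
  by (rule norm_le_componentwise) (auto simp: coord_proj_inner)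

text \<open>A volume argument carried out in the full space. W is the product of the r-balls of span
  J and of its orthogonal complement. The balls of radius \<eta> around a maximal separated set S
  cover the first factor, so W is covered by copies of itself shrunk by \<eta> / r in the
  J-directions and moved to the points of S. Each copy has (\<eta> / r)^(card J) times the volume of
  W.\<close>

lemma packing_coord_subspace:
  fixes J :: "'a::euclidean_space set"
  assumes J: "J \<subseteq> Basis" and pos: "0 < \<eta>" "0 < r"
  shows "\<exists>S. finite S \<and> S \<subseteq> span J \<inter> cball 0 r \<and> separated \<eta> S \<and> (r / \<eta>) ^ card J \<le> real (card S)"
proof -
  have "bounded (span J \<inter> cball 0 r)" by (rule bounded_subset[OF bounded_cball]) auto
  then obtain S where S: "finite S" "S \<subseteq> span J \<inter> cball 0 r" "separated \<eta> S" "span J \<inter> cball 0 r \<subseteq> (\<Union>p\<in>S. ball p \<eta>)"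
    using maximal_separated_bounded[OF _ pos(1), of "span J \<inter> cball 0 r"] by auto
  define W where "W = {x. norm (coord_proj J x) \<le> r \<and> norm (x - coord_proj J x) \<le> r}"
  define c where "c j = (if j \<in> J then \<eta> / r else 1)" for j :: 'a
  have c: "c j \<noteq> 0" for j using pos by (simp add: c_def)
  define T where "T v x = v + (\<Sum>j\<in>Basis. (c j * (x \<bullet> j)) *\<^sub>R j)" for v x :: 'a
  have contP: "continuous_on UNIV (coord_proj J)" by (rule linear_continuous_on) (simp add: linear_coord_proj linear_conv_bounded_linear[symmetric])
  have clW: "closed W"
  proof -
    have "W = {x. norm (coord_proj J x) \<le> r} \<inter> {x. norm (x - coord_proj J x) \<le> r}" by (auto simp: W_def)
    then show ?thesis by (auto intro!: closed_Int closed_Collect_le continuous_intros contP)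
  qed
  have Wb: "W \<subseteq> cball 0 (2 * r)"
  proof
    fix x assume x: "x \<in> W"
    have "norm x \<le> norm (coord_proj J x) + norm (x - coord_proj J x)"
      using norm_triangle_ineq[of "coord_proj J x" "x - coord_proj J x"] by simp
    then show "x \<in> cball 0 (2 * r)" using x by (simp add: W_def)
  qed
  have Wpos: "ball 0 (r/2) \<subseteq> W"
  proof
    fix x :: 'a assume "x \<in> ball 0 (r/2)"
    then have x: "norm x < r/2" by simp
    have "norm (x - coord_proj J x) \<le> norm x + norm (coord_proj J x)" by (rule norm_triangle_ineq4)
    then show "x \<in> W" using x norm_coord_proj_le[OF J, of x] pos by (simp add: W_def)
  qed
  have cW: "compact W" using clW bounded_subset[OF bounded_cball Wb] by (simp add: compact_eq_bounded_closed)
  have em: "emeasure lborel (T v ` W) = ennreal ((\<eta> / r) ^ card J) * emeasure lborel W" for v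
  proof -
    have Tc: "continuous_on UNIV (T v)" unfolding T_def by (intro continuous_intros)
    have Tinj: "inj (T v)"
    proof (rule injI)
      fix x y assume "T v x = T v y"
      then have eq: "(\<Sum>j\<in>Basis. (c j * (x \<bullet> j)) *\<^sub>R j) \<bullet> b = (\<Sum>j\<in>Basis. (c j * (y \<bullet> j)) *\<^sub>R j) \<bullet> b" for b by (simp add: T_def)
      have "c b * (x \<bullet> b) = c b * (y \<bullet> b)" if "b \<in> Basis" for b
        using eq[of b] that by (simp only: inner_sum_left_Basis)
      then show "x = y" using c by - (rule euclidean_eqI, auto)
    qed
    have TW: "T v ` W \<in> sets borel"
      using compact_continuous_image[OF continuous_on_subset[OF Tc] cW] by (auto intro: borel_compact)
    have "emeasure lborel (T v ` W) = emeasure (density (distr lborel borel (T v)) (\<lambda>_. (\<Prod>j\<in>Basis. \<bar>c j\<bar>))) (T v ` W)"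
      unfolding T_def by (subst lborel_affine_euclidean[where c=c and t=v, symmetric]) (simp_all add: c)
    also have "\<dots> = ennreal (\<Prod>j\<in>Basis. \<bar>c j\<bar>) * emeasure (distr lborel borel (T v)) (T v ` W)"
      using TW by (subst emeasure_density) (auto simp: nn_integral_cmult_indicator)
    also have "emeasure (distr lborel borel (T v)) (T v ` W) = emeasure lborel W"
      using TW Tc Tinj by (subst emeasure_distr) (auto intro!: borel_measurable_continuous_onI simp: inj_vimage_image_eq)
    also have "(\<Prod>j\<in>Basis. \<bar>c j\<bar>) = (\<eta> / r) ^ card J"
    proof -
      have "(\<Prod>j\<in>Basis. \<bar>c j\<bar>) = (\<Prod>j\<in>Basis. if j \<in> J then \<eta> / r else 1)"
        using pos by (intro prod.cong) (auto simp: c_def)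
      also have "\<dots> = (\<Prod>j\<in>Basis \<inter> J. \<eta> / r)" by (rule prod.inter_restrict[symmetric]) simp
      also have "\<dots> = (\<eta> / r) ^ card J" using J by (simp add: Int_absorb1)
      finally show ?thesis .
    qed
    finally show ?thesis .
  qed
  have cov: "W \<subseteq> (\<Union>v\<in>S. T v ` W)"
  proof
    fix x assume x: "x \<in> W"
    then have "coord_proj J x \<in> span J \<inter> cball 0 r" using coord_proj_in_span[OF J] by (simp add: W_def)
    then obtain v where v: "v \<in> S" "dist v (coord_proj J x) < \<eta>" using S(4) by auto
    have vJ: "coord_proj J v = v" using S(2) v span_coord[OF J] by auto
    define y where "y = (r / \<eta>) *\<^sub>R (coord_proj J x - v) + (x - coord_proj J x)"
    have Py: "coord_proj J y = (r / \<eta>) *\<^sub>R (coord_proj J x - v)"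
      using linear_coord_proj[of J] by (simp add: y_def linear_add linear_diff linear_scale vJ coord_proj_idem[OF J])
    have "norm (coord_proj J y) \<le> r"
    proof -
      have "norm (coord_proj J y) = r / \<eta> * dist v (coord_proj J x)" using pos by (simp add: Py dist_norm norm_minus_commute)
      also have "\<dots> \<le> r / \<eta> * \<eta>" using v pos by (intro mult_left_mono) auto
      finally show ?thesis using pos by simp
    qed
    moreover have "y - coord_proj J y = x - coord_proj J x" by (simp only: Py) (simp add: y_def)
    ultimately have yW: "y \<in> W" using x by (simp add: W_def)
    have "x = T v y"
    proof (rule euclidean_eqI)
      fix b :: 'a assume b: "b \<in> Basis"
      have v0: "v \<bullet> b = (if b \<in> J then v \<bullet> b else 0)" using coord_proj_inner[OF J b, of v] vJ by simp
      show "x \<bullet> b = T v y \<bullet> b"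
        using b pos v0 by (cases "b \<in> J") (simp_all add: T_def y_def c_def inner_add_left inner_diff_left coord_proj_inner[OF J])
    qed
    then show "x \<in> (\<Union>v\<in>S. T v ` W)" using v yW by blast
  qed
  have Wfin: "emeasure lborel W < \<infinity>"
    by (rule le_less_trans[OF emeasure_mono[OF Wb] emeasure_lborel_cball_finite]) simp
  then obtain m where m: "emeasure lborel W = ennreal m" "0 \<le> m" by (cases "emeasure lborel W") auto
  have "0 < emeasure lborel (ball (0::'a) (r/2))" using pos by (subst emeasure_ball) auto
  also have "\<dots> \<le> emeasure lborel W" using Wpos clW by (intro emeasure_mono) auto
  finally have mpos: "0 < m" using m by simp
  have "ennreal m \<le> emeasure lborel (\<Union>v\<in>S. T v ` W)"
    unfolding m(1)[symmetric]
  proof (rule emeasure_mono[OF cov])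
    have "T v ` W \<in> sets borel" for v
    proof -
      have "continuous_on UNIV (T v)" unfolding T_def by (intro continuous_intros)
      then show ?thesis using compact_continuous_image[OF continuous_on_subset cW] by (auto intro: borel_compact)
    qed
    then show "(\<Union>v\<in>S. T v ` W) \<in> sets lborel" using S(1) by (auto intro: sets.finite_UN)
  qed
  also have "\<dots> \<le> (\<Sum>v\<in>S. emeasure lborel (T v ` W))"
  proof (rule emeasure_subadditive_finite[OF S(1)])
    have "T v ` W \<in> sets borel" for v
    proof -
      have "continuous_on UNIV (T v)" unfolding T_def by (intro continuous_intros)
      then show ?thesis using compact_continuous_image[OF continuous_on_subset cW] by (auto intro: borel_compact)
    qed
    then show "(\<lambda>v. T v ` W) ` S \<subseteq> sets lborel" by auto
  qed
  also have "\<dots> = (\<Sum>v\<in>S. ennreal ((\<eta> / r) ^ card J * m))"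
    using m pos by (simp add: em ennreal_mult')
  also have "\<dots> = ennreal (real (card S) * ((\<eta> / r) ^ card J * m))"
    using m pos by (simp add: ennreal_of_nat_eq_real_of_nat ennreal_mult')
  finally have "m \<le> real (card S) * ((\<eta> / r) ^ card J * m)"
    using m pos by (subst (asm) ennreal_le_iff) auto
  then have "1 \<le> real (card S) * (\<eta> / r) ^ card J" using mpos by simp
  then have "(r / \<eta>) ^ card J \<le> real (card S)"
    using pos by (simp add: power_divide field_simps)
  then show ?thesis using S by blast
qed

lemma packing_subspace:
  fixes N :: "'a::euclidean_space set"
  assumes N: "subspace N" and pos: "0 < \<eta>" "0 < r"
  shows "\<exists>S. finite S \<and> S \<subseteq> N \<inter> cball 0 r \<and> separated \<eta> S \<and> (r / \<eta>) ^ dim N \<le> real (card S)"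
proof -
  have "dim N \<le> card (Basis :: 'a set)" using dim_subset_UNIV[of N] by simp
  then obtain J :: "'a set" where J: "J \<subseteq> Basis" "card J = dim N" using obtain_subset_with_card_n by metis
  have "dim (span J) = dim N" using J dim_eq_card_independent[of J] independent_mono[OF independent_Basis] by auto
  then obtain f g where f: "linear f" "linear g" "f ` span J = N" "g ` N = span J" "\<And>x. x \<in> span J \<Longrightarrow> norm (f x) = norm x"
      "\<And>x. x \<in> N \<Longrightarrow> norm (g x) = norm x" "\<And>x. x \<in> span J \<Longrightarrow> g (f x) = x" "\<And>x. x \<in> N \<Longrightarrow> f (g x) = x"
    by (rule isometries_subspaces[OF subspace_span N]) (rule that)
  obtain S where S: "finite S" "S \<subseteq> span J \<inter> cball 0 r" "separated \<eta> S" "(r / \<eta>) ^ card J \<le> real (card S)"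
    using packing_coord_subspace[OF J(1) pos] by blast
  have iso: "dist (f x) (f y) = dist x y" if "x \<in> S" "y \<in> S" for x y
  proof -
    have "x - y \<in> span J" using that S(2) by (auto intro: span_diff)
    then show ?thesis using f(5)[of "x - y"] f(1) by (simp add: dist_norm linear_diff)
  qed
  have "inj_on f S" by (rule inj_onI) (metis iso dist_eq_0_iff)
  then have "card (f ` S) = card S" by (rule card_image)
  moreover have "separated \<eta> (f ` S)" using S(3) iso by (auto simp: separated_def)
  moreover have "f ` S \<subseteq> N \<inter> cball 0 r" using S(2) f(3,5) by (auto simp: subset_iff)
  ultimately show ?thesis using S(1,4) J(2) by (intro exI[of _ "f ` S"]) auto
qed

lemma dH_ge:
  assumes "x \<in> A" "B \<noteq> {}" "\<And>y. y \<in> B \<Longrightarrow> e \<le> dist x y"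
  shows "ereal e \<le> dH A B"
proof -
  have "e \<le> infdist x B" using assms(2,3) by (auto simp: infdist_def intro!: cINF_greatest)
  then have "ereal e \<le> ereal \<bar>infdist x A - infdist x B\<bar>" using assms(1) by (simp add: infdist_zero)
  also have "\<dots> \<le> dH A B" unfolding dH_def by (rule SUP_upper) simp
  finally show ?thesis .
qed

section \<open>Hypersurfaces of revolution\<close>

text \<open>The cube of the positive part is C2 and vanishes on a half-line. Rims, necks and bumps
  are built from it, so that they join flat or unperturbed pieces smoothly enough.\<close>

lemma DERIV_max_power:
  "((\<lambda>x::real. (max 0 x) ^ Suc (Suc n)) has_real_derivative real (Suc (Suc n)) * (max 0 x) ^ Suc n) (at x)"
proof (cases "x = 0")
  case True
  have lim: "((\<lambda>h::real. \<bar>h\<bar> ^ Suc n) \<longlongrightarrow> 0) (at 0)"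
    by (rule tendsto_eq_intros | simp)+
  have "((\<lambda>h::real. (max 0 h) ^ Suc (Suc n) / h) \<longlongrightarrow> 0) (at 0)"
  proof (rule Lim_null_comparison[OF _ lim], rule always_eventually, rule allI)
    fix h :: real
    show "norm ((max 0 h) ^ Suc (Suc n) / h) \<le> \<bar>h\<bar> ^ Suc n"
    proof (cases "h > 0")
      case False
      then have "max 0 h = 0" by simp
      then show ?thesis by (simp del: power_Suc add: zero_power)
    qed (simp add: max_def)
  qed
  then show ?thesis unfolding True has_field_derivative_iff by simp
next
  case False
  show ?thesis
  proof (cases "0 < x")
    case True
    have "((\<lambda>x::real. x ^ Suc (Suc n)) has_real_derivative real (Suc (Suc n)) * x ^ Suc n) (at x)"
      using DERIV_pow[of "Suc (Suc n)" x UNIV] by simp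
    then have "((\<lambda>x::real. (max 0 x) ^ Suc (Suc n)) has_real_derivative real (Suc (Suc n)) * x ^ Suc n) (at x)"
      by (rule has_field_derivative_transform_within_open[of _ _ _ "{0<..}"]) (use True in auto)
    then show ?thesis using True by simp
  next
    case False
    then have "x < 0" using \<open>x \<noteq> 0\<close> by simp
    have "((\<lambda>x::real. 0) has_real_derivative 0) (at x)" by simp
    then have "((\<lambda>x::real. (max 0 x) ^ Suc (Suc n)) has_real_derivative 0) (at x)"
      by (rule has_field_derivative_transform_within_open[of _ _ _ "{..<0}"]) (use \<open>x < 0\<close> in auto)
    then show ?thesis using \<open>x < 0\<close> by simp
  qed
qed

lemma DERIV_max_cube: "((\<lambda>x::real. (max 0 x) ^ 3) has_real_derivative 3 * (max 0 x)\<^sup>2) (at x)"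
  using DERIV_max_power[of 1 x] by (simp add: numeral_eq_Suc)

lemma DERIV_max_square: "((\<lambda>x::real. (max 0 x)\<^sup>2) has_real_derivative 2 * max 0 x) (at x)"
  using DERIV_max_power[of 0 x] by (simp add: numeral_eq_Suc)

text \<open>At a point x with s = x \<bullet> x, the radial function given by F has gradient 2 F' x
  and Hessian 2 F' id + 4 F'' x x^T, of norm at most 2 (|F'| + 2 s |F''|). This combination is
  therefore the curvature bound for all radial functions below.\<close>

lemma radial_gradient_lipschitz:
  fixes x y :: "'a::euclidean_space"
  assumes D: "\<And>s. (F' has_real_derivative F'' s) (at s)"
    and K: "\<And>s. 0 \<le> s \<Longrightarrow> s \<le> m \<Longrightarrow> \<bar>F' s\<bar> + 2 * s * \<bar>F'' s\<bar> \<le> K"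
    and xy: "x \<bullet> x \<le> m" "y \<bullet> y \<le> m"
  shows "norm ((2 * F' (x \<bullet> x)) *\<^sub>R x - (2 * F' (y \<bullet> y)) *\<^sub>R y) \<le> 2 * K * norm (x - y)"
proof (rule differentiable_bound[where f="\<lambda>x. (2 * F' (x \<bullet> x)) *\<^sub>R x" and S="cball 0 (sqrt m)"
      and f'="\<lambda>x h. (2 * F' (x \<bullet> x)) *\<^sub>R h + (2 * (F'' (x \<bullet> x) * (x \<bullet> h + h \<bullet> x))) *\<^sub>R x"])
  have m: "0 \<le> m" using xy(1) inner_ge_zero[of x] by linarith
  fix z :: 'a assume z: "z \<in> cball 0 (sqrt m)"
  then have zm: "z \<bullet> z \<le> m" using m by (simp add: norm_eq_sqrt_inner)
  have i: "((\<lambda>z. z \<bullet> z) has_derivative (\<lambda>h. z \<bullet> h + h \<bullet> z)) (at z within cball 0 (sqrt m))"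
    by (rule has_derivative_inner) (auto intro: has_derivative_ident)
  have "((\<lambda>z. F' (z \<bullet> z)) has_derivative (\<lambda>h. F'' (z \<bullet> z) * (z \<bullet> h + h \<bullet> z))) (at z within cball 0 (sqrt m))"
    by (rule has_derivative_compose[OF i, of F']) (use D in \<open>simp add: has_field_derivative_def\<close>)
  then show "((\<lambda>x. (2 * F' (x \<bullet> x)) *\<^sub>R x) has_derivative
      (\<lambda>h. (2 * F' (z \<bullet> z)) *\<^sub>R h + (2 * (F'' (z \<bullet> z) * (z \<bullet> h + h \<bullet> z))) *\<^sub>R z)) (at z within cball 0 (sqrt m))"
    by (intro has_derivative_scaleR has_derivative_mult_right has_derivative_ident)
  show "onorm (\<lambda>h. (2 * F' (z \<bullet> z)) *\<^sub>R h + (2 * (F'' (z \<bullet> z) * (z \<bullet> h + h \<bullet> z))) *\<^sub>R z) \<le> 2 * K"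
  proof (rule onorm_le)
    fix h
    have "\<bar>z \<bullet> h\<bar> \<le> norm z * norm h" by (rule Cauchy_Schwarz_ineq2)
    then have 1: "\<bar>z \<bullet> h\<bar> * norm z \<le> (z \<bullet> z) * norm h"
      using mult_right_mono[of "\<bar>z \<bullet> h\<bar>" "norm z * norm h" "norm z"]
      by (simp add: power2_norm_eq_inner[symmetric] power2_eq_square mult.commute mult.left_commute)
    have "norm ((2 * F' (z \<bullet> z)) *\<^sub>R h + (2 * (F'' (z \<bullet> z) * (z \<bullet> h + h \<bullet> z))) *\<^sub>R z)
        \<le> 2 * \<bar>F' (z \<bullet> z)\<bar> * norm h + 4 * \<bar>F'' (z \<bullet> z)\<bar> * (\<bar>z \<bullet> h\<bar> * norm z)"
      by (rule order_trans[OF norm_triangle_ineq]) (simp add: inner_commute abs_mult mult.commute mult.left_commute)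
    also have "\<dots> \<le> 2 * \<bar>F' (z \<bullet> z)\<bar> * norm h + 4 * \<bar>F'' (z \<bullet> z)\<bar> * ((z \<bullet> z) * norm h)"
      using 1 by (intro add_left_mono mult_left_mono) auto
    also have "\<dots> = 2 * (\<bar>F' (z \<bullet> z)\<bar> + 2 * (z \<bullet> z) * \<bar>F'' (z \<bullet> z)\<bar>) * norm h" by (simp add: algebra_simps)
    also have "\<dots> \<le> 2 * K * norm h" using K[OF inner_ge_zero zm] by (intro mult_right_mono mult_left_mono) auto
    finally show "norm ((2 * F' (z \<bullet> z)) *\<^sub>R h + (2 * (F'' (z \<bullet> z) * (z \<bullet> h + h \<bullet> z))) *\<^sub>R z) \<le> 2 * K * norm h" .
  qed
qed (use xy in \<open>auto simp: norm_eq_sqrt_inner\<close>)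

text \<open>Along the segment from x to y the remainder has nonpositive derivative, because the
  gradient is Lipschitz with constant 2 * K. By convexity the segment stays in the ball of squared
  radius m.\<close>

lemma radial_taylor_upper:
  fixes x y :: "'a::euclidean_space"
  assumes D: "\<And>s. (F has_real_derivative F' s) (at s)" "\<And>s. (F' has_real_derivative F'' s) (at s)"
    and K: "\<And>s. 0 \<le> s \<Longrightarrow> s \<le> m \<Longrightarrow> \<bar>F' s\<bar> + 2 * s * \<bar>F'' s\<bar> \<le> K"
    and xy: "x \<bullet> x \<le> m" "y \<bullet> y \<le> m"
  shows "F (y \<bullet> y) - F (x \<bullet> x) - 2 * F' (x \<bullet> x) * (x \<bullet> (y - x)) \<le> K * (norm (y - x))\<^sup>2"
proof -
  define v where "v = y - x"
  define z where "z t = x + t *\<^sub>R v" for t :: real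
  define h where "h w = (2 * F' (w \<bullet> w)) *\<^sub>R w" for w :: 'a
  define \<phi> where "\<phi> t = F (z t \<bullet> z t) - t * (h x \<bullet> v) - K * t\<^sup>2 * (norm v)\<^sup>2" for t
  have m: "0 \<le> m" using xy(1) inner_ge_zero[of x] by linarith
  have zm: "z t \<bullet> z t \<le> m" if "0 \<le> t" "t \<le> 1" for t
  proof -
    have "norm x \<le> sqrt m" "norm y \<le> sqrt m" using xy by (auto simp: norm_eq_sqrt_inner)
    then have "x \<in> cball 0 (sqrt m)" "y \<in> cball 0 (sqrt m)" by auto
    then have "(1 - t) *\<^sub>R x + t *\<^sub>R y \<in> cball 0 (sqrt m)" using that by (intro convexD[OF convex_cball]) auto
    moreover have "(1 - t) *\<^sub>R x + t *\<^sub>R y = z t" by (simp add: z_def v_def algebra_simps)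
    ultimately have "norm (z t) \<le> sqrt m" by simp
    then show ?thesis using m by (simp add: norm_eq_sqrt_inner)
  qed
  have "\<phi> 1 \<le> \<phi> 0"
  proof (rule DERIV_nonpos_imp_nonincreasing[of 0 1 \<phi>])
    fix t :: real assume t: "0 \<le> t" "t \<le> 1"
    have zd: "(z has_derivative (\<lambda>s. s *\<^sub>R v)) (at t)" unfolding z_def by (auto intro!: derivative_eq_intros)
    have "((\<lambda>t. z t \<bullet> z t) has_derivative (\<lambda>s. z t \<bullet> (s *\<^sub>R v) + (s *\<^sub>R v) \<bullet> z t)) (at t)"
      by (rule has_derivative_inner[OF zd zd])
    then have "((\<lambda>t. z t \<bullet> z t) has_real_derivative (2 * (z t \<bullet> v))) (at t)"
      by (rule has_derivative_imp_has_field_derivative) (simp add: inner_commute)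
    from DERIV_chain2[OF D(1) this]
    have 1: "((\<lambda>t. F (z t \<bullet> z t)) has_real_derivative F' (z t \<bullet> z t) * (2 * (z t \<bullet> v))) (at t)" .
    have "(\<phi> has_real_derivative F' (z t \<bullet> z t) * (2 * (z t \<bullet> v)) - h x \<bullet> v - K * (2 * t) * (norm v)\<^sup>2) (at t)"
      unfolding \<phi>_def by (rule derivative_eq_intros 1 | simp)+
    moreover have "F' (z t \<bullet> z t) * (2 * (z t \<bullet> v)) - h x \<bullet> v - K * (2 * t) * (norm v)\<^sup>2 \<le> 0"
    proof -
      have "F' (z t \<bullet> z t) * (2 * (z t \<bullet> v)) - h x \<bullet> v = (h (z t) - h x) \<bullet> v"
        by (simp add: h_def inner_diff_left)
      also have "\<dots> \<le> norm (h (z t) - h x) * norm v" by (rule norm_cauchy_schwarz)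
      also have "\<dots> \<le> (2 * K * norm (z t - x)) * norm v"
        unfolding h_def by (rule mult_right_mono[OF radial_gradient_lipschitz[OF D(2) K zm[OF t] xy(1)]]) auto
      also have "\<dots> = K * (2 * t) * (norm v)\<^sup>2" using t by (simp add: z_def power2_eq_square)
      finally show ?thesis by simp
    qed
    ultimately show "\<exists>y. (\<phi> has_real_derivative y) (at t) \<and> y \<le> 0" by blast
  qed simp
  then show ?thesis by (simp add: \<phi>_def z_def v_def h_def algebra_simps)
qed

lemma radial_taylor:
  fixes x y :: "'a::euclidean_space"
  assumes D: "\<And>s. (F has_real_derivative F' s) (at s)" "\<And>s. (F' has_real_derivative F'' s) (at s)"
    and K: "\<And>s. 0 \<le> s \<Longrightarrow> s \<le> m \<Longrightarrow> \<bar>F' s\<bar> + 2 * s * \<bar>F'' s\<bar> \<le> K"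
    and xy: "x \<bullet> x \<le> m" "y \<bullet> y \<le> m"
  shows "\<bar>F (y \<bullet> y) - F (x \<bullet> x) - 2 * F' (x \<bullet> x) * (x \<bullet> (y - x))\<bar> \<le> K * (norm (y - x))\<^sup>2"
proof -
  have "F (y \<bullet> y) - F (x \<bullet> x) - 2 * F' (x \<bullet> x) * (x \<bullet> (y - x)) \<le> K * (norm (y - x))\<^sup>2"
    by (rule radial_taylor_upper[OF D K xy])
  moreover have "(- F (y \<bullet> y)) - (- F (x \<bullet> x)) - 2 * (- F' (x \<bullet> x)) * (x \<bullet> (y - x)) \<le> K * (norm (y - x))\<^sup>2"
    by (rule radial_taylor_upper[where F="\<lambda>s. - F s" and F'="\<lambda>s. - F' s" and F''="\<lambda>s. - F'' s" and m=m])
       (use K xy in \<open>auto intro!: derivative_intros D\<close>)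
  ultimately show ?thesis by (simp add: abs_le_iff)
qed

text \<open>Both inequalities concern the function h^2 / r^2 + F s - 1, with h the height and s the
  squared radius. The first bounds its Hessian by 2 / r^2, the second says that on the surface its
  gradient has norm at least 2\<rho> / r^2; the quotient of the two is the quadratic tangent bound
  with \<rho>. The first is required for all t \<le> s since Taylor expansion runs through the
  interior of the disc.\<close>

definition profile :: "real \<Rightarrow> real \<Rightarrow> (real \<Rightarrow> real) \<Rightarrow> (real \<Rightarrow> real) \<Rightarrow> (real \<Rightarrow> real) \<Rightarrow> bool" where
  "profile r \<rho> F F' F'' \<longleftrightarrow> (\<forall>s. (F has_real_derivative F' s) (at s)) \<and> (\<forall>s. (F' has_real_derivative F'' s) (at s)) \<and>
     continuous_on UNIV F'' \<and>
     (\<forall>s\<ge>0. F s \<le> 1 \<longrightarrow> (\<forall>t. 0 \<le> t \<and> t \<le> s \<longrightarrow> \<bar>F' t\<bar> + 2 * t * \<bar>F'' t\<bar> \<le> 1 / r\<^sup>2) \<and>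
        \<rho>\<^sup>2 \<le> r\<^sup>2 * (1 - F s) + r ^ 4 * (F' s)\<^sup>2 * s)"

text \<open>The centre u is meant to have no component along I, so radii are read off p itself. F =
  0 gives two parallel planes at heights r and -r above u; F s = s / r^2 gives a sphere.\<close>

definition revolution :: "'a::euclidean_space set \<Rightarrow> 'a \<Rightarrow> 'a \<Rightarrow> real \<Rightarrow> (real \<Rightarrow> real) \<Rightarrow> 'a set" where
  "revolution I u e r F = {p. p - u \<in> span (insert e I) \<and>
      ((p - u) \<bullet> e)\<^sup>2 / r\<^sup>2 + F (coord_proj I p \<bullet> coord_proj I p) = 1}"

text \<open>\<open>quad_tangent\<close> handles chords that start at p. The last clause compares
  chords between any two points near p with the single space T, which makes projection to T
  expanding up to a constant and so bounds local volumes.\<close>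

definition well_curved :: "nat \<Rightarrow> real \<Rightarrow> 'a::euclidean_space set \<Rightarrow> 'a \<Rightarrow> bool" where
  "well_curved d \<rho> M p \<longleftrightarrow> chart_at d M p \<and> (\<exists>T. dim T = d \<and> tangent_at M p T \<and> quad_tangent \<rho> M p T \<and>
     (\<forall>q\<in>M \<inter> cball p (\<rho>/12). \<forall>q'\<in>M \<inter> cball p (\<rho>/12). \<exists>w\<in>T. norm (q - q' - w) \<le> norm (q - q') / 4))"

context
  fixes I :: "'a::euclidean_space set" and u e :: 'a and r \<rho> :: real and F F' F'' :: "real \<Rightarrow> real"
  assumes I: "I \<subseteq> Basis" and e: "e \<in> Basis" "e \<notin> I" and u: "coord_proj I u = 0"
    and r: "0 < r" "0 < \<rho>" and prof: "profile r \<rho> F F' F''"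
begin

definition "gfun p = ((p - u) \<bullet> e)\<^sup>2 / r\<^sup>2 + F (coord_proj I p \<bullet> coord_proj I p) - 1"
definition "grad p = (2 * ((p - u) \<bullet> e) / r\<^sup>2) *\<^sub>R e + (2 * F' (coord_proj I p \<bullet> coord_proj I p)) *\<^sub>R coord_proj I p"

lemmas profD = prof[unfolded profile_def]

lemma dF: "(F has_real_derivative F' s) (at s)" "(F' has_real_derivative F'' s) (at s)"
  using profD by auto

lemma prof_bound: "0 \<le> t \<Longrightarrow> t \<le> s \<Longrightarrow> F s \<le> 1 \<Longrightarrow> \<bar>F' t\<bar> + 2 * t * \<bar>F'' t\<bar> \<le> 1 / r\<^sup>2"
  using conjunct2[OF conjunct2[OF conjunct2[OF profD]], rule_format, of s] by simp

lemma prof_lower: "0 \<le> s \<Longrightarrow> F s \<le> 1 \<Longrightarrow> \<rho>\<^sup>2 \<le> r\<^sup>2 * (1 - F s) + r ^ 4 * (F' s)\<^sup>2 * s"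
  using conjunct2[OF conjunct2[OF conjunct2[OF profD]], rule_format, of s] by simp

lemma eI: "insert e I \<subseteq> Basis" using I e by auto

lemma proj_split: "v \<in> span (insert e I) \<Longrightarrow> v = coord_proj I v + (v \<bullet> e) *\<^sub>R e"
proof -
  assume v: "v \<in> span (insert e I)"
  have fin: "finite I" by (rule finite_subset[OF I finite_Basis])
  have "v = coord_proj (insert e I) v" using v span_coord[OF eI] by simp
  also have "\<dots> = coord_proj I v + (v \<bullet> e) *\<^sub>R e" using fin e by (simp add: coord_proj_def)
  finally show ?thesis .
qed

lemma proj_e: "coord_proj I v \<bullet> e = 0" "e \<bullet> coord_proj I v = 0"
  using coord_proj_inner[OF I e(1)] e(2) by (auto simp: inner_commute)

lemma proj_self: "coord_proj I v \<bullet> w = coord_proj I v \<bullet> coord_proj I w"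
proof -
  have "coord_proj I v \<bullet> w = (\<Sum>b\<in>Basis. (coord_proj I v \<bullet> b) * (w \<bullet> b))" by (rule euclidean_inner)
  also have "\<dots> = (\<Sum>b\<in>Basis. (coord_proj I v \<bullet> b) * (coord_proj I w \<bullet> b))"
    by (rule sum.cong) (auto simp: coord_proj_inner[OF I])
  also have "\<dots> = coord_proj I v \<bullet> coord_proj I w" by (rule euclidean_inner[symmetric])
  finally show ?thesis .
qed

lemma norm_split: "v \<in> span (insert e I) \<Longrightarrow> (norm v)\<^sup>2 = (norm (coord_proj I v))\<^sup>2 + (v \<bullet> e)\<^sup>2"
proof -
  assume v: "v \<in> span (insert e I)"
  have "v \<bullet> v = (coord_proj I v + (v \<bullet> e) *\<^sub>R e) \<bullet> (coord_proj I v + (v \<bullet> e) *\<^sub>R e)" using proj_split[OF v] by simp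
  also have "\<dots> = coord_proj I v \<bullet> coord_proj I v + (v \<bullet> e) * (v \<bullet> e)"
    using e by (simp add: inner_add_left inner_add_right proj_e)
  finally show ?thesis by (simp only: power2_norm_eq_inner power2_eq_square[of "v \<bullet> e"])
qed

lemma grad_in: "grad p \<in> span (insert e I)"
  unfolding grad_def
  by (intro span_add span_scale) (auto intro: span_base subsetD[OF span_mono[of I "insert e I"]] coord_proj_in_span[OF I])

lemma revolution_iff: "p \<in> revolution I u e r F \<longleftrightarrow> p - u \<in> span (insert e I) \<and> gfun p = 0"
  by (auto simp: revolution_def gfun_def)

lemma F_le_1: "p \<in> revolution I u e r F \<Longrightarrow> F (coord_proj I p \<bullet> coord_proj I p) \<le> 1"
proof -
  assume "p \<in> revolution I u e r F"
  then have "((p - u) \<bullet> e)\<^sup>2 / r\<^sup>2 + F (coord_proj I p \<bullet> coord_proj I p) = 1" by (simp add: revolution_def)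
  moreover have "0 \<le> ((p - u) \<bullet> e)\<^sup>2 / r\<^sup>2" by simp
  ultimately show ?thesis by linarith
qed

lemma radial_bound:
  assumes "p \<in> revolution I u e r F" "q \<in> revolution I u e r F"
  shows "\<And>s. 0 \<le> s \<Longrightarrow> s \<le> max (coord_proj I p \<bullet> coord_proj I p) (coord_proj I q \<bullet> coord_proj I q) \<Longrightarrow>
      \<bar>F' s\<bar> + 2 * s * \<bar>F'' s\<bar> \<le> 1 / r\<^sup>2"
  using prof_bound[OF _ _ F_le_1[OF assms(1)]] prof_bound[OF _ _ F_le_1[OF assms(2)]]
  by (metis le_max_iff_disj)

lemma proj_diff: "coord_proj I (p - q) = coord_proj I p - coord_proj I q"
  by (rule linear_diff[OF linear_coord_proj])

lemma rev_diff: "p \<in> revolution I u e r F \<Longrightarrow> q \<in> revolution I u e r F \<Longrightarrow> q - p \<in> span (insert e I)"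
proof -
  assume "p \<in> revolution I u e r F" "q \<in> revolution I u e r F"
  then have "(q - u) - (p - u) \<in> span (insert e I)" by - (rule span_diff, auto simp: revolution_def)
  then show ?thesis by simp
qed

text \<open>Both points lie on the zero set of \<open>gfun\<close>, so the first-order term is minus
  the second-order remainder, which the Hessian bound controls.\<close>

lemma grad_inner_le:
  assumes p: "p \<in> revolution I u e r F" and q: "q \<in> revolution I u e r F"
  shows "\<bar>grad p \<bullet> (q - p)\<bar> \<le> (norm (q - p))\<^sup>2 / r\<^sup>2"
proof -
  define v where "v = q - p"
  let ?X = "coord_proj I"
  have vL: "v \<in> span (insert e I)" unfolding v_def by (rule rev_diff[OF p q])
  have Xv: "?X v = ?X q - ?X p" by (simp add: v_def proj_diff)
  have tay: "\<bar>F (?X q \<bullet> ?X q) - F (?X p \<bullet> ?X p) - 2 * F' (?X p \<bullet> ?X p) * (?X p \<bullet> (?X q - ?X p))\<bar> \<le> 1 / r\<^sup>2 * (norm (?X q - ?X p))\<^sup>2"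
    by (rule radial_taylor[OF dF radial_bound[OF p q]]) auto
  have G: "grad p \<bullet> v = 2 * ((p - u) \<bullet> e) * (v \<bullet> e) / r\<^sup>2 + 2 * F' (?X p \<bullet> ?X p) * (?X p \<bullet> ?X v)"
    using e by (simp add: grad_def inner_add_left proj_self[of p v] inner_commute[of e v])
  have qe: "(q - u) \<bullet> e = (p - u) \<bullet> e + v \<bullet> e" by (simp add: v_def inner_diff_left)
  have "((q - u) \<bullet> e)\<^sup>2 / r\<^sup>2 + F (?X q \<bullet> ?X q) = ((p - u) \<bullet> e)\<^sup>2 / r\<^sup>2 + F (?X p \<bullet> ?X p)"
    using p q by (simp add: revolution_def)
  then have "F (?X q \<bullet> ?X q) - F (?X p \<bullet> ?X p) = - (2 * ((p - u) \<bullet> e) * (v \<bullet> e) + (v \<bullet> e)\<^sup>2) / r\<^sup>2"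
    unfolding qe by (simp add: power2_sum diff_divide_distrib add_divide_distrib)
  then have eq: "grad p \<bullet> v = - ((v \<bullet> e)\<^sup>2 / r\<^sup>2) - (F (?X q \<bullet> ?X q) - F (?X p \<bullet> ?X p) - 2 * F' (?X p \<bullet> ?X p) * (?X p \<bullet> (?X q - ?X p)))"
    unfolding G Xv by (simp add: add_divide_distrib diff_divide_distrib)
  have "\<bar>- a - b\<bar> \<le> a + c" if "0 \<le> a" "\<bar>b\<bar> \<le> c" for a b c :: real using that by linarith
  from this[OF _ tay, of "(v \<bullet> e)\<^sup>2 / r\<^sup>2"]
  have "\<bar>grad p \<bullet> v\<bar> \<le> (v \<bullet> e)\<^sup>2 / r\<^sup>2 + 1 / r\<^sup>2 * (norm (?X v))\<^sup>2"
    unfolding eq Xv by simp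
  also have "\<dots> = (norm v)\<^sup>2 / r\<^sup>2" using norm_split[OF vL] by (simp add: add_divide_distrib)
  finally show ?thesis by (simp add: v_def)
qed

text \<open>Substituting the equation of the surface for the height turns the second condition of
  \<open>profile\<close> into this bound.\<close>

lemma grad_norm_ge:
  assumes p: "p \<in> revolution I u e r F"
  shows "2 * \<rho> / r\<^sup>2 \<le> norm (grad p)"
proof -
  let ?s = "coord_proj I p \<bullet> coord_proj I p"
  have 1: "((p - u) \<bullet> e)\<^sup>2 / r\<^sup>2 = 1 - F ?s" using p by (simp add: revolution_def)
  have 2: "\<rho>\<^sup>2 \<le> r\<^sup>2 * (1 - F ?s) + r ^ 4 * (F' ?s)\<^sup>2 * ?s"
    by (rule prof_lower[OF inner_ge_zero F_le_1[OF p]])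
  have "(norm (grad p))\<^sup>2 = 4 * ((p - u) \<bullet> e)\<^sup>2 / r ^ 4 + 4 * (F' ?s)\<^sup>2 * ?s"
    unfolding power2_norm_eq_inner grad_def using e
    by (simp add: inner_add_left inner_add_right proj_e power2_eq_square power4_eq_xxxx)
  also have "4 * ((p - u) \<bullet> e)\<^sup>2 / r ^ 4 = 4 / r\<^sup>2 * (((p - u) \<bullet> e)\<^sup>2 / r\<^sup>2)" by (simp add: power2_eq_square power4_eq_xxxx)
  also have "\<dots> = 4 / r\<^sup>2 * (1 - F ?s)" by (simp only: 1)
  also have "4 / r\<^sup>2 * (1 - F ?s) + 4 * (F' ?s)\<^sup>2 * ?s = 4 / r ^ 4 * (r\<^sup>2 * (1 - F ?s) + r ^ 4 * (F' ?s)\<^sup>2 * ?s)"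
    using r by (simp add: field_simps power2_eq_square power4_eq_xxxx)
  finally have eq: "(norm (grad p))\<^sup>2 = 4 / r ^ 4 * (r\<^sup>2 * (1 - F ?s) + r ^ 4 * (F' ?s)\<^sup>2 * ?s)" .
  have "(2 * \<rho> / r\<^sup>2)\<^sup>2 = 4 / r ^ 4 * \<rho>\<^sup>2" by (simp add: power_divide power_mult_distrib)
  also have "\<dots> \<le> (norm (grad p))\<^sup>2" unfolding eq using 2 by (intro mult_left_mono) auto
  finally show ?thesis by (rule power2_le_imp_le) simp
qed

definition "tspace p = {v \<in> span (insert e I). v \<bullet> grad p = 0}"

lemma tspace_subspace: "subspace (tspace p)"
  unfolding tspace_def subspace_def by (auto intro: span_0 span_add span_scale simp: inner_add_left)

lemma tspace_approx:
  assumes G: "grad p \<noteq> 0" and v: "v \<in> span (insert e I)"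
  shows "\<exists>w\<in>tspace p. norm (v - w) = \<bar>grad p \<bullet> v\<bar> / norm (grad p)"
proof
  let ?c = "(grad p \<bullet> v) / (grad p \<bullet> grad p)"
  show "v - ?c *\<^sub>R grad p \<in> tspace p"
  proof -
    have "v - ?c *\<^sub>R grad p \<in> span (insert e I)" by (rule span_diff[OF v span_scale[OF grad_in]])
    moreover have "(v - ?c *\<^sub>R grad p) \<bullet> grad p = v \<bullet> grad p - ?c * (grad p \<bullet> grad p)"
      by (simp only: inner_diff_left inner_scaleR_left)
    moreover have "?c * (grad p \<bullet> grad p) = v \<bullet> grad p" using G by (simp add: inner_commute)
    ultimately show ?thesis by (simp add: tspace_def)
  qed
  show "norm (v - (v - ?c *\<^sub>R grad p)) = \<bar>grad p \<bullet> v\<bar> / norm (grad p)"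
  proof -
    have "norm (v - (v - ?c *\<^sub>R grad p)) = \<bar>grad p \<bullet> v\<bar> / (norm (grad p))\<^sup>2 * norm (grad p)"
      by (simp add: power2_norm_eq_inner)
    then show ?thesis using G by (simp add: power2_eq_square)
  qed
qed

lemma grad_nonzero: "p \<in> revolution I u e r F \<Longrightarrow> grad p \<noteq> 0"
proof -
  assume "p \<in> revolution I u e r F"
  then have "2 * \<rho> / r\<^sup>2 \<le> norm (grad p)" by (rule grad_norm_ge)
  moreover have "0 < 2 * \<rho> / r\<^sup>2" using r by simp
  ultimately show ?thesis by auto
qed

lemma tspace_dim:
  assumes p: "p \<in> revolution I u e r F"
  shows "dim (tspace p) = card I"
proof -
  have "dim {y \<in> span (insert e I). \<forall>x\<in>span {grad p}. orthogonal x y} + dim (span {grad p}) = dim (span (insert e I))"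
    by (rule dim_subspace_orthogonal_to_vectors) (auto simp: span_minimal grad_in)
  moreover have "{y \<in> span (insert e I). \<forall>x\<in>span {grad p}. orthogonal x y} = tspace p"
  proof -
    have "(\<forall>x\<in>span {grad p}. orthogonal x y) \<longleftrightarrow> y \<bullet> grad p = 0" for y
      by (auto simp: orthogonal_def span_singleton inner_commute)
    then show ?thesis by (simp add: tspace_def)
  qed
  moreover have "dim (span {grad p}) = 1" using grad_nonzero[OF p] by simp
  moreover have "dim (span (insert e I)) = card (insert e I)"
    using dim_eq_card_independent[of "insert e I"] independent_mono[OF independent_Basis eI] by simp
  moreover have "card (insert e I) = card I + 1" using finite_subset[OF I finite_Basis] e by simp
  ultimately show ?thesis by simp
qed

lemma revolution_quad:
  assumes p: "p \<in> revolution I u e r F" and q: "q \<in> revolution I u e r F"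
  shows "\<exists>w\<in>tspace p. norm (q - p - w) \<le> (norm (q - p))\<^sup>2 / (2 * \<rho>)"
proof -
  obtain w where w: "w \<in> tspace p" "norm (q - p - w) = \<bar>grad p \<bullet> (q - p)\<bar> / norm (grad p)"
    using tspace_approx[OF grad_nonzero[OF p] rev_diff[OF p q]] by blast
  have "\<bar>grad p \<bullet> (q - p)\<bar> / norm (grad p) \<le> ((norm (q - p))\<^sup>2 / r\<^sup>2) / (2 * \<rho> / r\<^sup>2)"
    using grad_inner_le[OF p q] grad_norm_ge[OF p] r by (intro frac_le) auto
  also have "\<dots> = (norm (q - p))\<^sup>2 / (2 * \<rho>)" using r by simp
  finally show ?thesis using w by (intro bexI[of _ w]) simp_all
qed

lemma grad_lipschitz:
  assumes p: "p \<in> revolution I u e r F" and q: "q \<in> revolution I u e r F"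
  shows "norm (grad p - grad q) \<le> 4 / r\<^sup>2 * norm (p - q)"
proof -
  let ?X = "coord_proj I"
  have "grad p - grad q = (2 * ((p - q) \<bullet> e) / r\<^sup>2) *\<^sub>R e + ((2 * F' (?X p \<bullet> ?X p)) *\<^sub>R ?X p - (2 * F' (?X q \<bullet> ?X q)) *\<^sub>R ?X q)"
  proof -
    have "2 * ((p - u) \<bullet> e) / r\<^sup>2 = 2 * ((p - q) \<bullet> e) / r\<^sup>2 + 2 * ((q - u) \<bullet> e) / r\<^sup>2"
      by (simp add: inner_diff_left add_divide_distrib[symmetric])
    then show ?thesis unfolding grad_def by (simp add: scaleR_add_left)
  qed
  also have "norm \<dots> \<le> 2 * \<bar>(p - q) \<bullet> e\<bar> / r\<^sup>2 + 2 * (1 / r\<^sup>2) * norm (?X p - ?X q)"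
    by (rule order_trans[OF norm_triangle_ineq add_mono[OF _ radial_gradient_lipschitz[OF dF(2) radial_bound[OF p q]]]])
       (use e in auto)
  also have "\<dots> \<le> 2 * norm (p - q) / r\<^sup>2 + 2 * (1 / r\<^sup>2) * norm (p - q)"
  proof (intro add_mono mult_left_mono divide_right_mono)
    show "\<bar>(p - q) \<bullet> e\<bar> \<le> norm (p - q)" using Basis_le_norm[OF e(1)] .
    show "norm (?X p - ?X q) \<le> norm (p - q)" using norm_coord_proj_le[OF I, of "p - q"] by (simp add: proj_diff)
  qed auto
  finally show ?thesis by simp
qed

text \<open>The chord is compared with the tangent space at q', and the gradient is then moved from
  q' to p. Within radius \<rho>/12 the two errors are 1/3 and 1/6 of \<rho> / r^2 times the chord,
  together exactly a quarter of the gradient bound 2\<rho> / r^2.\<close>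

lemma revolution_flat:
  assumes p: "p \<in> revolution I u e r F" and q: "q \<in> revolution I u e r F" and q': "q' \<in> revolution I u e r F"
    and near: "dist p q \<le> \<rho>/12" "dist p q' \<le> \<rho>/12"
  shows "\<exists>w\<in>tspace p. norm (q - q' - w) \<le> norm (q - q') / 4"
proof -
  let ?v = "q - q'"
  obtain w where w: "w \<in> tspace p" "norm (?v - w) = \<bar>grad p \<bullet> ?v\<bar> / norm (grad p)"
    using tspace_approx[OF grad_nonzero[OF p] rev_diff[OF q' q]] by blast
  have vn: "norm ?v \<le> \<rho>/6" using near dist_triangle[of q q' p] by (simp add: dist_norm norm_minus_commute)
  have "\<bar>grad p \<bullet> ?v\<bar> = \<bar>(grad p - grad q') \<bullet> ?v + grad q' \<bullet> ?v\<bar>" by (simp add: inner_diff_left)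
  also have "\<dots> \<le> norm (grad p - grad q') * norm ?v + (norm ?v)\<^sup>2 / r\<^sup>2"
    using Cauchy_Schwarz_ineq2[of "grad p - grad q'" ?v] grad_inner_le[OF q' q] by linarith
  also have "\<dots> \<le> (4 / r\<^sup>2 * (\<rho>/12)) * norm ?v + (\<rho>/6 * norm ?v) / r\<^sup>2"
  proof (intro add_mono mult_right_mono divide_right_mono)
    have "norm (grad p - grad q') \<le> 4 / r\<^sup>2 * norm (p - q')" by (rule grad_lipschitz[OF p q'])
    also have "\<dots> \<le> 4 / r\<^sup>2 * (\<rho>/12)" using near by (intro mult_left_mono) (auto simp: dist_norm)
    finally show "norm (grad p - grad q') \<le> 4 / r\<^sup>2 * (\<rho>/12)" .
    show "(norm ?v)\<^sup>2 \<le> \<rho>/6 * norm ?v" using mult_right_mono[OF vn norm_ge_zero[of ?v]] by (simp add: power2_eq_square)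
  qed auto
  also have "\<dots> = (2 * \<rho> / r\<^sup>2) * (norm ?v / 4)" using r by (simp add: field_simps)
  also have "\<dots> \<le> norm (grad p) * (norm ?v / 4)" by (rule mult_right_mono[OF grad_norm_ge[OF p]]) simp
  finally have "\<bar>grad p \<bullet> ?v\<bar> / norm (grad p) \<le> norm ?v / 4"
    using grad_nonzero[OF p] by (simp add: divide_le_eq mult.commute)
  then show ?thesis using w by (intro bexI[of _ w]) simp_all
qed

lemma gfun_derivative: "(gfun has_derivative (\<lambda>h. grad p \<bullet> h)) (at p)"
proof -
  let ?X = "coord_proj I"
  have bX: "bounded_linear ?X" by (simp add: linear_coord_proj linear_conv_bounded_linear[symmetric])
  have Xd: "(?X has_derivative ?X) (at p)" by (rule bounded_linear_imp_has_derivative[OF bX])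
  have "((\<lambda>p. ?X p \<bullet> ?X p) has_derivative (\<lambda>h. ?X p \<bullet> ?X h + ?X h \<bullet> ?X p)) (at p)"
    by (rule has_derivative_inner[OF Xd Xd])
  from has_derivative_compose[OF this, of F "(*) (F' (?X p \<bullet> ?X p))"]
  have 1: "((\<lambda>p. F (?X p \<bullet> ?X p)) has_derivative (\<lambda>h. F' (?X p \<bullet> ?X p) * (?X p \<bullet> ?X h + ?X h \<bullet> ?X p))) (at p)"
    using dF(1) by (simp add: has_field_derivative_def)
  have 2: "((\<lambda>p. ((p - u) \<bullet> e)\<^sup>2 / r\<^sup>2) has_derivative (\<lambda>h. 2 * ((p - u) \<bullet> e) * (h \<bullet> e) / r\<^sup>2)) (at p)"
    using r by (auto intro!: derivative_eq_intros simp: divide_simps)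
  have "(gfun has_derivative (\<lambda>h. 2 * ((p - u) \<bullet> e) * (h \<bullet> e) / r\<^sup>2 + F' (?X p \<bullet> ?X p) * (?X p \<bullet> ?X h + ?X h \<bullet> ?X p) - 0)) (at p)"
    unfolding gfun_def by (intro has_derivative_diff has_derivative_add has_derivative_const 1 2)
  moreover have "(\<lambda>h. 2 * ((p - u) \<bullet> e) * (h \<bullet> e) / r\<^sup>2 + F' (?X p \<bullet> ?X p) * (?X p \<bullet> ?X h + ?X h \<bullet> ?X p) - 0) = (\<lambda>h. grad p \<bullet> h)"
  proof (rule ext)
    fix h
    have "grad p \<bullet> h = 2 * ((p - u) \<bullet> e) / r\<^sup>2 * (e \<bullet> h) + 2 * F' (?X p \<bullet> ?X p) * (?X p \<bullet> h)"
      by (simp add: grad_def inner_add_left)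
    then show "2 * ((p - u) \<bullet> e) * (h \<bullet> e) / r\<^sup>2 + F' (?X p \<bullet> ?X p) * (?X p \<bullet> ?X h + ?X h \<bullet> ?X p) - 0 = grad p \<bullet> h"
      using proj_self[of p h] by (simp add: inner_commute[of "?X h"] inner_commute[of e h])
  qed
  ultimately show ?thesis by simp
qed

lemma gfun_C2: "C2_on UNIV gfun"
proof -
  let ?X = "coord_proj I"
  have bX: "bounded_linear ?X" by (simp add: linear_coord_proj linear_conv_bounded_linear[symmetric])
  have CX: "C2_on UNIV ?X" by (rule C2_on_bounded_linear[OF bX]) simp
  have CF: "C2_on UNIV F" using profD by (intro C2_on_real[of F F' F'']) auto
  have "C2_on UNIV (\<lambda>p. ?X p \<bullet> ?X p)" by (rule C2_on_bilinear[OF bounded_bilinear_inner CX CX])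
  then have 1: "C2_on UNIV (\<lambda>p. F (?X p \<bullet> ?X p))" by (rule C2_on_compose[OF CF]) simp
  have be: "C2_on UNIV (\<lambda>p. p \<bullet> e)" by (rule C2_on_bounded_linear[OF bounded_linear_inner_left]) simp
  have 2: "C2_on UNIV (\<lambda>p. p \<bullet> e + (- (u \<bullet> e)))" by (rule C2_on_add[OF be C2_on_const]) simp
  have 3: "C2_on UNIV (\<lambda>p. (1 / r\<^sup>2) * ((p \<bullet> e + (- (u \<bullet> e))) * (p \<bullet> e + (- (u \<bullet> e)))))"
    by (rule C2_on_bilinear[OF bounded_bilinear_mult C2_on_const C2_on_bilinear[OF bounded_bilinear_mult 2 2]]) simp
  have "C2_on UNIV (\<lambda>p. (1 / r\<^sup>2) * ((p \<bullet> e + (- (u \<bullet> e))) * (p \<bullet> e + (- (u \<bullet> e)))) + F (?X p \<bullet> ?X p) + (-1))"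
    by (rule C2_on_add[OF C2_on_add[OF 3 1] C2_on_const]) simp
  moreover have "(\<lambda>p. (1 / r\<^sup>2) * ((p \<bullet> e + (- (u \<bullet> e))) * (p \<bullet> e + (- (u \<bullet> e)))) + F (?X p \<bullet> ?X p) + (-1)) = gfun"
    by (rule ext) (simp add: gfun_def inner_diff_left power2_eq_square)
  ultimately show ?thesis by simp
qed

lemma revolution_chart:
  assumes p: "p \<in> revolution I u e r F" "p \<in> W" "p \<in> M" and W: "open W"
    and M: "\<And>x. x \<in> W \<Longrightarrow> x \<in> M \<longleftrightarrow> x \<in> revolution I u e r F"
  shows "chart_at (card I) M p" "tangent_at M p (tspace p)"
proof -
  define G where "G = grad p"
  have G: "G \<bullet> G \<noteq> 0" using grad_nonzero[OF p(1)] by (simp add: G_def)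
  have GL: "G \<in> span (insert e I)" by (simp add: G_def grad_in)
  \<comment> \<open>The inner product of \<Phi> x with G is \<open>gfun x\<close>, so the surface
    becomes exactly the preimage of \<open>tspace p\<close>. The correction term has zero derivative
    at p, where \<open>gfun\<close> has gradient G.\<close>
  define \<Phi> where "\<Phi> x = (x - p) + ((gfun x - (x - p) \<bullet> G) / (G \<bullet> G)) *\<^sub>R G" for x
  have iff: "x \<in> revolution I u e r F \<longleftrightarrow> \<Phi> x \<in> tspace p" for x
  proof -
    have pL: "p - u \<in> span (insert e I)" using p(1) by (simp add: revolution_iff)
    have GG: "\<Phi> x \<bullet> G = gfun x" using G by (simp add: \<Phi>_def inner_add_left)
    have "\<Phi> x \<in> span (insert e I) \<longleftrightarrow> x - p \<in> span (insert e I)"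
      unfolding \<Phi>_def by (rule span_add_eq2[OF span_scale[OF GL]])
    also have "\<dots> \<longleftrightarrow> x - u \<in> span (insert e I)"
      using span_add_eq2[OF pL, of "x - p"] by simp
    finally show ?thesis by (simp add: tspace_def G_def[symmetric] GG revolution_iff)
  qed
  have C2: "C2_on UNIV \<Phi>"
  proof -
    have id: "C2_on UNIV (\<lambda>x::'a. x)" by (rule C2_on_bounded_linear[OF bounded_linear_ident]) simp
    have a: "C2_on UNIV (\<lambda>x. x + (- p))" by (rule C2_on_add[OF id C2_on_const]) simp
    have b: "C2_on UNIV (\<lambda>x. (x + (- p)) \<bullet> (- G))" by (rule C2_on_bilinear[OF bounded_bilinear_inner a C2_on_const]) simp
    have c: "C2_on UNIV (\<lambda>x. gfun x + (x + (- p)) \<bullet> (- G))" by (rule C2_on_add[OF gfun_C2 b])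
    have d: "C2_on UNIV (\<lambda>x. (1 / (G \<bullet> G)) * (gfun x + (x + (- p)) \<bullet> (- G)))"
      by (rule C2_on_bilinear[OF bounded_bilinear_mult C2_on_const c]) simp
    have "C2_on UNIV (\<lambda>x. (x + (- p)) + ((1 / (G \<bullet> G)) * (gfun x + (x + (- p)) \<bullet> (- G))) *\<^sub>R G)"
      by (rule C2_on_add[OF a C2_on_bilinear[OF bounded_bilinear_scaleR d C2_on_const]]) simp
    moreover have "(\<lambda>x. (x + (- p)) + ((1 / (G \<bullet> G)) * (gfun x + (x + (- p)) \<bullet> (- G))) *\<^sub>R G) = \<Phi>"
      by (rule ext) (simp add: \<Phi>_def)
    ultimately show ?thesis by simp
  qed
  have der: "(\<Phi> has_derivative (\<lambda>h. h)) (at p)"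
  proof -
    have "((\<lambda>x. (gfun x - (x - p) \<bullet> G) / (G \<bullet> G)) has_derivative (\<lambda>h. (G \<bullet> h - (h - 0) \<bullet> G) / (G \<bullet> G))) (at p)"
    proof (rule bounded_linear.has_derivative[OF bounded_linear_divide])
      have "((\<lambda>x. x - p) has_derivative (\<lambda>h. h - 0)) (at p)" by (intro has_derivative_diff has_derivative_ident has_derivative_const)
      then have "((\<lambda>x. (x - p) \<bullet> G) has_derivative (\<lambda>h. (h - 0) \<bullet> G)) (at p)" by (rule has_derivative_inner_left)
      then show "((\<lambda>x. gfun x - (x - p) \<bullet> G) has_derivative (\<lambda>h. G \<bullet> h - (h - 0) \<bullet> G)) (at p)"
        using gfun_derivative[of p] unfolding G_def[symmetric] by (intro has_derivative_diff)
    qed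
    from has_derivative_scaleR[OF this has_derivative_const[of G]]
    have "((\<lambda>x. ((gfun x - (x - p) \<bullet> G) / (G \<bullet> G)) *\<^sub>R G) has_derivative (\<lambda>h. 0)) (at p)"
      by (simp add: inner_commute)
    then have "((\<lambda>x. (x - p) + ((gfun x - (x - p) \<bullet> G) / (G \<bullet> G)) *\<^sub>R G) has_derivative (\<lambda>h. (h - 0) + 0)) (at p)"
      by (intro has_derivative_add has_derivative_diff has_derivative_ident has_derivative_const)
    then show ?thesis by (simp add: \<Phi>_def[abs_def])
  qed
  have lv: "\<And>x. x \<in> W \<Longrightarrow> x \<in> M \<longleftrightarrow> \<Phi> x \<in> tspace p" using M iff by blast
  show "chart_at (card I) M p" "tangent_at M p (tspace p)"
    using chart_and_tangent_of_level_map[OF p(2,3) W C2_on_subset[OF C2 subset_UNIV W] der tspace_subspace tspace_dim[OF p(1)] lv]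
    by auto
qed

text \<open>Agreement of M with the surface on the neighbourhood W yields the chart and the tangent
  space. The metric bounds follow from the inclusion of the points of M within 2 * \<rho>, the range
  where the quadratic bound is nontrivial.\<close>

lemma well_curved_revolution:
  assumes p: "p \<in> revolution I u e r F" "p \<in> W" "p \<in> M" and W: "open W"
    and M: "\<And>x. x \<in> W \<Longrightarrow> x \<in> M \<longleftrightarrow> x \<in> revolution I u e r F"
    and near: "\<And>q. q \<in> M \<Longrightarrow> dist p q < 2 * \<rho> \<Longrightarrow> q \<in> revolution I u e r F"
  shows "well_curved (card I) \<rho> M p"
  unfolding well_curved_def
proof (intro conjI exI[of _ "tspace p"] ballI)
  show "chart_at (card I) M p" by (rule revolution_chart(1)[OF p W M])
  show "tangent_at M p (tspace p)" by (rule revolution_chart(2)[OF p W M])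
  show "dim (tspace p) = card I" by (rule tspace_dim[OF p(1)])
  show "quad_tangent \<rho> M p (tspace p)"
  proof (rule quad_tangent_local[OF _ r(2) tspace_subspace])
    fix q assume "q \<in> M" "norm (q - p) < 2 * \<rho>"
    then have "q \<in> revolution I u e r F" using near by (simp add: dist_norm norm_minus_commute)
    then show "\<exists>w\<in>tspace p. norm (q - p - w) \<le> (norm (q - p))\<^sup>2 / (2 * \<rho>)" by (rule revolution_quad[OF p(1)])
  qed
  fix q q' assume q: "q \<in> M \<inter> cball p (\<rho>/12)" "q' \<in> M \<inter> cball p (\<rho>/12)"
  then have "q \<in> revolution I u e r F" "q' \<in> revolution I u e r F" using near r by auto
  then show "\<exists>w\<in>tspace p. norm (q - q' - w) \<le> norm (q - q') / 4"
    using q by (intro revolution_flat[OF p(1)]) auto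
qed

end

section \<open>Profiles of planes, spheres, rims and necks\<close>

lemma profile_flat:
  assumes "0 < \<rho>" "\<rho> \<le> r"
  shows "profile r \<rho> (\<lambda>_. 0) (\<lambda>_. 0) (\<lambda>_. 0)"
  using assms by (auto simp: profile_def intro: power_mono)

lemma profile_sphere:
  assumes "0 < \<rho>" "\<rho> \<le> r"
  shows "profile r \<rho> (\<lambda>s. s / r\<^sup>2) (\<lambda>_. 1 / r\<^sup>2) (\<lambda>_. 0)"
proof -
  have "\<rho>\<^sup>2 \<le> r\<^sup>2" using assms by (intro power_mono) auto
  moreover have "r\<^sup>2 * (1 - s / r\<^sup>2) + r ^ 4 * (1 / r\<^sup>2)\<^sup>2 * s = r\<^sup>2" for s
    using assms by (simp add: field_simps power2_eq_square power4_eq_xxxx)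
  moreover have "((\<lambda>s. s / r\<^sup>2) has_real_derivative 1 / r\<^sup>2) (at s)" for s
    by (rule DERIV_cdivide[OF DERIV_ident])
  ultimately show ?thesis unfolding profile_def by simp
qed

text \<open>As a profile: two sheets that stay flat up to squared radius B and meet at squared
  radius B + C, where the value 1 forces height 0.\<close>

definition rimF :: "real \<Rightarrow> real \<Rightarrow> real \<Rightarrow> real" where
  "rimF B C s = (max 0 ((s - B) / C)) ^ 3"

text \<open>Flat from squared radius A outwards. The factor 2 makes the profile reach 1 before the
  axis, at squared radius A (1 - w) with w^3 = 1/2, which leaves a hole: the throat of the
  neck.\<close>

definition neckF :: "real \<Rightarrow> real \<Rightarrow> real" where
  "neckF A s = 2 * (max 0 ((A - s) / A)) ^ 3"

text \<open>The difference to 3/8, the value at u = 1, has the factor 1 - u.\<close>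

lemma rim_poly: "0 \<le> u \<Longrightarrow> u \<le> 1 \<Longrightarrow> 1/4 \<le> 1 - u ^ 3 + 3/8 * u ^ 4" for u :: real
proof -
  assume u: "0 \<le> u" "u \<le> 1"
  have "1 - u ^ 3 + 3/8 * u ^ 4 - 3/8 = (1 - u) * (5/8 * (1 + u + u^2) - 3/8 * u ^ 3)"
    by (simp add: field_simps power2_eq_square power3_eq_cube power4_eq_xxxx)
  moreover have "3/8 * u ^ 3 \<le> 5/8 * (1 + u + u^2)"
  proof -
    have "u ^ 3 \<le> 1" using u by (intro power_le_one) auto
    then show ?thesis using u by (simp add: field_simps) (smt (verit) zero_le_power)
  qed
  ultimately have "0 \<le> 1 - u ^ 3 + 3/8 * u ^ 4 - 3/8" using u by simp
  then show ?thesis by linarith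
qed

text \<open>The relation C^2 = 24 r^2 B splits the curvature bound evenly: 12 B / C^2 is 1 / (2
  r^2), and 30 r^2 \<le> C bounds the remaining 15 / C by the same amount. It also turns 9 r^4 B /
  C^2 into 3/8 r^2, the coefficient in \<open>rim_poly\<close>.\<close>

lemma profile_rim:
  assumes r: "0 < r" and C: "0 < C" "C\<^sup>2 = 24 * r\<^sup>2 * B" "30 * r\<^sup>2 \<le> C"
  shows "profile r (r/2) (rimF B C) (\<lambda>s. 3 / C * (max 0 ((s - B) / C))\<^sup>2) (\<lambda>s. 6 / C\<^sup>2 * max 0 ((s - B) / C))"
proof -
  have B: "0 < B"
  proof -
    have "0 < 24 * r\<^sup>2 * B" using C(1) by (simp flip: C(2))
    then show ?thesis using r by (simp add: zero_less_mult_iff)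
  qed
  have d: "((\<lambda>s. (s - B) / C) has_real_derivative 1 / C) (at s)" for s
    by (rule DERIV_cdivide) (auto intro!: derivative_eq_intros)
  have 1: "(rimF B C has_real_derivative 3 / C * (max 0 ((s - B) / C))\<^sup>2) (at s)" for s
    using DERIV_chain2[OF DERIV_max_cube d, of s] by (simp add: rimF_def[abs_def])
  have 2: "((\<lambda>s. 3 / C * (max 0 ((s - B) / C))\<^sup>2) has_real_derivative 6 / C\<^sup>2 * max 0 ((s - B) / C)) (at s)" for s
    using DERIV_cmult[OF DERIV_chain2[OF DERIV_max_square d, of s], of "3 / C"] by (simp add: power2_eq_square)
  have 3: "continuous_on UNIV (\<lambda>s. 6 / C\<^sup>2 * max 0 ((s - B) / C))"
    by (intro continuous_intros) (use C in auto)
  have 4: "\<bar>3 / C * (max 0 ((t - B) / C))\<^sup>2\<bar> + 2 * t * \<bar>6 / C\<^sup>2 * max 0 ((t - B) / C)\<bar> \<le> 1 / r\<^sup>2"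
    if t: "0 \<le> t" "t \<le> s" "rimF B C s \<le> 1" for s t
  proof -
    define w where "w = max 0 ((t - B) / C)"
    define w' where "w' = max 0 ((s - B) / C)"
    have "w \<le> w'" unfolding w_def w'_def by (rule max.mono) (use t C(1) in \<open>auto intro!: divide_right_mono\<close>)
    moreover have "w' \<le> 1"
    proof (rule ccontr)
      assume "\<not> w' \<le> 1" then have "1 < w' ^ 3" by (intro one_less_power) auto
      then show False using t by (simp add: rimF_def w'_def)
    qed
    ultimately have w: "0 \<le> w" "w \<le> 1" by (auto simp: w_def)
    have tw: "t * w \<le> (B + C) * w"
    proof (cases "w = 0")
      case False
      then have "w = (t - B) / C" by (auto simp: w_def max_def split: if_splits)
      then have "t = B + C * w" using C by (simp add: field_simps)
      then show ?thesis using w C by (intro mult_right_mono) auto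
    qed simp
    have "\<bar>3 / C * w\<^sup>2\<bar> + 2 * t * \<bar>6 / C\<^sup>2 * w\<bar> = 3 / C * w\<^sup>2 + 12 / C\<^sup>2 * (t * w)"
      using C(1) w t(1) by (simp add: abs_mult)
    also have "\<dots> \<le> 3 / C * 1 + 12 / C\<^sup>2 * ((B + C) * 1)"
    proof (intro add_mono mult_left_mono)
      show "w\<^sup>2 \<le> 1" using w by (simp add: power_le_one)
      have "(B + C) * w \<le> (B + C) * 1" using w B C(1) by (intro mult_left_mono) auto
      then show "t * w \<le> (B + C) * 1" using tw by linarith
    qed (use C(1) in auto)
    also have "\<dots> = 15 / C + 12 * B / C\<^sup>2" using C(1) by (simp add: field_simps power2_eq_square)
    also have "\<dots> = 15 / C + 1 / (2 * r\<^sup>2)" using B r by (simp add: C(2))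
    also have "15 / C \<le> 15 / (30 * r\<^sup>2)" using C r by (intro divide_left_mono) auto
    finally show ?thesis by (simp add: w_def field_simps)
  qed
  have 5: "(r/2)\<^sup>2 \<le> r\<^sup>2 * (1 - rimF B C s) + r ^ 4 * (3 / C * (max 0 ((s - B) / C))\<^sup>2)\<^sup>2 * s"
    if s: "0 \<le> s" "rimF B C s \<le> 1" for s
  proof -
    define w where "w = max 0 ((s - B) / C)"
    have w1: "w \<le> 1"
    proof (rule ccontr)
      assume "\<not> w \<le> 1" then have "1 < w ^ 3" by (intro one_less_power) auto
      then show False using s by (simp add: rimF_def w_def)
    qed
    have w0: "0 \<le> w" by (simp add: w_def)
    have sB: "w ^ 4 * B \<le> w ^ 4 * s"
    proof (cases "w = 0")
      case False
      then have "w = (s - B) / C" by (auto simp: w_def max_def split: if_splits)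
      then have "0 < (s - B) / C" using False w0 by linarith
      then have "B \<le> s" using C by (simp add: zero_less_divide_iff)
      then show ?thesis by (intro mult_left_mono) auto
    qed simp
    have "(r/2)\<^sup>2 = r\<^sup>2 * (1/4)" by (simp add: power_divide)
    also have "\<dots> \<le> r\<^sup>2 * (1 - w ^ 3 + 3/8 * w ^ 4)" using rim_poly[OF w0 w1] by (intro mult_left_mono) auto
    also have "\<dots> = r\<^sup>2 * (1 - w ^ 3) + r ^ 4 * 9 / C\<^sup>2 * (w ^ 4 * B)"
      unfolding C(2) using B r by (simp add: field_simps power2_eq_square power4_eq_xxxx)
    also have "\<dots> \<le> r\<^sup>2 * (1 - w ^ 3) + r ^ 4 * 9 / C\<^sup>2 * (w ^ 4 * s)"
      by (rule add_left_mono, rule mult_left_mono[OF sB]) simp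
    also have "\<dots> = r\<^sup>2 * (1 - w ^ 3) + r ^ 4 * (3 / C * w\<^sup>2)\<^sup>2 * s"
      by (simp add: power_divide power_mult_distrib power_mult[symmetric])
    finally show ?thesis by (simp add: rimF_def w_def)
  qed
  show ?thesis unfolding profile_def using 1 2 3 4 5 by blast
qed

text \<open>The constraint gives w \<le> 4/5, so the last term is at least 9/10 w^4. Up to 7/10 the
  cube alone is small enough; beyond that w^4 compensates.\<close>

lemma neck_poly: "0 \<le> w \<Longrightarrow> 2 * w ^ 3 \<le> 1 \<Longrightarrow> 1/4 \<le> 1 - 2 * w ^ 3 + 9/2 * (w ^ 4 * (1 - w))" for w :: real
proof -
  assume w: "0 \<le> w" "2 * w ^ 3 \<le> 1"
  have w8: "w \<le> 4/5"
  proof (rule ccontr)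
    assume "\<not> w \<le> 4/5"
    then have "(4/5) ^ 3 \<le> w ^ 3" by (intro power_mono) auto
    then show False using w by (simp add: power3_eq_cube)
  qed
  then have "w ^ 4 * (1/5) \<le> w ^ 4 * (1 - w)" by (intro mult_left_mono) auto
  then have low: "1 - 2 * w ^ 3 + 9/10 * w ^ 4 \<le> 1 - 2 * w ^ 3 + 9/2 * (w ^ 4 * (1 - w))" by linarith
  have "1/4 \<le> 1 - 2 * w ^ 3 + 9/10 * w ^ 4"
  proof (cases "w \<le> 7/10")
    case True
    then have "w ^ 3 \<le> (7/10) ^ 3" using w by (intro power_mono) auto
    then have "w ^ 3 \<le> 343/1000" by (simp add: power3_eq_cube)
    moreover have "0 \<le> w ^ 4" by simp
    ultimately show ?thesis by linarith
  next
    case False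
    then have "w ^ 3 * (7/10) \<le> w ^ 3 * w" using w by (intro mult_left_mono) auto
    moreover have "w ^ 3 * w = w ^ 4" by (simp add: power3_eq_cube power4_eq_xxxx)
    ultimately show ?thesis using w(2) by linarith
  qed
  then show ?thesis using low by linarith
qed

text \<open>With w = 1 - s / A the curvature expression is (24 w - 18 w^2) / A, with maximum 8 / A
  at w = 2/3; this is the origin of A = 8 r^2. The gradient condition becomes
  \<open>neck_poly\<close>.\<close>

lemma profile_neck:
  assumes r: "0 < r" and A: "A = 8 * r\<^sup>2"
  shows "profile r (r/2) (neckF A) (\<lambda>s. - (6 / A * (max 0 ((A - s) / A))\<^sup>2)) (\<lambda>s. 12 / A\<^sup>2 * max 0 ((A - s) / A))"
proof -
  have A0: "0 < A" using r A by simp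
  have d: "((\<lambda>s. (A - s) / A) has_real_derivative - (1 / A)) (at s)" for s
    using A0 by (auto intro!: derivative_eq_intros)
  have 1: "(neckF A has_real_derivative - (6 / A * (max 0 ((A - s) / A))\<^sup>2)) (at s)" for s
    using DERIV_cmult[OF DERIV_chain2[OF DERIV_max_cube d, of s], of 2] by (simp add: neckF_def[abs_def])
  have 2: "((\<lambda>s. - (6 / A * (max 0 ((A - s) / A))\<^sup>2)) has_real_derivative 12 / A\<^sup>2 * max 0 ((A - s) / A)) (at s)" for s
    using DERIV_minus[OF DERIV_cmult[OF DERIV_chain2[OF DERIV_max_square d, of s], of "6 / A"]] by (simp add: power2_eq_square)
  have 3: "continuous_on UNIV (\<lambda>s. 12 / A\<^sup>2 * max 0 ((A - s) / A))"
    by (intro continuous_intros) (use A0 in auto)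
  have 4: "\<bar>- (6 / A * (max 0 ((A - t) / A))\<^sup>2)\<bar> + 2 * t * \<bar>12 / A\<^sup>2 * max 0 ((A - t) / A)\<bar> \<le> 1 / r\<^sup>2"
    if t: "0 \<le> t" for t
  proof -
    define w where "w = max 0 ((A - t) / A)"
    have w0: "0 \<le> w" by (simp add: w_def)
    have tw: "t * w = A * (1 - w) * w"
    proof (cases "w = 0")
      case False
      then have "w = (A - t) / A" by (auto simp: w_def max_def split: if_splits)
      then have "t = A * (1 - w)" using A0 by (simp add: field_simps)
      then show ?thesis by simp
    qed simp
    have "\<bar>- (6 / A * w\<^sup>2)\<bar> + 2 * t * \<bar>12 / A\<^sup>2 * w\<bar> = 6 / A * w\<^sup>2 + 24 / A\<^sup>2 * (t * w)"
      using A0 w0 by (simp add: abs_mult)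
    also have "\<dots> = (24 * w - 18 * w\<^sup>2) / A" unfolding tw using A0 by (simp add: field_simps power2_eq_square)
    also have "\<dots> \<le> 8 / A"
    proof (rule divide_right_mono)
      have "0 \<le> 2 * (3 * w - 2)\<^sup>2" by simp
      then show "24 * w - 18 * w\<^sup>2 \<le> 8" by (simp add: power2_eq_square algebra_simps)
    qed (use A0 in simp)
    also have "\<dots> = 1 / r\<^sup>2" by (simp add: A)
    finally show ?thesis by (simp add: w_def)
  qed
  have 5: "(r/2)\<^sup>2 \<le> r\<^sup>2 * (1 - neckF A s) + r ^ 4 * (- (6 / A * (max 0 ((A - s) / A))\<^sup>2))\<^sup>2 * s"
    if s: "0 \<le> s" "neckF A s \<le> 1" for s
  proof -
    define w where "w = max 0 ((A - s) / A)"
    have w0: "0 \<le> w" "2 * w ^ 3 \<le> 1" using s by (auto simp: w_def neckF_def)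
    have sw: "w ^ 4 * s = w ^ 4 * (A * (1 - w))"
    proof (cases "w = 0")
      case False
      then have "w = (A - s) / A" by (auto simp: w_def max_def split: if_splits)
      then have "s = A * (1 - w)" using A0 by (simp add: field_simps)
      then show ?thesis by simp
    qed simp
    have "(r/2)\<^sup>2 = r\<^sup>2 * (1/4)" by (simp add: power_divide)
    also have "\<dots> \<le> r\<^sup>2 * (1 - 2 * w ^ 3 + 9/2 * (w ^ 4 * (1 - w)))" using neck_poly[OF w0] by (intro mult_left_mono) auto
    also have "\<dots> = r\<^sup>2 * (1 - 2 * w ^ 3) + r ^ 4 * 36 / A\<^sup>2 * (w ^ 4 * (A * (1 - w)))"
      unfolding A using r by (simp add: field_simps power2_eq_square power4_eq_xxxx)
    also have "\<dots> = r\<^sup>2 * (1 - 2 * w ^ 3) + r ^ 4 * (- (6 / A * w\<^sup>2))\<^sup>2 * s"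
      unfolding sw[symmetric] by (simp add: power_divide power_mult_distrib power_mult[symmetric])
    finally show ?thesis by (simp add: neckF_def w_def)
  qed
  show ?thesis unfolding profile_def using 1 2 3 4 5 by blast
qed

text \<open>Since z falls as the radius grows, the changes of radius and of h - z have the same
  sign, so the increments of their sum \<open>\<tau>\<close> dominate chords in the meridian
  half-plane. Together with the direction \<theta> this compares S with a product of the unit sphere
  and [0, Rm + h].\<close>

lemma hausdorff_outer_monotone_profile:
  fixes I :: "'a::euclidean_space set"
  assumes I: "I \<subseteq> Basis" "I \<noteq> {}" and d: "d = card I" and pos: "0 < Rm" "0 < h"
    and z: "\<And>p. p \<in> S \<Longrightarrow> 0 \<le> z p \<and> z p \<le> h" and R: "\<And>p. p \<in> S \<Longrightarrow> norm (coord_proj I p) \<le> Rm"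
    and dist: "\<And>p q. p \<in> S \<Longrightarrow> q \<in> S \<Longrightarrow> (dist p q)\<^sup>2 \<le> (norm (coord_proj I p - coord_proj I q))\<^sup>2 + (z p - z q)\<^sup>2"
    and anti: "\<And>p q. p \<in> S \<Longrightarrow> q \<in> S \<Longrightarrow> norm (coord_proj I p) < norm (coord_proj I q) \<Longrightarrow> z q \<le> z p"
  shows "hausdorff_outer d S \<le> ennreal (2 * sqrt 2 ^ d * slice_const d * Rm ^ (d - 1) * (Rm + h)) *
      hausdorff_outer (d - 1) {x\<in>span I. norm x = 1}"
proof -
  have fin: "finite I" by (rule finite_subset[OF I(1) finite_Basis])
  obtain i where i: "i \<in> I" using I by auto
  let ?X = "coord_proj I"
  \<comment> \<open>On the axis the direction is arbitrary; the basis vector \<open>i\<close> is a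
    unit default.\<close>
  define \<theta> where "\<theta> p = (if ?X p = 0 then i else (1 / norm (?X p)) *\<^sub>R ?X p)" for p
  have th: "\<theta> p \<in> {x\<in>span I. norm x = 1}" for p
    using i I coord_proj_in_span[OF I(1)] by (auto simp: \<theta>_def span_base intro!: span_scale)
  have X: "?X p = norm (?X p) *\<^sub>R \<theta> p" for p by (simp add: \<theta>_def)
  have n1: "norm (\<theta> p) = 1" for p using th by auto
  have polar: "(norm (a *\<^sub>R x - b *\<^sub>R y))\<^sup>2 = (a - b)\<^sup>2 + a * b * (norm (x - y))\<^sup>2" if "norm x = 1" "norm y = 1" for a b :: real and x y :: 'a
  proof -
    have "x \<bullet> x = 1" "y \<bullet> y = 1" using that by (auto simp: norm_eq_1)
    then show ?thesis
      unfolding power2_norm_eq_inner by (simp add: inner_diff_left inner_diff_right inner_commute power2_eq_square algebra_simps)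
  qed
  define \<tau> where "\<tau> p = norm (?X p) + (h - z p)" for p
  show ?thesis
  proof (rule hausdorff_outer_product_le[of d S \<theta> _ \<tau> "Rm + h" Rm])
    show "1 \<le> d" using d fin I(2) by (simp add: Suc_leI card_gt_0_iff)
    show "0 \<le> \<tau> p \<and> \<tau> p \<le> Rm + h" if "p \<in> S" for p using z[OF that] R[OF that] by (auto simp: \<tau>_def add_nonneg_nonneg)
    fix p q assume pq: "p \<in> S" "q \<in> S"
    let ?a = "norm (?X p)" and ?b = "norm (?X q)"
    \<comment> \<open>For equal radii \<open>\<tau>\<close> differs by the heights alone, so
      monotonicity is invoked only for different radii.\<close>
    have same: "(?a - ?b)\<^sup>2 + (z p - z q)\<^sup>2 \<le> (\<tau> p - \<tau> q)\<^sup>2 \<or> ?a = ?b"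
    proof -
      consider "?a < ?b" | "?b < ?a" | "?a = ?b" by linarith
      then show ?thesis
      proof cases
        case 1
        then have "0 \<le> (?a - ?b) * (z q - z p)" using anti[OF pq] by (intro mult_nonpos_nonpos) auto
        then show ?thesis by (simp add: \<tau>_def power2_eq_square algebra_simps)
      next
        case 2
        then have "0 \<le> (?a - ?b) * (z q - z p)" using anti[OF pq(2,1)] by (intro mult_nonneg_nonneg) auto
        then show ?thesis by (simp add: \<tau>_def power2_eq_square algebra_simps)
      qed auto
    qed
    have le: "(?a - ?b)\<^sup>2 + (z p - z q)\<^sup>2 \<le> (\<tau> p - \<tau> q)\<^sup>2"
      using same by (auto simp: \<tau>_def power2_eq_square algebra_simps)
    have "(dist p q)\<^sup>2 \<le> (norm (?X p - ?X q))\<^sup>2 + (z p - z q)\<^sup>2" by (rule dist[OF pq])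
    also have "(norm (?X p - ?X q))\<^sup>2 = (?a - ?b)\<^sup>2 + ?a * ?b * (norm (\<theta> p - \<theta> q))\<^sup>2"
      using polar[OF n1 n1, of ?a p ?b q] X by metis
    also have "(?a - ?b)\<^sup>2 + ?a * ?b * (norm (\<theta> p - \<theta> q))\<^sup>2 + (z p - z q)\<^sup>2 \<le> Rm * Rm * (norm (\<theta> p - \<theta> q))\<^sup>2 + (\<tau> p - \<tau> q)\<^sup>2"
    proof -
      have "?a * ?b * (norm (\<theta> p - \<theta> q))\<^sup>2 \<le> Rm * Rm * (norm (\<theta> p - \<theta> q))\<^sup>2"
        using R[OF pq(1)] R[OF pq(2)] pos by (intro mult_right_mono mult_mono) auto
      then show ?thesis using le by linarith
    qed
    finally show "(dist p q)\<^sup>2 \<le> (Rm * dist (\<theta> p) (\<theta> q))\<^sup>2 + (\<tau> p - \<tau> q)\<^sup>2"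
      by (simp add: dist_norm power_mult_distrib power2_eq_square[of Rm])
  qed (use pos th in auto)
qed

section \<open>Hamiltonian paths in grids and the separation of their edges\<close>

lemma grid_path:
  assumes "finite J" "0 < m"
  shows "\<exists>c :: nat \<Rightarrow> 'b \<Rightarrow> int. inj_on c {..<m ^ card J} \<and> (\<forall>i<m ^ card J. \<forall>j. 0 \<le> c i j \<and> c i j \<le> int m - 1 \<and> (j \<notin> J \<longrightarrow> c i j = 0)) \<and>
    (\<forall>i. Suc i < m ^ card J \<longrightarrow> (\<exists>j\<in>J. \<exists>s\<in>{1,-1}. c (Suc i) = (c i)(j := c i j + s)))"
  using assms(1)
proof (induction J)
  case empty
  show ?case using assms(2) by (intro exI[of _ "\<lambda>_ _. 0"]) (auto simp: inj_on_def)
next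
  case (insert a J)
  obtain c :: "nat \<Rightarrow> 'b \<Rightarrow> int" where c: "inj_on c {..<m ^ card J}"
      "\<And>i j. i < m ^ card J \<Longrightarrow> 0 \<le> c i j \<and> c i j \<le> int m - 1 \<and> (j \<notin> J \<longrightarrow> c i j = 0)"
      "\<And>i. Suc i < m ^ card J \<Longrightarrow> \<exists>j\<in>J. \<exists>s\<in>{1,-1}. c (Suc i) = (c i)(j := c i j + s)"
    using insert.IH by blast
  \<comment> \<open>Boustrophedon order: the new coordinate runs up in even blocks and down in odd
    ones, so at a change of block it stays put while the old path makes its step.\<close>
  define g where "g i = (if even (i div m) then int (i mod m) else int m - 1 - int (i mod m))" for i
  define c' where "c' i = (c (i div m))(a := g i)" for i
  have M: "m ^ card (insert a J) = m * m ^ card J" using insert by simp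
  have dv: "i div m < m ^ card J" if "i < m * m ^ card J" for i
    using that assms(2) by (simp add: less_mult_imp_div_less mult.commute)
  have ml: "i mod m < m" for i using assms(2) by simp
  have a0: "c i a = 0" if "i < m ^ card J" for i using c(2)[OF that, of a] insert(2) by auto
  have "inj_on c' {..<m * m ^ card J}"
  proof (rule inj_onI)
    fix x y assume xy: "x \<in> {..<m * m ^ card J}" "y \<in> {..<m * m ^ card J}" "c' x = c' y"
    have "c (x div m) = (c' x)(a := 0)" "c (y div m) = (c' y)(a := 0)"
      using a0 dv xy by (auto simp: c'_def fun_eq_iff)
    then have "c (x div m) = c (y div m)" using xy by simp
    then have D: "x div m = y div m" using c(1) dv xy by (auto dest: inj_onD)
    have "g x = g y" using fun_cong[OF xy(3), of a] by (simp add: c'_def)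
    then have "x mod m = y mod m" using D by (auto simp: g_def split: if_splits)
    then show "x = y" using D by (metis div_mult_mod_eq)
  qed
  moreover have "0 \<le> c' i j \<and> c' i j \<le> int m - 1 \<and> (j \<notin> insert a J \<longrightarrow> c' i j = 0)" if "i < m * m ^ card J" for i j
    using c(2)[OF dv[OF that], of j] ml[of i] by (auto simp: c'_def g_def)
  moreover have "\<exists>j\<in>insert a J. \<exists>s\<in>{1,-1}. c' (Suc i) = (c' i)(j := c' i j + s)" if i: "Suc i < m * m ^ card J" for i
  proof (cases "Suc (i mod m) = m")
    case True
    then have "Suc i mod m = 0" "Suc i div m = Suc (i div m)" by (auto simp: mod_Suc div_Suc)
    moreover have "Suc (i div m) < m ^ card J" using dv[OF i] calculation by simp
    then obtain j s where js: "j \<in> J" "s \<in> {1,-1}" "c (Suc (i div m)) = (c (i div m))(j := c (i div m) j + s)" using c(3) by blast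
    moreover have "g (Suc i) = g i" using calculation(1,2) True by (auto simp: g_def)
    moreover have "j \<noteq> a" using js insert(2) by auto
    ultimately have "c' (Suc i) = (c' i)(j := c' i j + s)" by (auto simp: c'_def fun_eq_iff)
    then show ?thesis using js by blast
  next
    case False
    then have "Suc i mod m = Suc (i mod m)" "Suc i div m = i div m" by (auto simp: mod_Suc div_Suc)
    then have "c' (Suc i) = (c' i)(a := c' i a + (if even (i div m) then 1 else -1))"
      by (auto simp: c'_def g_def fun_eq_iff)
    then show ?thesis by (intro bexI[of _ a] bexI[of _ "if even (i div m) then 1 else -1"]) auto
  qed
  ultimately show ?case unfolding M by (intro exI[of _ c']) blast
qed

text \<open>If all the coordinates in question differed by less than 1, those other than j and j'
  would agree, and in the directions j and j' integrality would match an endpoint of one edge with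
  an endpoint of the other. Allowing steps of size 0 covers single vertices. The restriction on k
  keeps the coordinate among the directions in which the path can move.\<close>

lemma lattice_edges_far:
  fixes a b a' b' :: "'b \<Rightarrow> int" and t t' :: real
  assumes ab: "b = a(j := a j + s)" "\<bar>s\<bar> \<le> 1" and ab': "b' = a'(j' := a' j' + s')" "\<bar>s'\<bar> \<le> 1"
    and disj: "a \<noteq> a'" "a \<noteq> b'" "b \<noteq> a'" "b \<noteq> b'" and t: "0 \<le> t" "t \<le> 1" "0 \<le> t'" "t' \<le> 1"
  shows "\<exists>k\<in>{k. a k \<noteq> a' k \<or> k = j \<or> k = j'}. 1 \<le> \<bar>(a k + t * (b k - a k)) - (a' k + t' * (b' k - a' k))\<bar>"
proof (rule ccontr)
  assume neg: "\<not> ?thesis"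
  have lt: "\<bar>(a k + t * (b k - a k)) - (a' k + t' * (b' k - a' k))\<bar> < 1" if "a k \<noteq> a' k \<or> k = j \<or> k = j'" for k
    using neg that by (auto simp: not_le)
  have off: "a k = a' k" if "k \<noteq> j" "k \<noteq> j'" for k
  proof (rule ccontr)
    assume ne: "a k \<noteq> a' k"
    have "\<bar>real_of_int (a k - a' k)\<bar> < 1" using lt[of k] ne that ab ab' by simp
    then show False using ne by linarith
  qed
  have s01: "s = 0 \<or> s = 1 \<or> s = -1" "s' = 0 \<or> s' = 1 \<or> s' = -1" using ab(2) ab'(2) by auto
  have ext': "f = g" if "f j = g j" "f j' = g j'" "\<And>k. k \<noteq> j \<Longrightarrow> k \<noteq> j' \<Longrightarrow> f k = g k" for f g :: "'b \<Rightarrow> int"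
    by (rule ext) (metis that)
  \<comment> \<open>A point x + t * s of a unit edge is at distance less than 1 only from those
    integers that are its endpoints.\<close>
  have near: "\<lbrakk>\<bar>(real_of_int x + t * real_of_int s) - real_of_int y\<bar> < 1; s = 0 \<or> s = 1 \<or> s = -1; 0 \<le> t; t \<le> 1\<rbrakk> \<Longrightarrow> y = x \<or> y = x + s" for x y s :: int and t :: real
    by (elim disjE) (simp_all, linarith+)
  show False
  proof (cases "j = j'")
    case True
    have l: "\<bar>(a j + t * s) - (a' j + t' * s')\<bar> < 1" using lt[of j] True ab ab' by simp
    have "0 \<le> t * s \<and> t * s \<le> 1 \<and> s = 1 \<or> -1 \<le> t * s \<and> t * s \<le> 0 \<and> s = -1 \<or> t * s = 0 \<and> s = 0" using s01(1) t by auto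
    moreover have "0 \<le> t' * s' \<and> t' * s' \<le> 1 \<and> s' = 1 \<or> -1 \<le> t' * s' \<and> t' * s' \<le> 0 \<and> s' = -1 \<or> t' * s' = 0 \<and> s' = 0" using s01(2) t by auto
    ultimately have "a j = a' j \<or> a j = a' j + s' \<or> a j + s = a' j \<or> a j + s = a' j + s'"
      using l by (elim disjE conjE) (simp_all, linarith+)
    then consider "a j = a' j" | "a j = a' j + s'" | "a j + s = a' j" | "a j + s = a' j + s'" by blast
    then show False
    proof cases
      case 1 then have "a = a'" using off True by (intro ext') auto
      then show False using disj by simp
    next
      case 2 then have "a = b'" using off True ab'(1) by (intro ext') auto
      then show False using disj by simp
    next
      case 3 then have "b = a'" using off True ab(1) by (intro ext') auto
      then show False using disj by simp
    next
      case 4 then have "b = b'" using off True ab(1) ab'(1) by (intro ext') auto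
      then show False using disj by simp
    qed
  next
    case False
    have 1: "\<bar>(a j + t * s) - a' j\<bar> < 1" using lt[of j] False ab ab' by simp
    have 2: "\<bar>(a' j' + t' * s') - a j'\<bar> < 1" using lt[of j'] False ab ab' by (simp add: abs_minus_commute)
    consider "a' j = a j" "a j' = a' j'" | "a' j = a j" "a j' = a' j' + s'" | "a' j = a j + s" "a j' = a' j'" | "a' j = a j + s" "a j' = a' j' + s'"
      using near[OF 1 s01(1) t(1,2)] near[OF 2 s01(2) t(3,4)] by blast
    then show False
    proof cases
      case 1 then have "a = a'" using off by (intro ext') auto
      then show False using disj by simp
    next
      case 2 then have "a = b'" using off False ab'(1) by (intro ext') auto
      then show False using disj by simp
    next
      case 3 then have "b = a'" using off False ab(1) by (intro ext') auto
      then show False using disj by simp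
    next
      case 4 then have "b = b'" using off False ab(1) ab'(1) by (intro ext') auto
      then show False using disj by simp
    qed
  qed
qed

section \<open>Chains of flattened discs\<close>

lemma coord_proj_compl:
  assumes "I \<subseteq> Basis" shows "p - coord_proj I p = coord_proj (Basis - I) p"
proof (rule euclidean_eqI)
  fix b :: 'a assume b: "b \<in> Basis"
  show "(p - coord_proj I p) \<bullet> b = coord_proj (Basis - I) p \<bullet> b"
    using b assms by (simp add: inner_diff_left coord_proj_inner coord_proj_inner[of "Basis - I"])
qed

lemma revolution_iff_height:
  fixes I :: "'a::euclidean_space set"
  assumes I: "I \<subseteq> Basis" and e: "e \<in> Basis" "e \<notin> I" and u: "coord_proj I u = 0" and r: "0 < r"
  shows "p \<in> revolution I u e r F \<longleftrightarrow> (\<exists>t. p - coord_proj I p = u + (r * t) *\<^sub>R e \<and> t\<^sup>2 + F (coord_proj I p \<bullet> coord_proj I p) = 1)"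
proof
  assume "p \<in> revolution I u e r F"
  then have p: "p - u \<in> span (insert e I)" "((p - u) \<bullet> e)\<^sup>2 / r\<^sup>2 + F (coord_proj I p \<bullet> coord_proj I p) = 1"
    by (auto simp: revolution_def)
  have "p - u = coord_proj (insert e I) (p - u)" using span_coord[of "insert e I"] I e p(1) by simp
  also have "\<dots> = coord_proj I (p - u) + ((p - u) \<bullet> e) *\<^sub>R e"
    using e finite_subset[OF I finite_Basis] by (simp add: coord_proj_def)
  also have "coord_proj I (p - u) = coord_proj I p" using linear_diff[OF linear_coord_proj, of I p u] u by simp
  finally have "p - u = coord_proj I p + ((p - u) \<bullet> e) *\<^sub>R e" .
  moreover have "r * (((p - u) \<bullet> e) / r) = (p - u) \<bullet> e" using r by simp
  ultimately have "p - coord_proj I p = u + (r * (((p - u) \<bullet> e) / r)) *\<^sub>R e" by (simp only:) (metis add_diff_eq add_diff_cancel_left' diff_add_cancel add.commute)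
  then show "\<exists>t. p - coord_proj I p = u + (r * t) *\<^sub>R e \<and> t\<^sup>2 + F (coord_proj I p \<bullet> coord_proj I p) = 1"
    using p(2) by (intro exI[of _ "((p - u) \<bullet> e) / r"]) (simp add: power_divide)
next
  assume "\<exists>t. p - coord_proj I p = u + (r * t) *\<^sub>R e \<and> t\<^sup>2 + F (coord_proj I p \<bullet> coord_proj I p) = 1"
  then obtain t where t: "p - coord_proj I p = u + (r * t) *\<^sub>R e" "t\<^sup>2 + F (coord_proj I p \<bullet> coord_proj I p) = 1" by blast
  have pu: "p - u = coord_proj I p + (r * t) *\<^sub>R e" using t(1) by (simp add: algebra_simps)
  have "p - u \<in> span (insert e I)" unfolding pu
    by (intro span_add span_scale) (auto intro: span_base subsetD[OF span_mono[of I "insert e I"]] coord_proj_in_span[OF I])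
  moreover have "(p - u) \<bullet> e = r * t" unfolding pu using coord_proj_inner[OF I e(1), of p] e by (simp add: inner_add_left)
  ultimately show "p \<in> revolution I u e r F" using t(2) r by (simp add: revolution_def power_mult_distrib)
qed

text \<open>I spans the directions of the discs, J those of the stacking. The path c has 2 * N
  vertices, one for each flat sheet: sheets 2l and 2l + 1 are joined along the outer rim to form the
  l-th disc, sheets 2l + 1 and 2l + 2 through a neck in the middle, and the first and last sheets
  are left without a hole.\<close>

locale snake =
  fixes I J :: "'a::euclidean_space set" and r B C :: real and N :: nat and c :: "nat \<Rightarrow> 'a \<Rightarrow> int" and z0 :: 'a
  assumes I: "I \<subseteq> Basis" "I \<noteq> {}" and J: "J \<subseteq> Basis" "I \<inter> J = {}" and r: "0 < r"
    and C: "0 < C" "C\<^sup>2 = 24 * r\<^sup>2 * B" "30 * r\<^sup>2 \<le> C" and N: "1 \<le> N"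
    and z0: "coord_proj I z0 = 0"
    and inj: "inj_on c {..<2 * N}" and supp: "\<And>i j. i < 2 * N \<Longrightarrow> j \<notin> J \<Longrightarrow> c i j = 0"
    and step: "\<And>i. Suc i < 2 * N \<Longrightarrow> \<exists>j\<in>J. \<exists>s\<in>{1,-1}. c (Suc i) = (c i)(j := c i j + s)"
begin

abbreviation "X \<equiv> coord_proj I"
abbreviation "Y p \<equiv> p - X p"

definition "v i = z0 + (\<Sum>j\<in>J. (2 * r * real_of_int (c i j)) *\<^sub>R j)"
definition "ed i = (SOME j. j \<in> J \<and> (\<exists>s\<in>{1,-1}. c (Suc i) = (c i)(j := c i j + s)))"
definition "mid i = (1/2) *\<^sub>R (v i + v (Suc i))"

text \<open>The cut at radius 4r lies where both profiles are flat: the neck from radius sqrt 8 * r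
  < 3r on, the rim up to radius sqrt B \<ge> 6r. Pieces that meet there share a plane, so gluing
  them costs no smoothness.\<close>

definition "rim l = {p \<in> revolution I (mid (2 * l)) (ed (2 * l)) r (rimF B C). 4 * r \<le> norm (X p)}"
definition "neck l = {p \<in> revolution I (mid (Suc (2 * l))) (ed (Suc (2 * l))) r (neckF (8 * r\<^sup>2)). norm (X p) \<le> 4 * r}"
definition "cap i = {p. Y p = v i \<and> norm (X p) \<le> 4 * r}"
definition "M = (\<Union>l<N. rim l) \<union> (\<Union>l\<in>{l. Suc l < N}. neck l) \<union> cap 0 \<union> cap (2 * N - 1)"

lemma finI: "finite I" and finJ: "finite J"
  using I J finite_subset[OF _ finite_Basis] by auto

lemma B_ge: "36 * r\<^sup>2 \<le> B"
proof -
  have "(30 * r\<^sup>2)\<^sup>2 \<le> C\<^sup>2" using C(3) by (intro power_mono) auto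
  then have "900 * (r\<^sup>2 * r\<^sup>2) \<le> r\<^sup>2 * (24 * B)" unfolding C(2) by (simp add: power2_eq_square mult_ac)
  then have "r\<^sup>2 * (900 * r\<^sup>2) \<le> r\<^sup>2 * (24 * B)" by (simp add: mult_ac)
  then have "900 * r\<^sup>2 \<le> 24 * B" using r by (subst (asm) mult_le_cancel_left_pos) auto
  then show ?thesis using zero_le_power2[of r] by linarith
qed

lemma ed: assumes "Suc i < 2 * N"
  shows "ed i \<in> J" "\<exists>s\<in>{1,-1}. c (Suc i) = (c i)(ed i := c i (ed i) + s)"
  using someI_ex[of "\<lambda>j. j \<in> J \<and> (\<exists>s\<in>{1,-1}. c (Suc i) = (c i)(j := c i j + s))"] step[OF assms]
  unfolding ed_def[symmetric] by blast+

lemma ed_basis: assumes "Suc i < 2 * N" shows "ed i \<in> Basis" "ed i \<notin> I"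
  using ed(1)[OF assms] J by auto

lemma v_inner: "k \<in> Basis \<Longrightarrow> v i \<bullet> k = z0 \<bullet> k + (if k \<in> J then 2 * r * real_of_int (c i k) else 0)"
proof -
  assume k: "k \<in> Basis"
  have "(\<Sum>j\<in>J. (2 * r * real_of_int (c i j)) *\<^sub>R j) \<bullet> k = (\<Sum>j\<in>J. if j = k then 2 * r * real_of_int (c i j) else 0)"
    unfolding inner_sum_left using J k by (intro sum.cong) (auto simp: inner_Basis)
  then show ?thesis using finJ by (simp add: v_def inner_add_left)
qed

lemma X_v: "X (v i) = 0"
proof (rule euclidean_eqI)
  fix b :: 'a assume b: "b \<in> Basis"
  have "b \<in> I \<Longrightarrow> z0 \<bullet> b = 0" using coord_proj_inner[OF I(1) b, of z0] z0 by simp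
  then show "X (v i) \<bullet> b = 0 \<bullet> b" using b J by (auto simp: coord_proj_inner[OF I(1)] v_inner)
qed

lemma linX: "linear X" by (rule linear_coord_proj)

lemma X_basis: assumes "e \<in> Basis" "e \<notin> I" shows "X e = 0"
proof (rule euclidean_eqI)
  fix b :: 'a assume b: "b \<in> Basis"
  then show "X e \<bullet> b = 0 \<bullet> b" using assms by (auto simp: coord_proj_inner[OF I(1) b] inner_Basis)
qed

lemma X_mid: "X (mid i) = 0"
  unfolding mid_def linear_scale[OF linX] linear_add[OF linX] X_v by simp

lemma v_step: assumes "Suc i < 2 * N"
  obtains s :: real where "s = 1 \<or> s = -1" "v (Suc i) = v i + (2 * r * s) *\<^sub>R ed i"
proof -
  obtain s where s0: "s \<in> {1, -1}" and s2: "c (Suc i) = (c i)(ed i := c i (ed i) + s)" by (rule bexE[OF ed(2)[OF assms]])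
  then have s: "s = 1 \<or> s = -1" "c (Suc i) = (c i)(ed i := c i (ed i) + s)" by auto
  have "v (Suc i) = v i + (2 * r * real_of_int s) *\<^sub>R ed i"
  proof (rule euclidean_eqI)
    fix b :: 'a assume b: "b \<in> Basis"
    show "v (Suc i) \<bullet> b = (v i + (2 * r * real_of_int s) *\<^sub>R ed i) \<bullet> b"
      using b ed(1)[OF assms] ed_basis(1)[OF assms] s(2) by (auto simp: v_inner inner_add_left inner_Basis algebra_simps)
  qed
  moreover have "real_of_int s = 1 \<or> real_of_int s = -1" using s(1) by auto
  ultimately show ?thesis using that by blast
qed

text \<open>\<open>lattice_edges_far\<close> scaled by the mesh 2 * r. The choice k = i stands for a
  single sheet, as needed for the caps.\<close>

lemma far:
  assumes i: "k < 2 * N" "k = i \<or> k = Suc i" and i': "k' < 2 * N" "k' = i' \<or> k' = Suc i'"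
    and disj: "i \<noteq> i'" "i \<noteq> k'" "k \<noteq> i'" "k \<noteq> k'" and t: "0 \<le> t" "t \<le> 1" "0 \<le> t'" "t' \<le> 1"
  shows "2 * r \<le> dist (v i + t *\<^sub>R (v k - v i)) (v i' + t' *\<^sub>R (v k' - v i'))"
proof -
  have lt: "i < 2 * N" "i' < 2 * N" using i i' by auto
  have "Suc 0 < 2 * N" using N by simp
  then obtain j0 where j0: "j0 \<in> J" using ed(1) by blast
  have ex: "\<exists>j\<in>J. \<exists>s. \<bar>s\<bar> \<le> 1 \<and> c b = (c a)(j := c a j + s)" if "b < 2 * N" "b = a \<or> b = Suc a" for a b
  proof (cases "b = a")
    case True then show ?thesis using j0 by (intro bexI[of _ j0] exI[of _ 0]) auto
  next
    case False
    then have ba: "b = Suc a" using that by simp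
    have sa: "Suc a < 2 * N" using that ba by simp
    obtain s where "s \<in> {1, -1}" "c (Suc a) = (c a)(ed a := c a (ed a) + s)" by (rule bexE[OF ed(2)[OF sa]])
    then show ?thesis using ed(1)[OF sa] ba by (intro bexI[of _ "ed a"] exI[of _ s]) auto
  qed
  obtain j s where js: "j \<in> J" "\<bar>s\<bar> \<le> 1" "c k = (c i)(j := c i j + s)" using ex[OF i] by blast
  obtain j' s' where js': "j' \<in> J" "\<bar>s'\<bar> \<le> 1" "c k' = (c i')(j' := c i' j' + s')" using ex[OF i'] by blast
  have ne: "c x \<noteq> c y" if "x < 2 * N" "y < 2 * N" "x \<noteq> y" for x y using inj that by (auto dest: inj_onD)
  obtain \<kappa> where k: "c i \<kappa> \<noteq> c i' \<kappa> \<or> \<kappa> = j \<or> \<kappa> = j'"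
      "1 \<le> \<bar>(c i \<kappa> + t * (c k \<kappa> - c i \<kappa>)) - (c i' \<kappa> + t' * (c k' \<kappa> - c i' \<kappa>))\<bar>"
    using lattice_edges_far[OF js(3,2) js'(3,2) ne ne ne ne t] lt i i' disj by auto
  have kJ: "\<kappa> \<in> J" using k(1) js js' supp[OF lt(1), of \<kappa>] supp[OF lt(2), of \<kappa>] by (cases "\<kappa> \<in> J") auto
  then have kB: "\<kappa> \<in> Basis" using J by auto
  let ?y = "v i + t *\<^sub>R (v k - v i)" and ?y' = "v i' + t' *\<^sub>R (v k' - v i')"
  have "(?y - ?y') \<bullet> \<kappa> = 2 * r * ((c i \<kappa> + t * (c k \<kappa> - c i \<kappa>)) - (c i' \<kappa> + t' * (c k' \<kappa> - c i' \<kappa>)))"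
    using kJ by (simp add: inner_diff_left inner_add_left v_inner[OF kB] algebra_simps)
  then have "2 * r * 1 \<le> \<bar>(?y - ?y') \<bullet> \<kappa>\<bar>" using k(2) r by (simp add: abs_mult)
  also have "\<dots> \<le> norm (?y - ?y')" by (rule Basis_le_norm[OF kB])
  finally show ?thesis by (simp add: dist_norm)
qed

lemma v_far: "i < 2 * N \<Longrightarrow> i' < 2 * N \<Longrightarrow> i \<noteq> i' \<Longrightarrow> 2 * r \<le> dist (v i) (v i')"
  using far[of i i i' i' 0 0] by simp

lemma Y_dist: "dist (Y p) (Y q) \<le> dist p q"
proof -
  have "Y p - Y q = coord_proj (Basis - I) (p - q)"
    using coord_proj_compl[OF I(1), of "p - q"] linear_diff[OF linX, of p q] by (simp add: algebra_simps)
  then show ?thesis using norm_coord_proj_le[of "Basis - I" "p - q"] by (simp add: dist_norm)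
qed

lemma X_dist: "\<bar>norm (X p) - norm (X q)\<bar> \<le> dist p q"
proof -
  have "\<bar>norm (X p) - norm (X q)\<bar> \<le> norm (X (p - q))"
    unfolding linear_diff[OF linX] by (rule norm_triangle_ineq3)
  then show ?thesis using norm_coord_proj_le[OF I(1), of "p - q"] by (simp add: dist_norm)
qed

lemma XX: "X p \<bullet> X p = (norm (X p))\<^sup>2" by (simp add: power2_norm_eq_inner)

lemma rev_iff: "Suc i < 2 * N \<Longrightarrow> p \<in> revolution I (mid i) (ed i) r F \<longleftrightarrow>
    (\<exists>t. Y p = mid i + (r * t) *\<^sub>R ed i \<and> t\<^sup>2 + F (X p \<bullet> X p) = 1)"
  by (rule revolution_iff_height[OF I(1) ed_basis X_mid r])

lemma on_edge:
  assumes i: "Suc i < 2 * N" and p: "p \<in> revolution I (mid i) (ed i) r F" and F: "0 \<le> F (X p \<bullet> X p)"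
  shows "\<exists>t. 0 \<le> t \<and> t \<le> 1 \<and> Y p = v i + t *\<^sub>R (v (Suc i) - v i)"
    "F (X p \<bullet> X p) = 0 \<Longrightarrow> Y p = v i \<or> Y p = v (Suc i)"
proof -
  obtain t where t: "Y p = mid i + (r * t) *\<^sub>R ed i" "t\<^sup>2 + F (X p \<bullet> X p) = 1" using p rev_iff[OF i] by blast
  obtain s where s: "s = 1 \<or> s = -1" "v (Suc i) = v i + (2 * r * s) *\<^sub>R ed i" by (rule v_step[OF i])
  have ss: "s * s = 1" using s(1) by auto
  have "t\<^sup>2 \<le> 1" using t(2) F by linarith
  then have t1: "\<bar>t\<bar> \<le> 1" by (simp add: abs_square_le_1)
  have st: "\<bar>s * t\<bar> \<le> 1" using s(1) t1 by auto
  \<comment> \<open>The height t is measured along \<open>ed i\<close>, whereas the edge runs in the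
    direction s times \<open>ed i\<close>; hence the parameter (1 + s * t) / 2.\<close>
  have "Y p = v i + ((1 + s * t) / 2) *\<^sub>R (v (Suc i) - v i)"
  proof -
    have "v i + ((1 + s * t) / 2) *\<^sub>R (v (Suc i) - v i) = v i + (r * s + r * (s * s) * t) *\<^sub>R ed i"
    proof -
      have "((1 + s * t) / 2) * (2 * r * s) = r * s + r * (s * s) * t" by (simp add: field_simps)
      then show ?thesis unfolding s(2) by (simp only: add_diff_cancel_left' scaleR_scaleR)
    qed
    also have "\<dots> = v i + (r * s) *\<^sub>R ed i + (r * t) *\<^sub>R ed i" by (simp add: ss scaleR_add_left)
    also have "v i + (r * s) *\<^sub>R ed i = mid i" unfolding mid_def s(2) by (simp add: algebra_simps) (simp flip: scaleR_add_left)
    finally show ?thesis using t(1) by simp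
  qed
  then show "\<exists>t. 0 \<le> t \<and> t \<le> 1 \<and> Y p = v i + t *\<^sub>R (v (Suc i) - v i)"
    using st by (intro exI[of _ "(1 + s * t) / 2"]) auto
  assume "F (X p \<bullet> X p) = 0"
  then have "t = 1 \<or> t = -1" using t(2) by (simp add: power2_eq_1_iff)
  then have "s * t = 1 \<or> s * t = -1" using s(1) by auto
  then show "Y p = v i \<or> Y p = v (Suc i)" using \<open>Y p = v i + ((1 + s * t) / 2) *\<^sub>R (v (Suc i) - v i)\<close> by auto
qed

lemma flat_in_rev:
  assumes i: "Suc i < 2 * N" and Yp: "Y p = v i \<or> Y p = v (Suc i)" and F: "F (X p \<bullet> X p) = 0"
  shows "p \<in> revolution I (mid i) (ed i) r F"
proof -
  obtain s where s: "s = 1 \<or> s = -1" "v (Suc i) = v i + (2 * r * s) *\<^sub>R ed i" by (rule v_step[OF i])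
  have m: "mid i = v i + (r * s) *\<^sub>R ed i" unfolding mid_def s(2) by (simp add: algebra_simps) (simp flip: scaleR_add_left)
  have "\<exists>t. Y p = mid i + (r * t) *\<^sub>R ed i \<and> t\<^sup>2 = 1"
  proof (cases "Y p = v i")
    case True then show ?thesis using s(1) by (intro exI[of _ "-s"]) (auto simp: m)
  next
    case False
    then have "Y p = mid i + (r * s) *\<^sub>R ed i" using Yp by (simp add: m s(2) algebra_simps flip: scaleR_add_left)
    then show ?thesis using s(1) by (intro exI[of _ s]) auto
  qed
  then show ?thesis using F rev_iff[OF i] by auto
qed

lemma rim_nonneg: "0 \<le> rimF B C s" and neck_nonneg: "0 \<le> neckF A s"
  by (auto simp: rimF_def neckF_def)

lemma rim_zero: "s \<le> B \<Longrightarrow> rimF B C s = 0"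
  using C(1) by (simp add: rimF_def divide_nonpos_pos)

lemma neck_zero: "8 * r\<^sup>2 \<le> s \<Longrightarrow> neckF (8 * r\<^sup>2) s = 0"
  using r by (simp add: neckF_def divide_nonpos_pos)

lemma rim_flat: "norm (X p) \<le> 5 * r \<Longrightarrow> rimF B C (X p \<bullet> X p) = 0"
proof -
  assume "norm (X p) \<le> 5 * r"
  then have "(norm (X p))\<^sup>2 \<le> (5 * r)\<^sup>2" by (intro power_mono) auto
  moreover have "(5 * r)\<^sup>2 = 25 * r\<^sup>2" by (simp add: power_mult_distrib)
  ultimately have "X p \<bullet> X p \<le> B" using B_ge zero_le_power2[of r] unfolding XX by linarith
  then show ?thesis by (rule rim_zero)
qed

lemma neck_flat: "3 * r \<le> norm (X p) \<Longrightarrow> neckF (8 * r\<^sup>2) (X p \<bullet> X p) = 0"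
proof -
  assume "3 * r \<le> norm (X p)"
  then have "(3 * r)\<^sup>2 \<le> (norm (X p))\<^sup>2" using r by (intro power_mono) auto
  moreover have "(3 * r)\<^sup>2 = 9 * r\<^sup>2" by (simp add: power_mult_distrib)
  ultimately have "8 * r\<^sup>2 \<le> X p \<bullet> X p" using zero_le_power2[of r] unfolding XX by linarith
  then show ?thesis by (rule neck_zero)
qed

lemma rim_edge: assumes "l < N" "p \<in> rim l"
  shows "\<exists>t. 0 \<le> t \<and> t \<le> 1 \<and> Y p = v (2 * l) + t *\<^sub>R (v (Suc (2 * l)) - v (2 * l))"
    "norm (X p) \<le> 5 * r \<Longrightarrow> Y p = v (2 * l) \<or> Y p = v (Suc (2 * l))"
  using on_edge[of "2 * l" p "rimF B C"] assms rim_nonneg rim_flat by (auto simp: rim_def)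

lemma neck_edge: assumes "Suc l < N" "p \<in> neck l"
  shows "\<exists>t. 0 \<le> t \<and> t \<le> 1 \<and> Y p = v (Suc (2 * l)) + t *\<^sub>R (v (Suc (Suc (2 * l))) - v (Suc (2 * l)))"
    "3 * r \<le> norm (X p) \<Longrightarrow> Y p = v (Suc (2 * l)) \<or> Y p = v (Suc (Suc (2 * l)))"
  using on_edge[of "Suc (2 * l)" p "neckF (8 * r\<^sup>2)"] assms neck_nonneg neck_flat by (auto simp: neck_def)

text \<open>Every sheet other than the first and last is an endpoint of an odd edge, so a neck
  supplies its annulus between radii 3r and 4r; the end sheets get it from the caps.\<close>

lemma plane_in_M:
  assumes a: "a < 2 * N" "Y p = v a" and p: "3 * r \<le> norm (X p)" "norm (X p) \<le> 4 * r"
  shows "p \<in> M"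
proof (cases "a = 0 \<or> a = 2 * N - 1")
  case True then show ?thesis using a p by (auto simp: M_def cap_def)
next
  case False
  define l where "l = (a - 1) div 2"
  have l: "Suc l < N" "a = Suc (2 * l) \<or> a = Suc (Suc (2 * l))" using False a by (auto simp: l_def)
  have "p \<in> revolution I (mid (Suc (2 * l))) (ed (Suc (2 * l))) r (neckF (8 * r\<^sup>2))"
    using l a by (intro flat_in_rev neck_flat p) auto
  then show ?thesis using l p by (auto simp: M_def neck_def)
qed

lemma Y_cases:
  assumes "q \<in> M"
  obtains (rim) l where "l < N" "q \<in> rim l" | (neck) l where "Suc l < N" "q \<in> neck l" | (cap) i where "i = 0 \<or> i = 2 * N - 1" "q \<in> cap i"
  using assms unfolding M_def by blast

lemma same_plane:
  assumes "Y p = v a" "Y q = v b" "a < 2 * N" "b < 2 * N" "dist p q < r"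
  shows "a = b"
  using v_far[of a b] Y_dist[of p q] assms r by fastforce

text \<open>Pieces on disjoint edges are at least 2 * r apart. If q lies in a neck or a cap, both
  points are in flat parts, hence on sheets, and a distance below r forces the same sheet. The next
  two lemmas follow the same pattern.\<close>

lemma near_rim:
  assumes l: "l < N" "p \<in> rim l" and q: "q \<in> M" "dist p q < r"
  shows "q \<in> revolution I (mid (2 * l)) (ed (2 * l)) r (rimF B C)"
proof -
  have sl: "Suc (2 * l) < 2 * N" using l by auto
  have pX: "4 * r \<le> norm (X p)" using l by (simp add: rim_def)
  have plane: "q \<in> revolution I (mid (2 * l)) (ed (2 * l)) r (rimF B C)"
    if "norm (X q) \<le> 4 * r" "Y q = v b" "b < 2 * N" for b
  proof -
    have p5: "norm (X p) \<le> 5 * r" using X_dist[of p q] q that by linarith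
    then have "Y p = v (2 * l) \<or> Y p = v (Suc (2 * l))" using rim_edge(2)[OF l] by simp
    then have "b = 2 * l \<or> b = Suc (2 * l)" using same_plane[of p _ q b] that q sl by (metis Suc_lessD)
    then show ?thesis using that r by (intro flat_in_rev[OF sl] rim_flat) auto
  qed
  from q(1) show ?thesis
  proof (cases rule: Y_cases)
    case (rim l')
    show ?thesis
    proof (cases "l = l'")
      case True then show ?thesis using rim by (simp add: rim_def)
    next
      case False
      obtain t where t: "0 \<le> t" "t \<le> 1" "Y p = v (2 * l) + t *\<^sub>R (v (Suc (2 * l)) - v (2 * l))" using rim_edge(1)[OF l] by blast
      obtain t' where t': "0 \<le> t'" "t' \<le> 1" "Y q = v (2 * l') + t' *\<^sub>R (v (Suc (2 * l')) - v (2 * l'))" using rim_edge(1)[OF rim] by blast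
      have n: "2 * l \<noteq> 2 * l'" "2 * l \<noteq> Suc (2 * l')" "Suc (2 * l) \<noteq> 2 * l'" "Suc (2 * l) \<noteq> Suc (2 * l')"
        using False by presburger+
      have sl': "Suc (2 * l') < 2 * N" using rim by auto
      have "2 * r \<le> dist (Y p) (Y q)" unfolding t(3) t'(3)
        by (rule far[OF sl _ sl' _ n t(1,2) t'(1,2)]) auto
      then show ?thesis using Y_dist[of p q] q r by linarith
    qed
  next
    case (neck l')
    have qX: "norm (X q) \<le> 4 * r" using neck by (simp add: neck_def)
    have "3 * r \<le> norm (X q)" using X_dist[of p q] pX q by linarith
    then obtain b where "Y q = v b" "b < 2 * N" using neck_edge(2)[OF neck] neck(1) by force
    then show ?thesis using plane qX by blast
  next
    case (cap i)
    then show ?thesis using plane[of i] N by (auto simp: cap_def)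
  qed
qed

lemma near_neck:
  assumes l: "Suc l < N" "p \<in> neck l" and q: "q \<in> M" "dist p q < r"
  shows "q \<in> revolution I (mid (Suc (2 * l))) (ed (Suc (2 * l))) r (neckF (8 * r\<^sup>2))"
proof -
  have sl: "Suc (Suc (2 * l)) < 2 * N" using l by auto
  have pX: "norm (X p) \<le> 4 * r" using l by (simp add: neck_def)
  obtain t where t: "0 \<le> t" "t \<le> 1" "Y p = v (Suc (2 * l)) + t *\<^sub>R (v (Suc (Suc (2 * l))) - v (Suc (2 * l)))"
    using neck_edge(1)[OF l] by blast
  from q(1) show ?thesis
  proof (cases rule: Y_cases)
    case (neck l')
    show ?thesis
    proof (cases "l = l'")
      case True then show ?thesis using neck by (simp add: neck_def)
    next
      case False
      obtain t' where t': "0 \<le> t'" "t' \<le> 1" "Y q = v (Suc (2 * l')) + t' *\<^sub>R (v (Suc (Suc (2 * l'))) - v (Suc (2 * l')))" using neck_edge(1)[OF neck] by blast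
      have n: "Suc (2 * l) \<noteq> Suc (2 * l')" "Suc (2 * l) \<noteq> Suc (Suc (2 * l'))" "Suc (Suc (2 * l)) \<noteq> Suc (2 * l')"
          "Suc (Suc (2 * l)) \<noteq> Suc (Suc (2 * l'))"
        using False by presburger+
      have sl': "Suc (Suc (2 * l')) < 2 * N" using neck by auto
      have "2 * r \<le> dist (Y p) (Y q)" unfolding t(3) t'(3)
        by (rule far[OF sl _ sl' _ n t(1,2) t'(1,2)]) auto
      then show ?thesis using Y_dist[of p q] q r by linarith
    qed
  next
    case (rim l')
    have qX: "4 * r \<le> norm (X q)" using rim by (simp add: rim_def)
    have q5: "norm (X q) \<le> 5 * r" and p3: "3 * r \<le> norm (X p)" using X_dist[of p q] pX qX q by linarith+
    have "Y p = v (Suc (2 * l)) \<or> Y p = v (Suc (Suc (2 * l)))" using neck_edge(2)[OF l p3] .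
    moreover obtain b where b: "Y q = v b" "b < 2 * N" using rim_edge(2)[OF rim q5] rim(1) by force
    ultimately have "b = Suc (2 * l) \<or> b = Suc (Suc (2 * l))" using same_plane[of p _ q b] q sl by (metis Suc_lessD)
    then show ?thesis using b qX r by (intro flat_in_rev[OF sl] neck_flat) auto
  next
    case (cap i)
    then have Yq: "Y q = v i + 0 *\<^sub>R (v i - v i)" by (simp add: cap_def)
    have n: "Suc (2 * l) \<noteq> i" "Suc (Suc (2 * l)) \<noteq> i" "i < 2 * N" using cap(1) l(1) by presburger+
    have "2 * r \<le> dist (Y p) (Y q)" unfolding t(3) Yq
      by (rule far[OF sl _ n(3) _ n(1,1,2,2) t(1,2)]) auto
    then show ?thesis using Y_dist[of p q] q r by linarith
  qed
qed

lemma near_cap: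
  assumes i: "i = 0 \<or> i = 2 * N - 1" "p \<in> cap i" and q: "q \<in> M" "dist p q < r"
  shows "Y q = v i"
proof -
  have iN: "i < 2 * N" using i N by auto
  have pX: "norm (X p) \<le> 4 * r" "Y p = v i" using i by (auto simp: cap_def)
  from q(1) show ?thesis
  proof (cases rule: Y_cases)
    case (neck l)
    obtain t where t: "0 \<le> t" "t \<le> 1" "Y q = v (Suc (2 * l)) + t *\<^sub>R (v (Suc (Suc (2 * l))) - v (Suc (2 * l)))"
      using neck_edge(1)[OF neck] by blast
    have Yp: "Y p = v i + 0 *\<^sub>R (v i - v i)" using pX by simp
    have sl: "Suc (Suc (2 * l)) < 2 * N" using neck by auto
    have n: "Suc (2 * l) \<noteq> i" "Suc (Suc (2 * l)) \<noteq> i" using i(1) neck(1) by presburger+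
    have "2 * r \<le> dist (Y q) (Y p)" unfolding t(3) Yp
      by (rule far[OF sl _ iN _ n(1,1,2,2) t(1,2)]) auto
    then have "2 * r \<le> dist (Y p) (Y q)" by (simp add: dist_commute)
    then show ?thesis using Y_dist[of p q] q r by linarith
  next
    case (rim l)
    have "norm (X q) \<le> 5 * r" using X_dist[of p q] pX q by linarith
    then obtain b where b: "Y q = v b" "b < 2 * N" using rim_edge(2)[OF rim] rim(1) by force
    then show ?thesis using same_plane[OF pX(2) b(1) iN b(2) q(2)] by simp
  next
    case (cap j)
    then have b: "Y q = v j" "j < 2 * N" using N by (auto simp: cap_def)
    then show ?thesis using same_plane[OF pX(2) b(1) iN b(2) q(2)] by simp
  qed
qed

lemma cont_X: "continuous_on UNIV X"
  by (rule linear_continuous_on) (simp add: linear_coord_proj linear_conv_bounded_linear[symmetric])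

lemma open_gt: "open {x. a < norm (X x)}" and open_lt: "open {x. norm (X x) < a}"
  by (auto intro!: open_Collect_less continuous_intros cont_X)

text \<open>The distance r of the three previous lemmas is 2 * \<rho> for \<rho> = r/2, the range
  that \<open>well_curved_revolution\<close> asks for.\<close>

lemma M_well_curved:
  assumes p: "p \<in> M"
  shows "well_curved (card I) (r/2) M p"
proof (cases "\<exists>l<N. p \<in> rim l")
  case True
  then obtain l where l: "l < N" "p \<in> rim l" by auto
  have sl: "Suc (2 * l) < 2 * N" using l by auto
  let ?W = "ball p r \<inter> {x. 3 * r < norm (X x)}"
  show ?thesis
  proof (rule well_curved_revolution[OF I(1) ed_basis[OF sl] X_mid r _ profile_rim[OF r C], where W="?W"])
    show "p \<in> revolution I (mid (2 * l)) (ed (2 * l)) r (rimF B C)" using l by (simp add: rim_def)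
    show "p \<in> ?W" using l r by (auto simp: rim_def)
    show "open ?W" by (intro open_Int open_ball open_gt)
    show "x \<in> M \<longleftrightarrow> x \<in> revolution I (mid (2 * l)) (ed (2 * l)) r (rimF B C)" if x: "x \<in> ?W" for x
    proof
      assume "x \<in> M" then show "x \<in> revolution I (mid (2 * l)) (ed (2 * l)) r (rimF B C)" using near_rim[OF l] x by simp
    next
      assume xr: "x \<in> revolution I (mid (2 * l)) (ed (2 * l)) r (rimF B C)"
      show "x \<in> M"
      proof (cases "4 * r \<le> norm (X x)")
        case True then show ?thesis using xr l by (auto simp: M_def rim_def)
      next
        case False
        then have "rimF B C (X x \<bullet> X x) = 0" using r by (intro rim_flat) auto
        then have "Y x = v (2 * l) \<or> Y x = v (Suc (2 * l))" using on_edge(2)[OF sl xr] rim_nonneg by simp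
        then show ?thesis using plane_in_M[of "2 * l" x] plane_in_M[of "Suc (2 * l)" x] sl False x by auto
      qed
    qed
    show "q \<in> revolution I (mid (2 * l)) (ed (2 * l)) r (rimF B C)" if "q \<in> M" "dist p q < 2 * (r/2)" for q
      using near_rim[OF l] that by simp
  qed (use p r in auto)
next
  case False
  \<comment> \<open>A point of a neck or cap on the cut also belongs to a rim. Here p is therefore
    strictly inside, and an open neighbourhood avoids the cut.\<close>
  have lt: "norm (X p) < 4 * r"
  proof (rule ccontr)
    assume ge: "\<not> norm (X p) < 4 * r"
    from p show False
    proof (cases rule: Y_cases)
      case (neck l)
      then have e: "norm (X p) = 4 * r" using ge by (simp add: neck_def)
      then obtain a where a: "Y p = v a" "a < 2 * N" using neck_edge(2)[OF neck] neck(1) r by force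
      have sl: "Suc (2 * (a div 2)) < 2 * N" using a(2) by presburger
      have aa: "a = 2 * (a div 2) \<or> a = Suc (2 * (a div 2))" by presburger
      then have Ya: "Y p = v (2 * (a div 2)) \<or> Y p = v (Suc (2 * (a div 2)))" using a(1) by metis
      have "p \<in> revolution I (mid (2 * (a div 2))) (ed (2 * (a div 2))) r (rimF B C)"
        using Ya e r by (intro flat_in_rev[OF sl] rim_flat) auto
      then have "p \<in> rim (a div 2)" using e by (simp add: rim_def)
      then show False using False a by auto
    next
      case (cap i)
      then have e: "norm (X p) = 4 * r" "Y p = v i" using ge by (auto simp: cap_def)
      have "i < 2 * N" using cap N by auto
      then have sl: "Suc (2 * (i div 2)) < 2 * N" by presburger
      have aa: "i = 2 * (i div 2) \<or> i = Suc (2 * (i div 2))" by presburger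
      then have Ya: "Y p = v (2 * (i div 2)) \<or> Y p = v (Suc (2 * (i div 2)))" using e(2) by metis
      have "p \<in> revolution I (mid (2 * (i div 2))) (ed (2 * (i div 2))) r (rimF B C)"
        using Ya e r by (intro flat_in_rev[OF sl] rim_flat) auto
      then have "p \<in> rim (i div 2)" using e by (simp add: rim_def)
      then show False using False \<open>i < 2 * N\<close> by auto
    qed (use False in auto)
  qed
  from p show ?thesis
  proof (cases rule: Y_cases)
    case (neck l)
    have sl: "Suc (Suc (2 * l)) < 2 * N" using neck by auto
    let ?W = "ball p r \<inter> {x. norm (X x) < 4 * r}"
    show ?thesis
    proof (rule well_curved_revolution[OF I(1) ed_basis[OF sl] X_mid r _ profile_neck[OF r refl], where W="?W"])
      show "p \<in> revolution I (mid (Suc (2 * l))) (ed (Suc (2 * l))) r (neckF (8 * r\<^sup>2))" using neck by (simp add: neck_def)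
      show "p \<in> ?W" using lt r by auto
      show "open ?W" by (intro open_Int open_ball open_lt)
      show "x \<in> M \<longleftrightarrow> x \<in> revolution I (mid (Suc (2 * l))) (ed (Suc (2 * l))) r (neckF (8 * r\<^sup>2))" if x: "x \<in> ?W" for x
      proof
        assume "x \<in> M" then show "x \<in> revolution I (mid (Suc (2 * l))) (ed (Suc (2 * l))) r (neckF (8 * r\<^sup>2))"
          using near_neck[OF neck] x by simp
      next
        assume "x \<in> revolution I (mid (Suc (2 * l))) (ed (Suc (2 * l))) r (neckF (8 * r\<^sup>2))"
        then have "x \<in> neck l" using x by (simp add: neck_def)
        then show "x \<in> M" using neck(1) unfolding M_def by blast
      qed
      show "q \<in> revolution I (mid (Suc (2 * l))) (ed (Suc (2 * l))) r (neckF (8 * r\<^sup>2))" if "q \<in> M" "dist p q < 2 * (r/2)" for q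
        using near_neck[OF neck] that by simp
    qed (use p r in auto)
  next
    case (cap i)
    have iN: "i < 2 * N" using cap N by auto
    have "Suc 0 < 2 * N" using N by simp
    note e0 = ed_basis[OF this]
    \<comment> \<open>A cap lies in one of the two planes of the profile F = 0; the centre is
      shifted by r so that the other plane is 2 * r away and misses the ball of radius r around
      p.\<close>
    let ?u = "v i + r *\<^sub>R ed 0"
    have Xu: "X ?u = 0"
      by (simp add: linear_add[OF linX] linear_scale[OF linX] X_v X_basis[OF e0])
    let ?G = "revolution I ?u (ed 0) r (\<lambda>_. 0)"
    have plane: "x \<in> ?G" if "Y x = v i" for x
      unfolding revolution_iff_height[OF I(1) e0 Xu r] using that by (intro exI[of _ "-1"]) auto
    let ?W = "ball p r \<inter> {x. norm (X x) < 4 * r}"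
    have Yp: "Y p = v i" using cap by (simp add: cap_def)
    show ?thesis
    proof (rule well_curved_revolution[OF I(1) e0 Xu r _ profile_flat, where W="?W"])
      show "p \<in> ?G" by (rule plane[OF Yp])
      show "p \<in> ?W" using lt r by auto
      show "open ?W" by (intro open_Int open_ball open_lt)
      show "x \<in> M \<longleftrightarrow> x \<in> ?G" if x: "x \<in> ?W" for x
      proof
        assume "x \<in> M" then show "x \<in> ?G" using near_cap[OF cap] x by (intro plane) auto
      next
        assume "x \<in> ?G"
        then obtain t where t: "Y x = ?u + (r * t) *\<^sub>R ed 0" "t\<^sup>2 = 1" unfolding revolution_iff_height[OF I(1) e0 Xu r] by auto
        have "t = -1"
        proof (rule ccontr)
          assume "t \<noteq> -1"
          then have "t = 1" using t(2) by (simp add: power2_eq_1_iff)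
          then have "Y x = v i + r *\<^sub>R ed 0 + r *\<^sub>R ed 0" using t(1) by simp
          moreover have "(2 * r) *\<^sub>R ed 0 = r *\<^sub>R ed 0 + r *\<^sub>R ed 0" by (simp flip: scaleR_add_left)
          ultimately have "Y x - Y p = (2 * r) *\<^sub>R ed 0" unfolding Yp by (simp only: add_diff_cancel_left' add.assoc)
          then have "norm (Y x - Y p) = 2 * r" using e0 r by simp
          then have "dist (Y x) (Y p) = 2 * r" by (simp add: dist_norm)
          then show False using Y_dist[of x p] x r by (simp add: dist_commute)
        qed
        then have "Y x = v i" using t(1) by simp
        then show "x \<in> M" using x cap by (auto simp: M_def cap_def)
      qed
      show "q \<in> ?G" if "q \<in> M" "dist p q < 2 * (r/2)" for q
        using near_cap[OF cap] that by (intro plane) auto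
    qed (use p r in auto)
  qed (use False in auto)
qed

end

section \<open>Compactness, connectedness and volume of the chain\<close>

lemma closed_revolution:
  assumes "I \<subseteq> Basis" "continuous_on UNIV F"
  shows "closed (revolution I u e r F)"
proof -
  have cX: "continuous_on UNIV (coord_proj I)"
    by (rule linear_continuous_on) (simp add: linear_coord_proj linear_conv_bounded_linear[symmetric])
  have "closed {p. p - u \<in> span (insert e I)}"
    using continuous_closed_vimage[OF closed_span, of "\<lambda>p. p - u" "insert e I"] by (simp add: vimage_def)
  moreover have "continuous_on UNIV (\<lambda>p. F (coord_proj I p \<bullet> coord_proj I p))"
    by (rule continuous_on_compose2[OF assms(2)]) (auto intro!: continuous_intros cX)
  then have "closed {p. ((p - u) \<bullet> e)\<^sup>2 / r\<^sup>2 + F (coord_proj I p \<bullet> coord_proj I p) = 1}"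
    by (cases "r = 0") (auto intro!: closed_Collect_eq continuous_intros)
  ultimately have "closed ({p. p - u \<in> span (insert e I)} \<inter> {p. ((p - u) \<bullet> e)\<^sup>2 / r\<^sup>2 + F (coord_proj I p \<bullet> coord_proj I p) = 1})"
    by (rule closed_Int)
  then show ?thesis by (simp add: revolution_def Collect_conj_eq)
qed

lemma revolution_norm_diff:
  assumes I: "I \<subseteq> Basis" and e: "e \<in> Basis" "e \<notin> I"
    and p: "p - u \<in> span (insert e I)" "q - u \<in> span (insert e I)"
  shows "(dist p q)\<^sup>2 = (norm (coord_proj I p - coord_proj I q))\<^sup>2 + ((p - u) \<bullet> e - (q - u) \<bullet> e)\<^sup>2"
proof -
  let ?v = "p - q"
  have v: "?v \<in> span (insert e I)" using span_diff[OF p] by simp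
  have "?v = coord_proj (insert e I) ?v" using span_coord[of "insert e I" ?v] I e v by simp
  also have "\<dots> = coord_proj I ?v + (?v \<bullet> e) *\<^sub>R e" using e finite_subset[OF I finite_Basis] by (simp add: coord_proj_def)
  finally have eq: "?v = coord_proj I ?v + (?v \<bullet> e) *\<^sub>R e" .
  have o: "coord_proj I ?v \<bullet> e = 0" using coord_proj_inner[OF I e(1)] e(2) by simp
  have "?v \<bullet> ?v = (coord_proj I ?v + (?v \<bullet> e) *\<^sub>R e) \<bullet> (coord_proj I ?v + (?v \<bullet> e) *\<^sub>R e)" by (rule arg_cong2[where f=inner, OF eq eq])
  also have "\<dots> = coord_proj I ?v \<bullet> coord_proj I ?v + (?v \<bullet> e) * (?v \<bullet> e)"
    using e(1) o inner_commute[of e "coord_proj I ?v"] by (simp add: inner_add_left inner_add_right)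
  finally have "(norm ?v)\<^sup>2 = (norm (coord_proj I ?v))\<^sup>2 + (?v \<bullet> e)\<^sup>2"
    by (simp only: power2_norm_eq_inner power2_eq_square[of "?v \<bullet> e"])
  moreover have "coord_proj I ?v = coord_proj I p - coord_proj I q" by (rule linear_diff[OF linear_coord_proj])
  moreover have "?v \<bullet> e = (p - u) \<bullet> e - (q - u) \<bullet> e" by (simp add: inner_diff_left)
  ultimately show ?thesis by (simp add: dist_norm)
qed

text \<open>The surface is cut into its upper and lower halves, \<sigma> = 1 and \<sigma> = -1. For
  increasing F the height falls with the radius; for decreasing F the same holds for r minus the
  height.\<close>

lemma revolution_volume_le:
  fixes I :: "'a::euclidean_space set"
  assumes I: "I \<subseteq> Basis" "I \<noteq> {}" and e: "e \<in> Basis" "e \<notin> I" and pos: "0 < r" "0 < Rm"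
    and F: "\<And>s. 0 \<le> s \<Longrightarrow> 0 \<le> F s" and mono: "mono_on {0..} F \<or> antimono_on {0..} F"
  shows "hausdorff_outer (card I) {p \<in> revolution I u e r F. norm (coord_proj I p) \<le> Rm} \<le>
    ennreal (2 * (2 * sqrt 2 ^ card I * slice_const (card I) * Rm ^ (card I - 1) * (Rm + r))) * hausdorff_outer (card I - 1) {x\<in>span I. norm x = 1}"
proof -
  let ?X = "coord_proj I"
  let ?h = "\<lambda>p. (p - u) \<bullet> e"
  define S where "S \<sigma> = {p \<in> revolution I u e r F. norm (?X p) \<le> Rm \<and> 0 \<le> \<sigma> * ?h p}" for \<sigma> :: real
  define k where "k = 2 * sqrt 2 ^ card I * slice_const (card I) * Rm ^ (card I - 1) * (Rm + r)"
  have k0: "0 \<le> k" unfolding k_def using slice_const_pos[of "card I"] pos by (intro mult_nonneg_nonneg) auto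
  have half: "hausdorff_outer (card I) (S \<sigma>) \<le> ennreal k * hausdorff_outer (card I - 1) {x\<in>span I. norm x = 1}" if s: "\<sigma> = 1 \<or> \<sigma> = -1" for \<sigma>
  proof -
    have s2: "\<sigma> * \<sigma> = 1" using s by auto
    have hh: "(\<sigma> * ?h p - \<sigma> * ?h q)\<^sup>2 = (?h p - ?h q)\<^sup>2" for p q using s by (elim disjE) (simp_all add: power2_eq_square algebra_simps)
    have eqn: "(\<sigma> * ?h p)\<^sup>2 = r\<^sup>2 * (1 - F (?X p \<bullet> ?X p))" if "p \<in> S \<sigma>" for p
    proof -
      have "(?h p)\<^sup>2 / r\<^sup>2 = 1 - F (?X p \<bullet> ?X p)" using that by (simp add: S_def revolution_def)
      moreover have "(?h p)\<^sup>2 = r\<^sup>2 * ((?h p)\<^sup>2 / r\<^sup>2)" using pos by simp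
      ultimately have "(?h p)\<^sup>2 = r\<^sup>2 * (1 - F (?X p \<bullet> ?X p))" by (simp only:)
      moreover have "(\<sigma> * ?h p)\<^sup>2 = (?h p)\<^sup>2" using s by auto
      ultimately show ?thesis by simp
    qed
    have rng: "0 \<le> \<sigma> * ?h p" "\<sigma> * ?h p \<le> r" if p: "p \<in> S \<sigma>" for p
    proof -
      show "0 \<le> \<sigma> * ?h p" using p by (simp add: S_def)
      have "(\<sigma> * ?h p)\<^sup>2 \<le> r\<^sup>2 * 1" unfolding eqn[OF p] using F[of "?X p \<bullet> ?X p"] by (intro mult_left_mono) auto
      then show "\<sigma> * ?h p \<le> r" using pos by (intro power2_le_imp_le[of "\<sigma> * ?h p" r]) auto
    qed
    have sq: "?X p \<bullet> ?X p \<le> ?X q \<bullet> ?X q" if "norm (?X p) < norm (?X q)" for p q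
    proof -
      have "(norm (?X p))\<^sup>2 \<le> (norm (?X q))\<^sup>2" using that by (intro power_mono) auto
      then show ?thesis unfolding power2_norm_eq_inner .
    qed
    have nd: "(dist p q)\<^sup>2 = (norm (?X p - ?X q))\<^sup>2 + (?h p - ?h q)\<^sup>2" if "p \<in> S \<sigma>" "q \<in> S \<sigma>" for p q
    proof -
      have "p - u \<in> span (insert e I)" "q - u \<in> span (insert e I)" using that by (simp_all add: S_def revolution_def)
      then show ?thesis by (rule revolution_norm_diff[OF I(1) e])
    qed
    have nX: "norm (?X p) \<le> Rm" if "p \<in> S \<sigma>" for p using that by (simp add: S_def)
    from mono show ?thesis
    proof
      assume m: "mono_on {0..} F"
      have anti: "\<sigma> * ?h q \<le> \<sigma> * ?h p" if pq: "p \<in> S \<sigma>" "q \<in> S \<sigma>" "norm (?X p) < norm (?X q)" for p q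
        proof (rule power2_le_imp_le)
          have "F (?X p \<bullet> ?X p) \<le> F (?X q \<bullet> ?X q)" by (rule mono_onD[OF m _ _ sq[OF pq(3)]]) simp_all
          then show "(\<sigma> * ?h q)\<^sup>2 \<le> (\<sigma> * ?h p)\<^sup>2" unfolding eqn[OF pq(1)] eqn[OF pq(2)] by (intro mult_left_mono) auto
        qed (rule rng(1)[OF pq(1)])
      have ds: "(dist p q)\<^sup>2 \<le> (norm (?X p - ?X q))\<^sup>2 + (\<sigma> * ?h p - \<sigma> * ?h q)\<^sup>2" if "p \<in> S \<sigma>" "q \<in> S \<sigma>" for p q
          unfolding hh nd[OF that] by (rule order_refl)
      show ?thesis unfolding k_def
        by (rule hausdorff_outer_monotone_profile[where z="\<lambda>p. \<sigma> * ?h p" and S="S \<sigma>", OF I refl pos(2,1) _ nX ds anti]) (use rng in blast)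
    next
      assume m: "antimono_on {0..} F"
      have anti: "r - \<sigma> * ?h q \<le> r - \<sigma> * ?h p" if pq: "p \<in> S \<sigma>" "q \<in> S \<sigma>" "norm (?X p) < norm (?X q)" for p q
        proof -
          have "F (?X q \<bullet> ?X q) \<le> F (?X p \<bullet> ?X p)" by (rule monotone_onD[OF m _ _ sq[OF pq(3)]]) auto
          then have "(\<sigma> * ?h p)\<^sup>2 \<le> (\<sigma> * ?h q)\<^sup>2" unfolding eqn[OF pq(1)] eqn[OF pq(2)] by (intro mult_left_mono) auto
          then have "\<sigma> * ?h p \<le> \<sigma> * ?h q" using rng(1)[OF pq(2)] by (rule power2_le_imp_le)
          then show ?thesis by simp
        qed
      have ds: "(dist p q)\<^sup>2 \<le> (norm (?X p - ?X q))\<^sup>2 + ((r - \<sigma> * ?h p) - (r - \<sigma> * ?h q))\<^sup>2" if "p \<in> S \<sigma>" "q \<in> S \<sigma>" for p q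
        proof -
          have e1: "(r - \<sigma> * ?h p) - (r - \<sigma> * ?h q) = \<sigma> * ?h q - \<sigma> * ?h p" by linarith
          show ?thesis unfolding nd[OF that] e1 hh power2_commute[of "?h q" "?h p"] by (rule order_refl)
        qed
      have "0 \<le> r - \<sigma> * ?h p \<and> r - \<sigma> * ?h p \<le> r" if "p \<in> S \<sigma>" for p using rng[OF that] by linarith
      then show ?thesis unfolding k_def
        by (rule hausdorff_outer_monotone_profile[where z="\<lambda>p. r - \<sigma> * ?h p" and S="S \<sigma>", OF I refl pos(2,1) _ nX ds anti])
    qed
  qed
  have split: "{p \<in> revolution I u e r F. norm (?X p) \<le> Rm} = S 1 \<union> S (-1)" by (auto simp: S_def)
  have "hausdorff_outer (card I) {p \<in> revolution I u e r F. norm (?X p) \<le> Rm} \<le> hausdorff_outer (card I) (S 1) + hausdorff_outer (card I) (S (-1))"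
    unfolding split by (rule hausdorff_outer_Un)
  also have "\<dots> \<le> ennreal k * hausdorff_outer (card I - 1) {x\<in>span I. norm x = 1} + ennreal k * hausdorff_outer (card I - 1) {x\<in>span I. norm x = 1}"
    by (intro add_mono half) auto
  also have "\<dots> = ennreal (2 * k) * hausdorff_outer (card I - 1) {x\<in>span I. norm x = 1}"
  proof -
    have "ennreal (2 * k) = 2 * ennreal k" using k0 by (simp add: ennreal_mult')
    then show ?thesis by (simp only: mult_2 distrib_right)
  qed
  finally show ?thesis by (simp add: k_def)
qed

lemma mono_rimF: "0 < C \<Longrightarrow> mono_on S (rimF B C)"
  unfolding mono_on_def rimF_def by (intro allI impI ballI power_mono max.mono order_refl divide_right_mono) auto

lemma antimono_neckF: "0 < A \<Longrightarrow> antimono_on S (neckF A)"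
  unfolding monotone_on_def neckF_def by (intro allI impI ballI mult_left_mono power_mono max.mono order_refl divide_right_mono) auto

lemma cont_rimF: "0 < C \<Longrightarrow> continuous_on T (rimF B C)" and cont_neckF: "0 < A \<Longrightarrow> continuous_on T (neckF A)"
  unfolding rimF_def neckF_def by (auto intro!: continuous_intros)

lemma max_cube_le: "(max 0 x) ^ 3 \<le> w ^ 3 \<Longrightarrow> 0 \<le> w \<Longrightarrow> x \<le> (w::real)"
  using power_le_imp_le_base[of "max 0 x" 2 w] by (simp add: numeral_eq_Suc)

context snake
begin

lemma rim_radius: "rimF B C s \<le> 1 \<Longrightarrow> s \<le> B + C"
  using max_cube_le[of "(s - B) / C" 1] C(1) by (simp add: rimF_def field_simps)

lemma rim_X_le: assumes "l < N" "p \<in> rim l" shows "(norm (X p))\<^sup>2 \<le> B + C"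
proof -
  have sl: "Suc (2 * l) < 2 * N" using assms by auto
  obtain t where "t\<^sup>2 + rimF B C (X p \<bullet> X p) = 1" using assms rev_iff[OF sl] by (auto simp: rim_def)
  then have "rimF B C (X p \<bullet> X p) \<le> 1" using zero_le_power2[of t] by linarith
  then show ?thesis using rim_radius by (simp add: XX)
qed

lemma norm_XY: "(norm p)\<^sup>2 = (norm (X p))\<^sup>2 + (norm (Y p))\<^sup>2"
proof -
  have "X p \<bullet> Y p = (\<Sum>b\<in>Basis. (X p \<bullet> b) * (Y p \<bullet> b))" by (rule euclidean_inner)
  also have "\<dots> = 0" by (rule sum.neutral) (auto simp: inner_diff_left coord_proj_inner[OF I(1)])
  finally have "X p \<bullet> Y p = 0" .
  then have "(X p + Y p) \<bullet> (X p + Y p) = X p \<bullet> X p + Y p \<bullet> Y p" by (simp only: inner_add_left inner_add_right inner_commute[of "Y p" "X p"])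
  then show ?thesis by (simp add: power2_norm_eq_inner)
qed

lemma M_bounded:
  assumes Ym: "\<And>i. i < 2 * N \<Longrightarrow> norm (v i) \<le> Ym"
  shows "M \<subseteq> cball 0 (sqrt (B + C + Ym\<^sup>2))"
proof
  fix p assume p: "p \<in> M"
  have seg: "norm (v i + t *\<^sub>R (v (Suc i) - v i)) \<le> Ym" if "Suc i < 2 * N" "0 \<le> t" "t \<le> 1" for i t
  proof -
    have "(1 - t) *\<^sub>R v i + t *\<^sub>R v (Suc i) \<in> cball 0 Ym"
      using that Ym[of i] Ym[of "Suc i"] by (intro convexD[OF convex_cball]) auto
    moreover have "(1 - t) *\<^sub>R v i + t *\<^sub>R v (Suc i) = v i + t *\<^sub>R (v (Suc i) - v i)" by (simp add: algebra_simps)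
    ultimately show ?thesis by simp
  qed
  have B0: "16 * r\<^sup>2 \<le> B + C" using B_ge C(1) zero_le_power2[of r] by linarith
  have small: "(norm (X p))\<^sup>2 \<le> B + C" if "norm (X p) \<le> 4 * r"
    using power_mono[OF that norm_ge_zero, of 2] B0 by (simp add: power_mult_distrib)
  have "(norm (X p))\<^sup>2 \<le> B + C \<and> norm (Y p) \<le> Ym"
    using p
  proof (cases rule: Y_cases)
    case (rim l)
    obtain t where "0 \<le> t" "t \<le> 1" "Y p = v (2 * l) + t *\<^sub>R (v (Suc (2 * l)) - v (2 * l))" using rim_edge(1)[OF rim] by blast
    then show ?thesis using seg[of "2 * l" t] rim rim_X_le[OF rim] by auto
  next
    case (neck l)
    obtain t where "0 \<le> t" "t \<le> 1" "Y p = v (Suc (2 * l)) + t *\<^sub>R (v (Suc (Suc (2 * l))) - v (Suc (2 * l)))" using neck_edge(1)[OF neck] by blast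
    then show ?thesis using seg[of "Suc (2 * l)" t] neck small by (auto simp: neck_def)
  next
    case (cap i)
    then show ?thesis using Ym[of i] N small by (auto simp: cap_def)
  qed
  then have "(norm p)\<^sup>2 \<le> B + C + Ym\<^sup>2" unfolding norm_XY[of p] by (intro add_mono power_mono) auto
  then show "p \<in> cball 0 (sqrt (B + C + Ym\<^sup>2))" by (simp add: real_le_rsqrt)
qed

lemma closed_norm: "closed {x. a \<le> norm (X x)}" "closed {x. norm (X x) \<le> a}"
  by (auto intro!: closed_Collect_le continuous_intros cont_X)

lemma closed_rim: "closed (rim l)"
proof -
  have "rim l = revolution I (mid (2 * l)) (ed (2 * l)) r (rimF B C) \<inter> {x. 4 * r \<le> norm (X x)}" by (auto simp: rim_def)
  then show ?thesis using closed_revolution[OF I(1) cont_rimF[OF C(1)]] closed_norm by auto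
qed

lemma closed_M: "closed M"
proof -
  have A0: "0 < 8 * r\<^sup>2" using r by simp
  have "neck l = revolution I (mid (Suc (2 * l))) (ed (Suc (2 * l))) r (neckF (8 * r\<^sup>2)) \<inter> {x. norm (X x) \<le> 4 * r}" for l by (auto simp: neck_def)
  then have nk: "closed (neck l)" for l using closed_revolution[OF I(1) cont_neckF[OF A0]] closed_norm by auto
  have "cap i = {x. Y x = v i} \<inter> {x. norm (X x) \<le> 4 * r}" for i by (auto simp: cap_def)
  moreover have "closed {x. Y x = v i}" for i by (auto intro!: closed_Collect_eq continuous_intros cont_X)
  ultimately have cp: "closed (cap i)" for i using closed_norm by auto
  have "finite {l. Suc l < N}" by (rule finite_subset[of _ "{..N}"]) auto
  then show ?thesis unfolding M_def
    by (intro closed_Un closed_UN cp) (auto intro: closed_rim nk)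
qed

lemma compact_M:
  "compact M"
proof -
  have "finite (v ` {..<2 * N})" by simp
  then obtain Ym where "\<And>i. i < 2 * N \<Longrightarrow> norm (v i) \<le> Ym" using finite_imp_bounded[THEN bounded_iff[THEN iffD1], of "v ` {..<2 * N}"] by auto
  then show ?thesis using closed_M bounded_subset[OF bounded_cball M_bounded] by (auto simp: compact_eq_bounded_closed)
qed

text \<open>Over a ray in direction \<theta> the surface consists of two graphs, one for each sign
  of the square root, and they meet at x0, where F = 1 makes the height 0.\<close>

lemma connected_arc:
  assumes i: "Suc i < 2 * N" and th: "\<theta> \<in> span I" "norm \<theta> = 1" and ab: "0 \<le> a" "a \<le> b"
    and F: "continuous_on UNIV F" "\<And>x. a \<le> x \<Longrightarrow> x \<le> b \<Longrightarrow> F (x\<^sup>2) \<le> 1" and x0: "a \<le> x0" "x0 \<le> b" "F (x0\<^sup>2) = 1"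
  shows "connected {p \<in> revolution I (mid i) (ed i) r F. \<exists>x\<in>{a..b}. X p = x *\<^sub>R \<theta>}"
proof -
  let ?S = "{p \<in> revolution I (mid i) (ed i) r F. \<exists>x\<in>{a..b}. X p = x *\<^sub>R \<theta>}"
  define arc where "arc \<sigma> x = x *\<^sub>R \<theta> + (mid i + (r * (\<sigma> * sqrt (1 - F (x\<^sup>2)))) *\<^sub>R ed i)" for \<sigma> x :: real
  have Xth: "X \<theta> = \<theta>" using span_coord[OF I(1)] th(1) by simp
  have Xarc: "X (arc \<sigma> x) = x *\<^sub>R \<theta>" for \<sigma> x
    unfolding arc_def linear_add[OF linX] linear_scale[OF linX] X_mid X_basis[OF ed_basis[OF i]] Xth by simp
  have tt: "x *\<^sub>R \<theta> \<bullet> x *\<^sub>R \<theta> = x\<^sup>2" for x using th(2) by (simp add: power2_eq_square norm_eq_1)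
  have sub: "arc \<sigma> x \<in> ?S" if "\<sigma> = 1 \<or> \<sigma> = -1" "x \<in> {a..b}" for \<sigma> x
  proof -
    have "Y (arc \<sigma> x) = mid i + (r * (\<sigma> * sqrt (1 - F (x\<^sup>2)))) *\<^sub>R ed i" by (simp add: Xarc) (simp add: arc_def)
    moreover have "(\<sigma> * sqrt (1 - F (x\<^sup>2)))\<^sup>2 + F (X (arc \<sigma> x) \<bullet> X (arc \<sigma> x)) = 1"
      using that F(2)[of x] unfolding Xarc tt by (auto simp: power_mult_distrib)
    ultimately show ?thesis using Xarc that rev_iff[OF i] by blast
  qed
  have cont: "continuous_on {a..b} (arc \<sigma>)" for \<sigma>
  proof -
    have "continuous_on {a..b} (\<lambda>x. F (x\<^sup>2))" by (rule continuous_on_compose2[OF F(1)]) (auto intro!: continuous_intros)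
    then show ?thesis unfolding arc_def by (intro continuous_intros) auto
  qed
  have "?S = arc 1 ` {a..b} \<union> arc (-1) ` {a..b}"
  proof (intro equalityI subsetI)
    fix p assume p: "p \<in> ?S"
    then obtain x where x: "x \<in> {a..b}" "X p = x *\<^sub>R \<theta>" by auto
    obtain t where t: "Y p = mid i + (r * t) *\<^sub>R ed i" "t\<^sup>2 + F (X p \<bullet> X p) = 1" using p rev_iff[OF i] by auto
    have "t\<^sup>2 = 1 - F (x\<^sup>2)" using t(2) x(2) tt by simp
    then have "sqrt (1 - F (x\<^sup>2)) = \<bar>t\<bar>" by (metis real_sqrt_abs)
    then have "t = 1 * sqrt (1 - F (x\<^sup>2)) \<or> t = -1 * sqrt (1 - F (x\<^sup>2))" by (cases "0 \<le> t") auto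
    moreover have "p = X p + Y p" by simp
    then have "p = x *\<^sub>R \<theta> + (mid i + (r * t) *\<^sub>R ed i)" unfolding t(1) unfolding x(2) .
    ultimately have "p = arc 1 x \<or> p = arc (-1) x" unfolding arc_def by blast
    then show "p \<in> arc 1 ` {a..b} \<union> arc (-1) ` {a..b}" using x(1) by blast
  qed (use sub in auto)
  moreover have "arc 1 x0 = arc (-1) x0" using x0(3) by (simp add: arc_def)
  then have "arc 1 x0 \<in> arc 1 ` {a..b}" "arc 1 x0 \<in> arc (-1) ` {a..b}" using x0(1,2) by (auto intro: imageI) (metis imageI atLeastAtMost_iff)
  then have "connected (arc 1 ` {a..b} \<union> arc (-1) ` {a..b})"
    by (intro connected_Un connected_continuous_image cont connected_Icc) (rule notI, blast)
  ultimately show ?thesis by simp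
qed

text \<open>Each point is moved along its meridian to a cut point \<open>P \<theta> i\<close> with
  the same direction \<theta>, and such points are joined along the chain to the centre of the first
  cap. Directions change only inside that cap, so the argument includes card I = 1, where rims and
  necks are disconnected.\<close>

lemma connected_M: "connected M"
proof -
  have A0: "0 < 8 * r\<^sup>2" using r by simp
  obtain i0 where i0: "i0 \<in> I" using I by auto
  define P where "P \<theta> i = (4 * r) *\<^sub>R \<theta> + v i" for \<theta> i
  have PX: "X (P \<theta> i) = (4 * r) *\<^sub>R \<theta>" "Y (P \<theta> i) = v i" if "\<theta> \<in> span I" for \<theta> i
  proof -
    show 1: "X (P \<theta> i) = (4 * r) *\<^sub>R \<theta>"
      unfolding P_def linear_add[OF linX] linear_scale[OF linX] X_v using that span_coord[OF I(1)] by simp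
    show "Y (P \<theta> i) = v i" unfolding 1 by (simp add: P_def)
  qed
  have rimc: "connected_component M p (P \<theta> j)"
    if l: "l < N" and th: "\<theta> \<in> span I" "norm \<theta> = 1" and p: "p \<in> rim l" "X p = x *\<^sub>R \<theta>" "0 \<le> x" and j: "j = 2 * l \<or> j = Suc (2 * l)" for l \<theta> p x j
  proof -
    have sl: "Suc (2 * l) < 2 * N" using l by auto
    let ?b = "sqrt (B + C)"
    have BC: "0 \<le> B + C" using B_ge C(1) zero_le_power2[of r] by linarith
    have ab: "4 * r \<le> ?b"
    proof (rule real_le_rsqrt)
      have "(4 * r)\<^sup>2 = 16 * r\<^sup>2" by (simp add: power_mult_distrib)
      then show "(4 * r)\<^sup>2 \<le> B + C" using B_ge C(1) zero_le_power2[of r] by linarith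
    qed
    let ?T = "{p \<in> revolution I (mid (2 * l)) (ed (2 * l)) r (rimF B C). \<exists>x\<in>{4 * r..?b}. X p = x *\<^sub>R \<theta>}"
    have "connected ?T"
    proof (rule connected_arc[OF sl th _ ab cont_rimF[OF C(1)] _ ab order_refl])
      show "rimF B C (?b\<^sup>2) = 1" using C(1) BC by (simp add: rimF_def)
      show "rimF B C (x\<^sup>2) \<le> 1" if "4 * r \<le> x" "x \<le> ?b" for x
      proof -
        have "x\<^sup>2 \<le> ?b\<^sup>2" using that r by (intro power_mono) auto
        then have "rimF B C (x\<^sup>2) \<le> rimF B C (?b\<^sup>2)" using mono_onD[OF mono_rimF[OF C(1), of UNIV]] by auto
        then show ?thesis using \<open>rimF B C (?b\<^sup>2) = 1\<close> by simp
      qed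
    qed (use r in auto)
    moreover have "?T \<subseteq> M"
    proof
      fix q assume q: "q \<in> ?T"
      then obtain x where "4 * r \<le> x" "X q = x *\<^sub>R \<theta>" by auto
      then have "4 * r \<le> norm (X q)" using th r by simp
      then show "q \<in> M" using q l by (auto simp: M_def rim_def)
    qed
    moreover have "p \<in> ?T"
    proof -
      have "norm (X p) = x" using p th by simp
      then have "4 * r \<le> x" "x\<^sup>2 \<le> B + C" using p rim_X_le[OF l p(1)] by (auto simp: rim_def)
      then show ?thesis using p by (auto simp: rim_def real_le_rsqrt)
    qed
    moreover have "P \<theta> j \<in> ?T"
    proof -
      have "norm (X (P \<theta> j)) = 4 * r" using PX[OF th(1)] th(2) r by simp
      then have "P \<theta> j \<in> revolution I (mid (2 * l)) (ed (2 * l)) r (rimF B C)"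
        using PX[OF th(1)] j r by (intro flat_in_rev[OF sl] rim_flat) auto
      then show ?thesis using PX[OF th(1)] ab by auto
    qed
    ultimately show ?thesis unfolding connected_component_def by blast
  qed
  have neckc: "connected_component M p (P \<theta> j)"
    if l: "Suc l < N" and th: "\<theta> \<in> span I" "norm \<theta> = 1" and p: "p \<in> neck l" "X p = x *\<^sub>R \<theta>" "0 \<le> x" and j: "j = Suc (2 * l) \<or> j = Suc (Suc (2 * l))" for l \<theta> p x j
  proof -
    have sl: "Suc (Suc (2 * l)) < 2 * N" using l by auto
    \<comment> \<open>With this w, \<open>neckF\<close> equals 1 at squared radius 8 r^2 (1 - w),
      the throat where the upper and lower halves of the neck meet.\<close>
    define w where "w = root 3 (1/2)"
    have w: "0 \<le> w" "w \<le> 1" "w ^ 3 = 1/2" by (auto simp: w_def)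
    define a where "a = sqrt (8 * r\<^sup>2 * (1 - w))"
    have a2: "a\<^sup>2 = 8 * r\<^sup>2 * (1 - w)" using w by (simp add: a_def)
    have a0: "0 \<le> a" using w by (simp add: a_def)
    have ab: "a \<le> 4 * r"
    proof (rule power2_le_imp_le)
      have "8 * r\<^sup>2 * (1 - w) \<le> 8 * r\<^sup>2 * 1" using w by (intro mult_left_mono) auto
      moreover have "(4 * r)\<^sup>2 = 16 * r\<^sup>2" by (simp add: power_mult_distrib)
      ultimately show "a\<^sup>2 \<le> (4 * r)\<^sup>2" unfolding a2 using zero_le_power2[of r] by linarith
    qed (use r in simp)
    have Fa: "neckF (8 * r\<^sup>2) (a\<^sup>2) = 1"
    proof -
      have "(8 * r\<^sup>2 - a\<^sup>2) / (8 * r\<^sup>2) = w" unfolding a2 using r by (simp add: field_simps)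
      then show ?thesis using w by (simp add: neckF_def)
    qed
    let ?T = "{p \<in> revolution I (mid (Suc (2 * l))) (ed (Suc (2 * l))) r (neckF (8 * r\<^sup>2)). \<exists>x\<in>{a..4 * r}. X p = x *\<^sub>R \<theta>}"
    have "connected ?T"
    proof (rule connected_arc[OF sl th a0 ab cont_neckF[OF A0] _ order_refl ab Fa])
      fix x assume x: "a \<le> x" "x \<le> 4 * r"
      have "a\<^sup>2 \<le> x\<^sup>2" using x a0 by (intro power_mono) auto
      then have "neckF (8 * r\<^sup>2) (x\<^sup>2) \<le> neckF (8 * r\<^sup>2) (a\<^sup>2)" using antimono_neckF[OF A0, of UNIV] by (auto simp: monotone_on_def)
      then show "neckF (8 * r\<^sup>2) (x\<^sup>2) \<le> 1" using Fa by simp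
    qed
    moreover have "?T \<subseteq> M"
    proof
      fix q assume q: "q \<in> ?T"
      then obtain x where "x \<in> {a..4 * r}" "X q = x *\<^sub>R \<theta>" unfolding mem_Collect_eq by (elim conjE bexE)
      then have "0 \<le> x" "x \<le> 4 * r" "X q = x *\<^sub>R \<theta>" using a0 by auto
      then have "norm (X q) \<le> 4 * r" using th by simp
      then have "q \<in> neck l" using q by (auto simp: neck_def)
      then show "q \<in> M" using l unfolding M_def by blast
    qed
    moreover have "p \<in> ?T"
    proof -
      have nx: "norm (X p) = x" using p th by simp
      obtain t where "t\<^sup>2 + neckF (8 * r\<^sup>2) (X p \<bullet> X p) = 1" using p rev_iff[OF sl] by (auto simp: neck_def)
      then have "neckF (8 * r\<^sup>2) (x\<^sup>2) \<le> 1" using zero_le_power2[of t] unfolding XX nx by linarith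
      then have "(max 0 ((8 * r\<^sup>2 - x\<^sup>2) / (8 * r\<^sup>2))) ^ 3 \<le> w ^ 3" unfolding neckF_def w(3) by linarith
      then have "(8 * r\<^sup>2 - x\<^sup>2) / (8 * r\<^sup>2) \<le> w" using w(1) by (rule max_cube_le)
      then have "a\<^sup>2 \<le> x\<^sup>2" unfolding a2 using A0 by (simp add: pos_divide_le_eq algebra_simps)
      then have "a \<le> x" using p(3) by (rule power2_le_imp_le)
      moreover have "norm (X p) \<le> 4 * r" using p(1) unfolding neck_def by blast
      then have "x \<le> 4 * r" unfolding nx .
      ultimately show ?thesis using p by (auto simp: neck_def)
    qed
    moreover have "P \<theta> j \<in> ?T"
    proof -
      have "norm (X (P \<theta> j)) = 4 * r" using PX[OF th(1)] th(2) r by simp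
      then have "P \<theta> j \<in> revolution I (mid (Suc (2 * l))) (ed (Suc (2 * l))) r (neckF (8 * r\<^sup>2))"
        using PX[OF th(1)] j r by (intro flat_in_rev[OF sl] neck_flat) auto
      then show ?thesis using PX[OF th(1)] ab by auto
    qed
    ultimately show ?thesis unfolding connected_component_def by blast
  qed
  have capc: "connected_component M p (x *\<^sub>R \<theta> + v i)"
    if i: "i = 0 \<or> i = 2 * N - 1" and th: "\<theta> \<in> span I" "norm \<theta> = 1" and p: "p \<in> cap i" and x: "0 \<le> x" "x \<le> 4 * r" for i \<theta> p x
  proof -
    let ?q = "x *\<^sub>R \<theta> + v i"
    have Xq: "X ?q = x *\<^sub>R \<theta>" unfolding linear_add[OF linX] linear_scale[OF linX] X_v using th span_coord[OF I(1)] by simp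
    have qc: "?q \<in> cap i" unfolding cap_def mem_Collect_eq Xq using th x by simp
    have "convex (cap i)"
    proof -
      have "cap i = (\<lambda>y. y + v i) ` (span I \<inter> cball 0 (4 * r))"
      proof (intro equalityI subsetI)
        fix y assume "y \<in> cap i"
        then have y: "y = X y + v i" "norm (X y) \<le> 4 * r" by (auto simp: cap_def algebra_simps)
        have "X y \<in> span I \<inter> cball 0 (4 * r)" using y(2) coord_proj_in_span[OF I(1)] by simp
        then show "y \<in> (\<lambda>y. y + v i) ` (span I \<inter> cball 0 (4 * r))" using y(1) by (rule rev_image_eqI)
      next
        fix y assume "y \<in> (\<lambda>y. y + v i) ` (span I \<inter> cball 0 (4 * r))"
        then obtain z where z: "z \<in> span I" "norm z \<le> 4 * r" "y = z + v i" by auto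
        then have "X y = z" unfolding z(3) linear_add[OF linX] X_v using span_coord[OF I(1)] by simp
        then show "y \<in> cap i" using z by (simp add: cap_def)
      qed
      moreover have "convex (span I \<inter> cball 0 (4 * r))" by (intro convex_Int convex_cball subspace_imp_convex subspace_span)
      then have "convex ((\<lambda>y. y + v i) ` (span I \<inter> cball 0 (4 * r)))" using convex_translation[of _ "v i"] by (simp add: add.commute)
      ultimately show ?thesis by simp
    qed
    then have "connected (cap i)" by (rule convex_connected)
    moreover have "cap i \<subseteq> M" using i by (auto simp: M_def)
    ultimately show ?thesis unfolding connected_component_def using p qc by blast
  qed
  have v0: "v 0 \<in> cap 0" using r by (simp add: cap_def X_v)
  have chain: "connected_component M (v 0) (P \<theta> i)" if th: "\<theta> \<in> span I" "norm \<theta> = 1" and "i < 2 * N" for \<theta> i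
    using \<open>i < 2 * N\<close>
  proof (induction i)
    case 0
    show ?case unfolding P_def by (rule capc[OF _ th v0]) (use r in auto)
  next
    case (Suc i)
    have IH: "connected_component M (v 0) (P \<theta> i)" using Suc by simp
    have nP: "norm (X (P \<theta> i)) = 4 * r" using PX[OF th(1)] th(2) r by simp
    show ?case
    proof (cases "even i")
      case True
      then obtain l where l: "i = 2 * l" by auto
      have lN: "l < N" "Suc (2 * l) < 2 * N" using Suc l by auto
      have "P \<theta> i \<in> rim l" using flat_in_rev[OF lN(2), of "P \<theta> i" "rimF B C"] PX[OF th(1)] nP rim_flat[of "P \<theta> i"] r l by (auto simp: rim_def)
      then have "connected_component M (P \<theta> i) (P \<theta> (Suc i))"
        using PX(1)[OF th(1)] r l by (intro rimc[OF lN(1) th, of _ "4 * r"]) auto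
      then show ?thesis using IH connected_component_trans by metis
    next
      case False
      then obtain l where l: "i = Suc (2 * l)" by (metis oddE Suc_eq_plus1)
      have lN: "Suc l < N" "Suc (Suc (2 * l)) < 2 * N" using Suc l by auto
      have "P \<theta> i \<in> neck l" using flat_in_rev[OF lN(2), of "P \<theta> i" "neckF (8 * r\<^sup>2)"] PX[OF th(1)] nP neck_flat[of "P \<theta> i"] r l by (auto simp: neck_def)
      then have "connected_component M (P \<theta> i) (P \<theta> (Suc i))"
        using PX(1)[OF th(1)] r l by (intro neckc[OF lN(1) th, of _ "4 * r"]) auto
      then show ?thesis using IH connected_component_trans by metis
    qed
  qed
  have all: "connected_component M (v 0) p" if p: "p \<in> M" for p
  proof -
    define \<theta> where "\<theta> = (if X p = 0 then i0 else (1 / norm (X p)) *\<^sub>R X p)"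
    have th: "\<theta> \<in> span I" "norm \<theta> = 1"
      using i0 I coord_proj_in_span[OF I(1)] by (auto simp: \<theta>_def span_base intro!: span_scale)
    have Xp: "X p = norm (X p) *\<^sub>R \<theta>" by (simp add: \<theta>_def)
    from p show ?thesis
    proof (cases rule: Y_cases)
      case (rim l)
      then have "connected_component M p (P \<theta> (2 * l))" by (intro rimc[OF rim(1) th rim(2) Xp norm_ge_zero]) simp
      moreover have "connected_component M (v 0) (P \<theta> (2 * l))" using rim by (intro chain[OF th]) auto
      ultimately show ?thesis using connected_component_trans connected_component_sym by metis
    next
      case (neck l)
      then have "connected_component M p (P \<theta> (Suc (2 * l)))" by (intro neckc[OF neck(1) th neck(2) Xp norm_ge_zero]) simp
      moreover have "connected_component M (v 0) (P \<theta> (Suc (2 * l)))" using neck by (intro chain[OF th]) auto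
      ultimately show ?thesis using connected_component_trans connected_component_sym by metis
    next
      case (cap i)
      have "connected_component M p ((4 * r) *\<^sub>R \<theta> + v i)" using r by (intro capc[OF cap(1) th cap(2)]) auto
      moreover have "connected_component M (v 0) (P \<theta> i)" using cap N by (intro chain[OF th]) auto
      ultimately show ?thesis unfolding P_def using connected_component_trans connected_component_sym by metis
    qed
  qed
  show ?thesis unfolding connected_iff_connected_component
    using all connected_component_trans connected_component_sym by metis
qed

lemma rim_disjoint: "disjoint_family_on rim {..<N}"
  unfolding disjoint_family_on_def
proof (intro ballI impI)
  fix l l' assume ll: "l \<in> {..<N}" "l' \<in> {..<N}" "l \<noteq> l'"
  show "rim l \<inter> rim l' = {}"
  proof (rule ccontr)
    assume "rim l \<inter> rim l' \<noteq> {}"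
    then obtain p where p: "p \<in> rim l" "p \<in> rim l'" by auto
    obtain t where t: "0 \<le> t" "t \<le> 1" "Y p = v (2 * l) + t *\<^sub>R (v (Suc (2 * l)) - v (2 * l))" using rim_edge(1)[of l p] ll p by auto
    obtain t' where t': "0 \<le> t'" "t' \<le> 1" "Y p = v (2 * l') + t' *\<^sub>R (v (Suc (2 * l')) - v (2 * l'))" using rim_edge(1)[of l' p] ll p by auto
    have n: "2 * l \<noteq> 2 * l'" "2 * l \<noteq> Suc (2 * l')" "Suc (2 * l) \<noteq> 2 * l'" "Suc (2 * l) \<noteq> Suc (2 * l')"
      using ll(3) by presburger+
    have sl: "Suc (2 * l) < 2 * N" "Suc (2 * l') < 2 * N" using ll by auto
    have "2 * r \<le> dist (v (2 * l) + t *\<^sub>R (v (Suc (2 * l)) - v (2 * l))) (v (2 * l') + t' *\<^sub>R (v (Suc (2 * l')) - v (2 * l')))"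
      by (rule far[OF sl(1) disjI2[OF refl] sl(2) disjI2[OF refl] n t(1,2) t'(1,2)])
    then have "2 * r \<le> dist (Y p) (Y p)" unfolding t(3)[symmetric] t'(3)[symmetric] .
    then show False using r by simp
  qed
qed

lemma M_volume_ge: "(\<Sum>l<N. hausdorff_outer k (rim l)) \<le> hausdorff_outer k M"
proof -
  have "(\<Sum>l<N. hausdorff_outer k (rim l)) = hausdorff_outer k (\<Union>l<N. rim l)"
    using rim_disjoint closed_rim by (intro hausdorff_outer_UN_disjoint[symmetric]) auto
  also have "\<dots> \<le> hausdorff_outer k M" by (intro hausdorff_outer_mono) (auto simp: M_def)
  finally show ?thesis .
qed

text \<open>Each of the N - 1 necks costs two sheets of radius 4r and each of the two caps one,
  which makes 2 * N sheets in all.\<close>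

lemma M_volume_le:
  fixes S
  defines "S \<equiv> hausdorff_outer (card I - 1) {x\<in>span I. norm x = 1}"
  shows "hausdorff_outer (card I) M \<le> (\<Sum>l<N. hausdorff_outer (card I) (rim l)) +
    of_nat (2 * N) * (ennreal (2 * sqrt 2 ^ card I * slice_const (card I) * (4 * r) ^ (card I - 1) * (4 * r + r)) * S)"
proof -
  let ?d = "card I"
  define k where "k = 2 * sqrt 2 ^ card I * slice_const (card I) * (4 * r) ^ (card I - 1) * (4 * r + r)"
  have k0: "0 \<le> k" unfolding k_def using slice_const_pos[of "card I"] r by (intro mult_nonneg_nonneg) auto
  have nk: "hausdorff_outer ?d (neck l) \<le> ennreal (2 * k) * S" if "Suc l < N" for l
  proof -
    have sl: "Suc (Suc (2 * l)) < 2 * N" using that by auto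
    have A0: "0 < 8 * r\<^sup>2" using r by simp
    have "hausdorff_outer ?d (neck l) \<le> ennreal (2 * (2 * sqrt 2 ^ card I * slice_const (card I) * (4 * r) ^ (card I - 1) * (4 * r + r))) * S"
      unfolding neck_def S_def
      by (rule revolution_volume_le[OF I ed_basis[OF sl] r]) (use r antimono_neckF[OF A0] neck_nonneg in auto)
    then show ?thesis by (simp add: k_def)
  qed
  have cp: "hausdorff_outer ?d (cap i) \<le> ennreal k * S" for i
    unfolding k_def S_def
  proof (rule hausdorff_outer_monotone_profile[OF I refl, where z="\<lambda>_. 0"])
    show "(dist p q)\<^sup>2 \<le> (norm (X p - X q))\<^sup>2 + (0 - 0)\<^sup>2" if "p \<in> cap i" "q \<in> cap i" for p q
    proof -
      have "p = X p + v i" "q = X q + v i" using that by (auto simp: cap_def algebra_simps)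
      then have "p - q = X p - X q" by (metis add_diff_cancel_right)
      then show ?thesis by (simp add: dist_norm)
    qed
  qed (use r in \<open>auto simp: cap_def\<close>)
  let ?L = "{l. Suc l < N}"
  have fin: "finite ?L" by (rule finite_subset[of _ "{..N}"]) auto
  have cardL: "card ?L = N - 1"
  proof -
    have "?L = {..<N - 1}" by auto
    then show ?thesis by simp
  qed
  have "hausdorff_outer ?d M \<le> hausdorff_outer ?d (\<Union>l<N. rim l) + hausdorff_outer ?d (\<Union>l\<in>?L. neck l) + hausdorff_outer ?d (cap 0) + hausdorff_outer ?d (cap (2 * N - 1))"
    unfolding M_def by (intro order_trans[OF hausdorff_outer_Un] add_mono order_refl)
  also have "\<dots> \<le> (\<Sum>l<N. hausdorff_outer ?d (rim l)) + (\<Sum>l\<in>?L. ennreal (2 * k) * S) + ennreal k * S + ennreal k * S"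
    by (intro add_mono cp order_trans[OF hausdorff_outer_UN_finite] sum_mono nk) (use fin in auto)
  also have "(\<Sum>l\<in>?L. ennreal (2 * k) * S) = of_nat (N - 1) * (ennreal (2 * k) * S)" by (simp add: cardL)
  also have "(\<Sum>l<N. hausdorff_outer ?d (rim l)) + of_nat (N - 1) * (ennreal (2 * k) * S) + ennreal k * S + ennreal k * S
      = (\<Sum>l<N. hausdorff_outer ?d (rim l)) + of_nat (2 * N) * (ennreal k * S)"
  proof -
    obtain n where n: "N = Suc n" using N by (cases N) auto
    have "ennreal (2 * k) = 2 * ennreal k" using k0 by (simp add: ennreal_mult')
    then show ?thesis by (simp add: n algebra_simps mult_2)
  qed
  finally show ?thesis by (simp add: k_def)
qed

lemma rim_volume_le:
  assumes "l < N"
  shows "hausdorff_outer (card I) (rim l) \<le> ennreal (2 * (2 * sqrt 2 ^ card I * slice_const (card I) * (sqrt (B + C)) ^ (card I - 1) * (sqrt (B + C) + r)))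
     * hausdorff_outer (card I - 1) {x\<in>span I. norm x = 1}"
proof -
  have sl: "Suc (2 * l) < 2 * N" using assms by auto
  have BC: "0 < B + C" using B_ge C(1) zero_le_power2[of r] by linarith
  have "rim l \<subseteq> {p \<in> revolution I (mid (2 * l)) (ed (2 * l)) r (rimF B C). norm (X p) \<le> sqrt (B + C)}"
    using rim_X_le[OF assms] by (auto simp: rim_def real_le_rsqrt)
  then have "hausdorff_outer (card I) (rim l) \<le> hausdorff_outer (card I) {p \<in> revolution I (mid (2 * l)) (ed (2 * l)) r (rimF B C). norm (X p) \<le> sqrt (B + C)}"
    by (rule hausdorff_outer_mono)
  also have "\<dots> \<le> ennreal (2 * (2 * sqrt 2 ^ card I * slice_const (card I) * (sqrt (B + C)) ^ (card I - 1) * (sqrt (B + C) + r)))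
     * hausdorff_outer (card I - 1) {x\<in>span I. norm x = 1}"
    by (rule revolution_volume_le[OF I ed_basis[OF sl] r]) (use BC mono_rimF[OF C(1)] rim_nonneg in auto)
  finally show ?thesis .
qed

text \<open>A rim contains two flat annuli, one in each of its sheets, between the cut and a radius
  b \<le> sqrt B.\<close>

lemma rim_volume_ge:
  assumes "l < N" and b: "4 * r < b" "b\<^sup>2 \<le> B"
  shows "2 * (ennreal (slice_const (card I) * ((b ^ card I - (4 * r) ^ card I) / real (card I))) * hausdorff_outer (card I - 1) {x\<in>span I. norm x = 1})
    \<le> hausdorff_outer (card I) (rim l)"
proof -
  have sl: "Suc (2 * l) < 2 * N" using assms by auto
  let ?A = "\<lambda>i. {p. p - v i \<in> span I \<and> 4 * r \<le> norm (p - v i) \<and> norm (p - v i) \<le> b}"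
  have cI: "1 \<le> card I" using I finI by (simp add: Suc_leI card_gt_0_iff)
  have low: "ennreal (slice_const (card I) * ((b ^ card I - (4 * r) ^ card I) / real (card I))) * hausdorff_outer (card I - 1) {x\<in>span I. norm x = 1} \<le> hausdorff_outer (card I) (?A i)" for i
    using r b cI by (intro hausdorff_outer_annulus_ge) (auto intro: span_scale)
  have Ain: "X p = p - v i" "Y p = v i" if "p \<in> ?A i" for p i
  proof -
    have "X p = X (p - v i)" unfolding linear_diff[OF linX] X_v by simp
    also have "\<dots> = p - v i" using that span_coord[OF I(1)] by simp
    finally show "X p = p - v i" .
    then show "Y p = v i" by simp
  qed
  have sub: "?A i \<subseteq> rim l" if "i = 2 * l \<or> i = Suc (2 * l)" for i
  proof
    fix p assume p: "p \<in> ?A i"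
    have "(norm (X p))\<^sup>2 \<le> b\<^sup>2" using p Ain[OF p] by (intro power_mono) auto
    then have "rimF B C (X p \<bullet> X p) = 0" using b by (intro rim_zero) (simp add: XX)
    then have "p \<in> revolution I (mid (2 * l)) (ed (2 * l)) r (rimF B C)"
      using Ain[OF p] that by (intro flat_in_rev[OF sl]) auto
    then show "p \<in> rim l" using p Ain[OF p] by (simp add: rim_def)
  qed
  have cl: "closed (?A i)" for i
  proof -
    have "?A i = {p. p - v i \<in> span I} \<inter> {p. 4 * r \<le> norm (p - v i)} \<inter> {p. norm (p - v i) \<le> b}" by auto
    moreover have "closed {p. p - v i \<in> span I}"
      using continuous_closed_vimage[OF closed_span, of "\<lambda>p. p - v i" I] by (simp add: vimage_def)
    ultimately show ?thesis by (auto intro!: closed_Int closed_Collect_le continuous_intros)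
  qed
  have "?A (2 * l) \<inter> ?A (Suc (2 * l)) = {}"
  proof -
    have ne: "v (2 * l) \<noteq> v (Suc (2 * l))" using v_far[of "2 * l" "Suc (2 * l)"] sl r by auto
    show ?thesis
    proof (rule ccontr)
      assume "?A (2 * l) \<inter> ?A (Suc (2 * l)) \<noteq> {}"
      then obtain p where p: "p \<in> ?A (2 * l)" "p \<in> ?A (Suc (2 * l))" by (elim ex_in_conv[THEN iffD2, THEN exE]) (erule IntE, rule that)
      then show False using Ain(2)[OF p(1)] Ain(2)[OF p(2)] ne by (metis (no_types))
    qed
  qed
  then have "hausdorff_outer (card I) (?A (2 * l)) + hausdorff_outer (card I) (?A (Suc (2 * l))) = hausdorff_outer (card I) (?A (2 * l) \<union> ?A (Suc (2 * l)))"
    using cl by (intro hausdorff_outer_Un_disjoint[symmetric]) auto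
  also have "\<dots> \<le> hausdorff_outer (card I) (rim l)" using sub by (intro hausdorff_outer_mono) auto
  finally show ?thesis using add_mono[OF low[of "2 * l"] low[of "Suc (2 * l)"]] unfolding mult_2 by (rule order_trans[rotated])
qed

text \<open>All rims are congruent to one model, so a single number enters both the lower and the
  upper volume bound; the number of discs can then be fixed by division.\<close>

lemma rim_isometric:
  assumes l: "l < N" and e0: "e0 \<in> Basis" "e0 \<notin> I"
  shows "hausdorff_outer k (rim l) = hausdorff_outer k {p \<in> revolution I 0 e0 r (rimF B C). 4 * r \<le> norm (X p)}"
proof -
  have sl: "Suc (2 * l) < 2 * N" using l by auto
  let ?S = "{p \<in> revolution I 0 e0 r (rimF B C). 4 * r \<le> norm (X p)}"
  define f where "f p = X p + (mid (2 * l) + (p \<bullet> e0) *\<^sub>R ed (2 * l))" for p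
  have X0: "X (0::'a) = 0" using linear_0[OF linX] .
  note R0 = revolution_iff_height[OF I(1) e0 X0 r]
  have Xf: "X (f p) = X p" for p
    unfolding f_def linear_add[OF linX] linear_scale[OF linX] X_mid X_basis[OF ed_basis[OF sl]] coord_proj_idem[OF I(1)] by simp
  have Yf: "Y (f p) = mid (2 * l) + (p \<bullet> e0) *\<^sub>R ed (2 * l)" for p unfolding Xf by (simp add: f_def)
  have Se: "p \<bullet> e0 = r * t" if "Y p = (r * t) *\<^sub>R e0" for p t
  proof -
    have "p = X p + (r * t) *\<^sub>R e0" using that by (simp add: algebra_simps)
    then have "p \<bullet> e0 = X p \<bullet> e0 + (r * t) * (e0 \<bullet> e0)" by (metis inner_add_left inner_scaleR_left)
    then show ?thesis using coord_proj_inner[OF I(1) e0(1), of p] e0 by simp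
  qed
  have "f ` ?S = rim l"
  proof (intro equalityI subsetI)
    fix y assume "y \<in> f ` ?S"
    then obtain p where p: "p \<in> ?S" "y = f p" by auto
    then obtain t where t: "Y p = (r * t) *\<^sub>R e0" "t\<^sup>2 + rimF B C (X p \<bullet> X p) = 1" using R0 by auto
    then have "Y y = mid (2 * l) + (r * t) *\<^sub>R ed (2 * l)" using Yf[of p] Se[OF t(1)] p by simp
    then show "y \<in> rim l" using t(2) p Xf rev_iff[OF sl] by (auto simp: rim_def)
  next
    fix y assume y: "y \<in> rim l"
    then obtain t where t: "Y y = mid (2 * l) + (r * t) *\<^sub>R ed (2 * l)" "t\<^sup>2 + rimF B C (X y \<bullet> X y) = 1"
      using rev_iff[OF sl] by (auto simp: rim_def)
    define p where "p = X y + (r * t) *\<^sub>R e0"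
    have Xp: "X p = X y" unfolding p_def linear_add[OF linX] linear_scale[OF linX] X_basis[OF e0] coord_proj_idem[OF I(1)] by simp
    have Yp: "Y p = (r * t) *\<^sub>R e0" unfolding Xp by (simp add: p_def)
    have "p \<in> ?S" using Yp Xp t(2) y R0[of p] by (auto simp: rim_def)
    moreover have "y = f p" unfolding f_def Xp Se[OF Yp] t(1)[symmetric] by simp
    ultimately show "y \<in> f ` ?S" by blast
  qed
  moreover have "hausdorff_outer k (f ` ?S) = hausdorff_outer k ?S"
  proof (rule hausdorff_outer_isometric)
    fix p q assume pq: "p \<in> ?S" "q \<in> ?S"
    have a: "(dist p q)\<^sup>2 = (norm (X p - X q))\<^sup>2 + ((p - 0) \<bullet> e0 - (q - 0) \<bullet> e0)\<^sup>2"
      using pq by (intro revolution_norm_diff[OF I(1) e0]) (auto simp: revolution_def)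
    have fp: "f x - mid (2 * l) \<in> span (insert (ed (2 * l)) I)" for x
    proof -
      have "f x - mid (2 * l) = X x + (x \<bullet> e0) *\<^sub>R ed (2 * l)" by (simp add: f_def)
      then show ?thesis using coord_proj_in_span[OF I(1), of x] span_mono[of I "insert (ed (2 * l)) I"]
        by (auto intro!: span_add span_scale intro: span_base)
    qed
    have fe: "(f x - mid (2 * l)) \<bullet> ed (2 * l) = x \<bullet> e0" for x
      using coord_proj_inner[OF I(1) ed_basis(1)[OF sl], of x] ed_basis[OF sl] by (simp add: f_def inner_add_left inner_diff_left)
    have "(dist (f p) (f q))\<^sup>2 = (norm (X (f p) - X (f q)))\<^sup>2 + ((f p - mid (2 * l)) \<bullet> ed (2 * l) - (f q - mid (2 * l)) \<bullet> ed (2 * l))\<^sup>2"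
      by (rule revolution_norm_diff[OF I(1) ed_basis[OF sl] fp fp])
    then have "(dist (f p) (f q))\<^sup>2 = (dist p q)\<^sup>2" unfolding Xf fe a by simp
    then show "dist (f p) (f q) = dist p q" by simp
  qed
  ultimately show ?thesis by simp
qed

end

section \<open>The base manifold\<close>

lemma unit_ball_vol_step:
  assumes "0 \<le> n" shows "unit_ball_vol (n + 2) = 2 * pi / (n + 2) * unit_ball_vol n"
proof -
  have "Gamma ((n/2 + 1) + 1) = (n/2 + 1) * Gamma (n/2 + 1)"
    using assms by (intro Gamma_plus1) (auto elim!: nonpos_Ints_cases)
  moreover have "(n + 2)/2 + 1 = (n/2 + 1) + 1" by simp
  moreover have "pi powr ((n + 2)/2) = pi powr (n/2) * pi" by (simp add: add_divide_distrib powr_add)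
  ultimately have "unit_ball_vol (n + 2) = (pi powr (n/2) * pi) / ((n/2 + 1) * Gamma (n/2 + 1))"
    unfolding unit_ball_vol_def by (simp only:)
  moreover have "x * pi / ((n/2 + 1) * g) = 2 * pi / (n + 2) * (x / g)" for x g :: real
    using assms by (cases "g = 0") (auto simp: field_simps)
  ultimately show ?thesis unfolding unit_ball_vol_def by (simp only:)
qed

lemma slice_const_step: "1 \<le> d \<Longrightarrow> slice_const (d + 2) = slice_const d * ((real d + 1) / (real d + 2))"
proof -
  assume d: "1 \<le> d"
  then obtain k where k: "d = Suc k" by (cases d) auto
  have "unit_ball_vol (real (d + 2)) = 2 * pi / (real d + 2) * unit_ball_vol (real d)"
    using unit_ball_vol_step[of "real d"] by (simp add: add.commute)
  moreover have "unit_ball_vol (real (d + 2 - 1)) = 2 * pi / (real d + 1) * unit_ball_vol (real (d - 1))"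
    using unit_ball_vol_step[of "real k"] k by (simp add: add.commute)
  moreover have "(2 * pi / (D + 2) * x) / (2 * (2 * pi / (D + 1) * y)) = x / (2 * y) * ((D + 1) / (D + 2))" if "0 \<le> D" "0 < y" for x y D :: real
  proof -
    have "2 * pi / (D + 2) * x = 2 * pi * (x / (D + 2))" "2 * (2 * pi / (D + 1) * y) = 2 * pi * (2 * y / (D + 1))" by simp_all
    then have "(2 * pi / (D + 2) * x) / (2 * (2 * pi / (D + 1) * y)) = (x / (D + 2)) / (2 * y / (D + 1))"
      by (simp only: mult_divide_mult_cancel_left) simp
    then show ?thesis by simp
  qed
  ultimately show ?thesis unfolding slice_const_def using unit_ball_vol_pos[of "real (d - 1)"] by simp
qed

text \<open>Induction in steps of two, since passing from d to d + 2 multiplies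
  \<open>slice_const\<close> by (d + 1) / (d + 2); it starts from the values 1 and pi / 4.\<close>

lemma slice_const_bounds: "1 \<le> d \<Longrightarrow> 1 / real d \<le> slice_const d \<and> slice_const d \<le> 1"
proof (induction d rule: less_induct)
  case (less d)
  consider "d = 1" | "d = 2" | k where "d = k + 2" "1 \<le> k"
    using less.prems by (metis One_nat_def Suc_1 add_2_eq_Suc' diff_add_inverse2 le_add_diff_inverse2 less_2_cases_iff not_less_eq_eq not_one_le_zero less_one not_le order_le_less)
  then show ?case
  proof cases
    case 1
    then show ?thesis by (simp add: slice_const_def unit_ball_vol_1)
  next
    case 2
    have "slice_const 2 = pi / 4" by (simp add: slice_const_def unit_ball_vol_1 unit_ball_vol_2)
    then show ?thesis using 2 pi_ge_two pi_less_4 by simp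
  next
    case 3
    have IH: "1 / real k \<le> slice_const k" "slice_const k \<le> 1" using less.IH[of k] 3 by auto
    have eq: "slice_const d = slice_const k * ((real k + 1) / (real k + 2))" using slice_const_step 3 by simp
    have "slice_const k * ((real k + 1) / (real k + 2)) \<le> 1 * 1"
      using IH slice_const_pos[of k] by (intro mult_mono) auto
    moreover have "1 / real d \<le> 1 / real k * ((real k + 1) / (real k + 2))"
    proof -
      have "1 * (1 / (real k + 2)) \<le> (1 + 1 / real k) * (1 / (real k + 2))" by (rule mult_right_mono) auto
      also have "(1 + 1 / real k) = (real k + 1) / real k" using 3 by (simp add: field_simps)
      finally show ?thesis using 3 by (simp add: mult_ac add.commute)
    qed
    moreover have "\<dots> \<le> slice_const k * ((real k + 1) / (real k + 2))" using IH by (intro mult_right_mono) auto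
    ultimately show ?thesis unfolding eq by linarith
  qed
qed

lemma norm_hyperplane_split:
  assumes "I \<subseteq> Basis" "e \<in> Basis" "e \<notin> I" "p \<in> span (insert e I)"
  shows "(norm p)\<^sup>2 = (norm (coord_proj I p))\<^sup>2 + (p \<bullet> e)\<^sup>2"
  using revolution_norm_diff[OF assms(1-3), of p 0 0] assms(4) linear_0[OF linear_coord_proj, of I]
  by (simp add: span_zero)

lemma revolution_sphere:
  assumes "I \<subseteq> Basis" "e \<in> Basis" "e \<notin> I" "0 < l"
  shows "revolution I 0 e l (\<lambda>s. s / l\<^sup>2) = {p \<in> span (insert e I). norm p = l}"
proof -
  have "(p \<bullet> e)\<^sup>2 / l\<^sup>2 + coord_proj I p \<bullet> coord_proj I p / l\<^sup>2 = 1 \<longleftrightarrow> norm p = l" if "p \<in> span (insert e I)" for p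
  proof -
    have "(p \<bullet> e)\<^sup>2 / l\<^sup>2 + coord_proj I p \<bullet> coord_proj I p / l\<^sup>2 = (norm p)\<^sup>2 / l\<^sup>2"
      unfolding norm_hyperplane_split[OF assms(1-3) that] by (simp add: power2_norm_eq_inner add_divide_distrib)
    also have "\<dots> = 1 \<longleftrightarrow> (norm p)\<^sup>2 = l\<^sup>2" using assms(4) by simp (rule eq_commute)
    also have "\<dots> \<longleftrightarrow> norm p = l" using assms(4) by (intro power2_eq_iff_nonneg) auto
    finally show ?thesis .
  qed
  then show ?thesis unfolding revolution_def by auto
qed

text \<open>Connectedness comes from radial projection of the punctured span, whose dimension card I
  + 1 is at least 2.\<close>

lemma subspace_sphere_manifold:
  fixes I :: "'a::euclidean_space set"
  assumes I: "I \<subseteq> Basis" "I \<noteq> {}" and e: "e \<in> Basis" "e \<notin> I" and l: "0 < \<rho>" "\<rho> \<le> l"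
  defines "M \<equiv> {p \<in> span (insert e I). norm p = l}"
  shows "compact M" "connected M" "M \<noteq> {}" "M \<subseteq> cball 0 l" "\<forall>p\<in>M. well_curved (card I) \<rho> M p"
    "hausdorff_outer k M = ennreal (l ^ k) * hausdorff_outer k {p \<in> span (insert e I). norm p = 1}"
proof -
  have l0: "0 < l" using l by simp
  have eI: "insert e I \<subseteq> Basis" using I e by auto
  have img: "M = (\<lambda>x. l *\<^sub>R x) ` {p \<in> span (insert e I). norm p = 1}"
  proof (intro equalityI subsetI)
    fix p assume "p \<in> M"
    then have "p = l *\<^sub>R ((1/l) *\<^sub>R p)" "(1/l) *\<^sub>R p \<in> {p \<in> span (insert e I). norm p = 1}"
      using l0 by (auto simp: M_def span_scale)
    then show "p \<in> (\<lambda>x. l *\<^sub>R x) ` {p \<in> span (insert e I). norm p = 1}" by (rule image_eqI)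
  qed (use l0 in \<open>auto simp: M_def span_scale\<close>)
  show "hausdorff_outer k M = ennreal (l ^ k) * hausdorff_outer k {p \<in> span (insert e I). norm p = 1}"
    unfolding img by (rule hausdorff_outer_scaleR[OF l0])
  have "M = span (insert e I) \<inter> sphere 0 l" by (auto simp: M_def)
  then show "compact M" using closed_Int_compact[OF closed_span compact_sphere] by simp
  show "M \<subseteq> cball 0 l" by (auto simp: M_def)
  have "l *\<^sub>R e \<in> M" using e l0 by (auto simp: M_def intro!: span_scale intro: span_base)
  then show "M \<noteq> {}" by auto
  have ind: "independent (insert e I)" using independent_mono[OF independent_Basis eI] .
  have "dim (span (insert e I)) = card (insert e I)" using ind by (simp add: dim_eq_card_independent)
  moreover have "2 \<le> card (insert e I)"
    using I e finite_subset[OF I(1) finite_Basis] card_gt_0_iff[of I] by simp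
  ultimately have ad: "aff_dim (span (insert e I)) \<noteq> 1" by (simp add: aff_dim_subspace)
  have "connected (span (insert e I) - {0})"
    by (rule connected_punctured_convex[OF _ ad]) (simp add: subspace_imp_convex)
  moreover have "continuous_on (span (insert e I) - {0}) (\<lambda>x. (l / norm x) *\<^sub>R x)" by (auto intro!: continuous_intros)
  ultimately have "connected ((\<lambda>x. (l / norm x) *\<^sub>R x) ` (span (insert e I) - {0}))" by (intro connected_continuous_image)
  moreover have "(\<lambda>x. (l / norm x) *\<^sub>R x) ` (span (insert e I) - {0}) = M"
  proof (intro equalityI subsetI)
    fix p assume p: "p \<in> M"
    then have "p = (l / norm p) *\<^sub>R p" "p \<in> span (insert e I) - {0}" using l0 by (auto simp: M_def)
    then show "p \<in> (\<lambda>x. (l / norm x) *\<^sub>R x) ` (span (insert e I) - {0})" by (rule image_eqI)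
  qed (use l0 in \<open>auto simp: M_def span_scale\<close>)
  ultimately show "connected M" by simp
  have Mr: "M = revolution I 0 e l (\<lambda>s. s / l\<^sup>2)" unfolding M_def by (rule revolution_sphere[OF I(1) e l0, symmetric])
  show "\<forall>p\<in>M. well_curved (card I) \<rho> M p"
  proof
    fix p assume p: "p \<in> M"
    show "well_curved (card I) \<rho> M p"
      by (rule well_curved_revolution[OF I(1) e linear_0[OF linear_coord_proj] l0 l(1) profile_sphere[OF l] _ UNIV_I p open_UNIV])
        (use p Mr in auto)
  qed
qed

text \<open>From above, the sphere is treated as a surface of revolution. From below, orthogonal
  projection to span I is nonexpansive and maps it onto the unit ball, which contains the annulus
  between radii 1/4 and 1.\<close>

lemma subspace_sphere_volume:
  fixes I :: "'a::euclidean_space set"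
  assumes I: "I \<subseteq> Basis" "I \<noteq> {}" and e: "e \<in> Basis" "e \<notin> I"
    and s: "hausdorff_outer (card I - 1) {x\<in>span I. norm x = 1} = ennreal s" "0 < s"
  obtains h where "hausdorff_outer (card I) {p \<in> span (insert e I). norm p = 1} = ennreal h"
    "slice_const (card I) * s * (3 / (4 * real (card I))) \<le> h" "h \<le> 8 * sqrt 2 ^ card I * slice_const (card I) * s"
proof -
  let ?d = "card I"
  let ?S = "{p \<in> span (insert e I). norm p = 1}"
  have d: "1 \<le> ?d" using I finite_subset[OF I(1) finite_Basis] card_gt_0_iff[of I] by simp
  have c0: "0 < slice_const ?d" by (rule slice_const_pos)
  have Sr: "?S = revolution I 0 e 1 (\<lambda>s. s / 1\<^sup>2)" by (rule revolution_sphere[OF I(1) e, symmetric]) simp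
  have nX: "norm (coord_proj I p) \<le> 1" if "p \<in> ?S" for p
    using norm_coord_proj_le[OF I(1), of p] that by simp
  then have "?S = {p \<in> revolution I 0 e 1 (\<lambda>s. s / 1\<^sup>2). norm (coord_proj I p) \<le> 1}" unfolding Sr by auto
  then have "hausdorff_outer ?d ?S \<le> ennreal (2 * (2 * sqrt 2 ^ ?d * slice_const ?d * 1 ^ (?d - 1) * (1 + 1))) * hausdorff_outer (?d - 1) {x\<in>span I. norm x = 1}"
    using revolution_volume_le[OF I e, of 1 1 "\<lambda>s. s / 1\<^sup>2" 0] by (simp add: mono_on_def)
  also have "\<dots> = ennreal (8 * sqrt 2 ^ ?d * slice_const ?d * s)"
    unfolding s(1) using s(2) c0 by (subst ennreal_mult''[symmetric]) (auto intro: arg_cong[where f=ennreal])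
  finally have up: "hausdorff_outer ?d ?S \<le> ennreal (8 * sqrt 2 ^ ?d * slice_const ?d * s)" .
  then have fin: "hausdorff_outer ?d ?S < \<top>" by (rule le_less_trans) simp
  let ?A = "{p. p - 0 \<in> span I \<and> 1/4 \<le> norm (p - 0) \<and> norm (p - 0) \<le> (1::real)}"
  have "(1/4::real) ^ ?d \<le> (1/4) ^ 1" using d by (intro power_decreasing) auto
  then have "slice_const ?d * s * (3 / (4 * real ?d)) \<le> slice_const ?d * ((1 ^ ?d - (1/4) ^ ?d) / real ?d) * s"
    using c0 s(2) d by (simp add: field_simps)
  then have "ennreal (slice_const ?d * s * (3 / (4 * real ?d))) \<le> ennreal (slice_const ?d * ((1 ^ ?d - (1/4) ^ ?d) / real ?d)) * ennreal s"
    using s(2) by (simp add: ennreal_mult''[symmetric] ennreal_leI)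
  also have "\<dots> \<le> hausdorff_outer ?d ?A"
    unfolding s(1)[symmetric] by (rule hausdorff_outer_annulus_ge[OF _ d]) (auto intro: span_scale)
  also have "\<dots> \<le> hausdorff_outer ?d ?S"
  proof (rule hausdorff_outer_nonexpansive_onto[where f="coord_proj I"])
    show "dist (coord_proj I x) (coord_proj I y) \<le> dist x y" for x y
      unfolding dist_norm linear_diff[OF linear_coord_proj, symmetric] by (rule norm_coord_proj_le[OF I(1)])
    show "?A \<subseteq> coord_proj I ` ?S"
    proof
      fix x assume "x \<in> ?A"
      then have x: "x \<in> span I" "norm x \<le> 1" by auto
      define p where "p = x + sqrt (1 - (norm x)\<^sup>2) *\<^sub>R e"
      have Xx: "coord_proj I x = x" using span_coord[OF I(1)] x by simp
      have Xe: "coord_proj I e = 0" using e by (intro euclidean_eqI[where x="coord_proj I e"]) (auto simp: coord_proj_inner[OF I(1)] inner_Basis)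
      have Xp: "coord_proj I p = x" unfolding p_def linear_add[OF linear_coord_proj] linear_scale[OF linear_coord_proj] Xx Xe by simp
      have "x \<bullet> e = 0" using coord_proj_inner[OF I(1) e(1), of x] e(2) Xx by simp
      then have pe: "p \<bullet> e = sqrt (1 - (norm x)\<^sup>2)" using e by (simp add: p_def inner_add_left)
      have pin: "p \<in> span (insert e I)" unfolding p_def
        using x(1) span_mono[of I "insert e I"] by (intro span_add span_scale) (auto intro: span_base)
      have "(norm x)\<^sup>2 \<le> 1" using x(2) by (simp add: power_le_one)
      then have "(norm p)\<^sup>2 = 1" unfolding norm_hyperplane_split[OF I(1) e pin] Xp pe by simp
      then have "norm p = 1" by (simp add: power2_eq_1_iff) (smt (verit) norm_ge_zero)
      then show "x \<in> coord_proj I ` ?S" using pin Xp by (intro image_eqI[of _ _ p]) auto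
    qed
  qed
  finally have lo: "ennreal (slice_const ?d * s * (3 / (4 * real ?d))) \<le> hausdorff_outer ?d ?S" .
  obtain h where h: "hausdorff_outer ?d ?S = ennreal h" "0 \<le> h" using fin by (cases "hausdorff_outer ?d ?S") auto
  show ?thesis
  proof (rule that[OF h(1)])
    show "slice_const ?d * s * (3 / (4 * real ?d)) \<le> h" using lo h by (simp add: ennreal_le_iff)
    show "h \<le> 8 * sqrt 2 ^ ?d * slice_const ?d * s" using up h s(2) c0 by (subst (asm) h(1)) (simp add: ennreal_le_iff)
  qed
qed

text \<open>Here \<open>\<alpha>\<close> is the measure of the model rim and does not depend on N;
  the second and third claims allow it to be estimated before N is chosen.\<close>

lemma snake_exists:
  fixes I J :: "'a::euclidean_space set"
  assumes I: "I \<subseteq> Basis" "I \<noteq> {}" and J: "J \<subseteq> Basis" "I \<inter> J = {}" and r: "0 < r"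
    and C: "0 < C" "C\<^sup>2 = 24 * r\<^sup>2 * B" "30 * r\<^sup>2 \<le> C" and N: "1 \<le> N" "2 * N \<le> m ^ card J"
    and s: "hausdorff_outer (card I - 1) {x\<in>span I. norm x = 1} = ennreal s" "0 < s"
    and e0: "e0 \<in> Basis" "e0 \<notin> I"
  defines "d \<equiv> card I" and "\<alpha> \<equiv> hausdorff_outer (card I) {p \<in> revolution I 0 e0 r (rimF B C). 4 * r \<le> norm (coord_proj I p)}"
  shows "\<exists>M :: 'a set. compact M \<and> connected M \<and> M \<noteq> {} \<and> M \<subseteq> cball 0 (sqrt (B + C + real (card J) * (r * (real m - 1))\<^sup>2)) \<and>
      (\<forall>p\<in>M. well_curved d (r/2) M p) \<and> of_nat N * \<alpha> \<le> hausdorff_outer d M \<and>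
      hausdorff_outer d M \<le> of_nat N * \<alpha> + of_nat (2 * N) * ennreal (2 * sqrt 2 ^ d * slice_const d * (4 * r) ^ (d - 1) * (4 * r + r) * s)"
    and "\<alpha> \<le> ennreal (2 * (2 * sqrt 2 ^ d * slice_const d * (sqrt (B + C)) ^ (d - 1) * (sqrt (B + C) + r)) * s)"
    and "\<And>b. 4 * r < b \<Longrightarrow> b\<^sup>2 \<le> B \<Longrightarrow> ennreal (2 * (slice_const d * ((b ^ d - (4 * r) ^ d) / real d) * s)) \<le> \<alpha>"
proof -
  have m0: "0 < m"
  proof (rule ccontr)
    assume m: "\<not> 0 < m"
    show False using N m by (cases "card J = 0") (auto simp: zero_power)
  qed
  have fJ: "finite J" by (rule finite_subset[OF J(1) finite_Basis])
  obtain c :: "nat \<Rightarrow> 'a \<Rightarrow> int" where c: "inj_on c {..<m ^ card J}"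
      "\<forall>i<m ^ card J. \<forall>j. 0 \<le> c i j \<and> c i j \<le> int m - 1 \<and> (j \<notin> J \<longrightarrow> c i j = 0)"
      "\<forall>i. Suc i < m ^ card J \<longrightarrow> (\<exists>j\<in>J. \<exists>s\<in>{1,-1}. c (Suc i) = (c i)(j := c i j + s))"
    using grid_path[OF fJ m0] by (elim exE conjE) (rule that)
  \<comment> \<open>The grid coordinates run from 0 to m - 1 with mesh 2 * r; this shift centres
    them, so that offsets stay within r * (m - 1).\<close>
  define z0 where "z0 = (- r * (real m - 1)) *\<^sub>R (\<Sum>j\<in>J. j)"
  have z0i: "z0 \<bullet> b = (if b \<in> J then - r * (real m - 1) else 0)" if "b \<in> Basis" for b
  proof -
    have "(\<Sum>j\<in>J. j) \<bullet> b = (\<Sum>j\<in>J. if j = b then 1 else 0)"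
      unfolding inner_sum_left using J that by (intro sum.cong) (auto simp: inner_Basis)
    then show ?thesis using fJ by (simp add: z0_def)
  qed
  have Xz: "coord_proj I z0 = 0"
    using J by (intro euclidean_eqI[where x="coord_proj I z0"]) (auto simp: coord_proj_inner[OF I(1)] z0i)
  interpret S: snake I J r B C N c z0
  proof
    show "I \<subseteq> Basis" "I \<noteq> {}" "J \<subseteq> Basis" "I \<inter> J = {}" "0 < r" "0 < C" "C\<^sup>2 = 24 * r\<^sup>2 * B" "30 * r\<^sup>2 \<le> C" "1 \<le> N"
      "coord_proj I z0 = 0" by (fact I J r C N Xz)+
    show "inj_on c {..<2 * N}" using c(1) by (rule inj_on_subset) (use N in auto)
    show "c i j = 0" if "i < 2 * N" "j \<notin> J" for i j using c(2) that N by auto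
    show "\<exists>j\<in>J. \<exists>s\<in>{1,-1}. c (Suc i) = (c i)(j := c i j + s)" if "Suc i < 2 * N" for i
      using c(3)[rule_format, of i] that N by linarith
  qed
  have nv: "norm (S.v i) \<le> sqrt (real (card J) * (r * (real m - 1))\<^sup>2)" if i: "i < 2 * N" for i
  proof -
    have vb: "\<bar>S.v i \<bullet> b\<bar> \<le> (if b \<in> J then r * (real m - 1) else 0)" if b: "b \<in> Basis" for b
    proof (cases "b \<in> J")
      case True
      have "0 \<le> c i b" "c i b \<le> int m - 1" using c(2) i N by auto
      then have t: "0 \<le> real_of_int (c i b)" "real_of_int (c i b) \<le> real m - 1" by linarith+
      have "S.v i \<bullet> b = r * (2 * real_of_int (c i b) - (real m - 1))"
        using True S.v_inner[OF b, of i] z0i[OF b] by (simp add: algebra_simps)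
      moreover have "\<bar>2 * real_of_int (c i b) - (real m - 1)\<bar> \<le> real m - 1" using t by linarith
      ultimately show ?thesis using True r by (simp add: abs_mult mult_left_mono)
    qed (use S.v_inner[OF b, of i] z0i[OF b] in simp)
    have "(norm (S.v i))\<^sup>2 = (\<Sum>b\<in>Basis. (S.v i \<bullet> b)\<^sup>2)"
      unfolding power2_norm_eq_inner euclidean_inner[of "S.v i" "S.v i"] by (simp add: power2_eq_square)
    also have "\<dots> \<le> (\<Sum>b\<in>Basis. if b \<in> J then (r * (real m - 1))\<^sup>2 else 0)"
    proof (rule sum_mono)
      fix b :: 'a assume b: "b \<in> Basis"
      show "(S.v i \<bullet> b)\<^sup>2 \<le> (if b \<in> J then (r * (real m - 1))\<^sup>2 else 0)"
        using power_mono[OF vb[OF b] abs_ge_zero, of 2] by (simp split: if_splits)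
    qed
    also have "\<dots> = real (card J) * (r * (real m - 1))\<^sup>2"
      using J by (simp add: sum.If_cases Int_absorb1)
    finally show ?thesis by (rule real_le_rsqrt)
  qed
  have bnd: "S.M \<subseteq> cball 0 (sqrt (B + C + (sqrt (real (card J) * (r * (real m - 1))\<^sup>2))\<^sup>2))"
    by (rule S.M_bounded[OF nv])
  have N0: "0 < N" using N by simp
  have rim: "hausdorff_outer (card I) (S.rim l) = \<alpha>" if "l < N" for l
    unfolding \<alpha>_def by (rule S.rim_isometric[OF that e0])
  have sumr: "(\<Sum>l<N. hausdorff_outer (card I) (S.rim l)) = of_nat N * \<alpha>" using rim by simp
  have k: "ennreal x * hausdorff_outer (card I - 1) {x\<in>span I. norm x = 1} = ennreal (x * s)" for x
    unfolding s(1) using s(2) by (simp add: ennreal_mult'')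
  show "\<exists>M :: 'a set. compact M \<and> connected M \<and> M \<noteq> {} \<and> M \<subseteq> cball 0 (sqrt (B + C + real (card J) * (r * (real m - 1))\<^sup>2)) \<and>
      (\<forall>p\<in>M. well_curved d (r/2) M p) \<and> of_nat N * \<alpha> \<le> hausdorff_outer d M \<and>
      hausdorff_outer d M \<le> of_nat N * \<alpha> + of_nat (2 * N) * ennreal (2 * sqrt 2 ^ d * slice_const d * (4 * r) ^ (d - 1) * (4 * r + r) * s)"
  proof -
    have "S.v 0 \<in> S.cap 0" using r by (simp add: S.cap_def S.X_v)
    then have 1: "S.M \<noteq> {}" by (auto simp: S.M_def)
    have 2: "S.M \<subseteq> cball 0 (sqrt (B + C + real (card J) * (r * (real m - 1))\<^sup>2))" using bnd by simp
    have 3: "\<forall>p\<in>S.M. well_curved d (r/2) S.M p" unfolding d_def using S.M_well_curved by (rule ballI)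
    have 4: "of_nat N * \<alpha> \<le> hausdorff_outer d S.M" using S.M_volume_ge[of "card I"] unfolding sumr d_def .
    have 5: "hausdorff_outer d S.M \<le> of_nat N * \<alpha> + of_nat (2 * N) * ennreal (2 * sqrt 2 ^ d * slice_const d * (4 * r) ^ (d - 1) * (4 * r + r) * s)"
      using S.M_volume_le unfolding sumr d_def k .
    show ?thesis by (rule exI[where x=S.M]) (intro conjI S.compact_M S.connected_M 1 2 3 4 5)
  qed
  show "\<alpha> \<le> ennreal (2 * (2 * sqrt 2 ^ d * slice_const d * (sqrt (B + C)) ^ (d - 1) * (sqrt (B + C) + r)) * s)"
    using S.rim_volume_le[OF N0] unfolding rim[OF N0] k d_def .
  fix b assume b: "4 * r < b" "b\<^sup>2 \<le> B"
  have "2 * ennreal (slice_const d * ((b ^ d - (4 * r) ^ d) / real d) * s) \<le> \<alpha>"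
    using S.rim_volume_ge[OF N0 b] unfolding rim[OF N0] k d_def .
  moreover have "ennreal (2 * y) = 2 * ennreal y" for y by (simp add: ennreal_mult')
  ultimately show "ennreal (2 * (slice_const d * ((b ^ d - (4 * r) ^ d) / real d) * s)) \<le> \<alpha>"
    by (simp only:)
qed

section \<open>Choice of scale for the chain and its numerical estimates\<close>

lemma power_growth:
  "1 \<le> d \<Longrightarrow> 111/100 * real d \<le> (19/10) ^ d" "9/25 * (real d)\<^sup>2 \<le> (64/25) ^ d"
proof -
  assume d: "1 \<le> d"
  show "111/100 * real d \<le> (19/10) ^ d"
    using d
  proof (induction d rule: dec_induct)
    case (step n)
    show ?case
    proof (cases "n = 1")
      case False
      then have "2 \<le> n" using step by simp
      then have "111/100 * real (Suc n) \<le> 19/10 * (111/100 * real n)" by simp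
      also have "\<dots> \<le> 19/10 * (19/10) ^ n" using step by (intro mult_left_mono) auto
      finally show ?thesis by simp
    qed (simp add: power2_eq_square)
  qed simp
next
  have "1 + real d * (3/5) \<le> (1 + 3/5) ^ d" using Bernoulli_inequality[of "3/5" d] by simp
  then have "3/5 * real d \<le> (8/5::real) ^ d" by simp
  then have "(3/5 * real d)\<^sup>2 \<le> ((8/5::real) ^ d)\<^sup>2" by (intro power_mono) auto
  also have "((8/5::real) ^ d)\<^sup>2 = ((8/5)\<^sup>2) ^ d" by (simp only: power_mult[symmetric] mult.commute)
  also have "(8/5::real)\<^sup>2 = 64/25" by (simp add: power2_eq_square)
  finally show "9/25 * (real d)\<^sup>2 \<le> (64/25) ^ d" by (simp add: power_mult_distrib power2_eq_square)
qed

lemma sqrt2_le: "sqrt 2 \<le> 14143/10000"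
  by (rule real_le_lsqrt) (auto simp: power2_eq_square)

lemma sqrt24_bounds: "122/25 \<le> sqrt 24" "sqrt 24 \<le> (49/10::real)"
  using real_le_rsqrt[of "122/25" 24] real_le_lsqrt[of "49/10" 24] by (simp_all add: power2_eq_square)

text \<open>For a = R / sqrt (d + j), the ball of radius R/2 contains the product of a d-ball of
  radius sqrt d * a / 2 and a j-cube of side a; the discs go into the first factor, the stacking
  into the second. C is the value that \<open>profile_rim\<close> prescribes for B = b^2. The
  divisor 9 is tuned to \<open>rim_upper\<close>, where sqrt 2 * 13/10 * b must stay below 4/19 *
  R.\<close>

locale snake_scale =
  fixes d j :: nat and a r b C :: real
  assumes d: "1 \<le> d" and r: "0 < r" "64 * r \<le> a" and b: "b = sqrt (real d) * a / 9" and C: "C = sqrt 24 * r * b"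
begin

lemma sd: "1 \<le> sqrt (real d)" "(sqrt (real d))\<^sup>2 = real d"
  using d by auto

lemma b_ge: "64/9 * r \<le> b" "a / 9 \<le> b" "0 < b" "64/9 * r * sqrt (real d) \<le> b"
proof -
  have "1 * a \<le> sqrt (real d) * a" using sd r by (intro mult_right_mono) auto
  then show "a / 9 \<le> b" unfolding b by simp
  then show "64/9 * r \<le> b" "0 < b" using r by linarith+
  have "sqrt (real d) * (64 * r) \<le> sqrt (real d) * a" using r sd by (intro mult_left_mono) auto
  then show "64/9 * r * sqrt (real d) \<le> b" unfolding b by (simp add: mult_ac)
qed

lemma C_facts: "0 < C" "C\<^sup>2 = 24 * r\<^sup>2 * b\<^sup>2" "30 * r\<^sup>2 \<le> C" "b\<^sup>2 + C \<le> (13/10 * b)\<^sup>2"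
proof -
  show "0 < C" unfolding C using r b_ge by simp
  show "C\<^sup>2 = 24 * r\<^sup>2 * b\<^sup>2" unfolding C by (simp add: power_mult_distrib)
  have "122/25 * r * (64/9 * r) \<le> sqrt 24 * r * b" using r b_ge sqrt24_bounds by (intro mult_mono) auto
  moreover have "30 * r\<^sup>2 \<le> 122/25 * r * (64/9 * r)" by (simp add: power2_eq_square)
  ultimately show "30 * r\<^sup>2 \<le> C" unfolding C by linarith
  have "sqrt 24 * r \<le> 49/10 * r" using r sqrt24_bounds by (intro mult_right_mono) auto
  also have "\<dots> \<le> 69/100 * b" using b_ge(1) r by linarith
  finally have "sqrt 24 * r * b \<le> 69/100 * b * b" using b_ge by (intro mult_right_mono) auto
  then show "b\<^sup>2 + C \<le> (13/10 * b)\<^sup>2" unfolding C by (simp add: power2_eq_square)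
qed

lemma fits:
  assumes "0 \<le> x" "x \<le> a / 2" shows "b\<^sup>2 + C + real j * x\<^sup>2 \<le> (sqrt (real (d + j)) * a / 2)\<^sup>2"
proof -
  have "b\<^sup>2 = real d * a\<^sup>2 / 81" unfolding b using sd by (simp add: power_divide power_mult_distrib)
  then have "(13/10 * b)\<^sup>2 \<le> real d * (a\<^sup>2 / 4)" by (simp only: power_mult_distrib) (simp add: power_divide)
  moreover have "x\<^sup>2 \<le> (a/2)\<^sup>2" using assms by (intro power_mono) auto
  then have "real j * x\<^sup>2 \<le> real j * (a\<^sup>2 / 4)" by (intro mult_left_mono) (auto simp: power_divide)
  moreover have "(sqrt (real (d + j)) * a / 2)\<^sup>2 = real d * (a\<^sup>2 / 4) + real j * (a\<^sup>2 / 4)"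
    by (simp add: power_divide power_mult_distrib distrib_right add_divide_distrib)
  ultimately show ?thesis using C_facts(4) by linarith
qed

text \<open>Compares the inner discs of radius 4r, which bound necks and caps, with the flat annuli
  of the rims. As b is at least 16/9 * sqrt d times 4r, its d-th power outgrows the factor d * sqrt
  2 ^ d.\<close>

lemma rim_dominates: "real d * sqrt 2 ^ d * (4 * r) ^ d \<le> 2 * (b ^ d - (4 * r) ^ d)"
proof -
  have y: "0 < 4 * r" using r by simp
  have bb: "(16/9 * sqrt (real d)) * (4 * r) \<le> b" using b_ge(4) by (simp add: algebra_simps)
  then have "((16/9 * sqrt (real d)) * (4 * r)) ^ d \<le> b ^ d" using r sd by (intro power_mono) auto
  then have bd: "(16/9 * sqrt (real d)) ^ d * (4 * r) ^ d \<le> b ^ d" unfolding power_mult_distrib[of _ "4 * r"] .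
  have key: "real d * sqrt 2 ^ d + 2 \<le> 2 * (16/9 * sqrt (real d)) ^ d"
  proof (cases "d = 1")
    case True
    then show ?thesis using sqrt2_le by simp
  next
    case False
    then have d2: "2 \<le> d" using d by simp
    have "sqrt (real d) ^ 2 \<le> sqrt (real d) ^ d" using d2 sd by (intro power_increasing) auto
    then have s1: "real d \<le> sqrt (real d) ^ d" using sd by simp
    have s2: "sqrt 2 ^ d \<le> (16/9) ^ d" using sqrt2_le by (intro power_mono) auto
    have "real d * sqrt 2 ^ d \<le> sqrt (real d) ^ d * (16/9) ^ d" using s1 s2 by (intro mult_mono) auto
    moreover have "2 * 1 \<le> sqrt (real d) ^ d * (16/9) ^ d" using s1 d2 by (intro mult_mono) (auto simp: one_le_power)
    ultimately have "real d * sqrt 2 ^ d + 2 \<le> 2 * (sqrt (real d) ^ d * (16/9) ^ d)" by linarith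
    then show ?thesis unfolding power_mult_distrib[of "16/9" "sqrt (real d)" d] by (simp only: mult.commute[of "(16/9) ^ d"])
  qed
  have "(real d * sqrt 2 ^ d + 2) * (4 * r) ^ d \<le> 2 * (16/9 * sqrt (real d)) ^ d * (4 * r) ^ d"
    using key y by (intro mult_right_mono) auto
  also have "\<dots> \<le> 2 * b ^ d" using bd by linarith
  finally show ?thesis by (simp add: algebra_simps)
qed

lemma rim_diff: "7/16 * (a / 9) ^ d \<le> b ^ d - (4 * r) ^ d"
proof -
  have "(4 * r) ^ d \<le> (9/16 * b) ^ d" using b_ge(1) r by (intro power_mono) auto
  also have "\<dots> = (9/16) ^ d * b ^ d" by (rule power_mult_distrib)
  also have "\<dots> \<le> (9/16) ^ 1 * b ^ d" using d b_ge(3) by (intro mult_right_mono power_decreasing) auto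
  finally have "7/16 * b ^ d \<le> b ^ d - (4 * r) ^ d" by simp
  moreover have "(a / 9) ^ d \<le> b ^ d" using b_ge(2) r by (intro power_mono) auto
  ultimately show ?thesis by linarith
qed

text \<open>The ratio 10/19 between the two radii leaves a factor (19/10)^d, which absorbs d by
  \<open>power_growth\<close>.\<close>

lemma rim_upper:
  assumes R: "sqrt (real d) * a \<le> R"
  shows "12 * (4 * sqrt 2 ^ d * (sqrt (b\<^sup>2 + C)) ^ (d - 1) * (sqrt (b\<^sup>2 + C) + r)) \<le> 48 * (2/5 * R) ^ d / real d"
proof -
  let ?A = "sqrt (b\<^sup>2 + C)"
  have "0 \<le> 13/10 * b" using b_ge(3) by simp
  then have A: "?A \<le> 13/10 * b" using C_facts(4) by (rule real_le_lsqrt)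
  have A0: "0 \<le> ?A" using C_facts(1) zero_le_power2[of b] by simp
  have "?A + r \<le> 111/100 * (13/10 * b)" using A b_ge(1,3) by linarith
  moreover have "?A ^ (d - 1) \<le> (13/10 * b) ^ (d - 1)" using A A0 by (intro power_mono) auto
  ultimately have "?A ^ (d - 1) * (?A + r) \<le> (13/10 * b) ^ (d - 1) * (111/100 * (13/10 * b))"
    using A A0 r b_ge(3) by (intro mult_mono) auto
  also have "\<dots> = 111/100 * (13/10 * b) ^ d" using d by (cases d) auto
  finally have "sqrt 2 ^ d * (?A ^ (d - 1) * (?A + r)) \<le> sqrt 2 ^ d * (111/100 * (13/10 * b) ^ d)" by (intro mult_left_mono) auto
  also have "\<dots> = 111/100 * (sqrt 2 * (13/10 * b)) ^ d" unfolding power_mult_distrib[of "sqrt 2"] by (rule mult.left_commute)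
  also have "(sqrt 2 * (13/10 * b)) ^ d \<le> (10/19 * (2/5 * R)) ^ d"
  proof (rule power_mono)
    have "9 * b \<le> R" using R unfolding b by simp
    have "sqrt 2 * (13/10 * b) \<le> 14143/10000 * (13/10 * b)" using b_ge(3) sqrt2_le by (intro mult_right_mono) auto
    also have "\<dots> \<le> 10/19 * (2/5 * R)" using \<open>9 * b \<le> R\<close> b_ge(3) by linarith
    finally show "sqrt 2 * (13/10 * b) \<le> 10/19 * (2/5 * R)" .
  qed (use b_ge(3) in simp)
  finally have 1: "sqrt 2 ^ d * (?A ^ (d - 1) * (?A + r)) \<le> 111/100 * (10/19 * (2/5 * R)) ^ d" by simp
  have "111/100 * real d * (10/19) ^ d \<le> (19/10) ^ d * (10/19) ^ d" using power_growth(1)[OF d] by (intro mult_right_mono) auto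
  also have "\<dots> = 1" by (simp add: power_mult_distrib[symmetric])
  finally have "111/100 * (10/19) ^ d \<le> 1 / real d" using d by (simp add: field_simps)
  moreover have R0: "0 \<le> 2/5 * R" using R r sd mult_nonneg_nonneg[of "sqrt (real d)" a] by linarith
  ultimately have "111/100 * (10/19) ^ d * (2/5 * R) ^ d \<le> 1 / real d * (2/5 * R) ^ d" by (intro mult_right_mono) auto
  moreover have "(10/19 * (2/5 * R)) ^ d = (10/19) ^ d * (2/5 * R) ^ d" by (rule power_mult_distrib)
  ultimately have "111/100 * (10/19 * (2/5 * R)) ^ d \<le> 1 / real d * (2/5 * R) ^ d" by simp
  with 1 have "48 * (sqrt 2 ^ d * (?A ^ (d - 1) * (?A + r))) \<le> 48 * (1 / real d * (2/5 * R) ^ d)" by linarith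
  then show ?thesis by (simp add: mult.assoc)
qed

end

text \<open>Up to rounding there are x = a / (6 * c) sheets per stacking direction, and 192 * c / a
  = 32 / x; the hypothesis on V therefore bounds V by a constant times the d-th power of a and the
  j-th power of x, the volume of a full grid of discs. Taking half of m^j and rounding down costs at
  most a factor 3.\<close>

lemma full_count:
  fixes a c s V :: real and d j m :: nat
  assumes d: "1 \<le> d" and j: "1 \<le> j" and c: "0 < c" "192 * c \<le> a" and s: "0 < s"
    and m: "a / (6 * c) \<le> real m" and V: "V * (192 * c / a) ^ (d + j) \<le> 36 * 8 ^ d * s * c ^ d"
    and \<alpha>: "7/8 / (real d)\<^sup>2 * (a / 9) ^ d * s \<le> \<alpha>"
  shows "V / 64 \<le> real (m ^ j div 2) * \<alpha>"
proof -
  have a: "0 < a" using c by linarith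
  define x where "x = a / (6 * c)"
  have x: "32 \<le> x" using c by (simp add: x_def field_simps)
  have q: "192 * c / a = 32 / x" using a c by (simp add: x_def)
  have x0: "0 < x" using x by simp
  have "x ^ j * 1 \<le> real (m ^ j)" using m x by (simp add: x_def[symmetric] power_mono)
  moreover have "32 \<le> x ^ j"
  proof -
    have "x ^ 1 \<le> x ^ j" using x j by (intro power_increasing) auto
    then show ?thesis using x by simp
  qed
  moreover have "real (m ^ j) \<le> 2 * real (m ^ j div 2) + 1"
  proof -
    have "m ^ j \<le> 2 * (m ^ j div 2) + 1" by presburger
    then have "real (m ^ j) \<le> real (2 * (m ^ j div 2) + 1)" by (rule of_nat_mono)
    then show ?thesis by simp
  qed
  ultimately have N: "x ^ j / 3 \<le> real (m ^ j div 2)" by linarith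
  have "V * (32 / x) ^ (d + j) = V * (32 / x) ^ d * (32 / x) ^ j" by (simp add: power_add)
  then have "V * (32 / x) ^ d * (32 / x) ^ j \<le> 36 * 8 ^ d * s * c ^ d" using V unfolding q by linarith
  then have "V * (32 / x) ^ d * (32 / x) ^ j * (x / 32) ^ (d + j) \<le> 36 * 8 ^ d * s * c ^ d * (x / 32) ^ (d + j)"
    using x0 by (intro mult_right_mono) auto
  moreover have "(32 / x) ^ d * (32 / x) ^ j * (x / 32) ^ (d + j) = 1"
    using x0 by (simp add: power_add[symmetric] power_mult_distrib[symmetric])
  ultimately have "V \<le> 36 * 8 ^ d * s * c ^ d * (x / 32) ^ (d + j)" by (metis mult.assoc mult.right_neutral)
  also have "\<dots> = 36 * s * (8 * c * (x / 32)) ^ d * (x / 32) ^ j" unfolding power_add power_mult_distrib by (simp only: mult_ac)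
  also have "8 * c * (x / 32) = a / 24" using c by (simp add: x_def)
  also have "(x / 32) ^ j = x ^ j * (1/32) ^ j" by (simp add: power_divide)
  also have "36 * s * (a / 24) ^ d * (x ^ j * (1/32) ^ j) \<le> 36 * s * (a / 24) ^ d * (x ^ j * (1/32))"
    using j s a x0 power_decreasing[of 1 j "1/32::real"] by (intro mult_left_mono) auto
  also have "\<dots> = 64 * (9 / 512 * (s * (a / 24) ^ d * x ^ j))" by simp
  finally have V1: "V / 64 \<le> 9 / 512 * (s * (a / 24) ^ d * x ^ j)" by linarith
  have "9/512 \<le> 7/24 / (real d)\<^sup>2 * (8/3) ^ d"
  proof -
    have "(64/25::real) ^ d \<le> (8/3) ^ d" by (intro power_mono) auto
    then have "9/25 * (real d)\<^sup>2 \<le> (8/3) ^ d" using power_growth(2)[of d] by linarith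
    moreover have "0 \<le> (8/3::real) ^ d" by simp
    ultimately have "9/512 * (real d)\<^sup>2 \<le> 7/24 * (8/3) ^ d" by linarith
    then show ?thesis using d by (simp add: field_simps)
  qed
  then have "9/512 * (s * (a / 24) ^ d * x ^ j) \<le> 7/24 / (real d)\<^sup>2 * (8/3) ^ d * (s * (a / 24) ^ d * x ^ j)"
    using s a x0 by (intro mult_right_mono) auto
  also have "\<dots> = x ^ j / 3 * (7/8 / (real d)\<^sup>2 * ((8/3) * (a / 24)) ^ d * s)" unfolding power_mult_distrib[of "8/3"] by (simp add: mult_ac)
  also have "8/3 * (a / 24) = a / 9" by simp
  also have "x ^ j / 3 * (7/8 / (real d)\<^sup>2 * (a / 9) ^ d * s) \<le> real (m ^ j div 2) * \<alpha>"
    using N \<alpha> s a x0 by (intro mult_mono) auto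
  finally show ?thesis using V1 by simp
qed

text \<open>The cases compare V with w, the volume of the sphere of radius 2/5 * R. If w is at least
  V/8, some smaller sphere has volume exactly V/8, and \<open>36 * 8 ^ d * s * c ^ d \<le> V\<close>
  makes its radius at least 3/2 * c. If w is between V/64 and V/8, the large sphere itself is the
  base. Below V/64 a chain is built.\<close>

lemma base_manifold:
  fixes I :: "'a::euclidean_space set"
  assumes I: "I \<subseteq> Basis" "card I = d" and d: "1 \<le> d" "d < DIM('a)" and c: "0 < c" and R: "144 * c \<le> R"
    and s: "hausdorff_outer (d - 1) {x\<in>span I. norm x = 1} = ennreal s" "0 < s"
    and k: "1 \<le> k" "k \<le> DIM('a)" and V: "36 * 8 ^ d * s * c ^ d \<le> V" "V * (192 * c * sqrt (real k) / R) ^ k \<le> 36 * 8 ^ d * s * c ^ d"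
  shows "\<exists>M :: 'a set. compact M \<and> connected M \<and> M \<noteq> {} \<and> M \<subseteq> cball 0 (R/2) \<and>
    (\<forall>p\<in>M. well_curved d (3/2 * c) M p) \<and> ennreal (V/64) \<le> hausdorff_outer d M \<and> hausdorff_outer d M \<le> ennreal (V/2)"
proof -
  have finI: "finite I" by (rule finite_subset[OF I(1) finite_Basis])
  have I0: "I \<noteq> {}" using I(2) d by auto
  have "I \<noteq> Basis" using I(2) d by auto
  then obtain e where e: "e \<in> Basis" "e \<notin> I" using I(1) by auto
  define es where "es = slice_const d"
  have es: "1 / real d \<le> es" "es \<le> 1" "0 < es" using slice_const_bounds[OF d(1)] slice_const_pos by (auto simp: es_def)
  have d0: "0 < real d" using d by simp
  have "hausdorff_outer (card I - 1) {x\<in>span I. norm x = 1} = ennreal s" using s I by simp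
  then obtain h where h: "hausdorff_outer d {p \<in> span (insert e I). norm p = 1} = ennreal h"
      "es * s * (3 / (4 * real d)) \<le> h" "h \<le> 8 * sqrt 2 ^ d * es * s"
    using subspace_sphere_volume[OF I(1) I0 e _ s(2), unfolded I(2), folded es_def] s(1) by metis
  have "0 < es * s * (3 / (4 * real d))" using es s d0 by simp
  then have h0: "0 < h" using h(2) by linarith
  have R0: "0 < R" using R c by linarith
  have cd: "0 < 36 * 8 ^ d * s * c ^ d" using s c by simp
  then have V0: "0 < V" using V by linarith
  have sphere: ?thesis if l: "3/2 * c \<le> l" "l \<le> 2/5 * R" "V / 64 \<le> l ^ d * h" "l ^ d * h \<le> V / 2" for l
  proof -
    have l0: "0 \<le> l" using l c by linarith
    let ?M = "{p \<in> span (insert e I). norm p = l}"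
    have c32: "0 < 3/2 * c" using c by simp
    note S = subspace_sphere_manifold[OF I(1) I0 e c32 l(1)]
    have vol: "hausdorff_outer d ?M = ennreal (l ^ d * h)" unfolding S(6) h(1) using l0 h0 by (simp add: ennreal_mult'')
    have "?M \<subseteq> cball 0 (R/2)" using S(4) l(2) R0 by auto
    then show ?thesis using S(1-3) S(5)[unfolded I(2)] vol l
      by (intro exI[where x="?M"] conjI) (auto intro: ennreal_leI)
  qed
  define w where "w = (2/5 * R) ^ d * h"
  consider "V / 8 \<le> w" | "V / 64 \<le> w" "w < V / 8" | "w < V / 64" by linarith
  then show ?thesis
  proof cases
    case 1
    define l where "l = root d (V / (8 * h))"
    have ld: "l ^ d = V / (8 * h)" unfolding l_def using d V0 h0 by (intro real_root_pow_pos2) auto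
    have l0: "0 \<le> l" unfolding l_def using V0 h0 by (intro real_root_ge_zero) auto
    have lh: "l ^ d * h = V / 8" unfolding ld using h0 by simp
    have "l ^ d \<le> (2/5 * R) ^ d"
      using 1 h0 unfolding w_def lh[symmetric] by (rule_tac mult_right_le_imp_le[of _ h]) auto
    then have u: "l \<le> 2/5 * R" using d l0 R0 by (subst (asm) power_mono_iff) auto
    have "(3/2 * c) ^ d * (8 * h) \<le> (3/2 * c) ^ d * (8 * (8 * sqrt 2 ^ d * 1 * s))"
      using h(3) es s c by (intro mult_left_mono order_trans[OF h(3)] mult_right_mono) auto
    also have "\<dots> = 64 * s * (3/2 * c * sqrt 2) ^ d" unfolding power_mult_distrib[of _ "sqrt 2"] by simp
    also have "\<dots> \<le> 64 * s * (4 * c) ^ d"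
    proof -
      have "3/2 * c * sqrt 2 \<le> 3/2 * c * (14143/10000)" using c sqrt2_le by (intro mult_left_mono) auto
      then have "3/2 * c * sqrt 2 \<le> 4 * c" using c by linarith
      then show ?thesis using s c by (intro mult_left_mono power_mono) auto
    qed
    also have "\<dots> \<le> 36 * 8 ^ d * s * c ^ d"
    proof -
      have "(2::real) ^ 1 \<le> 2 ^ d" using d by (intro power_increasing) auto
      then have "64 * s * (4 * c) ^ d \<le> 36 * 2 ^ d * s * (4 * c) ^ d" using s c by (intro mult_right_mono) auto
      also have "\<dots> = 36 * (2 * 4) ^ d * s * c ^ d" unfolding power_mult_distrib by (simp only: mult_ac)
      finally show ?thesis by simp
    qed
    also have "\<dots> \<le> V" by (rule V(1))
    finally have "(3/2 * c) ^ d \<le> l ^ d" unfolding ld using h0 by (simp add: pos_le_divide_eq)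
    then have "3/2 * c \<le> l" using d l0 c by (subst (asm) power_mono_iff) auto
    then show ?thesis using u by (rule sphere) (use lh V0 in auto)
  next
    case 2
    show ?thesis by (rule sphere[of "2/5 * R"]) (use 2 R c V0 in \<open>auto simp: w_def\<close>)
  next
    case 3
    define a where "a = R / sqrt (real k)"
    have sk: "1 \<le> sqrt (real k)" using k by simp
    have Ra: "R = sqrt (real k) * a" using sk by (simp add: a_def)
    have a0: "0 < a" using R0 sk by (simp add: a_def)
    define q where "q = 192 * c / a"
    have q0: "0 < q" using a0 c by (simp add: q_def)
    have qk: "V * q ^ k \<le> 36 * 8 ^ d * s * c ^ d" using V(2) sk by (simp add: q_def a_def)
    have q1: "q \<le> 1"
    proof (rule ccontr)
      assume "\<not> q \<le> 1"
      then have "1 < q ^ k" using k by (intro one_less_power) auto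
      then have "V * 1 < V * q ^ k" using V0 by (intro mult_strict_left_mono) auto
      then show False using qk V(1) by linarith
    qed
    have ac: "192 * c \<le> a" using q1 a0 by (simp add: q_def)
    have aR: "a \<le> R" unfolding Ra using sk a0 by simp
    have w_ge: "64 * ((2/5 * R) ^ d * (es * s * (3 / (4 * real d)))) \<le> V"
    proof -
      have "(2/5 * R) ^ d * (es * s * (3 / (4 * real d))) \<le> w" unfolding w_def using h R0 by (intro mult_left_mono) auto
      then show ?thesis using 3 by linarith
    qed
    \<comment> \<open>For k \<le> d the hypothesis would give V \<le> 36 s (R/24)^d, while here V
      exceeds 64 times the volume of the large sphere, which is more. So at least one stacking
      direction is available.\<close>
    have dk: "d < k"
    proof (rule ccontr)
      assume "\<not> d < k"
      then have "q ^ d \<le> q ^ k" using q0 q1 by (intro power_decreasing) auto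
      then have "V * q ^ d \<le> 36 * 8 ^ d * s * c ^ d" using qk V0 mult_left_mono[of "q ^ d" "q ^ k" V] by linarith
      then have f1: "V * q ^ d * (a / (192 * c)) ^ d \<le> 36 * 8 ^ d * s * c ^ d * (a / (192 * c)) ^ d"
        using a0 c by (intro mult_right_mono) auto
      have f2: "V * q ^ d * (a / (192 * c)) ^ d = V * (q * (a / (192 * c))) ^ d" unfolding power_mult_distrib by simp
      have f3: "q * (a / (192 * c)) = 1" using a0 c by (simp add: q_def)
      have f4: "36 * 8 ^ d * s * c ^ d * (a / (192 * c)) ^ d = 36 * s * (8 * c * (a / (192 * c))) ^ d"
        unfolding power_mult_distrib by (simp only: mult_ac)
      have f5: "8 * c * (a / (192 * c)) = a / 24" using c by simp
      have "V * 1 ^ d \<le> 36 * s * (a / 24) ^ d" using f1 unfolding f2 f3 f4 f5 .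
      then have "V \<le> 36 * s * (a / 24) ^ d" by simp
      also have "\<dots> \<le> 36 * s * (R / 24) ^ d" using aR a0 s by (intro mult_left_mono power_mono) auto
      finally have Vu: "V \<le> 36 * (s * (R / 24) ^ d)" by simp
      have "9/25 * (real d)\<^sup>2 * (15/4) \<le> (64/25) ^ d * (15/4) ^ d"
        using power_growth(2)[of d] power_increasing[of 1 d "15/4::real"] d by (intro mult_mono) auto
      also have "\<dots> = (48/5) ^ d" by (simp add: power_mult_distrib[symmetric])
      finally have g: "27/20 * (real d)\<^sup>2 \<le> (48/5) ^ d" by simp
      have "48 * (27/20) * (s * (R / 24) ^ d) \<le> 48 * ((48/5) ^ d / (real d)\<^sup>2) * (s * (R / 24) ^ d)"
        using g d0 s R0 by (intro mult_right_mono) (auto simp: pos_le_divide_eq)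
      also have "\<dots> = 48 / real d * (s * (48/5 * (R / 24)) ^ d) * (1 / real d)" unfolding power_mult_distrib[of "48/5"] by (simp add: power2_eq_square)
      also have "48/5 * (R / 24) = 2/5 * R" by simp
      also have "48 / real d * (s * (2/5 * R) ^ d) * (1 / real d) \<le> 48 / real d * (s * (2/5 * R) ^ d) * es"
        using es s R0 d0 by (intro mult_left_mono) auto
      also have "\<dots> = 64 * ((2/5 * R) ^ d * (es * s * (3 / (4 * real d))))" by simp
      also have "\<dots> \<le> V" by (rule w_ge)
      finally have "48 * (27/20) * (s * (R / 24) ^ d) \<le> V" .
      moreover have "0 < s * (R / 24) ^ d" using s R0 by simp
      ultimately show False using Vu by linarith
    qed
    define j where "j = k - d"
    have j: "1 \<le> j" "d + j = k" using dk by (auto simp: j_def)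
    have "j \<le> card (Basis - I)" using I k finI by (simp add: card_Diff_subset j_def)
    then obtain J where J0: "J \<subseteq> Basis - I" "card J = j" using obtain_subset_with_card_n by metis
    have J: "J \<subseteq> Basis" "I \<inter> J = {}" using J0 by auto
    \<comment> \<open>Rims and necks of scale r have tangent bound \<rho> = r/2, which becomes 3/2 *
      c. Sheets are 2 * r = 6 * c apart.\<close>
    define r where "r = 3 * c"
    have r: "0 < r" "64 * r \<le> a" using c ac by (auto simp: r_def)
    define m where "m = nat \<lfloor>a / (2 * r)\<rfloor> + 1"
    have fl: "32 \<le> a / (2 * r)" using r by (simp add: pos_le_divide_eq)
    then have m: "a / (2 * r) \<le> real m" "real m - 1 \<le> a / (2 * r)" "2 \<le> m"
      unfolding m_def using le_nat_floor[of 1 "a / (2 * r)"] by (auto simp: of_nat_nat) linarith+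
    have rm: "0 \<le> r * (real m - 1)" "r * (real m - 1) \<le> a / 2"
    proof -
      show "0 \<le> r * (real m - 1)" using r m by simp
      have "r * (real m - 1) \<le> r * (a / (2 * r))" using r m by (intro mult_left_mono) auto
      then show "r * (real m - 1) \<le> a / 2" using r by simp
    qed
    define b where "b = sqrt (real d) * a / 9"
    define C where "C = sqrt 24 * r * b"
    interpret sc: snake_scale d j a r b C by unfold_locales (fact d(1) r b_def C_def)+
    have mj: "2 \<le> m ^ j"
    proof -
      have "m ^ 1 \<le> m ^ j" using m j by (intro power_increasing) auto
      then show ?thesis using m by simp
    qed
    note SE = snake_exists[OF I(1) I0 J r(1) sc.C_facts(1-3) _ _ _ s(2) e, unfolded I(2), of _ m, unfolded J0(2), folded es_def]
    define \<alpha> where "\<alpha> = hausdorff_outer d {p \<in> revolution I 0 e r (rimF (b\<^sup>2) C). 4 * r \<le> norm (coord_proj I p)}"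
    have N1: "1 \<le> (1::nat)" "2 * 1 \<le> m ^ j" using mj by auto
    have al: "\<alpha> \<le> ennreal (2 * (2 * sqrt 2 ^ d * es * (sqrt (b\<^sup>2 + C)) ^ (d - 1) * (sqrt (b\<^sup>2 + C) + r)) * s)"
      unfolding \<alpha>_def by (rule SE(2)[OF N1 s(1)])
    have "4 * r < b" using sc.b_ge(1) r by linarith
    then have ag: "ennreal (2 * (es * ((b ^ d - (4 * r) ^ d) / real d) * s)) \<le> \<alpha>"
      unfolding \<alpha>_def by (rule SE(3)[OF N1 s(1) _ order_refl])
    have "\<alpha> < \<top>" using al by (rule le_less_trans) simp
    then obtain x where x: "\<alpha> = ennreal x" "0 \<le> x" by (cases \<alpha>) auto
    have pos: "0 \<le> es * ((b ^ d - (4 * r) ^ d) / real d) * s"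
    proof -
      have "0 \<le> b ^ d - (4 * r) ^ d" using sc.rim_diff a0 zero_le_power[of "a/9" d] by linarith
      then show ?thesis using es s by simp
    qed
    have xg: "2 * (es * ((b ^ d - (4 * r) ^ d) / real d) * s) \<le> x" using ag x by (simp add: ennreal_le_iff)
    have sbc: "0 \<le> sqrt (b\<^sup>2 + C)" using sc.C_facts(1) by simp
    have xl: "x \<le> 2 * (2 * sqrt 2 ^ d * es * (sqrt (b\<^sup>2 + C)) ^ (d - 1) * (sqrt (b\<^sup>2 + C) + r)) * s"
    proof -
      have "0 \<le> 2 * (2 * sqrt 2 ^ d * es * (sqrt (b\<^sup>2 + C)) ^ (d - 1) * (sqrt (b\<^sup>2 + C) + r)) * s"
        using es s r sbc by (intro mult_nonneg_nonneg add_nonneg_nonneg zero_le_power) auto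
      then show ?thesis using al unfolding x(1) by (simp only: ennreal_le_iff)
    qed
    have x12: "12 * x \<le> V"
    proof -
      have "sqrt (real d) \<le> sqrt (real k)" using dk by simp
      then have "sqrt (real d) * a \<le> R" unfolding Ra using a0 by (intro mult_right_mono) auto
      note u = sc.rim_upper[OF this]
      have "12 * x \<le> 12 * (4 * sqrt 2 ^ d * (sqrt (b\<^sup>2 + C)) ^ (d - 1) * (sqrt (b\<^sup>2 + C) + r)) * (es * s)"
        using xl by (simp add: mult_ac)
      also have "\<dots> \<le> 48 * (2/5 * R) ^ d / real d * (es * s)" using u es s by (intro mult_right_mono) auto
      also have "\<dots> = 64 * ((2/5 * R) ^ d * (es * s * (3 / (4 * real d))))" by simp
      also have "\<dots> \<le> V" by (rule w_ge)
      finally show ?thesis .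
    qed
    define y where "y = 2 * sqrt 2 ^ d * es * (4 * r) ^ (d - 1) * (4 * r + r) * s"
    have y0: "0 \<le> y" unfolding y_def using es s r by simp
    have y2: "2 * y \<le> 5 * x"
    proof -
      have p: "(4 * r) ^ (d - 1) * (4 * r + r) = 5/4 * (4 * r) ^ d" using d by (cases d) auto
      have "2 * y = 4 * sqrt 2 ^ d * es * ((4 * r) ^ (d - 1) * (4 * r + r)) * s" by (simp add: y_def)
      also have "\<dots> = 5 * (es * (sqrt 2 ^ d * (4 * r) ^ d) * s)" unfolding p by simp
      also have "\<dots> \<le> 5 * (es * (2 * (b ^ d - (4 * r) ^ d) / real d) * s)"
        using sc.rim_dominates es s d0 by (intro mult_left_mono mult_right_mono) (auto simp: pos_le_divide_eq mult_ac)
      also have "\<dots> = 5 * (2 * (es * ((b ^ d - (4 * r) ^ d) / real d) * s))" by simp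
      finally show ?thesis using xg by linarith
    qed
    have x78: "7/8 / (real d)\<^sup>2 * (a / 9) ^ d * s \<le> x"
    proof -
      have "7/8 / (real d)\<^sup>2 * (a / 9) ^ d * s = 2 * (1 / real d * ((7/16 * (a / 9) ^ d) / real d) * s)" by (simp add: power2_eq_square)
      also have "\<dots> \<le> 2 * (es * ((b ^ d - (4 * r) ^ d) / real d) * s)"
        using es sc.rim_diff s d0 a0 by (intro mult_left_mono mult_right_mono mult_mono divide_right_mono) auto
      finally show ?thesis using xg by linarith
    qed
    have x0: "0 < x"
    proof -
      have "0 < 7/8 / (real d)\<^sup>2 * (a / 9) ^ d * s" using d0 a0 s by simp
      then show ?thesis using x78 by linarith
    qed
    define f where "f = nat \<lfloor>V / (12 * x)\<rfloor>"
    have v1: "1 \<le> V / (12 * x)" using x12 x0 by simp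
    have f: "real f \<le> V / (12 * x)" "V / (12 * x) < real f + 1" unfolding f_def using v1 by linarith+
    then have f1: "1 \<le> f" using v1 by (cases f) auto
    \<comment> \<open>As many discs as the grid holds, but no more than V allows at 12 * x per disc.
      Since 2 * y \<le> 5 * x, necks and caps raise the cost of a disc to at most 6 * x, hence the
      upper bound V/2.\<close>
    define N where "N = min (m ^ j div 2) f"
    have N: "1 \<le> N" "2 * N \<le> m ^ j" "N \<le> f" using f1 mj by (auto simp: N_def)
    have "real N * (12 * x) \<le> real f * (12 * x)" using N x0 by (intro mult_right_mono) auto
    also have "\<dots> \<le> V" using f(1) x0 by (simp add: pos_le_divide_eq)
    finally have NV: "12 * (real N * x) \<le> V" by simp
    have NL: "V / 64 \<le> real N * x"
    proof (cases "N = f")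
      case True
      have "V / (12 * x) \<le> 2 * real f" using f f1 by linarith
      then have "V \<le> 2 * real f * (12 * x)" using x0 by (simp add: pos_divide_le_eq)
      then show ?thesis using True V0 by simp
    next
      case False
      then have Ne: "N = m ^ j div 2" by (auto simp: N_def)
      show ?thesis unfolding Ne
        by (rule full_count[OF d(1) j(1) c ac s(2) _ _ x78, of m V])
          (use m qk in \<open>simp_all add: r_def q_def j\<close>)
    qed
    have ex: "\<exists>M :: 'a set. compact M \<and> connected M \<and> M \<noteq> {} \<and> M \<subseteq> cball 0 (sqrt (b\<^sup>2 + C + real j * (r * (real m - 1))\<^sup>2)) \<and>
      (\<forall>p\<in>M. well_curved d (r/2) M p) \<and> of_nat N * \<alpha> \<le> hausdorff_outer d M \<and>
      hausdorff_outer d M \<le> of_nat N * \<alpha> + of_nat (2 * N) * ennreal y"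
      unfolding \<alpha>_def y_def by (rule SE(1)[OF N(1,2) s(1)])
    obtain M :: "'a set" where M: "compact M" "connected M" "M \<noteq> {}" "M \<subseteq> cball 0 (sqrt (b\<^sup>2 + C + real j * (r * (real m - 1))\<^sup>2))"
      "\<forall>p\<in>M. well_curved d (r/2) M p" "of_nat N * \<alpha> \<le> hausdorff_outer d M"
      "hausdorff_outer d M \<le> of_nat N * \<alpha> + of_nat (2 * N) * ennreal y"
      using ex by (elim exE conjE) (rule that)
    have "(sqrt (real (d + j)) * a / 2) = R / 2" unfolding j(2) Ra by simp
    then have "b\<^sup>2 + C + real j * (r * (real m - 1))\<^sup>2 \<le> (R/2)\<^sup>2" using sc.fits[OF rm] by simp
    then have "sqrt (b\<^sup>2 + C + real j * (r * (real m - 1))\<^sup>2) \<le> R/2" using R0 by (intro real_le_lsqrt) auto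
    then have MR: "M \<subseteq> cball 0 (R/2)" using M(4) by (meson cball_subset_cball_iff order_trans subset_cball)
    have Nx: "of_nat N * \<alpha> = ennreal (real N * x)" unfolding x(1) using x0 by (simp add: ennreal_mult'' ennreal_of_nat_eq_real_of_nat)
    have Ny: "of_nat (2 * N) * ennreal y = ennreal (real (2 * N) * y)"
      using y0 by (simp only: ennreal_mult'' ennreal_of_nat_eq_real_of_nat)
    have lo: "ennreal (V/64) \<le> hausdorff_outer d M"
      using order_trans[OF ennreal_leI[OF NL]] M(6) unfolding Nx by blast
    have "real N * x + real (2 * N) * y \<le> V / 2"
    proof -
      have "real N * (2 * y) \<le> real N * (5 * x)" using y2 by (intro mult_left_mono) auto
      then show ?thesis using NV by simp
    qed
    then have "ennreal (real N * x) + ennreal (real (2 * N) * y) \<le> ennreal (V/2)"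
    proof -
      have "ennreal (real N * x + real (2 * N) * y) = ennreal (real N * x) + ennreal (real (2 * N) * y)"
        using x0 y0 by (intro ennreal_plus) auto
      then show ?thesis using ennreal_leI[OF \<open>real N * x + real (2 * N) * y \<le> V / 2\<close>] by (simp only:)
    qed
    then have "hausdorff_outer d M \<le> ennreal (V/2)" using order_trans[OF M(7)] unfolding Nx Ny by blast
    moreover have "\<forall>p\<in>M. well_curved d (3/2 * c) M p" using M(5) by (simp add: r_def)
    ultimately show ?thesis using M(1-3) MR lo by blast
  qed
qed

section \<open>Bump perturbations\<close>

text \<open>A function of the squared distance, so that the radial calculus of the profiles
  applies.\<close>

definition bump :: "real \<Rightarrow> real \<Rightarrow> real" where
  "bump \<delta> s = (max 0 ((\<delta>\<^sup>2 - s) / \<delta>\<^sup>2)) ^ 3"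

definition bump' :: "real \<Rightarrow> real \<Rightarrow> real" where
  "bump' \<delta> s = 3 * (max 0 ((\<delta>\<^sup>2 - s) / \<delta>\<^sup>2))\<^sup>2 * (- 1 / \<delta>\<^sup>2)"

definition bump'' :: "real \<Rightarrow> real \<Rightarrow> real" where
  "bump'' \<delta> s = 3 * (2 * max 0 ((\<delta>\<^sup>2 - s) / \<delta>\<^sup>2) * (- 1 / \<delta>\<^sup>2)) * (- 1 / \<delta>\<^sup>2)"

lemma bump_deriv:
  "(bump \<delta> has_real_derivative bump' \<delta> s) (at s)" "(bump' \<delta> has_real_derivative bump'' \<delta> s) (at s)"
proof -
  have l: "((\<lambda>s. (\<delta>\<^sup>2 - s) / \<delta>\<^sup>2) has_real_derivative - 1 / \<delta>\<^sup>2) (at s)"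
    by (rule DERIV_cdivide) (auto intro!: derivative_eq_intros)
  show "(bump \<delta> has_real_derivative bump' \<delta> s) (at s)"
    unfolding bump_def bump'_def by (rule DERIV_chain2[OF DERIV_max_cube l])
  have "((\<lambda>s. (max 0 ((\<delta>\<^sup>2 - s) / \<delta>\<^sup>2))\<^sup>2) has_real_derivative 2 * max 0 ((\<delta>\<^sup>2 - s) / \<delta>\<^sup>2) * (- 1 / \<delta>\<^sup>2)) (at s)"
    by (rule DERIV_chain2[OF DERIV_max_square l])
  then show "(bump' \<delta> has_real_derivative bump'' \<delta> s) (at s)"
    unfolding bump'_def bump''_def by (intro DERIV_cmult_right DERIV_cmult)
qed

lemma bump_support: "(\<delta>::real)\<^sup>2 \<le> s \<Longrightarrow> max 0 ((\<delta>\<^sup>2 - s) / \<delta>\<^sup>2) = 0"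
  using divide_nonpos_nonneg[of "\<delta>\<^sup>2 - s" "\<delta>\<^sup>2"] by (auto simp: max_def)

lemma bump_zero: "\<delta>\<^sup>2 \<le> s \<Longrightarrow> bump \<delta> s = 0" "\<delta>\<^sup>2 \<le> s \<Longrightarrow> bump' \<delta> s = 0"
  by (simp_all add: bump_def bump'_def bump_support del: max.absorb1)

lemma bump_centre: "0 < \<delta> \<Longrightarrow> bump \<delta> 0 = 1"
  by (simp add: bump_def)

text \<open>With u = 1 - s / \<delta>^2 the expression is (12 u - 9 u^2) / \<delta>^2 inside the
  support, largest at u = 2/3.\<close>

lemma bump_bound: assumes "0 < \<delta>" "0 \<le> s" shows "\<bar>bump' \<delta> s\<bar> + 2 * s * \<bar>bump'' \<delta> s\<bar> \<le> 4 / \<delta>\<^sup>2"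
proof (cases "\<delta>\<^sup>2 \<le> s")
  case True
  then have "max 0 ((\<delta>\<^sup>2 - s) / \<delta>\<^sup>2) = 0" by (rule bump_support)
  then show ?thesis by (simp add: bump'_def bump''_def)
next
  case False
  define u where "u = (\<delta>\<^sup>2 - s) / \<delta>\<^sup>2"
  have u0: "0 \<le> u" using False by (simp add: u_def)
  have m: "max 0 ((\<delta>\<^sup>2 - s) / \<delta>\<^sup>2) = u" using u0 by (simp add: u_def)
  have d0: "0 < \<delta>\<^sup>2" using assms by simp
  have s: "s / \<delta>\<^sup>2 = 1 - u" using d0 by (simp add: u_def diff_divide_distrib)
  have a: "\<bar>bump' \<delta> s\<bar> = 3 * u\<^sup>2 / \<delta>\<^sup>2" unfolding bump'_def m using u0 by (simp add: abs_mult)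
  have b: "\<bar>bump'' \<delta> s\<bar> = 6 * u / \<delta>\<^sup>2 / \<delta>\<^sup>2" unfolding bump''_def m using u0 by (simp add: abs_mult)
  have "2 * s * (6 * u / \<delta>\<^sup>2 / \<delta>\<^sup>2) = 12 * (s / \<delta>\<^sup>2) * u / \<delta>\<^sup>2" by simp
  then have "\<bar>bump' \<delta> s\<bar> + 2 * s * \<bar>bump'' \<delta> s\<bar> = (3 * u\<^sup>2 + 12 * (1 - u) * u) / \<delta>\<^sup>2" unfolding a b s by (simp add: add_divide_distrib)
  also have "\<dots> \<le> 4 / \<delta>\<^sup>2"
  proof (rule divide_right_mono)
    have "0 \<le> (2 - 3 * u)\<^sup>2" by simp
    then show "3 * u\<^sup>2 + 12 * (1 - u) * u \<le> 4" by (simp add: power2_eq_square algebra_simps)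
  qed simp
  finally show ?thesis .
qed

lemma bump_gradient:
  fixes x h :: "'a::real_inner"
  assumes "0 < \<delta>" shows "\<bar>2 * bump' \<delta> (x \<bullet> x) * (x \<bullet> h)\<bar> \<le> 6 / \<delta> * norm h"
proof (cases "\<delta>\<^sup>2 \<le> x \<bullet> x")
  case True
  then show ?thesis using assms by (simp add: bump_zero)
next
  case False
  then have "(norm x)\<^sup>2 \<le> \<delta>\<^sup>2" by (simp add: power2_norm_eq_inner)
  then have nx: "norm x \<le> \<delta>" using assms by (simp add: power2_le_iff_abs_le)
  have "0 \<le> x \<bullet> x / \<delta>\<^sup>2" by simp
  then have "(\<delta>\<^sup>2 - x \<bullet> x) / \<delta>\<^sup>2 \<le> 1" using assms by (simp add: diff_divide_distrib)
  then have "(max 0 ((\<delta>\<^sup>2 - x \<bullet> x) / \<delta>\<^sup>2))\<^sup>2 \<le> 1" by (intro power_le_one) auto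
  then have "3 * (max 0 ((\<delta>\<^sup>2 - x \<bullet> x) / \<delta>\<^sup>2))\<^sup>2 * (1 / \<delta>\<^sup>2) \<le> 3 * (1 / \<delta>\<^sup>2)" by (intro mult_right_mono) auto
  then have b: "\<bar>bump' \<delta> (x \<bullet> x)\<bar> \<le> 3 * (1 / \<delta>\<^sup>2)" by (simp add: bump'_def abs_mult)
  have "\<bar>x \<bullet> h\<bar> \<le> \<delta> * norm h" using Cauchy_Schwarz_ineq2[of x h] mult_right_mono[OF nx norm_ge_zero[of h]] by linarith
  then have "\<bar>bump' \<delta> (x \<bullet> x)\<bar> * \<bar>x \<bullet> h\<bar> \<le> 3 * (1 / \<delta>\<^sup>2) * (\<delta> * norm h)" using b by (intro mult_mono) auto
  also have "\<dots> = 3 / \<delta> * norm h" using assms by (simp add: power2_eq_square)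
  finally show ?thesis by (simp add: abs_mult)
qed

lemma norm_sum_disjoint_support:
  assumes "finite P" "\<And>p. p \<in> P \<Longrightarrow> norm (g p) \<le> B" "\<And>p p'. p \<in> P \<Longrightarrow> p' \<in> P \<Longrightarrow> p \<noteq> p' \<Longrightarrow> g p = 0 \<or> g p' = 0" "0 \<le> B"
  shows "norm (sum g P) \<le> B"
proof (cases "\<exists>p\<in>P. g p \<noteq> 0")
  case True
  then obtain p where p: "p \<in> P" "g p \<noteq> 0" by blast
  have "sum g (P - {p}) = 0" using assms(3)[OF p(1)] p(2) by (intro sum.neutral) blast
  then have "sum g P = g p" using sum.remove[OF assms(1) p(1), of g] by simp
  then show ?thesis using assms(2)[OF p(1)] by simp
next
  case False
  then have "sum g P = 0" by (intro sum.neutral) blast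
  then show ?thesis using assms(4) by simp
qed

locale bumps =
  fixes P :: "'a::euclidean_space set" and \<delta> vm :: real and v :: "'a \<Rightarrow> 'a"
  assumes fin: "finite P" and sep: "separated (2 * \<delta>) P" and \<delta>: "0 < \<delta>" and vm: "0 \<le> vm" "\<And>p. p \<in> P \<Longrightarrow> norm (v p) \<le> vm"
begin

definition "\<Psi> x = x + (\<Sum>p\<in>P. bump \<delta> ((x - p) \<bullet> (x - p)) *\<^sub>R v p)"
definition "D\<Psi> x h = h + (\<Sum>p\<in>P. (2 * bump' \<delta> ((x - p) \<bullet> (x - p)) * ((x - p) \<bullet> h)) *\<^sub>R v p)"

lemma far_zero: "\<delta> \<le> norm (x - p) \<Longrightarrow> bump \<delta> ((x - p) \<bullet> (x - p)) = 0" "\<delta> \<le> norm (x - p) \<Longrightarrow> bump' \<delta> ((x - p) \<bullet> (x - p)) = 0"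
proof -
  assume "\<delta> \<le> norm (x - p)"
  then have "\<delta>\<^sup>2 \<le> (norm (x - p))\<^sup>2" using \<delta> by (intro power_mono) auto
  then have a: "\<delta>\<^sup>2 \<le> (x - p) \<bullet> (x - p)" by (simp add: power2_norm_eq_inner)
  show "bump \<delta> ((x - p) \<bullet> (x - p)) = 0" "bump' \<delta> ((x - p) \<bullet> (x - p)) = 0" by (rule bump_zero[OF a])+
qed

lemma one_near: assumes "p \<in> P" "p' \<in> P" "p \<noteq> p'" shows "\<delta> \<le> norm (x - p) \<or> \<delta> \<le> norm (x - p')"
proof -
  have "2 * \<delta> \<le> dist p p'" using sep assms by (auto simp: separated_def)
  also have "\<dots> \<le> norm (x - p) + norm (x - p')" using dist_triangle2[of p p' x] by (simp add: dist_norm norm_minus_commute)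
  finally show ?thesis by linarith
qed

lemma D\<Psi>: "(\<Psi> has_derivative D\<Psi> x) (at x)"
proof -
  have "((\<lambda>x. bump \<delta> ((x - p) \<bullet> (x - p)) *\<^sub>R v p) has_derivative
      (\<lambda>h. (2 * bump' \<delta> ((x - p) \<bullet> (x - p)) * ((x - p) \<bullet> h)) *\<^sub>R v p)) (at x)" for p
  proof -
    have "((\<lambda>x. (x - p) \<bullet> (x - p)) has_derivative (\<lambda>h. 2 * ((x - p) \<bullet> h))) (at x)"
      by (rule has_derivative_eq_rhs[OF has_derivative_inner]) (auto intro!: derivative_eq_intros simp: inner_commute)
    then have "((\<lambda>x. bump \<delta> ((x - p) \<bullet> (x - p))) has_derivative (\<lambda>h. bump' \<delta> ((x - p) \<bullet> (x - p)) * (2 * ((x - p) \<bullet> h)))) (at x)"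
      by (rule has_derivative_compose[OF _ bump_deriv(1)[unfolded has_field_derivative_def]])
    then have "((\<lambda>x. bump \<delta> ((x - p) \<bullet> (x - p)) *\<^sub>R v p) has_derivative
      (\<lambda>h. (bump' \<delta> ((x - p) \<bullet> (x - p)) * (2 * ((x - p) \<bullet> h))) *\<^sub>R v p)) (at x)"
      by (rule has_derivative_scaleR_left)
    then show ?thesis by (simp add: mult_ac)
  qed
  then show ?thesis unfolding \<Psi>_def[abs_def] D\<Psi>_def[abs_def] by (intro has_derivative_add has_derivative_sum has_derivative_ident)
qed

lemma D\<Psi>_near: "norm (D\<Psi> x h - h) \<le> 6 * vm / \<delta> * norm h"
proof -
  have "norm (\<Sum>p\<in>P. (2 * bump' \<delta> ((x - p) \<bullet> (x - p)) * ((x - p) \<bullet> h)) *\<^sub>R v p) \<le> 6 * vm / \<delta> * norm h"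
  proof (rule norm_sum_disjoint_support[OF fin])
    fix p assume p: "p \<in> P"
    have "\<bar>2 * bump' \<delta> ((x - p) \<bullet> (x - p)) * ((x - p) \<bullet> h)\<bar> * norm (v p) \<le> (6 / \<delta> * norm h) * vm"
      using bump_gradient[OF \<delta>] vm(2)[OF p] \<delta> by (intro mult_mono) auto
    then show "norm ((2 * bump' \<delta> ((x - p) \<bullet> (x - p)) * ((x - p) \<bullet> h)) *\<^sub>R v p) \<le> 6 * vm / \<delta> * norm h"
      unfolding norm_scaleR by (simp add: mult_ac)
  next
    fix p p' assume "p \<in> P" "p' \<in> P" "p \<noteq> p'"
    from one_near[OF this, of x]
    show "(2 * bump' \<delta> ((x - p) \<bullet> (x - p)) * ((x - p) \<bullet> h)) *\<^sub>R v p = 0 \<or> (2 * bump' \<delta> ((x - p') \<bullet> (x - p')) * ((x - p') \<bullet> h)) *\<^sub>R v p' = 0"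
      using far_zero(2)[of x p] far_zero(2)[of x p'] by auto
  qed (use vm \<delta> in auto)
  then show ?thesis by (simp add: D\<Psi>_def)
qed

text \<open>The two endpoints may lie in different bumps, so up to two summands are active; this
  doubles the bound 4 / \<delta>^2 of a single bump. The sum is split according to which bump
  contains x.\<close>

lemma \<Psi>_taylor: "norm (\<Psi> q - \<Psi> x - D\<Psi> x (q - x)) \<le> 8 * vm / \<delta>\<^sup>2 * (norm (q - x))\<^sup>2"
proof -
  define g where "g p = (bump \<delta> ((q - p) \<bullet> (q - p)) - bump \<delta> ((x - p) \<bullet> (x - p)) -
     2 * bump' \<delta> ((x - p) \<bullet> (x - p)) * ((x - p) \<bullet> (q - x))) *\<^sub>R v p" for p
  have eq: "\<Psi> q - \<Psi> x - D\<Psi> x (q - x) = sum g P"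
    unfolding \<Psi>_def D\<Psi>_def g_def by (simp add: scaleR_diff_left sum_subtractf)
  define B where "B = 4 * vm / \<delta>\<^sup>2 * (norm (q - x))\<^sup>2"
  have B0: "0 \<le> B" using vm by (simp add: B_def)
  have gB: "norm (g p) \<le> B" if p: "p \<in> P" for p
  proof -
    let ?m = "max ((x - p) \<bullet> (x - p)) ((q - p) \<bullet> (q - p))"
    have "(q - p) - (x - p) = q - x" by simp
    then have "\<bar>bump \<delta> ((q - p) \<bullet> (q - p)) - bump \<delta> ((x - p) \<bullet> (x - p)) - 2 * bump' \<delta> ((x - p) \<bullet> (x - p)) * ((x - p) \<bullet> (q - x))\<bar>
        \<le> 4 / \<delta>\<^sup>2 * (norm (q - x))\<^sup>2"
      using radial_taylor[OF bump_deriv, of ?m \<delta> "4 / \<delta>\<^sup>2" "x - p" "q - p"] bump_bound[OF \<delta>] by simp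
    then have "norm (g p) \<le> (4 / \<delta>\<^sup>2 * (norm (q - x))\<^sup>2) * vm"
      unfolding g_def norm_scaleR using vm(2)[OF p] by (intro mult_mono) auto
    then show ?thesis by (simp add: B_def mult_ac)
  qed
  define A where "A = {p \<in> P. norm (x - p) < \<delta>}"
  have A: "A \<subseteq> P" by (auto simp: A_def)
  have gz: "g p = 0" if "\<delta> \<le> norm (x - p)" "\<delta> \<le> norm (q - p)" for p
    unfolding g_def using far_zero[OF that(1)] far_zero[OF that(2)] by simp
  have "norm (sum g A) \<le> B"
  proof (rule norm_sum_disjoint_support)
    show "finite A" using A fin by (rule finite_subset)
    show "norm (g p) \<le> B" if "p \<in> A" for p using gB that A by auto
    show "g p = 0 \<or> g p' = 0" if "p \<in> A" "p' \<in> A" "p \<noteq> p'" for p p'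
      using one_near[of p p' x] that by (auto simp: A_def)
  qed (rule B0)
  moreover have "norm (sum g (P - A)) \<le> B"
  proof (rule norm_sum_disjoint_support)
    show "finite (P - A)" using fin by simp
    show "norm (g p) \<le> B" if "p \<in> P - A" for p using gB that by auto
    show "g p = 0 \<or> g p' = 0" if "p \<in> P - A" "p' \<in> P - A" "p \<noteq> p'" for p p'
      using one_near[of p p' q] that gz[of p] gz[of p'] by (auto simp: A_def)
  qed (rule B0)
  moreover have "sum g P = sum g (P - A) + sum g A" by (rule sum.subset_diff[OF A fin])
  ultimately have "norm (sum g P) \<le> B + B" using norm_triangle_ineq[of "sum g (P - A)" "sum g A"] by simp
  then show ?thesis unfolding eq B_def by simp
qed

lemma \<Psi>_C1: obtains D where "\<And>x. (\<Psi> has_derivative blinfun_apply (D x)) (at x)" "C1_on UNIV D" "\<And>x. blinfun_apply (D x) = D\<Psi> x"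
proof -
  have b: "C2_on UNIV (bump \<delta>)"
    by (rule C2_on_real[OF bump_deriv]) (use \<delta> in \<open>auto simp: bump''_def[abs_def] intro!: continuous_intros\<close>)
  have t: "C2_on UNIV (\<lambda>x. x - p)" for p :: 'a
    using C2_on_add[OF C2_on_bounded_linear[OF bounded_linear_ident open_UNIV] C2_on_const[OF open_UNIV, of "- p"]] by simp
  have "C2_on UNIV (\<lambda>x. bump \<delta> ((x - p) \<bullet> (x - p)) *\<^sub>R v p)" for p
    by (rule C2_on_bilinear[OF bounded_bilinear_scaleR C2_on_compose[OF b C2_on_bilinear[OF bounded_bilinear_inner t t]] C2_on_const]) auto
  then have "C2_on UNIV (\<lambda>x. \<Sum>p\<in>P. bump \<delta> ((x - p) \<bullet> (x - p)) *\<^sub>R v p)" by (intro C2_on_sum fin open_UNIV)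
  then have "C2_on UNIV \<Psi>" unfolding \<Psi>_def[abs_def]
    by (rule C2_on_add[OF C2_on_bounded_linear[OF bounded_linear_ident open_UNIV]])
  then obtain D where D: "\<And>x. (\<Psi> has_derivative blinfun_apply (D x)) (at x)" "C1_on UNIV D" unfolding C2_on_iff by auto
  have "blinfun_apply (D x) = D\<Psi> x" for x by (rule has_derivative_unique[OF D(1) D\<Psi>])
  then show ?thesis using D that by blast
qed

text \<open>At a site its bump has its maximum 1 and the others vanish to first order: the
  displacement is the full vector, and the tangent space of M is kept.\<close>

lemma \<Psi>_site: assumes "p \<in> P" shows "\<Psi> p = p + v p" "D\<Psi> p h = h"
proof -
  have z: "\<delta> \<le> norm (p - p')" if "p' \<in> P - {p}" for p'
    using that assms sep \<delta> by (force simp: separated_def dist_norm)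
  have "(\<Sum>p'\<in>P - {p}. bump \<delta> ((p - p') \<bullet> (p - p')) *\<^sub>R v p') = 0"
    using far_zero(1)[OF z] by (intro sum.neutral) auto
  then show "\<Psi> p = p + v p"
    unfolding \<Psi>_def sum.remove[OF fin assms] using bump_centre[OF \<delta>] by simp
  have "(\<Sum>p'\<in>P - {p}. (2 * bump' \<delta> ((p - p') \<bullet> (p - p')) * ((p - p') \<bullet> h)) *\<^sub>R v p') = 0"
    using far_zero(2)[OF z] by (intro sum.neutral) auto
  then show "D\<Psi> p h = h" unfolding D\<Psi>_def sum.remove[OF fin assms] by simp
qed

lemma \<Psi>_close: "norm (\<Psi> x - x) \<le> vm"
proof -
  have b1: "0 \<le> bump \<delta> s" "0 \<le> s \<Longrightarrow> bump \<delta> s \<le> 1" for s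
    by (auto simp: bump_def intro!: power_le_one) (use \<delta> in \<open>simp add: divide_le_eq_1\<close>)
  have "norm (\<Sum>p\<in>P. bump \<delta> ((x - p) \<bullet> (x - p)) *\<^sub>R v p) \<le> vm"
  proof (rule norm_sum_disjoint_support[OF fin])
    fix p assume p: "p \<in> P"
    have "bump \<delta> ((x - p) \<bullet> (x - p)) * norm (v p) \<le> 1 * vm" using b1 vm(2)[OF p] by (intro mult_mono) auto
    then show "norm (bump \<delta> ((x - p) \<bullet> (x - p)) *\<^sub>R v p) \<le> vm" using b1 by simp
  next
    fix p p' assume "p \<in> P" "p' \<in> P" "p \<noteq> p'"
    from one_near[OF this, of x]
    show "bump \<delta> ((x - p) \<bullet> (x - p)) *\<^sub>R v p = 0 \<or> bump \<delta> ((x - p') \<bullet> (x - p')) *\<^sub>R v p' = 0"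
      using far_zero(1)[of x p] far_zero(1)[of x p'] by auto
  qed (rule vm(1))
  then show ?thesis by (simp add: \<Psi>_def)
qed

end

section \<open>The two packings\<close>

text \<open>By the mean value inequality \<Psi> minus the identity is \<eta>-Lipschitz.\<close>

lemma near_identity_lipschitz:
  fixes \<Psi> :: "'a::euclidean_space \<Rightarrow> 'a"
  assumes der: "\<And>x. (\<Psi> has_derivative D x) (at x)" and near: "\<And>x h. norm (D x h - h) \<le> \<eta> * norm h"
  shows "norm (\<Psi> x - \<Psi> y) \<le> (1 + \<eta>) * norm (x - y)" "(1 - \<eta>) * norm (x - y) \<le> norm (\<Psi> x - \<Psi> y)"
proof -
  have "norm ((\<Psi> x - x) - (\<Psi> y - y)) \<le> \<eta> * norm (x - y)"
  proof (rule differentiable_bound[where f="\<lambda>x. \<Psi> x - x" and f'="\<lambda>x h. D x h - h" and S=UNIV])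
    show "((\<lambda>x. \<Psi> x - x) has_derivative (\<lambda>h. D x h - h)) (at x)" for x
      by (intro has_derivative_diff der has_derivative_ident)
    show "onorm (\<lambda>h. D x h - h) \<le> \<eta>" for x by (rule onorm_le) (rule near)
  qed auto
  moreover have "(\<Psi> x - x) - (\<Psi> y - y) = (\<Psi> x - \<Psi> y) - (x - y)" by simp
  ultimately have "norm ((\<Psi> x - \<Psi> y) - (x - y)) \<le> \<eta> * norm (x - y)" by simp
  moreover have "norm (\<Psi> x - \<Psi> y) - norm (x - y) \<le> norm ((\<Psi> x - \<Psi> y) - (x - y))" by (rule norm_triangle_ineq2)
  moreover have "norm (x - y) - norm (\<Psi> x - \<Psi> y) \<le> norm ((\<Psi> x - \<Psi> y) - (x - y))"
    using norm_triangle_ineq2[of "x - y" "\<Psi> x - \<Psi> y"] by (simp add: norm_minus_commute)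
  ultimately have "norm (\<Psi> x - \<Psi> y) \<le> norm (x - y) + \<eta> * norm (x - y)" "norm (x - y) - \<eta> * norm (x - y) \<le> norm (\<Psi> x - \<Psi> y)"
    by linarith+
  then show "norm (\<Psi> x - \<Psi> y) \<le> (1 + \<eta>) * norm (x - y)" "(1 - \<eta>) * norm (x - y) \<le> norm (\<Psi> x - \<Psi> y)"
    by (simp_all add: algebra_simps)
qed

text \<open>What makes the uniform law on M a member of the model with fmin = 1 / V: the density is
  the inverse of the volume and lies between 1 / V and 96 / V.\<close>

definition admissible :: "nat \<Rightarrow> real \<Rightarrow> real \<Rightarrow> real \<Rightarrow> 'a::euclidean_space set \<Rightarrow> bool" where
  "admissible d c V R M \<longleftrightarrow> compact M \<and> connected M \<and> M \<subseteq> cball 0 R \<and>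
     (\<forall>p\<in>M. chart_at d M p \<and> (\<exists>T. tangent_at M p T \<and> quad_tangent c M p T)) \<and>
     ennreal (V/96) \<le> hausdorff_outer d M \<and> hausdorff_outer d M \<le> ennreal V"

lemma packing_bound:
  fixes A :: "'i \<Rightarrow> 'a::euclidean_space set" and Q :: "'w \<Rightarrow> real list \<Rightarrow> ('a \<Rightarrow> real)"
  assumes sq: "sq_estimates P Q Out q \<tau> (bb_model d c fmin fmax L R) \<epsilon> \<alpha>" and \<tau>: "0 < \<tau>" and \<alpha>: "\<alpha> < 1"
    and f: "0 < fmin" "fmin \<le> fmax / 96" and L: "0 \<le> L" and c: "0 < c" and d: "1 \<le> d"
    and pos: "\<And>E :: 'a set. subspace E \<Longrightarrow> dim E = d \<Longrightarrow> 0 < hausdorff_outer (d - 1) {x\<in>E. norm x = 1}"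
    and fin: "finite \<Lambda>" and adm: "\<And>i. i \<in> \<Lambda> \<Longrightarrow> admissible d c (1 / fmin) R (A i)"
    and sep: "\<And>i j. i \<in> \<Lambda> \<Longrightarrow> j \<in> \<Lambda> \<Longrightarrow> i \<noteq> j \<Longrightarrow> ereal (2 * \<epsilon>) < dH (A i) (A j)"
  shows "real (card \<Lambda>) * (1 - \<alpha>) \<le> (1 + 1 / \<tau>) ^ q"
proof -
  define h where "h i = enn2real (hausdorff_outer d (A i))" for i
  define D where "D i = density (hausdorff_measure d) (\<lambda>x. ennreal (indicator (A i) x * (1 / h i)))" for i
  have U: "D i \<in> bb_model d c fmin fmax L R \<and> msupport (D i) = A i \<and> prob_space (D i) \<and> sets (D i) = sets borel" if i: "i \<in> \<Lambda>" for i
  proof -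
    note ad = adm[OF i, unfolded admissible_def]
    have "hausdorff_outer d (A i) < \<top>" using ad by (auto intro: le_less_trans)
    then have h: "hausdorff_outer d (A i) = ennreal (h i)" by (simp add: h_def)
    have h0: "0 \<le> h i" by (simp add: h_def)
    have b: "1 / fmin / 96 \<le> h i" "h i \<le> 1 / fmin" using ad h0 f unfolding h by (simp_all add: ennreal_le_iff)
    have hp: "0 < h i" using f b(1) by (intro less_le_trans[OF _ b(1)]) simp
    have "fmin \<le> 1 / h i" using b(2) hp f by (simp add: field_simps)
    moreover have "1 / h i \<le> fmax"
    proof -
      have "1 \<le> 96 * fmin * h i" using b(1) f by (simp add: field_simps)
      then have "1 / h i \<le> 96 * fmin" using hp by (simp add: pos_divide_le_eq)
      then show ?thesis using f by linarith
    qed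
    moreover have "A i \<in> manifolds d c"
      unfolding manifolds_def C2_submanifold_iff using ad reach_ge[OF _ c, of "A i"] by auto
    moreover have "A i \<subseteq> cball 0 R" using ad by simp
    moreover have "0 < hausdorff_outer d (A i \<inter> ball p e)" if "p \<in> A i" "0 < e" for p e
      using ad that by (intro hausdorff_outer_chart_pos[OF _ that(1) d that(2) pos]) auto
    ultimately show ?thesis unfolding D_def using uniform_in_bb_model[OF _ _ h hp _ _ L] by simp
  qed
  show ?thesis
  proof (rule sq_packing_bound[OF sq \<tau> \<alpha> fin])
    show "ereal (2 * \<epsilon>) < dH (msupport (D i)) (msupport (D j))" if "i \<in> \<Lambda>" "j \<in> \<Lambda>" "i \<noteq> j" for i j
      using sep[OF that] U that by simp
  qed (use U in auto)
qed

locale base =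
  fixes M0 :: "'a::euclidean_space set" and d :: nat and c V R :: real
  assumes cpt: "compact M0" and conn: "connected M0" and ne: "M0 \<noteq> {}" and inR: "M0 \<subseteq> cball 0 (R/2)"
    and curved: "\<And>p. p \<in> M0 \<Longrightarrow> well_curved d (3/2 * c) M0 p"
    and vol: "ennreal (V/64) \<le> hausdorff_outer d M0" "hausdorff_outer d M0 \<le> ennreal (V/2)"
    and c: "0 < c" "144 * c \<le> R" and V: "0 < V" and d: "1 \<le> d"
begin

text \<open>Bernoulli's inequality and d * \<eta> \<le> 1/4 keep (1 - \<eta>)^d above 3/4 and (1 +
  \<eta>)^d below 2, so volumes change by bounded factors whatever d is. Translations and bump maps
  are both instances.\<close>

lemma admissible_image:
  fixes \<Psi> :: "'a \<Rightarrow> 'a" and D :: "'a \<Rightarrow> 'a \<Rightarrow>\<^sub>L 'a"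
  assumes der: "\<And>x. (\<Psi> has_derivative blinfun_apply (D x)) (at x)" and C1: "C1_on UNIV D"
    and near: "\<And>x h. norm (D x h - h) \<le> \<eta> * norm h"
    and tay: "\<And>x q. norm (\<Psi> q - \<Psi> x - D x (q - x)) \<le> \<kappa> * (norm (q - x))\<^sup>2"
    and \<eta>: "0 \<le> \<eta>" "\<eta> \<le> 1/32" "real d * \<eta> \<le> 1/4" and \<kappa>: "\<kappa> \<le> 1 / (8 * c)" and im: "\<Psi> ` M0 \<subseteq> cball 0 R"
  shows "admissible d c V R (\<Psi> ` M0)"
  unfolding admissible_def
proof (intro conjI)
  note lip = near_identity_lipschitz[of \<Psi> "\<lambda>x. blinfun_apply (D x)" \<eta>, OF der near]
  have \<eta>1: "0 < 1 - \<eta>" using \<eta> by simp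
  have inj: "inj \<Psi>"
  proof (rule injI)
    fix x y assume "\<Psi> x = \<Psi> y"
    then have "(1 - \<eta>) * norm (x - y) \<le> 0" using lip(2)[of x y] by simp
    then have "norm (x - y) \<le> 0" using \<eta>1 by (simp add: mult_le_0_iff)
    then show "x = y" by simp
  qed
  have cont: "continuous_on UNIV \<Psi>" using der has_derivative_continuous continuous_at_imp_continuous_on by blast
  show "compact (\<Psi> ` M0)" by (rule compact_continuous_image[OF continuous_on_subset[OF cont subset_UNIV] cpt])
  show "connected (\<Psi> ` M0)" by (rule connected_continuous_image[OF continuous_on_subset[OF cont subset_UNIV] conn])
  show "\<Psi> ` M0 \<subseteq> cball 0 R" by (rule im)
  have nb: "norm (D x - id_blinfun) \<le> 1/2" for x
  proof (rule norm_blinfun_bound)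
    fix h
    have "norm ((D x - id_blinfun) h) = norm (D x h - h)" by (simp add: blinfun.diff_left)
    also have "\<dots> \<le> \<eta> * norm h" by (rule near)
    also have "\<dots> \<le> 1/2 * norm h" using \<eta> by (intro mult_right_mono) auto
    finally show "norm ((D x - id_blinfun) h) \<le> 1/2 * norm h" .
  qed simp
  show "\<forall>p\<in>\<Psi> ` M0. chart_at d (\<Psi> ` M0) p \<and> (\<exists>T. tangent_at (\<Psi> ` M0) p T \<and> quad_tangent c (\<Psi> ` M0) p T)"
  proof
    fix y assume "y \<in> \<Psi> ` M0"
    then obtain p where p: "p \<in> M0" "y = \<Psi> p" by blast
    obtain T where T: "chart_at d M0 p" "tangent_at M0 p T" "quad_tangent (3/2 * c) M0 p T"
      using curved[OF p(1)] unfolding well_curved_def by (elim conjE exE) (rule that)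
    have "chart_at d (\<Psi> ` M0) (\<Psi> p)" by (rule chart_at_image[OF der C1 nb inj T(1)])
    moreover have "tangent_at (\<Psi> ` M0) (\<Psi> p) (D p ` T)" by (rule tangent_at_image[OF der T(2)])
    moreover have "quad_tangent c (\<Psi> ` M0) (\<Psi> p) (D p ` T)"
    proof (rule quad_tangent_image[OF T(3) _ c(1) \<eta>(1), where \<kappa>=\<kappa>])
      show "linear (blinfun_apply (D p))" by (rule bounded_linear.linear[OF blinfun.bounded_linear_right])
      show "norm (D p h) \<le> (1 + \<eta>) * norm h" for h
        using near[of p h] norm_triangle_ineq2[of "D p h" h] by (simp add: algebra_simps)
      \<comment> \<open>The reach bound goes down from 3/2 * c to c. Once (1 - \<eta>)^2 is replaced
        by 1 - 2 * \<eta>, both sides equal 15/32 at \<eta> = 1/32, so the limits 1/32 for \<eta>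
        and 1 / (8 * c) for \<kappa> are matched.\<close>
      have "(1 + \<eta>) / 3 + 1/8 \<le> (1 - \<eta>)\<^sup>2 / 2"
      proof -
        have "(1 - \<eta>)\<^sup>2 = 1 - 2 * \<eta> + \<eta>\<^sup>2" by (simp add: power2_eq_square algebra_simps)
        then have "1 - 2 * \<eta> \<le> (1 - \<eta>)\<^sup>2" by simp
        then show ?thesis using \<eta>(2) by (simp add: field_simps)
      qed
      then have "((1 + \<eta>) / 3 + 1/8) / c \<le> (1 - \<eta>)\<^sup>2 / 2 / c" using c by (intro divide_right_mono) auto
      then show "(1 + \<eta>) / (2 * (3/2 * c)) + \<kappa> \<le> (1 - \<eta>)\<^sup>2 / (2 * c)" using \<kappa> by (simp add: add_divide_distrib)
    qed (use c \<eta> tay lip(2) in auto)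
    ultimately show "chart_at d (\<Psi> ` M0) y \<and> (\<exists>T. tangent_at (\<Psi> ` M0) y T \<and> quad_tangent c (\<Psi> ` M0) y T)"
      unfolding p(2) by blast
  qed
  have "1 + real d * (- \<eta>) \<le> (1 + - \<eta>) ^ d" by (rule Bernoulli_inequality) (use \<eta> in simp)
  then have B: "3/4 \<le> (1 - \<eta>) ^ d" using \<eta> by simp
  have "0 \<le> (1 + \<eta>) * (1 - \<eta>)" using \<eta> by (intro mult_nonneg_nonneg) auto
  moreover have "(1 + \<eta>) * (1 - \<eta>) \<le> 1" by (simp add: algebra_simps)
  ultimately have "((1 + \<eta>) * (1 - \<eta>)) ^ d \<le> 1" by (rule power_le_one)
  then have "(1 + \<eta>) ^ d * (1 - \<eta>) ^ d \<le> 1" by (simp only: power_mult_distrib)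
  moreover have "(1 + \<eta>) ^ d * (3/4) \<le> (1 + \<eta>) ^ d * (1 - \<eta>) ^ d" using B \<eta> by (intro mult_left_mono) auto
  ultimately have B2: "(1 + \<eta>) ^ d \<le> 2" by linarith
  have "hausdorff_outer d (\<Psi> ` M0) \<le> ennreal ((1 + \<eta>) ^ d) * hausdorff_outer d M0"
    using lip(1) \<eta> by (intro hausdorff_outer_lipschitz_image) (auto simp: dist_norm)
  also have "\<dots> \<le> ennreal 2 * ennreal (V/2)" using B2 vol by (intro mult_mono ennreal_leI) auto
  also have "\<dots> = ennreal V" using V by (subst ennreal_mult[symmetric]) auto
  finally show "hausdorff_outer d (\<Psi> ` M0) \<le> ennreal V" .
  have "hausdorff_outer d M0 \<le> ennreal ((1 / (1 - \<eta>)) ^ d) * hausdorff_outer d (\<Psi> ` M0)"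
  proof (rule hausdorff_outer_lipschitz_onto[where f="inv \<Psi>"])
    fix x y assume "x \<in> \<Psi> ` M0" "y \<in> \<Psi> ` M0"
    then obtain a b where ab: "x = \<Psi> a" "y = \<Psi> b" by blast
    show "dist (inv \<Psi> x) (inv \<Psi> y) \<le> 1 / (1 - \<eta>) * dist x y"
      unfolding ab inv_f_f[OF inj] dist_norm using lip(2)[of a b] \<eta>1 by (simp add: pos_le_divide_eq mult.commute)
  next
    show "M0 \<subseteq> inv \<Psi> ` \<Psi> ` M0" using inj by (simp add: image_image)
  qed (use \<eta>1 in auto)
  also have "\<dots> \<le> ennreal (4/3) * hausdorff_outer d (\<Psi> ` M0)"
  proof (intro mult_right_mono ennreal_leI)
    have "1 / (1 - \<eta>) ^ d \<le> 1 / (3/4)" using B by (intro divide_left_mono) auto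
    then show "(1 / (1 - \<eta>)) ^ d \<le> 4/3" by (simp add: power_one_over)
  qed simp
  finally have "ennreal (V/64) \<le> ennreal (4/3) * hausdorff_outer d (\<Psi> ` M0)" by (rule order_trans[OF vol(1)])
  then have "ennreal (3/4) * ennreal (V/64) \<le> ennreal (3/4) * (ennreal (4/3) * hausdorff_outer d (\<Psi> ` M0))" by (intro mult_left_mono) auto
  also have "\<dots> = hausdorff_outer d (\<Psi> ` M0)" by (simp add: mult.assoc[symmetric] ennreal_mult[symmetric])
  finally have "ennreal (3/4 * (V/64)) \<le> hausdorff_outer d (\<Psi> ` M0)" using V by (subst ennreal_mult) auto
  then show "ennreal (V/96) \<le> hausdorff_outer d (\<Psi> ` M0)" using V by (elim order_trans[rotated]) (auto intro!: ennreal_leI)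
qed

text \<open>Let x be a point of M0 that is extreme in the direction of v - w. Then v + x exceeds
  every point of the translate by w in that direction by at least norm (v - w).\<close>

lemma translate_dH: "ereal (norm (v - w)) \<le> dH ((\<lambda>x. v + x) ` M0) ((\<lambda>x. w + x) ` M0)"
proof (cases "v = w")
  case True
  then show ?thesis using dH_ge[of _ "(\<lambda>x. v + x) ` M0" "(\<lambda>x. w + x) ` M0" 0] ne by auto
next
  case False
  define u where "u = (1 / norm (v - w)) *\<^sub>R (v - w)"
  have nu: "norm u = 1" using False by (simp add: u_def)
  have vu: "(v - w) \<bullet> u = norm (v - w)" using False by (simp add: u_def power2_norm_eq_inner[symmetric] power2_eq_square)
  have "continuous_on M0 (\<lambda>x. x \<bullet> u)" by (intro continuous_intros)
  from continuous_attains_sup[OF cpt ne this]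
  obtain x where x: "x \<in> M0" "\<forall>y\<in>M0. y \<bullet> u \<le> x \<bullet> u" by (elim bexE) (rule that)
  show ?thesis
  proof (rule dH_ge[of "v + x"])
    fix y assume "y \<in> (\<lambda>x. w + x) ` M0"
    then obtain z where z: "z \<in> M0" "y = w + z" by blast
    have "norm (v - w) \<le> (v + x - y) \<bullet> u" using vu bspec[OF x(2) z(1)] by (simp add: z inner_add_left inner_diff_left)
    also have "\<dots> \<le> norm (v + x - y)" using norm_cauchy_schwarz[of "v + x - y" u] nu by simp
    finally show "norm (v - w) \<le> dist (v + x) y" by (simp add: dist_norm)
  qed (use x ne in auto)
qed

lemma admissible_translate: assumes "norm v \<le> R/2" shows "admissible d c V R ((\<lambda>x. v + x) ` M0)"
proof (rule admissible_image[where D="\<lambda>_. id_blinfun" and \<eta>=0 and \<kappa>=0])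
  show "((\<lambda>x. v + x) has_derivative blinfun_apply id_blinfun) (at x)" for x
    by (auto intro!: derivative_eq_intros)
  show "C1_on UNIV (\<lambda>_ :: 'a. id_blinfun :: 'a \<Rightarrow>\<^sub>L 'a)" by (rule C1_on_const)
  show "(\<lambda>x. v + x) ` M0 \<subseteq> cball 0 R"
  proof
    fix y assume "y \<in> (\<lambda>x. v + x) ` M0"
    then obtain x where x: "x \<in> M0" "y = v + x" by blast
    then have "norm x \<le> R/2" using inR by auto
    then show "y \<in> cball 0 R" using norm_triangle_ineq[of v x] assms x by simp
  qed
qed (use c in auto)

lemma translation_bound:
  assumes sq: "sq_estimates P Q Out q \<tau> (bb_model d c (1/V) fmax L R :: 'a measure set) \<epsilon> \<alpha>" and \<tau>: "0 < \<tau>" and \<alpha>: "\<alpha> < 1"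
    and f: "1/V \<le> fmax / 96" and L: "0 \<le> L" and \<epsilon>: "0 < \<epsilon>"
    and pos: "\<And>E :: 'a set. subspace E \<Longrightarrow> dim E = d \<Longrightarrow> 0 < hausdorff_outer (d - 1) {x\<in>E. norm x = 1}"
  shows "(R / (4 * \<epsilon>)) ^ DIM('a) * (1 - \<alpha>) \<le> (1 + 1 / \<tau>) ^ q"
proof -
  have R: "0 < R" using c by linarith
  have *: "(R / 2 / \<eta>) ^ DIM('a) * (1 - \<alpha>) \<le> (1 + 1 / \<tau>) ^ q" if \<eta>: "2 * \<epsilon> < \<eta>" for \<eta>
  proof -
    have "0 < \<eta>" "0 < R/2" using \<eta> \<epsilon> R by auto
    from packing_subspace[OF subspace_UNIV this]
    obtain S :: "'a set" where S: "finite S" "S \<subseteq> UNIV \<inter> cball 0 (R/2)" "separated \<eta> S" "(R / 2 / \<eta>) ^ dim (UNIV :: 'a set) \<le> real (card S)"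
      by (elim exE conjE) (rule that)
    have "real (card S) * (1 - \<alpha>) \<le> (1 + 1 / \<tau>) ^ q"
    proof (rule packing_bound[OF sq \<tau> \<alpha> _ f L c(1) d pos S(1), where A="\<lambda>v. (\<lambda>x. v + x) ` M0"])
      show "0 < 1 / V" using V by simp
      show "admissible d c (1 / (1/V)) R ((\<lambda>x. v + x) ` M0)" if "v \<in> S" for v
        using admissible_translate[of v] that S(2) by auto
      show "ereal (2 * \<epsilon>) < dH ((\<lambda>x. v + x) ` M0) ((\<lambda>x. w + x) ` M0)" if "v \<in> S" "w \<in> S" "v \<noteq> w" for v w
      proof -
        have "\<eta> \<le> norm (v - w)" using S(3) that by (simp add: separated_def dist_norm)
        then have "ereal (2 * \<epsilon>) < ereal (norm (v - w))" using \<eta> by simp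
        then show ?thesis using translate_dH by (rule less_le_trans)
      qed
    qed
    moreover have "(R / 2 / \<eta>) ^ DIM('a) * (1 - \<alpha>) \<le> real (card S) * (1 - \<alpha>)"
      using S(4) \<alpha> by (intro mult_right_mono) auto
    ultimately show ?thesis by linarith
  qed
  \<comment> \<open>Strict separation requires \<eta> > 2 * \<epsilon>; the bound at \<eta> = 2 *
    \<epsilon> follows in the limit.\<close>
  have "((\<lambda>\<eta>. (R / 2 / \<eta>) ^ DIM('a) * (1 - \<alpha>)) \<longlongrightarrow> (R / 2 / (2 * \<epsilon>)) ^ DIM('a) * (1 - \<alpha>)) (at_right (2 * \<epsilon>))"
    using \<epsilon> by (intro tendsto_intros) auto
  moreover have "\<forall>\<^sub>F \<eta> in at_right (2 * \<epsilon>). (R / 2 / \<eta>) ^ DIM('a) * (1 - \<alpha>) \<le> (1 + 1 / \<tau>) ^ q"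
    using * by (intro eventually_at_right_less[THEN eventually_mono]) auto
  ultimately have "(R / 2 / (2 * \<epsilon>)) ^ DIM('a) * (1 - \<alpha>) \<le> (1 + 1 / \<tau>) ^ q"
    by (rule tendsto_upperbound) simp
  then show ?thesis by simp
qed

end

text \<open>The moved site \<Psi> p is far from every image of a point q under the other map. If q
  is at least 50 \<epsilon> away from p, near-isometry leaves more than 49 \<epsilon> - 40
  \<epsilon>. If it is closer, the second image of q differs from that of p by a vector of T up to
  an error s^2 / c \<le> \<epsilon> / 10, while the offset u of the two images of p is orthogonal to
  T and cannot be shortened by it: 5/2 - 1/10 still exceeds 9/4.\<close>

lemma bumps_separation:
  fixes M :: "'a::euclidean_space set"
  assumes b: "bumps P \<delta> vm v" "bumps P \<delta> vm v'" and p: "p \<in> P" "p \<in> M" and T: "quad_tangent (3/2 * c) M p T" "subspace T"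
    and u: "\<And>t. t \<in> T \<Longrightarrow> (v p - v' p) \<bullet> t = 0" "5/2 * \<epsilon> \<le> norm (v p - v' p)" "norm (v p - v' p) \<le> 40 * \<epsilon>"
    and num: "6 * vm / \<delta> \<le> 1/100" "8 * vm / \<delta>\<^sup>2 \<le> 1 / (8 * c)" "0 < \<epsilon>" "2 ^ 34 * \<epsilon> \<le> c"
  shows "ereal (9/4 * \<epsilon>) \<le> dH (bumps.\<Psi> P \<delta> v ` M) (bumps.\<Psi> P \<delta> v' ` M)"
proof -
  interpret B: bumps P \<delta> vm v by (rule b(1))
  interpret B': bumps P \<delta> vm v' by (rule b(2))
  have c: "0 < c" using num by simp
  define u where "u = v p - v' p"
  have u: "\<And>t. t \<in> T \<Longrightarrow> u \<bullet> t = 0" "5/2 * \<epsilon> \<le> norm u" "norm u \<le> 40 * \<epsilon>" using u by (auto simp: u_def)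
  show ?thesis
  proof (rule dH_ge[of "B.\<Psi> p"])
    fix y assume "y \<in> B'.\<Psi> ` M"
    then obtain q where q: "q \<in> M" "y = B'.\<Psi> q" by blast
    define s where "s = norm (q - p)"
    have s0: "0 \<le> s" by (simp add: s_def)
    have eq: "B.\<Psi> p - B'.\<Psi> p = u" using B.\<Psi>_site(1)[OF p(1)] B'.\<Psi>_site(1)[OF p(1)] by (simp add: u_def)
    have "9/4 * \<epsilon> \<le> norm (B.\<Psi> p - B'.\<Psi> q)"
    proof (cases "50 * \<epsilon> \<le> s")
      case True
      have "norm (B'.D\<Psi> x h - h) \<le> 1/100 * norm h" for x h
        by (rule order_trans[OF B'.D\<Psi>_near mult_right_mono[OF num(1) norm_ge_zero]])
      then have "(1 - 1/100) * s \<le> norm (B'.\<Psi> q - B'.\<Psi> p)" unfolding s_def by (rule near_identity_lipschitz(2)[OF B'.D\<Psi>])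
      moreover have "norm (B'.\<Psi> q - B'.\<Psi> p) \<le> norm (B.\<Psi> p - B'.\<Psi> q) + norm u"
        unfolding eq[symmetric] using norm_triangle_ineq4[of "B.\<Psi> p - B'.\<Psi> p" "B.\<Psi> p - B'.\<Psi> q"] by (simp add: add.commute)
      ultimately have "99/100 * s \<le> norm (B.\<Psi> p - B'.\<Psi> q) + 40 * \<epsilon>" using u(3) by simp
      then show ?thesis using True num(3) by simp
    next
      case False
      obtain t where t: "t \<in> T" "norm (q - p - t) \<le> s\<^sup>2 / (2 * (3/2 * c))"
        using T(1) q(1) unfolding quad_tangent_def s_def by blast
      have e1: "norm (B'.\<Psi> q - B'.\<Psi> p - (q - p)) \<le> 1 / (8 * c) * s\<^sup>2"
        using B'.\<Psi>_taylor[of q p] mult_right_mono[OF num(2) zero_le_power2[of s]] unfolding B'.\<Psi>_site(2)[OF p(1)] s_def by linarith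
      have "B.\<Psi> p - B'.\<Psi> q = (u - t) - ((q - p - t) + (B'.\<Psi> q - B'.\<Psi> p - (q - p)))" using eq by (simp add: algebra_simps)
      then have "norm (u - t) \<le> norm (B.\<Psi> p - B'.\<Psi> q) + norm ((q - p - t) + (B'.\<Psi> q - B'.\<Psi> p - (q - p)))"
        using norm_triangle_ineq[of "B.\<Psi> p - B'.\<Psi> q" "(q - p - t) + (B'.\<Psi> q - B'.\<Psi> p - (q - p))"] by simp
      moreover have "norm ((q - p - t) + (B'.\<Psi> q - B'.\<Psi> p - (q - p))) \<le> s\<^sup>2 / (2 * (3/2 * c)) + 1 / (8 * c) * s\<^sup>2"
        by (rule norm_triangle_le[OF add_mono[OF t(2) e1]])
      moreover have "s\<^sup>2 / (2 * (3/2 * c)) + 1 / (8 * c) * s\<^sup>2 \<le> s\<^sup>2 / c" using c zero_le_power2[of s] by (simp add: field_simps)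
      moreover have "s\<^sup>2 / c \<le> 1/10 * \<epsilon>"
      proof -
        have "s\<^sup>2 \<le> (50 * \<epsilon>)\<^sup>2" using False s0 by (intro power_mono) auto
        also have "\<dots> = 2500 * \<epsilon> * \<epsilon>" by (simp add: power2_eq_square)
        also have "\<dots> \<le> 1/10 * c * \<epsilon>" using num by (intro mult_right_mono) auto
        finally show ?thesis using c by (simp add: pos_divide_le_eq mult_ac)
      qed
      moreover have "norm u \<le> norm (u - t)"
      proof (rule power2_le_imp_le)
        have "(norm (u - t))\<^sup>2 = (norm u)\<^sup>2 + (norm t)\<^sup>2"
          unfolding power2_norm_eq_inner using u(1)[OF t(1)] by (simp add: inner_diff_left inner_diff_right inner_commute)
        then show "(norm u)\<^sup>2 \<le> (norm (u - t))\<^sup>2" by simp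
      qed simp
      ultimately show ?thesis using u(2) num(3) by linarith
    qed
    then show "9/4 * \<epsilon> \<le> dist (B.\<Psi> p) y" by (simp add: q dist_norm)
  qed (use p in auto)
qed

context base
begin

text \<open>The number k of sites depends on the base, so the claim couples the bound it yields with
  a lower bound for it. The type \<open>'b\<close> supplies the d-dimensional model space of the
  local volume bound.\<close>

lemma bump_family_bound:
  assumes sq: "sq_estimates P0 Q Out q \<tau> (bb_model d c (1/V) fmax L R :: 'a measure set) \<epsilon> \<alpha>" and \<tau>: "0 < \<tau>" and \<alpha>: "\<alpha> < 1"
    and f: "1/V \<le> fmax / 96" and L: "0 \<le> L" and \<epsilon>: "0 < \<epsilon>" "2 ^ 34 * (real d)\<^sup>2 * \<epsilon> \<le> c"
    and pos: "\<And>E :: 'a set. subspace E \<Longrightarrow> dim E = d \<Longrightarrow> 0 < hausdorff_outer (d - 1) {x\<in>E. norm x = 1}"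
    and db: "d = DIM('b::euclidean_space)"
  shows "\<exists>k::nat. 8 ^ ((DIM('a) - d) * k) * (1 - \<alpha>) \<le> (1 + 1 / \<tau>) ^ q \<and>
    V / 64 \<le> real k * (unit_ball_vol (real d) * (10 * sqrt (1280 * c * \<epsilon>)) ^ d)"
proof -
  \<comment> \<open>Chosen so that the second-order bound 8 * vm / \<delta>^2 with vm = 20
    \<epsilon> is exactly 1 / (8 * c).\<close>
  define \<delta> where "\<delta> = sqrt (1280 * c * \<epsilon>)"
  define vm where "vm = 20 * \<epsilon>"
  have ce: "0 < 1280 * c * \<epsilon>" using c \<epsilon> by simp
  have \<delta>0: "0 < \<delta>" using ce by (simp add: \<delta>_def)
  have \<delta>2: "\<delta>\<^sup>2 = 1280 * c * \<epsilon>" using ce by (simp add: \<delta>_def)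
  have vm0: "0 \<le> vm" using \<epsilon> by (simp add: vm_def)
  have d1: "1 \<le> (real d)\<^sup>2" using d by simp
  have "\<epsilon> * 1 \<le> \<epsilon> * (real d)\<^sup>2" using d1 \<epsilon> by (intro mult_left_mono) auto
  then have \<epsilon>c: "2 ^ 34 * \<epsilon> \<le> c" using \<epsilon>(2) by (simp add: mult_ac)
  \<comment> \<open>The first-order bound must stay small after multiplication by d, for the sake of
    the volumes; this is how the square of d enters the condition on \<epsilon>.\<close>
  have "(12000 * real d * \<epsilon>)\<^sup>2 = 144000000 * ((real d)\<^sup>2 * \<epsilon>) * \<epsilon>" by (simp add: power2_eq_square)
  also have "\<dots> \<le> 1280 * c * \<epsilon>"
  proof (rule mult_right_mono)
    have "2 ^ 34 * ((real d)\<^sup>2 * \<epsilon>) \<le> c" using \<epsilon>(2) by (simp only: mult.assoc)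
    moreover have "144000000 * y \<le> 1280 * c" if "2 ^ 34 * y \<le> c" for y using that c(1) by simp
    ultimately show "144000000 * ((real d)\<^sup>2 * \<epsilon>) \<le> 1280 * c" by blast
  qed (use \<epsilon>(1) in simp)
  finally have "12000 * real d * \<epsilon> \<le> \<delta>" unfolding \<delta>_def by (rule real_le_rsqrt)
  then have "12000 * real d * \<epsilon> / \<delta> \<le> 1" using \<delta>0 by (simp add: pos_divide_le_eq)
  then have "12000 * real d * \<epsilon> / \<delta> / 100 \<le> 1 / 100" by (rule divide_right_mono) simp
  moreover have "real d * (6 * vm / \<delta>) = 12000 * real d * \<epsilon> / \<delta> / 100" by (simp add: vm_def)
  ultimately have dn: "real d * (6 * vm / \<delta>) \<le> 1/100" by (simp only:)
  have n0: "0 \<le> 6 * vm / \<delta>" using vm0 \<delta>0 by simp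
  have "1 * (6 * vm / \<delta>) \<le> real d * (6 * vm / \<delta>)" using d n0 by (intro mult_right_mono) auto
  then have n1: "6 * vm / \<delta> \<le> 1/100" using dn by linarith
  have "8 * vm / \<delta>\<^sup>2 = (160 * \<epsilon>) * 1 / ((160 * \<epsilon>) * (8 * c))" unfolding \<delta>2 vm_def by simp
  also have "\<dots> = 1 / (8 * c)" using \<epsilon>(1) by (intro mult_divide_mult_cancel_left) simp
  finally have n2: "8 * vm / \<delta>\<^sup>2 \<le> 1 / (8 * c)" by (rule eq_refl)
  have n3: "2 * \<delta> \<le> 3/2 * c / 12"
  proof -
    have "1280 * c * \<epsilon> \<le> (c/16)\<^sup>2"
    proof -
      have "c * (1280 * \<epsilon>) \<le> c * (c / 256)" using \<epsilon>c \<epsilon> c by (intro mult_left_mono) auto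
      then show ?thesis by (simp add: power2_eq_square mult_ac)
    qed
    then have "\<delta> \<le> c/16" unfolding \<delta>_def using c by (intro real_le_lsqrt) auto
    then show ?thesis by simp
  qed
  have "\<forall>p\<in>M0. \<exists>T. subspace T \<and> dim T = d \<and> quad_tangent (3/2 * c) M0 p T \<and>
     (\<forall>q\<in>M0 \<inter> cball p (3/2 * c / 12). \<forall>q'\<in>M0 \<inter> cball p (3/2 * c / 12). \<exists>w\<in>T. norm (q - q' - w) \<le> norm (q - q') / 4)"
  proof
    fix p assume p: "p \<in> M0"
    obtain T where T: "dim T = d" "tangent_at M0 p T" "quad_tangent (3/2 * c) M0 p T"
      "\<forall>q\<in>M0 \<inter> cball p (3/2 * c / 12). \<forall>q'\<in>M0 \<inter> cball p (3/2 * c / 12). \<exists>w\<in>T. norm (q - q' - w) \<le> norm (q - q') / 4"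
      using curved[OF p] unfolding well_curved_def by (elim conjE exE) (rule that)
    have "subspace T" using T(2) unfolding tangent_at_def by (rule conjunct1)
    then show "\<exists>T. subspace T \<and> dim T = d \<and> quad_tangent (3/2 * c) M0 p T \<and>
     (\<forall>q\<in>M0 \<inter> cball p (3/2 * c / 12). \<forall>q'\<in>M0 \<inter> cball p (3/2 * c / 12). \<exists>w\<in>T. norm (q - q' - w) \<le> norm (q - q') / 4)"
      by (intro exI[where x=T] conjI T)
  qed
  then obtain T where T: "\<forall>p\<in>M0. subspace (T p) \<and> dim (T p) = d \<and> quad_tangent (3/2 * c) M0 p (T p) \<and>
     (\<forall>q\<in>M0 \<inter> cball p (3/2 * c / 12). \<forall>q'\<in>M0 \<inter> cball p (3/2 * c / 12). \<exists>w\<in>T p. norm (q - q' - w) \<le> norm (q - q') / 4)"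
    by (rule bchoice[THEN exE])
  note T1 = conjunct1[OF bspec[OF T]] and T2 = conjunct1[OF conjunct2[OF bspec[OF T]]]
    and T3 = conjunct1[OF conjunct2[OF conjunct2[OF bspec[OF T]]]] and T4 = conjunct2[OF conjunct2[OF conjunct2[OF bspec[OF T]]]]
  have "0 < 2 * \<delta>" using \<delta>0 by simp
  from maximal_separated_bounded[OF compact_imp_bounded[OF cpt] this]
  obtain P where P: "finite P" "P \<subseteq> M0" "separated (2 * \<delta>) P" "M0 \<subseteq> (\<Union>p\<in>P. ball p (2 * \<delta>))"
    by (elim exE conjE) (rule that)
  define N where "N p = {y \<in> UNIV. \<forall>x\<in>T p. orthogonal x y}" for p
  have sN: "subspace (N p)" for p using subspace_orthogonal_to_vectors[of "T p"] by (simp add: N_def)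
  have dN: "dim (N p) = DIM('a) - d" if "p \<in> M0" for p
  proof -
    have "dim (N p) + dim (T p) = dim (UNIV :: 'a set)" unfolding N_def
      by (rule dim_subspace_orthogonal_to_vectors[OF T1[OF that] subspace_UNIV subset_UNIV])
    then show ?thesis using T2[OF that] by simp
  qed
  \<comment> \<open>Radius 20 \<epsilon> over separation 5/2 \<epsilon> gives the factor 8 for each
    of the normal dimensions. The excess of 5/2 over 2 pays for the curvature of M0 and of the
    bumps.\<close>
  have "\<forall>p\<in>P. \<exists>S. finite S \<and> S \<subseteq> N p \<inter> cball 0 vm \<and> separated (5/2 * \<epsilon>) S \<and> 8 ^ (DIM('a) - d) \<le> real (card S)"
  proof
    fix p assume p: "p \<in> P"
    have e: "0 < 5/2 * \<epsilon>" "0 < vm" using \<epsilon> by (auto simp: vm_def)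
    have v8: "vm / (5/2 * \<epsilon>) = 8" using \<epsilon> by (simp add: vm_def)
    show "\<exists>S. finite S \<and> S \<subseteq> N p \<inter> cball 0 vm \<and> separated (5/2 * \<epsilon>) S \<and> 8 ^ (DIM('a) - d) \<le> real (card S)"
      using packing_subspace[OF sN e, of p] unfolding v8 dN[OF subsetD[OF P(2) p]] .
  qed
  then obtain S where S: "\<forall>p\<in>P. finite (S p) \<and> S p \<subseteq> N p \<inter> cball 0 vm \<and> separated (5/2 * \<epsilon>) (S p) \<and> 8 ^ (DIM('a) - d) \<le> real (card (S p))"
    by (rule bchoice[THEN exE])
  note S1 = conjunct1[OF bspec[OF S]] and S2 = conjunct1[OF conjunct2[OF bspec[OF S]]]
    and S3 = conjunct1[OF conjunct2[OF conjunct2[OF bspec[OF S]]]] and S4 = conjunct2[OF conjunct2[OF conjunct2[OF bspec[OF S]]]]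
  define \<Lambda> where "\<Lambda> = PiE P S"
  have w: "w p \<in> N p" "norm (w p) \<le> vm" if "w \<in> \<Lambda>" "p \<in> P" for w p
  proof -
    have "w p \<in> S p" using that unfolding \<Lambda>_def by (rule PiE_mem)
    then have "w p \<in> N p \<inter> cball 0 vm" by (rule subsetD[OF S2[OF that(2)]])
    then show "w p \<in> N p" "norm (w p) \<le> vm" by auto
  qed
  have bumps: "bumps P \<delta> vm w" if "w \<in> \<Lambda>" for w
    by unfold_locales (use P \<delta>0 vm0 w[OF that] in auto)
  have "real (card \<Lambda>) * (1 - \<alpha>) \<le> (1 + 1 / \<tau>) ^ q"
  proof (rule packing_bound[OF sq \<tau> \<alpha> _ f L c(1) d pos, where A="\<lambda>w. bumps.\<Psi> P \<delta> w ` M0"])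
    show "0 < 1 / V" using V by simp
    show "finite \<Lambda>" unfolding \<Lambda>_def by (intro finite_PiE P(1) S1)
    fix w assume wL: "w \<in> \<Lambda>"
    interpret B: bumps P \<delta> vm w by (rule bumps[OF wL])
    obtain D where D: "\<And>x. (B.\<Psi> has_derivative blinfun_apply (D x)) (at x)" "C1_on UNIV D" "\<And>x. blinfun_apply (D x) = B.D\<Psi> x"
      by (rule B.\<Psi>_C1) (rule that)
    show "admissible d c (1 / (1/V)) R (B.\<Psi> ` M0)"
      unfolding div_by_1 divide_divide_eq_right mult_1
    proof (rule admissible_image[OF D(1,2), where \<eta>="6 * vm / \<delta>" and \<kappa>="8 * vm / \<delta>\<^sup>2"])
      show "norm (D x h - h) \<le> 6 * vm / \<delta> * norm h" for x h unfolding D(3) by (rule B.D\<Psi>_near)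
      show "norm (B.\<Psi> q - B.\<Psi> x - D x (q - x)) \<le> 8 * vm / \<delta>\<^sup>2 * (norm (q - x))\<^sup>2" for x q unfolding D(3) by (rule B.\<Psi>_taylor)
      show "0 \<le> 6 * vm / \<delta>" "6 * vm / \<delta> \<le> 1/32" "real d * (6 * vm / \<delta>) \<le> 1/4" "8 * vm / \<delta>\<^sup>2 \<le> 1 / (8 * c)"
        using n0 n1 n2 dn by linarith+
      show "B.\<Psi> ` M0 \<subseteq> cball 0 R"
      proof
        fix y assume "y \<in> B.\<Psi> ` M0"
        then obtain x where x: "x \<in> M0" "y = B.\<Psi> x" by blast
        have "norm x \<le> R/2" using x inR by auto
        moreover have "norm (B.\<Psi> x) \<le> norm (B.\<Psi> x - x) + norm x" using norm_triangle_sub[of "B.\<Psi> x" x] by linarith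
        moreover have "vm \<le> R/2" using \<epsilon>c c \<epsilon> by (simp add: vm_def)
        ultimately show "y \<in> cball 0 R" using B.\<Psi>_close[of x] x(2) by simp
      qed
    qed
    fix w' assume w': "w' \<in> \<Lambda>" "w \<noteq> w'"
    have "\<exists>p\<in>P. w p \<noteq> w' p"
    proof (rule ccontr)
      assume n: "\<not> (\<exists>p\<in>P. w p \<noteq> w' p)"
      have "w = w'" by (rule PiE_ext[OF wL[unfolded \<Lambda>_def] w'(1)[unfolded \<Lambda>_def]]) (use n in blast)
      then show False using w'(2) by contradiction
    qed
    then obtain p where p: "p \<in> P" "w p \<noteq> w' p" by (elim bexE) (rule that)
    have pM: "p \<in> M0" using p P by auto
    have wS: "w p \<in> S p" "w' p \<in> S p" using wL w'(1) p(1) unfolding \<Lambda>_def by (simp_all add: PiE_mem)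
    have s1: "5/2 * \<epsilon> \<le> norm (w p - w' p)"
      using S3[OF p(1)] wS p(2) unfolding separated_def dist_norm by blast
    have s2: "norm (w p - w' p) \<le> 40 * \<epsilon>"
      using norm_triangle_ineq4[of "w p" "w' p"] w(2)[OF wL p(1)] w(2)[OF w'(1) p(1)] by (simp add: vm_def)
    have s3: "(w p - w' p) \<bullet> t = 0" if "t \<in> T p" for t
    proof -
      have "t \<bullet> w p = 0" "t \<bullet> w' p = 0" using w(1)[OF wL p(1)] w(1)[OF w'(1) p(1)] that by (auto simp: N_def orthogonal_def)
      then show ?thesis by (metis inner_commute inner_diff_right diff_self)
    qed
    have "ereal (9/4 * \<epsilon>) \<le> dH (B.\<Psi> ` M0) (bumps.\<Psi> P \<delta> w' ` M0)"
      by (rule bumps_separation[OF bumps[OF wL] bumps[OF w'(1)] p(1) pM T3[OF pM] T1[OF pM] s3 s1 s2 n1 n2 \<epsilon>(1) \<epsilon>c])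
    moreover have "ereal (2 * \<epsilon>) < ereal (9/4 * \<epsilon>)" using \<epsilon> by simp
    ultimately show "ereal (2 * \<epsilon>) < dH (B.\<Psi> ` M0) (bumps.\<Psi> P \<delta> w' ` M0)" by (rule less_le_trans[rotated])
  qed
  moreover have "8 ^ ((DIM('a) - d) * card P) \<le> real (card \<Lambda>)"
  proof -
    have "(8::real) ^ ((DIM('a) - d) * card P) = (\<Prod>p\<in>P. 8 ^ (DIM('a) - d))" by (simp add: power_mult)
    also have "\<dots> \<le> (\<Prod>p\<in>P. real (card (S p)))" by (intro prod_mono conjI S4) simp_all
    also have "\<dots> = real (card \<Lambda>)" unfolding \<Lambda>_def card_PiE[OF P(1)] by simp
    finally show ?thesis .
  qed
  then have "8 ^ ((DIM('a) - d) * card P) * (1 - \<alpha>) \<le> real (card \<Lambda>) * (1 - \<alpha>)" using \<alpha> by (intro mult_right_mono) auto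
  \<comment> \<open>There are many sites, since the balls of radius 2 * \<delta> around them cover
    M0 and each contains only little of it; 10 * \<delta> is 5 times that radius.\<close>
  moreover have "V / 64 \<le> real (card P) * (unit_ball_vol (real d) * (10 * \<delta>) ^ d)"
  proof -
    let ?w = "unit_ball_vol (real d) * (10 * \<delta>) ^ d"
    have w0: "0 \<le> ?w" using \<delta>0 by simp
    have loc: "hausdorff_outer d (M0 \<inter> cball p (2 * \<delta>)) \<le> ennreal ?w" if "p \<in> P" for p
    proof -
      have pM: "p \<in> M0" using that P by auto
      have sub: "cball p (2 * \<delta>) \<subseteq> cball p (3/2 * c / 12)" using n3 by auto
      have "hausdorff_outer DIM('b) (M0 \<inter> cball p (2 * \<delta>)) \<le> ennreal (unit_ball_vol (real DIM('b)) * (5 * (2 * \<delta>)) ^ DIM('b))"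
      proof (rule hausdorff_outer_local_le[where T="T p"])
        show "subspace (T p)" by (rule T1[OF pM])
        show "dim (T p) = DIM('b)" using T2[OF pM] unfolding db .
        show "0 < 2 * \<delta>" using \<delta>0 by simp
        show "\<exists>w\<in>T p. norm (q - q' - w) \<le> norm (q - q') / 4" if "q \<in> M0 \<inter> cball p (2 * \<delta>)" "q' \<in> M0 \<inter> cball p (2 * \<delta>)" for q q'
        proof -
          have "q \<in> M0 \<inter> cball p (3/2 * c / 12)" "q' \<in> M0 \<inter> cball p (3/2 * c / 12)" using that sub by blast+
          then show ?thesis by (rule bspec[OF bspec[OF T4[OF pM]]])
        qed
      qed
      then show ?thesis unfolding db[symmetric] by simp
    qed
    have "M0 \<subseteq> (\<Union>p\<in>P. M0 \<inter> cball p (2 * \<delta>))"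
    proof
      fix x assume x: "x \<in> M0"
      then obtain p where "p \<in> P" "x \<in> ball p (2 * \<delta>)" using P(4) by blast
      then show "x \<in> (\<Union>p\<in>P. M0 \<inter> cball p (2 * \<delta>))" using x by (auto intro: less_imp_le)
    qed
    then have "hausdorff_outer d M0 \<le> hausdorff_outer d (\<Union>p\<in>P. M0 \<inter> cball p (2 * \<delta>))" by (rule hausdorff_outer_mono)
    also have "\<dots> \<le> (\<Sum>p\<in>P. ennreal ?w)" by (rule order_trans[OF hausdorff_outer_UN_finite[OF P(1)] sum_mono[OF loc]])
    also have "\<dots> = ennreal (real (card P) * ?w)" using w0 by (simp add: ennreal_mult'' ennreal_of_nat_eq_real_of_nat)
    finally have "ennreal (V/64) \<le> ennreal (real (card P) * ?w)" by (rule order_trans[OF vol(1)])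
    then show ?thesis using w0 by (simp only: ennreal_le_iff mult_nonneg_nonneg of_nat_0_le_iff)
  qed
  ultimately show ?thesis unfolding \<delta>_def[symmetric] by (intro exI[where x="card P"] conjI) linarith+
qed

end

text \<open>The constant 2^31 makes (128 D z)^2 \<le> c^2, as 128^2 * 128000 stays just below it.
  The resulting power 128^d absorbs the factor 64 of the volume bound and the factor d + 1 of n
  \<le> (d + 1) (n - d), by which the number of normal directions is replaced by n.\<close>

lemma bump_count_numerics:
  fixes c \<epsilon> V w :: real and d n k :: nat
  assumes c: "0 < c" "0 < \<epsilon>" and d: "1 \<le> d" "d < n" and w: "0 < w" and V: "0 < V"
    and k: "V / 64 \<le> real k * (w * (10 * sqrt (1280 * c * \<epsilon>)) ^ d)"
  shows "real n * (1 / (w * (1/V) * c ^ d) * (c / (2 ^ 31 * \<epsilon>)) powr (real d / 2)) \<le> real ((n - d) * k) * ln 8"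
proof -
  define z where "z = sqrt (c / (2 ^ 31 * \<epsilon>))"
  define D where "D = 10 * sqrt (1280 * c * \<epsilon>)"
  have z0: "0 < z" using c by (simp add: z_def)
  have D0: "0 < D" using c by (simp add: D_def)
  have "(c / (2 ^ 31 * \<epsilon>)) powr (real d / 2) = ((c / (2 ^ 31 * \<epsilon>)) powr (1/2)) powr real d" by (simp add: powr_powr)
  also have "(c / (2 ^ 31 * \<epsilon>)) powr (1/2) = z" unfolding z_def by (rule powr_half_sqrt) (use c in simp)
  also have "z powr real d = z ^ d" by (rule powr_realpow[OF z0])
  finally have zp: "(c / (2 ^ 31 * \<epsilon>)) powr (real d / 2) = z ^ d" .
  have "(128 * D * z)\<^sup>2 \<le> c\<^sup>2"
  proof -
    have "D\<^sup>2 = 128000 * c * \<epsilon>" "z\<^sup>2 = c / (2 ^ 31 * \<epsilon>)" using c by (simp_all add: D_def z_def power_mult_distrib)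
    then have "(128 * D * z)\<^sup>2 = 16384 * (128000 * c * \<epsilon>) * (c / (2 ^ 31 * \<epsilon>))" by (simp add: power_mult_distrib)
    also have "\<dots> = (2097152000 / 2147483648) * c\<^sup>2" using c by (simp add: power2_eq_square)
    also have "\<dots> \<le> 1 * c\<^sup>2" by (intro mult_right_mono) auto
    finally show ?thesis by simp
  qed
  then have "128 * D * z \<le> c" using c by (rule_tac power2_le_imp_le) auto
  then have "z / c \<le> 1 / (128 * D)" using c D0 by (simp add: pos_divide_le_eq pos_le_divide_eq mult.commute)
  then have "(z / c) ^ d \<le> (1 / (128 * D)) ^ d" using c z0 by (intro power_mono) auto
  then have zc: "z ^ d / c ^ d \<le> 1 / (128 ^ d * D ^ d)" by (simp only: power_divide power_mult_distrib power_one)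
  have "32 * (real d + 1) \<le> 128 ^ d" using d(1)
    by (induction d rule: dec_induct) auto
  then have g: "64 * (real d + 1) / 128 ^ d \<le> 2" by (simp add: pos_divide_le_eq)
  have "1 / (w * (1/V) * c ^ d) * z ^ d = V / w * (z ^ d / c ^ d)" using w V by simp
  also have "\<dots> \<le> V / w * (1 / (128 ^ d * D ^ d))" using zc w V by (intro mult_left_mono) auto
  also have "\<dots> = 64 / 128 ^ d * ((V / 64) / (w * D ^ d))" by simp
  also have "\<dots> \<le> 64 / 128 ^ d * real k"
    using k w D0 unfolding D_def[symmetric] by (intro mult_left_mono) (auto simp: pos_divide_le_eq)
  finally have Y: "1 / (w * (1/V) * c ^ d) * z ^ d \<le> 64 / 128 ^ d * real k" .
  have nd: "real n \<le> (real d + 1) * real (n - d)"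
  proof -
    have "real n = real d * 1 + real (n - d)" using d by simp
    also have "\<dots> \<le> real d * real (n - d) + real (n - d)" using d by (intro add_right_mono mult_left_mono) auto
    finally show ?thesis by (simp add: algebra_simps)
  qed
  have ln8: "2 \<le> ln (8::real)"
  proof -
    have "exp (2::real) = exp 1 * exp 1" by (simp add: exp_add[symmetric])
    also have "\<dots> \<le> 272/100 * (272/100)" using e_less_272 by (intro mult_mono) auto
    also have "\<dots> \<le> 8" by simp
    finally show ?thesis by (simp add: ln_ge_iff)
  qed
  have "real n * (1 / (w * (1/V) * c ^ d) * z ^ d) \<le> ((real d + 1) * real (n - d)) * (64 / 128 ^ d * real k)"
    by (intro mult_mono nd Y) (use w V c z0 in auto)
  also have "\<dots> = (64 * (real d + 1) / 128 ^ d) * real ((n - d) * k)" by simp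
  also have "\<dots> \<le> 2 * real ((n - d) * k)" by (rule mult_right_mono[OF g]) simp
  also have "\<dots> \<le> ln 8 * real ((n - d) * k)" by (rule mult_right_mono[OF ln8]) simp
  finally show ?thesis unfolding zp by (simp only: mult.commute)
qed

theorem theorem5p6:
  fixes P :: "'w measure"
    and Q :: "'w \<Rightarrow> real list \<Rightarrow> (real^'n \<Rightarrow> real)"
    and Out :: "'w \<Rightarrow> real list \<Rightarrow> (real^'n) set"
    and q :: nat
    and rch R fmin fmax L \<tau> \<alpha> \<epsilon> :: real
  defines "d \<equiv> CARD('d::finite)" and "n \<equiv> CARD('n::finite)"
  assumes "1 \<le> d" and "d < n"
    and "rch > 0" and "R \<ge> 144 * rch"
    and "0 < fmin" and "fmin \<le> fmax / 96" and "L \<ge> 0"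
    and "\<tau> > 0" and "\<alpha> < 1"
    and "0 < \<epsilon>" and "\<epsilon> \<le> rch / (2^34 * real d ^ 2)"
    and "Min ((\<lambda>k. (192 * rch * sqrt (real k) / R) ^ k) ` {1..n})
           \<le> 36 * 8^d * sigma_vol TYPE('d) * fmin * rch ^ d"
    and "36 * 8^d * sigma_vol TYPE('d) * fmin * rch ^ d \<le> 1"
    and "sq_estimates P Q Out q \<tau> (bb_model d rch fmin fmax L R) \<epsilon> \<alpha>"
  shows "real q \<ge>
     (real n * max (ln (R / (4 * \<epsilon>)))
                   (1 / (omega_vol TYPE('d) * fmin * rch ^ d)
                      * (rch / (2^31 * \<epsilon>)) powr (real d / 2))
      + ln (1 - \<alpha>)) / ln (1 + 1 / \<tau>)"
proof -
  note as = assms(3-)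
  let ?s = "sigma_vol TYPE('d)"
  have R0: "0 < R" using as(3,4) by linarith
  have n1: "1 \<le> n" using as(1,2) by linarith
  define g where "g k = (192 * rch * sqrt (real k) / R) ^ k" for k
  have "Min (g ` {1..n}) \<in> g ` {1..n}" using n1 by (intro Min_in) auto
  then obtain k where k: "1 \<le> k" "k \<le> n" "Min (g ` {1..n}) = g k" by auto
  have gk: "g k \<le> 36 * 8 ^ d * ?s * fmin * rch ^ d" using as(12) k(3) by (simp add: g_def[abs_def])
  \<comment> \<open>Positivity of the minimum makes \<open>sigma_vol\<close> positive; since
    \<open>enn2real\<close> sends infinity to 0, the sphere has finite measure as well.\<close>
  have "0 < g k" unfolding g_def using k(1) as(3) R0 by (intro zero_less_power divide_pos_pos mult_pos_pos) auto
  then have "0 < 36 * 8 ^ d * ?s * fmin * rch ^ d" using gk by linarith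
  then have s0: "0 < ?s" using as(3,5) by (simp add: zero_less_mult_iff)
  then have "hausdorff_outer (CARD('d) - 1) (sphere (0::real^'d) 1) \<noteq> \<top>" unfolding sigma_vol_def by (intro notI) simp
  then have sph: "hausdorff_outer (d - 1) {x\<in>UNIV. norm (x :: real^'d) = 1} = ennreal ?s"
    unfolding sigma_vol_def d_def by (simp add: sphere_def dist_norm less_top)
  have sE: "hausdorff_outer (d - 1) {x\<in>E. norm x = 1} = ennreal ?s" if "subspace E" "dim E = d" for E :: "(real^'n) set"
    using hausdorff_outer_subspace_sphere[OF that(1) subspace_UNIV, where 'b="real^'d" and k="d - 1"] that(2) sph by (simp add: d_def)
  have "d \<le> card (Basis :: (real^'n) set)" using as(2) by (simp add: n_def)
  then obtain I :: "(real^'n) set" where I: "I \<subseteq> Basis" "card I = d" using obtain_subset_with_card_n by metis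
  have "dim (span I) = d" using I dim_eq_card_independent[of I] independent_mono[OF independent_Basis] by auto
  then have sI: "hausdorff_outer (d - 1) {x\<in>span I. norm x = 1} = ennreal ?s" by (intro sE) auto
  \<comment> \<open>The largest volume that a density of at least fmin allows. Dividing the
    hypotheses by fmin gives the two conditions of \<open>base_manifold\<close>.\<close>
  define V where "V = 1 / fmin"
  have V0: "0 < V" and fV: "fmin = 1 / V" using as(5) by (auto simp: V_def)
  have V1: "36 * 8 ^ d * ?s * rch ^ d \<le> V" using as(13) as(5) by (simp add: V_def pos_le_divide_eq mult_ac)
  have V2: "V * (192 * rch * sqrt (real k) / R) ^ k \<le> 36 * 8 ^ d * ?s * rch ^ d"
    using gk as(5) unfolding g_def by (simp add: V_def pos_divide_le_eq mult_ac)
  have dn: "d < DIM(real^'n)" "k \<le> DIM(real^'n)" using as(2) k(2) by (simp_all add: n_def)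
  obtain M0 :: "(real^'n) set" where M0: "compact M0" "connected M0" "M0 \<noteq> {}" "M0 \<subseteq> cball 0 (R/2)"
    "\<forall>p\<in>M0. well_curved d (3/2 * rch) M0 p" "ennreal (V/64) \<le> hausdorff_outer d M0" "hausdorff_outer d M0 \<le> ennreal (V/2)"
    using base_manifold[OF I as(1) dn(1) as(3,4) sI s0 k(1) dn(2) V1 V2] by (elim exE conjE) (rule that)
  interpret base M0 d rch V R
    by unfold_locales (use M0 as V0 in auto)
  define T where "T = 1 + 1 / \<tau>"
  have T: "1 < T" using as(8) by (simp add: T_def)
  have sq: "sq_estimates P Q Out q \<tau> (bb_model d rch (1/V) fmax L R) \<epsilon> \<alpha>" using as(14) unfolding fV .
  have pos: "0 < hausdorff_outer (d - 1) {x\<in>E. norm x = 1}" if "subspace E" "dim E = d" for E :: "(real^'n) set"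
    unfolding sE[OF that] using s0 by simp
  have f96: "1 / V \<le> fmax / 96" using as(6) unfolding fV .
  have lnT: "0 < ln T" using T by simp
  have a1: "0 < 1 - \<alpha>" using as(9) by simp
  have "(R / (4 * \<epsilon>)) ^ n * (1 - \<alpha>) \<le> T ^ q"
    using translation_bound[OF sq as(8,9) f96 as(7,10) pos] by (simp add: T_def n_def)
  then have "ln ((R / (4 * \<epsilon>)) ^ n * (1 - \<alpha>)) \<le> ln (T ^ q)" using R0 as(10) a1 T by (subst ln_le_cancel_iff) auto
  then have 1: "real n * ln (R / (4 * \<epsilon>)) + ln (1 - \<alpha>) \<le> real q * ln T"
    using R0 as(10) a1 T by (simp add: ln_mult ln_realpow)
  have d0: "0 < 2 ^ 34 * (real d)\<^sup>2" using as(1) by simp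
  have "\<epsilon> * (2 ^ 34 * (real d)\<^sup>2) \<le> rch" using as(11) d0 by (subst (asm) pos_le_divide_eq) auto
  then have e2: "2 ^ 34 * (real d)\<^sup>2 * \<epsilon> \<le> rch" by (simp only: mult.commute)
  obtain m :: nat where m: "8 ^ ((DIM(real^'n) - d) * m) * (1 - \<alpha>) \<le> (1 + 1 / \<tau>) ^ q"
     "V / 64 \<le> real m * (unit_ball_vol (real d) * (10 * sqrt (1280 * rch * \<epsilon>)) ^ d)"
    using bump_family_bound[where 'b="real^'d", OF sq as(8,9) f96 as(7,10) e2 pos] by (auto simp: d_def)
  have "(8::real) ^ ((n - d) * m) * (1 - \<alpha>) \<le> T ^ q" using m(1) by (simp add: T_def n_def)
  then have "ln ((8::real) ^ ((n - d) * m) * (1 - \<alpha>)) \<le> ln (T ^ q)" using a1 T by (subst ln_le_cancel_iff) auto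
  then have 2: "real ((n - d) * m) * ln 8 + ln (1 - \<alpha>) \<le> real q * ln T"
    using a1 T by (simp only: ln_mult ln_realpow zero_less_power zero_less_numeral) (simp add: ln_mult ln_realpow)
  \<comment> \<open>The normalising constant of the Hausdorff weights is the Lebesgue volume of the
    unit ball, so the count of sites is already in terms of \<open>omega_vol\<close>.\<close>
  have w: "omega_vol TYPE('d) = unit_ball_vol (real d)"
    unfolding omega_vol_def d_def using content_ball[of 1 "0::real^'d"] by simp
  have w0: "0 < unit_ball_vol (real d)" by simp
  have "real n * (1 / (omega_vol TYPE('d) * fmin * rch ^ d) * (rch / (2 ^ 31 * \<epsilon>)) powr (real d / 2)) \<le> real ((n - d) * m) * ln 8"
    unfolding w fV by (rule bump_count_numerics[OF as(3,10,1,2) w0 V0 m(2)])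
  then have "real n * (1 / (omega_vol TYPE('d) * fmin * rch ^ d) * (rch / (2 ^ 31 * \<epsilon>)) powr (real d / 2)) + ln (1 - \<alpha>) \<le> real q * ln T"
    using 2 by linarith
  with 1 have "real n * max (ln (R / (4 * \<epsilon>))) (1 / (omega_vol TYPE('d) * fmin * rch ^ d) * (rch / (2^31 * \<epsilon>)) powr (real d / 2)) + ln (1 - \<alpha>) \<le> real q * ln T"
    unfolding max_def by (simp split: if_splits)
  then show ?thesis using lnT unfolding T_def by (simp add: pos_divide_le_eq)
qed

end
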